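(* Let $n\ge 2$, $E\in\mathrm{GL}_n(\mathbb C)$ and $\mathcal A=\mathcal A(E)=\mathcal B(E)*\mathbb C\mathbb Z_2$. Then the sequence of right $\mathcal A$-modules $$0\to \mathcal A\xrightarrow{\Phi_3}M_n(\mathcal A)\xrightarrow{\Phi_2}M_n(\mathcal A)\oplus\bigl(\mathbb C(1-g)\otimes_{\mathbb C\mathbb Z_2}\mathcal A\bigr)\xrightarrow{\Phi_1}\mathcal A\xrightarrow{\varepsilon}\mathbb C_\varepsilon\to0$$ with $$\Phi_3(a)=\bigl(ExE^{-t}-E^tE^{-1}\bigr)a,\qquad \Phi_2(A)=\bigl(A+(E^{-1}x^tAE)^t,\,0\bigr),$$ $$\Phi_1\bigl(A,(1-g)\otimes_{\mathbb C\mathbb Z_2}a\bigr)=\mathrm{tr}(x^tA)-\mathrm{tr}(A)+(1-g)a$$ ($a\in\mathcal A$, $A\in M_n(\mathcal A)$) is a projective resolution of the counit of $\mathcal A$, i.e. it is exact and all modules other than $\mathbb C_\varepsilon$ are projective.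
   Context: All vector spaces and algebras are over $\mathbb C$. $t$ denotes the transpose ($(A^t)_{ij}=A_{ji}$, also for matrices over noncommutative algebras) and $E^{-t}:=(E^{-1})^t$; $\mathrm{tr}(A)=\sum_iA_{ii}$. For $E\in \mathrm{GL}_n(\mathbb C)$, $n\ge 2$, $\mathcal B(E)$ is the universal unital algebra generated by the entries of $x=(x_{ij})_{i,j=1}^n$ subject to $E^{-1}x^tEx=I=xE^{-1}x^tE$; it is a Hopf algebra with $\Delta(x_{ij})=\sum_kx_{ik}\otimes x_{kj}$, $\varepsilon(x_{ij})=\delta_{ij}$, $S(x)=E^{-1}x^tE$. $\mathbb C\mathbb Z_2$ is the group algebra of the group of order 2 with generator $g$, $g^2=1$, $\Delta(g)=g\otimes g$. $\mathcal A(E)$ is the free product $\mathcal B(E)*\mathbb C\mathbb Z_2$ of unital algebras, with the Hopf algebra structure extending those of the two factors. $\mathbb C(1-g)\subset\mathbb C\mathbb Z_2$ is the one-dimensional right ideal spanned by $1-g$. $M_n(\mathcal A)$ is the right $\mathcal A$-module of $n\times n$-matrices with entrywise right multiplication. $\mathbb C_\varepsilon$ is $\mathbb C$ with $z\cdot a=z\varepsilon(a)$. *)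

theory Defs
  imports
    "HOL-Algebra.Algebra"
    "HOL-Analysis.Determinants"
    "HOL-Library.Poly_Mapping"
begin

section \<open>Unital complex algebras\<close>

text \<open>
  A unital, not necessarily commutative complex algebra is a ring in the sense of HOL-Algebra
  together with a scalar multiplication, stored in a record of type
  \<^typ>\<open>(complex, 'a) module\<close>. The locale \<^locale>\<open>algebra\<close> is not used since it requires
  commutativity.
\<close>

definition alg_hom :: "(complex, 'a) module \<Rightarrow> (complex, 'b) module \<Rightarrow> ('a \<Rightarrow> 'b) set" where
  "alg_hom A B =
     {f \<in> ring_hom A B. \<forall>c. \<forall>a\<in>carrier A. f (c \<odot>\<^bsub>A\<^esub> a) = c \<odot>\<^bsub>B\<^esub> f a}"

definition complex_alg :: "(complex, complex) module" where
  "complex_alg =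
     \<lparr>carrier = UNIV, monoid.mult = (*), monoid.one = 1, ring.zero = 0, ring.add = (+),
      smult = (*)\<rparr>"

text \<open>The quotient by a two-sided ideal; the operations are those of \<^const>\<open>FactRing\<close>.\<close>

definition quot_alg :: "(complex, 'a) module \<Rightarrow> 'a set \<Rightarrow> (complex, 'a set) module" where
  "quot_alg A I =
     \<lparr>carrier = carrier (A Quot I), monoid.mult = monoid.mult (A Quot I),
      monoid.one = monoid.one (A Quot I),
      ring.zero = ring.zero (A Quot I), ring.add = ring.add (A Quot I),
      smult = (\<lambda>c U. \<Union>a\<in>U. I +>\<^bsub>A\<^esub> (c \<odot>\<^bsub>A\<^esub> a))\<rparr>"

text \<open>
  The monoid algebra of \<open>M\<close> over the complex numbers: finitely supported functions on the
  carrier of \<open>M\<close> with convolution as product. Both group algebras and free algebras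
  (the monoid algebras of free monoids) are instances.
\<close>

definition monoid_alg :: "'g monoid \<Rightarrow> (complex, 'g \<Rightarrow>\<^sub>0 complex) module" where
  "monoid_alg M =
     \<lparr>carrier = {f. Poly_Mapping.keys f \<subseteq> carrier M},
      monoid.mult = (\<lambda>f h. \<Sum>u\<in>Poly_Mapping.keys f. \<Sum>v\<in>Poly_Mapping.keys h.
        Poly_Mapping.single (u \<otimes>\<^bsub>M\<^esub> v) (Poly_Mapping.lookup f u * Poly_Mapping.lookup h v)),
      monoid.one = Poly_Mapping.single \<one>\<^bsub>M\<^esub> 1, ring.zero = 0, ring.add = (+),
      smult = (\<lambda>c. Poly_Mapping.map ((*) c))\<rparr>"

definition free_monoid :: "'g set \<Rightarrow> 'g list monoid" where
  "free_monoid U = \<lparr>carrier = lists U, monoid.mult = (@), monoid.one = []\<rparr>"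

definition free_alg :: "'g set \<Rightarrow> (complex, 'g list \<Rightarrow>\<^sub>0 complex) module" where
  "free_alg U = monoid_alg (free_monoid U)"

definition free_gen :: "'g \<Rightarrow> 'g list \<Rightarrow>\<^sub>0 complex" where
  "free_gen s = Poly_Mapping.single [s] 1"


section \<open>Free products of algebras\<close>

text \<open>
  The free product (coproduct of unital algebras) of \<open>A\<close> and \<open>B\<close> is the free algebra on the
  disjoint union of the two carriers modulo the relations that turn the two canonical maps into
  homomorphisms of unital algebras.
\<close>

definition hom_relations ::
  "(complex, 'a) module \<Rightarrow> (complex, 'b) module \<Rightarrow> ('a \<Rightarrow> 'b) \<Rightarrow> 'b set" where
  "hom_relations A F f =
     {f (a \<oplus>\<^bsub>A\<^esub> b) \<ominus>\<^bsub>F\<^esub> (f a \<oplus>\<^bsub>F\<^esub> f b) |a b. a \<in> carrier A \<and> b \<in> carrier A}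
   \<union> {f (a \<otimes>\<^bsub>A\<^esub> b) \<ominus>\<^bsub>F\<^esub> (f a \<otimes>\<^bsub>F\<^esub> f b) |a b. a \<in> carrier A \<and> b \<in> carrier A}
   \<union> {f (c \<odot>\<^bsub>A\<^esub> a) \<ominus>\<^bsub>F\<^esub> (c \<odot>\<^bsub>F\<^esub> f a) |c a. a \<in> carrier A}
   \<union> {f \<one>\<^bsub>A\<^esub> \<ominus>\<^bsub>F\<^esub> \<one>\<^bsub>F\<^esub>}"

definition free_prod_cover ::
  "(complex, 'a) module \<Rightarrow> (complex, 'b) module \<Rightarrow> (complex, ('a + 'b) list \<Rightarrow>\<^sub>0 complex) module"
  where "free_prod_cover A B = free_alg (Inl ` carrier A \<union> Inr ` carrier B)"

definition free_prod_ideal ::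
  "(complex, 'a) module \<Rightarrow> (complex, 'b) module \<Rightarrow> (('a + 'b) list \<Rightarrow>\<^sub>0 complex) set" where
  "free_prod_ideal A B =
     genideal (free_prod_cover A B)
       (hom_relations A (free_prod_cover A B) (\<lambda>a. free_gen (Inl a))
        \<union> hom_relations B (free_prod_cover A B) (\<lambda>b. free_gen (Inr b)))"

definition free_prod ::
  "(complex, 'a) module \<Rightarrow> (complex, 'b) module
     \<Rightarrow> (complex, (('a + 'b) list \<Rightarrow>\<^sub>0 complex) set) module" where
  "free_prod A B = quot_alg (free_prod_cover A B) (free_prod_ideal A B)"

definition free_prod_inl ::
  "(complex, 'a) module \<Rightarrow> (complex, 'b) module \<Rightarrow> 'a \<Rightarrow> (('a + 'b) list \<Rightarrow>\<^sub>0 complex) set" where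
  "free_prod_inl A B a = free_prod_ideal A B +>\<^bsub>free_prod_cover A B\<^esub> free_gen (Inl a)"

definition free_prod_inr ::
  "(complex, 'a) module \<Rightarrow> (complex, 'b) module \<Rightarrow> 'b \<Rightarrow> (('a + 'b) list \<Rightarrow>\<^sub>0 complex) set" where
  "free_prod_inr A B b = free_prod_ideal A B +>\<^bsub>free_prod_cover A B\<^esub> free_gen (Inr b)"


section \<open>Matrices over a noncommutative algebra\<close>

type_synonym ('n, 'a) matr = "'n \<Rightarrow> 'n \<Rightarrow> 'a"

definition matr_mult ::
  "(complex, 'a) module \<Rightarrow> ('n::finite, 'a) matr \<Rightarrow> ('n, 'a) matr \<Rightarrow> ('n, 'a) matr" where
  "matr_mult A U V = (\<lambda>i j. \<Oplus>\<^bsub>A\<^esub>k\<in>UNIV. U i k \<otimes>\<^bsub>A\<^esub> V k j)"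

definition matr_transpose :: "('n, 'a) matr \<Rightarrow> ('n, 'a) matr" where
  "matr_transpose U = (\<lambda>i j. U j i)"

definition matr_add ::
  "(complex, 'a) module \<Rightarrow> ('n, 'a) matr \<Rightarrow> ('n, 'a) matr \<Rightarrow> ('n, 'a) matr" where
  "matr_add A U V = (\<lambda>i j. U i j \<oplus>\<^bsub>A\<^esub> V i j)"

definition matr_minus ::
  "(complex, 'a) module \<Rightarrow> ('n, 'a) matr \<Rightarrow> ('n, 'a) matr \<Rightarrow> ('n, 'a) matr" where
  "matr_minus A U V = (\<lambda>i j. U i j \<ominus>\<^bsub>A\<^esub> V i j)"

definition matr_trace :: "(complex, 'a) module \<Rightarrow> ('n::finite, 'a) matr \<Rightarrow> 'a" where
  "matr_trace A U = (\<Oplus>\<^bsub>A\<^esub>i\<in>UNIV. U i i)"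

text \<open>A complex matrix regarded as a matrix over the algebra \<open>A\<close>.\<close>

definition matr_const :: "(complex, 'a) module \<Rightarrow> complex^'n^'n \<Rightarrow> ('n, 'a) matr" where
  "matr_const A C = (\<lambda>i j. (C $ i $ j) \<odot>\<^bsub>A\<^esub> \<one>\<^bsub>A\<^esub>)"


section \<open>The algebras B(E), CZ2 and A(E)\<close>

type_synonym 'n B_elem = "(('n \<times> 'n) list \<Rightarrow>\<^sub>0 complex) set"
type_synonym Z2_elem = "int \<Rightarrow>\<^sub>0 complex"
type_synonym 'n A_elem = "(('n B_elem + Z2_elem) list \<Rightarrow>\<^sub>0 complex) set"

definition B_cover :: "(complex, ('n \<times> 'n) list \<Rightarrow>\<^sub>0 complex) module" where
  "B_cover = free_alg UNIV"

definition B_relations :: "complex^'n^'n \<Rightarrow> (('n::finite \<times> 'n) list \<Rightarrow>\<^sub>0 complex) set" where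
  "B_relations E =
    (let F = B_cover;
         x = (\<lambda>i j. free_gen (i, j));
         c = matr_const F;
         R1 = matr_mult F (matr_mult F (matr_mult F (c (matrix_inv E)) (matr_transpose x)) (c E)) x;
         R2 = matr_mult F (matr_mult F (matr_mult F x (c (matrix_inv E))) (matr_transpose x)) (c E)
     in {matr_minus F R1 (c (mat 1)) i j |i j. True}
      \<union> {matr_minus F R2 (c (mat 1)) i j |i j. True})"

definition B_ideal :: "complex^'n^'n \<Rightarrow> (('n::finite \<times> 'n) list \<Rightarrow>\<^sub>0 complex) set" where
  "B_ideal E = genideal B_cover (B_relations E)"

definition B_alg :: "complex^'n^'n \<Rightarrow> (complex, 'n::finite B_elem) module" where
  "B_alg E = quot_alg B_cover (B_ideal E)"

definition B_gen :: "complex^'n^'n \<Rightarrow> ('n::finite, 'n B_elem) matr" where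
  "B_gen E = (\<lambda>i j. B_ideal E +>\<^bsub>B_cover\<^esub> free_gen (i, j))"

definition Z2_alg :: "(complex, Z2_elem) module" where
  "Z2_alg = monoid_alg (integer_mod_group 2)"

definition Z2_gen :: Z2_elem where
  "Z2_gen = Poly_Mapping.single 1 1"

definition A_alg :: "complex^'n^'n \<Rightarrow> (complex, 'n::finite A_elem) module" where
  "A_alg E = free_prod (B_alg E) Z2_alg"

definition A_x :: "complex^'n^'n \<Rightarrow> ('n::finite, 'n A_elem) matr" where
  "A_x E = (\<lambda>i j. free_prod_inl (B_alg E) Z2_alg (B_gen E i j))"

definition Z2_to_A :: "complex^'n^'n \<Rightarrow> Z2_elem \<Rightarrow> 'n::finite A_elem" where
  "Z2_to_A E = free_prod_inr (B_alg E) Z2_alg"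

definition A_g :: "complex^'n^'n \<Rightarrow> 'n::finite A_elem" where
  "A_g E = Z2_to_A E Z2_gen"

text \<open>
  The counits, as the unique algebra homomorphisms with the prescribed values on generators,
  respectively with the prescribed restrictions to the two factors of the free product.
  Membership in \<^const>\<open>extensional\<close> fixes the irrelevant values outside the carrier.
\<close>

definition B_counit :: "complex^'n^'n \<Rightarrow> 'n::finite B_elem \<Rightarrow> complex" where
  "B_counit E =
     (THE f. f \<in> alg_hom (B_alg E) complex_alg \<and> f \<in> extensional (carrier (B_alg E)) \<and>
        (\<forall>i j. f (B_gen E i j) = (if i = j then 1 else 0)))"

definition Z2_counit :: "Z2_elem \<Rightarrow> complex" where
  "Z2_counit =
     (THE f. f \<in> alg_hom Z2_alg complex_alg \<and> f \<in> extensional (carrier Z2_alg) \<and> f Z2_gen = 1)"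

definition A_counit :: "complex^'n^'n \<Rightarrow> 'n::finite A_elem \<Rightarrow> complex" where
  "A_counit E =
     (THE f. f \<in> alg_hom (A_alg E) complex_alg \<and> f \<in> extensional (carrier (A_alg E)) \<and>
        (\<forall>b\<in>carrier (B_alg E). f (free_prod_inl (B_alg E) Z2_alg b) = B_counit E b) \<and>
        (\<forall>z\<in>carrier Z2_alg. f (free_prod_inr (B_alg E) Z2_alg z) = Z2_counit z))"


section \<open>Right modules\<close>

text \<open>
  Right modules over a noncommutative ring are stored in the record \<^typ>\<open>('r, 'm) module\<close> of
  HOL-Algebra, where \<open>r \<odot>\<^bsub>M\<^esub> m\<close> is to be read as \<open>m\<close> acted upon by \<open>r\<close> from the right; hence
  the order of the factors in \<open>rsmult_assoc\<close>. As usual for that record, the fields \<open>mult\<close> and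
  \<open>one\<close> of a module play no role.
\<close>

locale right_module = R?: ring R + M?: abelian_group M
  for R :: "('r, 'x) ring_scheme" (structure) and M :: "('r, 'm) module" (structure) +
  assumes rsmult_closed: "\<lbrakk>r \<in> carrier R; m \<in> carrier M\<rbrakk> \<Longrightarrow> r \<odot>\<^bsub>M\<^esub> m \<in> carrier M"
    and rsmult_distr_ring: "\<lbrakk>r \<in> carrier R; s \<in> carrier R; m \<in> carrier M\<rbrakk> \<Longrightarrow>
          (r \<oplus>\<^bsub>R\<^esub> s) \<odot>\<^bsub>M\<^esub> m = r \<odot>\<^bsub>M\<^esub> m \<oplus>\<^bsub>M\<^esub> s \<odot>\<^bsub>M\<^esub> m"
    and rsmult_distr_module: "\<lbrakk>r \<in> carrier R; m \<in> carrier M; m' \<in> carrier M\<rbrakk> \<Longrightarrow>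
          r \<odot>\<^bsub>M\<^esub> (m \<oplus>\<^bsub>M\<^esub> m') = r \<odot>\<^bsub>M\<^esub> m \<oplus>\<^bsub>M\<^esub> r \<odot>\<^bsub>M\<^esub> m'"
    and rsmult_assoc: "\<lbrakk>r \<in> carrier R; s \<in> carrier R; m \<in> carrier M\<rbrakk> \<Longrightarrow>
          (r \<otimes>\<^bsub>R\<^esub> s) \<odot>\<^bsub>M\<^esub> m = s \<odot>\<^bsub>M\<^esub> (r \<odot>\<^bsub>M\<^esub> m)"
    and rsmult_one: "m \<in> carrier M \<Longrightarrow> \<one>\<^bsub>R\<^esub> \<odot>\<^bsub>M\<^esub> m = m"

definition right_module_hom ::
  "('r, 'x) ring_scheme \<Rightarrow> ('r, 'm) module \<Rightarrow> ('r, 'k) module \<Rightarrow> ('m \<Rightarrow> 'k) set" where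
  "right_module_hom R M N =
     {f \<in> carrier M \<rightarrow> carrier N.
        (\<forall>m\<in>carrier M. \<forall>m'\<in>carrier M. f (m \<oplus>\<^bsub>M\<^esub> m') = f m \<oplus>\<^bsub>N\<^esub> f m') \<and>
        (\<forall>r\<in>carrier R. \<forall>m\<in>carrier M. f (r \<odot>\<^bsub>M\<^esub> m) = r \<odot>\<^bsub>N\<^esub> f m)}"

definition exact_at ::
  "('r, 'm) module \<Rightarrow> ('m \<Rightarrow> 'k) \<Rightarrow> ('r, 'k) module \<Rightarrow> ('k \<Rightarrow> 'l) \<Rightarrow> ('r, 'l) module \<Rightarrow> bool" where
  "exact_at M f N g P \<longleftrightarrow> f ` carrier M = a_kernel N P g"

text \<open>
  Projectivity by the lifting property. A HOL formula cannot quantify over types, so the types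
  carrying the two test modules are parameters; projectivity proper is the statement for
  arbitrary type variables \<open>'m\<close> and \<open>'k\<close>.
\<close>

definition projective_right_module ::
  "'m itself \<Rightarrow> 'k itself \<Rightarrow> ('r, 'x) ring_scheme \<Rightarrow> ('r, 'p) module \<Rightarrow> bool" where
  "projective_right_module _ _ R P \<longleftrightarrow>
     right_module R P \<and>
     (\<forall>(M :: ('r, 'm) module) (N :: ('r, 'k) module) e f.
        right_module R M \<and> right_module R N \<and>
        e \<in> right_module_hom R M N \<and> e ` carrier M = carrier N \<and> f \<in> right_module_hom R P N \<longrightarrow>
        (\<exists>h\<in>right_module_hom R P M. \<forall>p\<in>carrier P. e (h p) = f p))"

definition regular_module :: "(complex, 'a) module \<Rightarrow> ('a, 'a) module" where
  "regular_module A =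
     \<lparr>carrier = carrier A, monoid.mult = monoid.mult A, monoid.one = monoid.one A,
      ring.zero = ring.zero A, ring.add = ring.add A, smult = (\<lambda>a b. b \<otimes>\<^bsub>A\<^esub> a)\<rparr>"

definition matr_module :: "(complex, 'a) module \<Rightarrow> ('a, ('n::finite, 'a) matr) module" where
  "matr_module A =
     \<lparr>carrier = {U. \<forall>i j. U i j \<in> carrier A}, monoid.mult = matr_mult A,
      monoid.one = matr_const A (mat 1), ring.zero = (\<lambda>i j. \<zero>\<^bsub>A\<^esub>), ring.add = matr_add A,
      smult = (\<lambda>a U i j. U i j \<otimes>\<^bsub>A\<^esub> a)\<rparr>"

definition direct_sum_module ::
  "('r, 'm) module \<Rightarrow> ('r, 'k) module \<Rightarrow> ('r, 'm \<times> 'k) module" where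
  "direct_sum_module M N =
     \<lparr>carrier = carrier M \<times> carrier N, monoid.mult = undefined, monoid.one = undefined,
      ring.zero = (\<zero>\<^bsub>M\<^esub>, \<zero>\<^bsub>N\<^esub>),
      ring.add = (\<lambda>(m, k) (m', k'). (m \<oplus>\<^bsub>M\<^esub> m', k \<oplus>\<^bsub>N\<^esub> k')),
      smult = (\<lambda>r (m, k). (r \<odot>\<^bsub>M\<^esub> m, r \<odot>\<^bsub>N\<^esub> k))\<rparr>"

text \<open>The complex numbers as a right module through a character \<open>\<epsilon>\<close>.\<close>

definition character_module :: "('a \<Rightarrow> complex) \<Rightarrow> ('a, complex) module" where
  "character_module \<epsilon> =
     \<lparr>carrier = UNIV, monoid.mult = (*), monoid.one = 1, ring.zero = 0, ring.add = (+),
      smult = (\<lambda>a z. z * \<epsilon> a)\<rparr>"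


section \<open>Tensor products\<close>

text \<open>
  \<open>tensor_module R M \<phi> A\<close> is the tensor product over \<open>R\<close> of the right \<open>R\<close>-module \<open>M\<close> and of
  \<open>A\<close>, on which \<open>R\<close> acts from the left through the ring homomorphism \<open>\<phi>\<close> from \<open>R\<close> to \<open>A\<close>.
  It is the free abelian group on pairs modulo biadditivity and balancedness (complex
  bilinearity follows, the scalars being contained in \<open>R\<close>), and a right
  \<open>A\<close>-module by right multiplication on the second factor.
\<close>

definition tensor_relations ::
  "(complex, 'r) module \<Rightarrow> ('r, 'm) module \<Rightarrow> ('r \<Rightarrow> 'a) \<Rightarrow> (complex, 'a) module
     \<Rightarrow> ('m \<times> 'a \<Rightarrow>\<^sub>0 int) set" where
  "tensor_relations R M \<phi> A =
     {frag_of (m \<oplus>\<^bsub>M\<^esub> m', a) - frag_of (m, a) - frag_of (m', a) |m m' a.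
        m \<in> carrier M \<and> m' \<in> carrier M \<and> a \<in> carrier A}
   \<union> {frag_of (m, a \<oplus>\<^bsub>A\<^esub> a') - frag_of (m, a) - frag_of (m, a') |m a a'.
        m \<in> carrier M \<and> a \<in> carrier A \<and> a' \<in> carrier A}
   \<union> {frag_of (r \<odot>\<^bsub>M\<^esub> m, a) - frag_of (m, \<phi> r \<otimes>\<^bsub>A\<^esub> a) |r m a.
        r \<in> carrier R \<and> m \<in> carrier M \<and> a \<in> carrier A}"

definition tensor_cover ::
  "('r, 'm) module \<Rightarrow> (complex, 'a) module \<Rightarrow> ('m \<times> 'a \<Rightarrow>\<^sub>0 int) monoid" where
  "tensor_cover M A = free_Abelian_group (carrier M \<times> carrier A)"

definition tensor_kernel ::
  "(complex, 'r) module \<Rightarrow> ('r, 'm) module \<Rightarrow> ('r \<Rightarrow> 'a) \<Rightarrow> (complex, 'a) module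
     \<Rightarrow> ('m \<times> 'a \<Rightarrow>\<^sub>0 int) set" where
  "tensor_kernel R M \<phi> A = generate (tensor_cover M A) (tensor_relations R M \<phi> A)"

definition tensor_module ::
  "(complex, 'r) module \<Rightarrow> ('r, 'm) module \<Rightarrow> ('r \<Rightarrow> 'a) \<Rightarrow> (complex, 'a) module
     \<Rightarrow> ('a, ('m \<times> 'a \<Rightarrow>\<^sub>0 int) set) module" where
  "tensor_module R M \<phi> A =
    (let G = tensor_cover M A; H = tensor_kernel R M \<phi> A
     in \<lparr>carrier = carrier (G Mod H), monoid.mult = undefined, monoid.one = undefined,
         ring.zero = monoid.one (G Mod H), ring.add = monoid.mult (G Mod H),
         smult = (\<lambda>b T. \<Union>c\<in>T.
           H #>\<^bsub>G\<^esub> frag_extend (\<lambda>(m, a). frag_of (m, a \<otimes>\<^bsub>A\<^esub> b)) c)\<rparr>)"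

definition pure_tensor ::
  "(complex, 'r) module \<Rightarrow> ('r, 'm) module \<Rightarrow> ('r \<Rightarrow> 'a) \<Rightarrow> (complex, 'a) module
     \<Rightarrow> 'm \<Rightarrow> 'a \<Rightarrow> ('m \<times> 'a \<Rightarrow>\<^sub>0 int) set" where
  "pure_tensor R M \<phi> A m a = tensor_kernel R M \<phi> A #>\<^bsub>tensor_cover M A\<^esub> frag_of (m, a)"


section \<open>The sequence\<close>

definition Z2_one_minus_g :: Z2_elem where
  "Z2_one_minus_g = \<one>\<^bsub>Z2_alg\<^esub> \<ominus>\<^bsub>Z2_alg\<^esub> Z2_gen"

text \<open>The right ideal spanned by \<open>1 - g\<close>, as a right module over the group algebra.\<close>

definition Z2_line :: "(Z2_elem, Z2_elem) module" where
  "Z2_line = (regular_module Z2_alg)\<lparr>carrier := {c \<odot>\<^bsub>Z2_alg\<^esub> Z2_one_minus_g |c. True}\<rparr>"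

type_synonym 'n T_elem = "(Z2_elem \<times> 'n A_elem \<Rightarrow>\<^sub>0 int) set"

definition T_module :: "complex^'n^'n \<Rightarrow> ('n::finite A_elem, 'n T_elem) module" where
  "T_module E = tensor_module Z2_alg Z2_line (Z2_to_A E) (A_alg E)"

definition T_pure :: "complex^'n^'n \<Rightarrow> 'n::finite A_elem \<Rightarrow> 'n T_elem" where
  "T_pure E = pure_tensor Z2_alg Z2_line (Z2_to_A E) (A_alg E) Z2_one_minus_g"

definition Phi3 :: "complex^'n^'n \<Rightarrow> 'n::finite A_elem \<Rightarrow> ('n, 'n A_elem) matr" where
  "Phi3 E a =
    (let A = A_alg E; c = matr_const A
     in a \<odot>\<^bsub>matr_module A\<^esub>
        (matr_minus A
          (matr_mult A (matr_mult A (c E) (A_x E)) (c (transpose (matrix_inv E))))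
          (matr_mult A (c (transpose E)) (c (matrix_inv E)))))"

definition Phi2 ::
  "complex^'n^'n \<Rightarrow> ('n::finite, 'n A_elem) matr \<Rightarrow> ('n, 'n A_elem) matr \<times> 'n T_elem" where
  "Phi2 E U =
    (let A = A_alg E; c = matr_const A
     in (matr_add A U
          (matr_transpose
            (matr_mult A
              (matr_mult A (matr_mult A (c (matrix_inv E)) (matr_transpose (A_x E))) U) (c E))),
         \<zero>\<^bsub>T_module E\<^esub>))"

text \<open>
  Every element of the tensor product is of the form \<open>(1 - g) \<otimes> a\<close>; although \<open>a\<close> is not
  unique, the product of \<open>1 - g\<close> and \<open>a\<close> in \<open>A(E)\<close> is.
\<close>

definition Phi1 ::
  "complex^'n^'n \<Rightarrow> ('n::finite, 'n A_elem) matr \<times> 'n T_elem \<Rightarrow> 'n A_elem" where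
  "Phi1 E = (\<lambda>(U, T).
    let A = A_alg E
    in THE y. \<exists>a\<in>carrier A. T = T_pure E a \<and>
         y = (matr_trace A (matr_mult A (matr_transpose (A_x E)) U) \<ominus>\<^bsub>A\<^esub> matr_trace A U)
             \<oplus>\<^bsub>A\<^esub> (\<one>\<^bsub>A\<^esub> \<ominus>\<^bsub>A\<^esub> A_g E) \<otimes>\<^bsub>A\<^esub> a)"

end

theory Submission
  imports Defs
begin

text \<open>
  A relation between \<open>1 - g\<close> and the entries of \<open>x - 1\<close>, which generate the augmentation ideal,
  is detected by \<open>\<epsilon>\<close>-derivations: the universal property of \<open>A(E)\<close> provides a derivation that kills
  the \<open>x\<^sub>i\<^sub>j\<close> and sends \<open>g\<close> to \<open>g - 1\<close>, and one into the cokernel of \<open>\<Phi>\<^sub>2\<close> that kills \<open>g\<close> and sends \<open>x\<^sub>i\<^sub>j\<close>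
  to the class of a matrix unit, since \<open>\<Phi>\<^sub>2\<close> is the linearisation of the defining relations. This
  gives exactness at the middle term.
  
  For the kernel of \<open>\<Phi>\<^sub>2\<close>, a nonzero isotropic vector allows one to write \<open>x = P y Q\<close> with
  relations for \<open>y\<close> that form a confluent rewriting system together with \<open>g\<^sup>2 = 1\<close>. In the resulting
  basis of \<open>A(E)\<close> the equation \<open>\<Phi>\<^sub>2(U) = 0\<close> becomes \<open>D + y D\<^sup>t H = 0\<close>, and a solution is reduced
  to zero by induction on the length of its words, subtracting at each step an element of the image
  of \<open>\<Phi>\<^sub>3\<close>. Finally \<open>(1 - g) \<otimes> a\<close> is determined by \<open>(1 - g) a\<close>, and it generates a direct summand of
  \<open>A(E)\<close> because \<open>(1 - g)/2\<close> is idempotent.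
\<close>

text \<open>The obstacle sits at the left end. Exactness further right needs only universal
  properties, but the kernels of the two leftmost maps depend on which elements of A(E) vanish,
  hence on a basis. The relations \<open>x^t E x = E\<close> and \<open>x E^-1 x^t = E^-1\<close>
  offer no usable leading words as they stand. If one row of E is a unit vector with its entry off
  the diagonal, each relation of the first family gets one leading word, whose two row indices
  differ; two such words then never overlap each other, and likewise for columns, so only mixed
  ambiguities remain. The off-diagonal position is what needs an isotropic vector, which exists over
  the complex numbers once n is at least 2. The first family asks for a congruence of E and the
  second for one of its inverse, so P and Q are chosen independently. The resulting relations for y
  involve two different forms, and the one compatibility condition between them is an equality of
  traces that holds because both traces equal \<open>tr(E E^-t)\<close>.\<close>

section \<open>Linear maps on finitely supported functions\<close>

text \<open>The scalar multiplication of \<open>monoid_alg\<close>, named so that vectors of words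
  and elements of free algebras share one set of rules.\<close>

definition scal :: "complex \<Rightarrow> ('a \<Rightarrow>\<^sub>0 complex) \<Rightarrow> ('a \<Rightarrow>\<^sub>0 complex)" where
  "scal c = Poly_Mapping.map ((*) c)"

lemma lookup_scal [simp]: "Poly_Mapping.lookup (scal c f) w = c * Poly_Mapping.lookup f w"
  unfolding scal_def by (simp add: Poly_Mapping.map.rep_eq when_def)

lemma scal_simps [simp]:
  "scal c 0 = 0" "scal 0 f = 0" "scal 1 f = f" "scal c (scal d f) = scal (c * d) f"
  "scal c (Poly_Mapping.single w d) = Poly_Mapping.single w (c * d)"
  "scal (- c) f = - scal c f" "scal c (- f) = - scal c f"
  by (auto intro!: poly_mapping_eqI simp: lookup_single when_def)

lemma scal_add: "scal c (f + g) = scal c f + scal c g"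
  and scal_add_left: "scal (c + d) f = scal c f + scal d f"
  and scal_diff: "scal c (f - g) = scal c f - scal c g"
  and scal_diff_left: "scal (c - d) f = scal c f - scal d f"
  by (auto intro!: poly_mapping_eqI simp: lookup_add lookup_minus algebra_simps)

lemma scal_sum: "scal c (\<Sum>i\<in>I. f i) = (\<Sum>i\<in>I. scal c (f i))"
  by (induction I rule: infinite_finite_induct) (auto simp: scal_add)

lemma scal_sum_left: "scal (\<Sum>i\<in>I. c i) f = (\<Sum>i\<in>I. scal (c i) f)"
  by (induction I rule: infinite_finite_induct) (auto simp: scal_add_left)

lemma lookup_sum': "Poly_Mapping.lookup (\<Sum>i\<in>I. f i) w = (\<Sum>i\<in>I. Poly_Mapping.lookup (f i) w)"
  by (induction I rule: infinite_finite_induct) (auto simp: lookup_add)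

lemma keys_scal: "Poly_Mapping.keys (scal c f) \<subseteq> Poly_Mapping.keys f"
  by (auto simp: in_keys_iff)

definition lin :: "(('a \<Rightarrow>\<^sub>0 complex) \<Rightarrow> ('b \<Rightarrow>\<^sub>0 complex)) \<Rightarrow> bool" where
  "lin T \<longleftrightarrow> (\<forall>f g. T (f + g) = T f + T g) \<and> (\<forall>c f. T (scal c f) = scal c (T f))"

lemma linI: "(\<And>f g. T (f + g) = T f + T g) \<Longrightarrow> (\<And>c f. T (scal c f) = scal c (T f)) \<Longrightarrow> lin T"
  by (simp add: lin_def)

lemma lin_add: "lin T \<Longrightarrow> T (f + g) = T f + T g"
  and lin_scal: "lin T \<Longrightarrow> T (scal c f) = scal c (T f)"
  by (simp_all add: lin_def)

lemma lin_zero: "lin T \<Longrightarrow> T 0 = 0"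
  using lin_scal[of T 0 0] by simp

lemma lin_minus: "lin T \<Longrightarrow> T (- f) = - T f"
  using lin_scal[of T "-1" f] by simp

lemma lin_diff: "lin T \<Longrightarrow> T (f - g) = T f - T g"
  using lin_add[of T f "- g"] by (simp add: lin_minus)

lemma lin_sum: "lin T \<Longrightarrow> T (\<Sum>i\<in>I. f i) = (\<Sum>i\<in>I. T (f i))"
  by (induction I rule: infinite_finite_induct) (auto simp: lin_add lin_zero)

lemmas lin_rules = lin_add lin_scal lin_zero lin_minus lin_diff lin_sum

lemma sum_monomials:
  "f = (\<Sum>w\<in>Poly_Mapping.keys f. Poly_Mapping.single w (Poly_Mapping.lookup f w))"
proof (rule poly_mapping_eqI)
  fix v
  show "Poly_Mapping.lookup f v = Poly_Mapping.lookup
     (\<Sum>w\<in>Poly_Mapping.keys f. Poly_Mapping.single w (Poly_Mapping.lookup f w)) v"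
    by (cases "v \<in> Poly_Mapping.keys f")
      (auto simp: lookup_sum' lookup_single when_def in_keys_iff sum.delta)
qed

text \<open>Agreement is demanded only on the words that occur, so the lemma also compares maps on
  subspaces such as the span of the normal words.\<close>

lemma lin_eq_on_keys:
  assumes "lin S" "lin T" "\<And>w. w \<in> Poly_Mapping.keys f \<Longrightarrow>
    S (Poly_Mapping.single w 1) = T (Poly_Mapping.single w 1)"
  shows "S f = T f"
proof -
  have f: "f = (\<Sum>w\<in>Poly_Mapping.keys f. scal (Poly_Mapping.lookup f w) (Poly_Mapping.single w 1))"
    by (simp add: sum_monomials[symmetric])
  show ?thesis
    by (subst (1 2) f) (simp only: lin_sum[OF assms(1)] lin_sum[OF assms(2)]
      lin_scal[OF assms(1)] lin_scal[OF assms(2)] assms(3) cong: sum.cong)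
qed

text \<open>Linear extension of a map given on basis elements. Normal forms, left multiplication by
  a letter and the convolution product are instances, so their composition laws all come from
  \<open>ext_ext\<close>.\<close>

definition ext :: "('a \<Rightarrow> ('b \<Rightarrow>\<^sub>0 complex)) \<Rightarrow> ('a \<Rightarrow>\<^sub>0 complex) \<Rightarrow> ('b \<Rightarrow>\<^sub>0 complex)" where
  "ext \<phi> f = (\<Sum>w\<in>Poly_Mapping.keys f. scal (Poly_Mapping.lookup f w) (\<phi> w))"

lemma ext_superset:
  assumes "finite K" "Poly_Mapping.keys f \<subseteq> K"
  shows "ext \<phi> f = (\<Sum>w\<in>K. scal (Poly_Mapping.lookup f w) (\<phi> w))"
  unfolding ext_def using assms
  by (intro sum.mono_neutral_left) (auto simp: in_keys_iff)

lemma lin_ext [simp]: "lin (ext \<phi>)"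
proof (rule linI)
  fix f g :: "'a \<Rightarrow>\<^sub>0 complex" and c
  let ?K = "Poly_Mapping.keys f \<union> Poly_Mapping.keys g"
  have "Poly_Mapping.keys (f + g) \<subseteq> ?K" by (rule Poly_Mapping.keys_add)
  then show "ext \<phi> (f + g) = ext \<phi> f + ext \<phi> g"
    by (simp add: ext_superset[of ?K] lookup_add scal_add_left sum.distrib)
  show "ext \<phi> (scal c f) = scal c (ext \<phi> f)"
    using keys_scal[of c f] by (simp add: ext_superset[of "Poly_Mapping.keys f"] scal_sum)
qed

lemmas ext_rules = lin_rules[OF lin_ext]

lemma ext_single [simp]: "ext \<phi> (Poly_Mapping.single w c) = scal c (\<phi> w)"
  by (simp add: ext_def)

lemma ext_cong: "f = g \<Longrightarrow> (\<And>w. w \<in> Poly_Mapping.keys g \<Longrightarrow> \<phi> w = \<psi> w) \<Longrightarrow> ext \<phi> f = ext \<psi> g"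
  by (simp add: ext_def)

lemma lin_comp: "lin S \<Longrightarrow> lin T \<Longrightarrow> lin (\<lambda>f. S (T f))"
  by (simp add: lin_def)

lemma lin_ext_eq: "lin T \<Longrightarrow> T (ext \<phi> f) = ext (\<lambda>w. T (\<phi> w)) f"
  by (simp add: ext_def lin_sum lin_scal)

lemma ext_ext: "ext \<phi> (ext \<psi> f) = ext (\<lambda>w. ext \<phi> (\<psi> w)) f"
  by (rule lin_ext_eq) simp

lemma keys_ext: "Poly_Mapping.keys (ext \<phi> f) \<subseteq> (\<Union>w\<in>Poly_Mapping.keys f. Poly_Mapping.keys (\<phi> w))"
proof -
  have "Poly_Mapping.keys (\<Sum>w\<in>I. scal (Poly_Mapping.lookup f w) (\<phi> w)) \<subseteq> (\<Union>w\<in>I. Poly_Mapping.keys (\<phi> w))" for I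
  proof (induction I rule: infinite_finite_induct)
    case (insert x F)
    then show ?case using Poly_Mapping.keys_add keys_scal by fastforce
  qed auto
  then show ?thesis by (simp add: ext_def)
qed

lemma ext_single_id: "ext (\<lambda>w. Poly_Mapping.single w 1) f = f"
  by (simp add: ext_def sum_monomials[symmetric])

lemma ext_scal_left: "ext (\<lambda>w. scal c (\<phi> w)) f = scal c (ext \<phi> f)"
  by (simp add: ext_def scal_sum mult.commute)

text \<open>Depending on \<open>W\<close> this is the carrier of a monoid algebra, the span of the
  normal words, or a step of the length filtration.\<close>

definition span_words :: "'a set \<Rightarrow> ('a \<Rightarrow>\<^sub>0 complex) set" where
  "span_words W = {f. Poly_Mapping.keys f \<subseteq> W}"

lemma span_words_closed:
  "0 \<in> span_words W" "f \<in> span_words W \<Longrightarrow> g \<in> span_words W \<Longrightarrow> f + g \<in> span_words W"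
  "f \<in> span_words W \<Longrightarrow> scal c f \<in> span_words W"
  "f \<in> span_words W \<Longrightarrow> - f \<in> span_words W"
  "f \<in> span_words W \<Longrightarrow> g \<in> span_words W \<Longrightarrow> f - g \<in> span_words W"
  "w \<in> W \<Longrightarrow> Poly_Mapping.single w c \<in> span_words W"
  unfolding span_words_def
  using Poly_Mapping.keys_add[of f g] keys_scal[of c f] keys_diff[of f g] by auto

lemma span_words_sum: "(\<And>i. i \<in> I \<Longrightarrow> f i \<in> span_words W) \<Longrightarrow> (\<Sum>i\<in>I. f i) \<in> span_words W"
  by (induction I rule: infinite_finite_induct) (auto intro: span_words_closed)

lemma span_words_ext:
  "f \<in> span_words V \<Longrightarrow> (\<And>w. w \<in> V \<Longrightarrow> \<phi> w \<in> span_words W) \<Longrightarrow> ext \<phi> f \<in> span_words W"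
  unfolding span_words_def using keys_ext[of \<phi> f] by blast

lemma span_words_mono: "V \<subseteq> W \<Longrightarrow> f \<in> span_words V \<Longrightarrow> f \<in> span_words W"
  by (auto simp: span_words_def)

section \<open>Normal forms of words in \<open>y\<close> and \<open>g\<close>, and the linear
  equation solved with them\<close>

section \<open>A rewriting system on words\<close>

type_synonym 'n word = "('n \<times> 'n) option list"
type_synonym 'n wvec = "('n \<times> 'n) option list \<Rightarrow>\<^sub>0 complex"

definition cons_word :: "'a \<Rightarrow> ('a list \<Rightarrow>\<^sub>0 complex) \<Rightarrow> ('a list \<Rightarrow>\<^sub>0 complex)" where
  "cons_word s = ext (\<lambda>v. Poly_Mapping.single (s # v) 1)"

definition append_word :: "('a list \<Rightarrow>\<^sub>0 complex) \<Rightarrow> 'a list \<Rightarrow> ('a list \<Rightarrow>\<^sub>0 complex)" where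
  "append_word h v = ext (\<lambda>u. Poly_Mapping.single (u @ v) 1) h"

lemma lin_cons_word [simp]: "lin (cons_word s)"
  by (simp add: cons_word_def)

lemma cons_word_single [simp]:
  "cons_word s (Poly_Mapping.single v c) = Poly_Mapping.single (s # v) c"
  by (simp add: cons_word_def)

lemma lookup_cons_word:
  "Poly_Mapping.lookup (cons_word s f) w =
    (case w of [] \<Rightarrow> 0 | t # v \<Rightarrow> if t = s then Poly_Mapping.lookup f v else 0)"
proof -
  have "Poly_Mapping.lookup (cons_word s f) w =
      (\<Sum>u\<in>Poly_Mapping.keys f. if w = s # u then Poly_Mapping.lookup f u else 0)"
    by (auto simp: cons_word_def ext_def lookup_sum' lookup_single when_def intro!: sum.cong)
  also have "\<dots> = (case w of [] \<Rightarrow> 0 | t # v \<Rightarrow> if t = s then Poly_Mapping.lookup f v else 0)"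
    by (cases w) (auto simp: in_keys_iff)
  finally show ?thesis .
qed

lemma keys_cons_word: "Poly_Mapping.keys (cons_word s f) \<subseteq> (#) s ` Poly_Mapping.keys f"
  unfolding cons_word_def using keys_ext[of "\<lambda>v. Poly_Mapping.single (s # v) 1" f] by auto

lemma keys_append_word: "Poly_Mapping.keys (append_word h v) \<subseteq> (\<lambda>u. u @ v) ` Poly_Mapping.keys h"
  unfolding append_word_def using keys_ext[of "\<lambda>u. Poly_Mapping.single (u @ v) 1" h] by auto

lemma keys_single_diff_sum:
  fixes g :: "_ \<Rightarrow> _ \<Rightarrow> complex"
  shows "Poly_Mapping.keys (Poly_Mapping.single [] c - (\<Sum>p\<in>I. \<Sum>q\<in>J. Poly_Mapping.single [A p, B q] (g p q)))
     \<subseteq> insert [] ((\<lambda>(p, q). [A p, B q]) ` (I \<times> J))"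
proof -
  let ?W = "insert [] ((\<lambda>(p, q). [A p, B q]) ` (I \<times> J))"
  have "(\<Sum>p\<in>I. \<Sum>q\<in>J. Poly_Mapping.single [A p, B q] (g p q)) \<in> span_words ?W"
    by (intro span_words_sum span_words_closed) auto
  then show ?thesis
    using span_words_closed(5)[OF span_words_closed(6)[of "[]" ?W c]]
    unfolding span_words_def by blast
qed

text \<open>
  The letter \<open>Some (i, j)\<close> stands for the generator \<open>y\<^sub>i\<^sub>j\<close> and \<open>None\<close> for \<open>g\<close>. The relations are
  \<open>y\<^sup>tEy = F\<close>, \<open>y f y\<^sup>t = e\<close> and \<open>g\<^sup>2 = 1\<close>. Since the row \<open>r0\<close> of \<open>E\<close> and the row \<open>c0\<close> of \<open>f\<close> have a
  single nonzero entry, the first two can be solved for the words \<open>y\<^sub>r\<^sub>0\<^sub>j y\<^sub>r\<^sub>1\<^sub>l\<close> and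
  \<open>y\<^sub>i\<^sub>c\<^sub>0 y\<^sub>k\<^sub>c\<^sub>1\<close>. On \<open>y\<^sub>r\<^sub>0\<^sub>c\<^sub>0 y\<^sub>r\<^sub>1\<^sub>c\<^sub>1\<close> both rules apply; \<open>trace_eq\<close> is what makes them
  agree.
\<close>

locale rewriting =
  fixes E e f F :: "'n::finite \<Rightarrow> 'n \<Rightarrow> complex" and r0 r1 c0 c1 :: 'n
  assumes r01: "r0 \<noteq> r1" and c01: "c0 \<noteq> c1"
    and E_r0: "E r0 l = (if l = r1 then 1 else 0)"
    and f_c0: "f c0 l = (if l = c1 then 1 else 0)"
    and E_e: "(\<Sum>l\<in>UNIV. E k l * e l i) = (if k = i then 1 else 0)"
    and e_E: "(\<Sum>l\<in>UNIV. e k l * E l i) = (if k = i then 1 else 0)"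
    and f_F: "(\<Sum>l\<in>UNIV. f k l * F l i) = (if k = i then 1 else 0)"
    and F_f: "(\<Sum>l\<in>UNIV. F k l * f l i) = (if k = i then 1 else 0)"
    and trace_eq: "(\<Sum>i\<in>UNIV. \<Sum>j\<in>UNIV. E i j * e i j) = (\<Sum>i\<in>UNIV. \<Sum>j\<in>UNIV. f i j * F i j)"
begin

text \<open>Where both rules match, the row rule has precedence. The column relation for the index
  pair \<open>(r0, r1)\<close> is therefore not built into the system and has to be derived
  (\<open>Col_trace\<close>).\<close>

fun rhs :: "('n \<times> 'n) option \<Rightarrow> ('n \<times> 'n) option \<Rightarrow> 'n wvec option" where
  "rhs (Some (i, j)) (Some (k, l)) =
    (if i = r0 \<and> k = r1 then
       Some (Poly_Mapping.single [] (F j l) -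
         (\<Sum>p\<in>UNIV - {r0}. \<Sum>q\<in>UNIV. Poly_Mapping.single [Some (p, j), Some (q, l)] (E p q)))
     else if j = c0 \<and> l = c1 then
       Some (Poly_Mapping.single [] (e i k) -
         (\<Sum>p\<in>UNIV - {c0}. \<Sum>q\<in>UNIV. Poly_Mapping.single [Some (i, p), Some (k, q)] (f p q)))
     else None)"
| "rhs None None = Some (Poly_Mapping.single [] 1)"
| "rhs _ _ = None"

text \<open>Each critical index raises the rank by one. A rule replaces the critical index of the
  first letter by another value and keeps its second index, so the rank of that letter
  drops.\<close>

fun lrank :: "('n \<times> 'n) option \<Rightarrow> nat" where
  "lrank None = 1"
| "lrank (Some (i, j)) = 1 + of_bool (i = r0) + of_bool (j = c0)"

text \<open>Ranks read as digits in base 4: as they lie between 1 and 3, comparing weights compares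
  lengths first and then ranks lexicographically.\<close>

fun weight :: "'n word \<Rightarrow> nat" where
  "weight [] = 0"
| "weight (s # w) = lrank s * 4 ^ length w + weight w"

text \<open>The rightmost reduction: the first letter is touched only when the tail is already
  normal. This choice is what makes \<open>nf_Cons\<close> true without any appeal to
  confluence.\<close>

fun redex :: "'n word \<Rightarrow> 'n wvec option" where
  "redex [] = None"
| "redex (s # w) = (case redex w of Some p \<Rightarrow> Some (cons_word s p)
     | None \<Rightarrow> (case w of [] \<Rightarrow> None | t # v \<Rightarrow> map_option (\<lambda>h. append_word h v) (rhs s t)))"

abbreviation "irred w \<equiv> redex w = None"

lemma rank_bounds: "lrank s \<ge> 1" "lrank s \<le> 3"
  by (cases s rule: lrank.cases; simp)+

text \<open>The sums in the rules leave out \<open>r0\<close> in the row case and \<open>c0\<close>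
  in the column case, which is exactly the drop in rank of the first letter.\<close>

lemma keys_rhs:
  assumes "rhs s t = Some h" "u \<in> Poly_Mapping.keys h"
  shows "u = [] \<or> (\<exists>a b. u = [a, b] \<and> lrank a < lrank s)"
proof -
  show ?thesis
  proof (cases "(s, t)" rule: rhs.cases)
    case (1 i j k l)
    show ?thesis
    proof (cases "i = r0 \<and> k = r1")
      case True
      then show ?thesis using assms 1
          keys_single_diff_sum[where c = "F j l" and I = "UNIV - {r0}" and J = UNIV and A = "\<lambda>p. Some (p, j)" and B = "\<lambda>q. Some (q, l)" and g = E] by auto
    next
      case False
      then show ?thesis using assms 1
          keys_single_diff_sum[where c = "e i k" and I = "UNIV - {c0}" and J = UNIV and A = "\<lambda>p. Some (i, p)" and B = "\<lambda>q. Some (k, q)" and g = f]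
        by (auto split: if_splits)
    qed
  qed (use assms in auto)
qed

lemma redex_weight:
  "redex w = Some p \<Longrightarrow> u \<in> Poly_Mapping.keys p \<Longrightarrow> weight u < weight w \<and> length u \<le> length w"
proof (induction w arbitrary: p u)
  case (Cons s w)
  \<comment> \<open>Digits are at most 3, so a word of length n weighs less than
    \<open>4 ^ n\<close>.\<close>
  have weight_lt: "weight w < 4 ^ length w" for w
  proof (induction w)
    case (Cons s w)
    have "lrank s * 4 ^ length w \<le> 3 * 4 ^ length w"
      using rank_bounds(2) by (rule mult_right_mono) simp
    then have "weight (s # w) < 3 * 4 ^ length w + 4 ^ length w"
      using Cons.IH unfolding weight.simps by linarith
    then show ?case by simp
  qed simp
  show ?case
  proof (cases "redex w")
    case (Some q)
    with Cons.prems(1) have "p = cons_word s q" by simp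
    then have "u \<in> (#) s ` Poly_Mapping.keys q"
      using Cons.prems(2) keys_cons_word[of s q] by auto
    then obtain v where v: "u = s # v" "v \<in> Poly_Mapping.keys q" by (rule imageE)
    have "weight v < weight w \<and> length v \<le> length w" by (rule Cons.IH[OF Some v(2)])
    moreover from this have "lrank s * 4 ^ length v \<le> lrank s * 4 ^ length w"
      by (intro mult_left_mono power_increasing) auto
    ultimately show ?thesis unfolding v(1) weight.simps length_Cons by linarith
  next
    case None
    then obtain t v h where w: "w = t # v" "rhs s t = Some h" "p = append_word h v"
      using Cons.prems by (auto split: list.splits)
    then have "u \<in> (\<lambda>x. x @ v) ` Poly_Mapping.keys h"
      using Cons.prems(2) keys_append_word[of h v] by auto
    then obtain x where x: "u = x @ v" "x \<in> Poly_Mapping.keys h" by (rule imageE)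
    have pos: "weight (s # w) \<ge> 4 ^ length w + weight w" using mult_right_mono[OF rank_bounds(1)[of s], of "4 ^ length w"]
      unfolding weight.simps by linarith
    from keys_rhs[OF w(2) x(2)] show ?thesis
    proof (elim disjE exE conjE)
      fix a b assume ab: "x = [a, b]" "lrank a < lrank s"
      \<comment> \<open>The leading digit drops by at least one, which outweighs any change in the
        remaining digits.\<close>
      have "lrank a * 4 ^ length w + 4 ^ length w \<le> lrank s * 4 ^ length w"
        using ab(2) by (metis Suc_leI add.commute mult_Suc mult_le_mono1)
      moreover have "weight (b # v) < 4 ^ length w" using weight_lt[of "b # v"] w by simp
      ultimately have "weight u < weight (s # w)" using x(1) ab(1) w(1) unfolding weight.simps
        by (simp only: append_Cons append_Nil weight.simps length_Cons)
      then show ?thesis using x ab w by simp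
    next
      assume "x = []"
      moreover have "weight v < 4 ^ length w"
        using weight_lt[of v] w by (simp add: less_le_trans)
      ultimately show ?thesis using pos x w by simp
    qed
  qed
qed simp

text \<open>A fixed reduction strategy yields a well defined function by termination alone. That it
  respects all relations of the algebra is a separate statement, proved in
  \<open>relations_irred\<close>.\<close>

function nf :: "'n word \<Rightarrow> 'n wvec" where
  "nf w = (case redex w of None \<Rightarrow> Poly_Mapping.single w 1
     | Some p \<Rightarrow> (\<Sum>u\<in>Poly_Mapping.keys p. scal (Poly_Mapping.lookup p u) (nf u)))"
  by auto
termination
  by (relation "measure weight") (auto dest: redex_weight)

declare nf.simps [simp del]

text \<open>Left multiplication by a letter followed by reduction. These operators will be the
  images of the generators in a representation of A(E).\<close>

definition lf :: "('n \<times> 'n) option \<Rightarrow> 'n wvec \<Rightarrow> 'n wvec" where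
  "lf t = ext (\<lambda>v. nf (t # v))"

abbreviation NF :: "'n wvec \<Rightarrow> 'n wvec" where
  "NF \<equiv> ext nf"

abbreviation sgl :: "'n word \<Rightarrow> 'n wvec" where
  "sgl w \<equiv> Poly_Mapping.single w 1"

abbreviation NV :: "'n wvec set" where
  "NV \<equiv> span_words {w. irred w}"

lemma lin_lf [simp]: "lin (lf t)"
  by (simp add: lf_def)

lemmas lf_rules = lin_rules[OF lin_lf]

lemma lf_single: "lf t (Poly_Mapping.single v c) = scal c (nf (t # v))"
  by (simp add: lf_def)

lemma nf_irred: "irred w \<Longrightarrow> nf w = sgl w"
  by (simp add: nf.simps)

lemma nf_redex: "redex w = Some p \<Longrightarrow> nf w = NF p"
  by (subst nf.simps) (simp add: ext_def)

lemma nf_in_NV: "nf w \<in> NV"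
proof (induction w rule: nf.induct)
  case (1 w)
  show ?case
  proof (cases "redex w")
    case None
    then show ?thesis by (simp add: nf_irred span_words_closed)
  next
    case (Some p)
    then have "NF p \<in> NV"
      by (intro span_words_ext[of p "Poly_Mapping.keys p"] 1) (auto simp: span_words_def)
    then show ?thesis by (simp add: nf_redex Some)
  qed
qed

lemma NF_in_NV: "NF v \<in> NV"
  by (rule span_words_ext[where V = UNIV, OF _ nf_in_NV]) (simp add: span_words_def)

lemma lf_in_NV: "lf t v \<in> NV"
  unfolding lf_def
  by (rule span_words_ext[where V = UNIV, OF _ nf_in_NV]) (simp add: span_words_def)

lemma lin_eq_on_NV:
  assumes "v \<in> NV" "lin S" "lin T" "\<And>w. irred w \<Longrightarrow> S (sgl w) = T (sgl w)"
  shows "S v = T v"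
proof (rule lin_eq_on_keys[OF assms(2,3)])
  fix w assume "w \<in> Poly_Mapping.keys v"
  then show "S (sgl w) = T (sgl w)" using assms(1) by (intro assms(4)) (auto simp: span_words_def)
qed

lemma NF_id: "v \<in> NV \<Longrightarrow> NF v = v"
  by (rule lin_eq_on_NV[where T = "\<lambda>v. v"]) (simp_all add: nf_irred linI)

lemma NF_lf: "NF (lf t v) = lf t v"
  by (rule NF_id[OF lf_in_NV])

text \<open>The rightmost strategy reduces \<open>w\<close> completely before it looks at
  \<open>t\<close>, so both sides run through the same reductions.\<close>

lemma nf_Cons: "nf (t # w) = lf t (nf w)"
proof (induction w rule: nf.induct)
  case (1 w)
  show ?case
  proof (cases "redex w")
    case None
    then show ?thesis by (simp add: nf_irred lf_single)
  next
    case (Some p)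
    then have "nf (t # w) = NF (cons_word t p)" by (simp add: nf_redex)
    also have "\<dots> = ext (\<lambda>u. nf (t # u)) p" by (simp add: cons_word_def ext_ext)
    also have "\<dots> = ext (\<lambda>u. lf t (nf u)) p" by (intro ext_cong 1 refl) (auto simp: Some)
    also have "\<dots> = lf t (nf w)" by (simp add: nf_redex Some lin_ext_eq)
    finally show ?thesis .
  qed
qed

lemma lf_NF: "lf t (NF v) = lf t v"
  by (simp add: lin_ext_eq nf_Cons[symmetric]) (simp add: lf_def)

lemma irred_tail: "irred (s # w) \<Longrightarrow> irred w"
  by (simp split: option.splits)

lemma nf_rhs:
  assumes "irred (t # v)" "rhs s t = Some h"
  shows "nf (s # t # v) = NF (append_word h v)"
  using assms by (intro nf_redex) (simp only: redex.simps option.case list.case option.map)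

text \<open>No rule lengthens a word. The degree arguments for the twisted equation rest on
  this.\<close>

lemma nf_length: "nf w \<in> span_words {u. length u \<le> length w}"
proof (induction w rule: nf.induct)
  case (1 w)
  show ?case
  proof (cases "redex w")
    case None
    then show ?thesis by (simp add: nf_irred span_words_closed)
  next
    case (Some p)
    have "NF p \<in> span_words {u. length u \<le> length w}"
    proof (rule span_words_ext[of p "Poly_Mapping.keys p"])
      fix u assume u: "u \<in> Poly_Mapping.keys p"
      then have "length u \<le> length w" using redex_weight[OF Some] by blast
      with 1[OF Some u] show "nf u \<in> span_words {u. length u \<le> length w}"
        by (rule_tac span_words_mono[rotated]) auto
    qed (simp add: span_words_def)
    then show ?thesis by (simp add: nf_redex Some)
  qed
qed

end

section \<open>The defining relations on normal words\<close>

context rewriting begin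

abbreviation L :: "'n \<Rightarrow> 'n \<Rightarrow> 'n wvec \<Rightarrow> 'n wvec" where
  "L i j \<equiv> lf (Some (i, j))"

text \<open>The entry \<open>(j, j')\<close> of \<open>y^t E y\<close>, acting on normal words;
  \<open>Col\<close> is the corresponding entry of \<open>y f y^t\<close>.\<close>

definition Row :: "'n \<Rightarrow> 'n \<Rightarrow> 'n wvec \<Rightarrow> 'n wvec" where
  "Row j j' x = (\<Sum>p\<in>UNIV. \<Sum>q\<in>UNIV. scal (E p q) (L p j (L q j' x)))"

definition Col :: "'n \<Rightarrow> 'n \<Rightarrow> 'n wvec \<Rightarrow> 'n wvec" where
  "Col i i' x = (\<Sum>p\<in>UNIV. \<Sum>q\<in>UNIV. scal (f p q) (L i p (L i' q x)))"

lemma lin_Row [simp]: "lin (Row j j')"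
  by (rule linI) (simp_all add: Row_def lf_rules scal_add scal_sum sum.distrib mult.commute)

lemma lin_Col [simp]: "lin (Col i i')"
  by (rule linI) (simp_all add: Col_def lf_rules scal_add scal_sum sum.distrib mult.commute)

text \<open>Row \<open>r0\<close> of \<open>E\<close> is the unit vector at \<open>r1\<close>, so
  the leading product is isolated from the rest; \<open>sum_f_split\<close> does the same for
  columns.\<close>

lemma sum_E_split:
  "(\<Sum>p\<in>UNIV. \<Sum>q\<in>UNIV. scal (E p q) (g p q)) =
    g r0 r1 + (\<Sum>p\<in>UNIV - {r0}. \<Sum>q\<in>UNIV. scal (E p q) (g p q))"
proof -
  have "(\<Sum>q\<in>UNIV. scal (E r0 q) (g r0 q)) = (\<Sum>q\<in>UNIV. if q = r1 then g r0 q else 0)"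
    by (intro sum.cong) (auto simp: E_r0)
  also have "\<dots> = g r0 r1" by simp
  finally show ?thesis by (subst sum.remove[of _ r0]) auto
qed

lemma sum_f_split:
  "(\<Sum>p\<in>UNIV. \<Sum>q\<in>UNIV. scal (f p q) (g p q)) =
    g c0 c1 + (\<Sum>p\<in>UNIV - {c0}. \<Sum>q\<in>UNIV. scal (f p q) (g p q))"
proof -
  have "(\<Sum>q\<in>UNIV. scal (f c0 q) (g c0 q)) = (\<Sum>q\<in>UNIV. if q = c1 then g c0 q else 0)"
    by (intro sum.cong) (auto simp: f_c0)
  also have "\<dots> = g c0 c1" by simp
  finally show ?thesis by (subst sum.remove[of _ c0]) auto
qed

lemma lin_append_word: "lin (\<lambda>h. append_word h v)"
  by (simp add: append_word_def)

lemmas append_word_rules = lin_rules[OF lin_append_word]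

lemma NF_append:
  assumes "irred v"
  shows "NF (append_word (Poly_Mapping.single [] c -
      (\<Sum>p\<in>I. \<Sum>q\<in>J. Poly_Mapping.single [A p, B q] (g p q))) v) =
    scal c (sgl v) - (\<Sum>p\<in>I. \<Sum>q\<in>J. scal (g p q) (lf (A p) (lf (B q) (sgl v))))"
proof -
  have a: "append_word (Poly_Mapping.single u d) v = scal d (sgl (u @ v))" for u d
    by (simp add: append_word_def)
  show ?thesis
    using assms by (simp add: append_word_rules a ext_rules nf_Cons nf_irred lf_rules del: scal_simps(5))
qed

lemma L_sgl: "irred (s # v) \<Longrightarrow> lf s (sgl v) = sgl (s # v)"
  using nf_irred[of "s # v"] by (simp add: lf_single del: redex.simps)

lemma irred_Cons:
  "irred v \<Longrightarrow> (\<And>t u. v = t # u \<Longrightarrow> rhs s t = None) \<Longrightarrow> irred (s # v)"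
  by (simp split: list.splits)

lemma irred_Some:
  assumes "irred v"
    and "i = r0 \<Longrightarrow> \<forall>k u. v \<noteq> Some (r1, k) # u"
    and "j = c0 \<Longrightarrow> \<forall>k u. v \<noteq> Some (k, c1) # u"
  shows "irred (Some (i, j) # v)"
proof (rule irred_Cons[OF assms(1)])
  fix t u assume "v = t # u"
  then show "rhs (Some (i, j)) t = None"
    using assms(2,3) by (cases "(Some (i, j), t)" rule: rhs.cases) auto
qed

text \<open>If the word behind the critical first letter is normal, the row rule is the next
  reduction, and it is the claimed relation solved for its leading word.\<close>

lemma Row_step:
  assumes "irred (Some (r1, j') # v)"
  shows "Row j j' (sgl v) = scal (F j j') (sgl v)"
proof -
  have v: "irred v" by (rule irred_tail[OF assms])
  have r: "rhs (Some (r0, j)) (Some (r1, j')) = Some (Poly_Mapping.single [] (F j j') -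
      (\<Sum>p\<in>UNIV - {r0}. \<Sum>q\<in>UNIV. Poly_Mapping.single [Some (p, j), Some (q, j')] (E p q)))"
    by simp
  have "L r0 j (L r1 j' (sgl v)) = nf (Some (r0, j) # Some (r1, j') # v)"
    by (simp add: nf_Cons nf_irred[OF v] del: redex.simps)
  also have "\<dots> = scal (F j j') (sgl v) -
      (\<Sum>p\<in>UNIV - {r0}. \<Sum>q\<in>UNIV. scal (E p q) (L p j (L q j' (sgl v))))"
    unfolding nf_rhs[OF assms r] NF_append[OF v] by simp
  finally show ?thesis by (simp add: Row_def sum_E_split)
qed

text \<open>The excluded index pair is the one for which \<open>rhs\<close> may choose the row
  rule.\<close>

lemma Col_step:
  assumes "irred (Some (i', c1) # v)" "\<not> (i = r0 \<and> i' = r1)"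
  shows "Col i i' (sgl v) = scal (e i i') (sgl v)"
proof -
  have v: "irred v" by (rule irred_tail[OF assms(1)])
  have r: "rhs (Some (i, c0)) (Some (i', c1)) = Some (Poly_Mapping.single [] (e i i') -
      (\<Sum>p\<in>UNIV - {c0}. \<Sum>q\<in>UNIV. Poly_Mapping.single [Some (i, p), Some (i', q)] (f p q)))"
    using assms(2) by auto
  have "L i c0 (L i' c1 (sgl v)) = nf (Some (i, c0) # Some (i', c1) # v)"
    by (simp add: nf_Cons nf_irred[OF v] del: redex.simps)
  also have "\<dots> = scal (e i i') (sgl v) -
      (\<Sum>p\<in>UNIV - {c0}. \<Sum>q\<in>UNIV. scal (f p q) (L i p (L i' q (sgl v))))"
    unfolding nf_rhs[OF assms(1) r] NF_append[OF v] by simp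
  finally show ?thesis by (simp add: Col_def sum_f_split)
qed

text \<open>
  Expanding \<open>y f y\<^sup>t E y\<close> in two ways resolves the overlaps of row and column words without a
  computation in the rewriting system; the column analogue and the trace identity below play the
  same role for the other ambiguities.
\<close>

lemma Row_Col_overlap:
  "(\<Sum>p\<in>UNIV. \<Sum>q\<in>UNIV. scal (f p q) (Row j p (L i q x))) =
   (\<Sum>k\<in>UNIV. \<Sum>l\<in>UNIV. scal (E k l) (L k j (Col l i x)))"
proof -
  have "(\<Sum>p\<in>UNIV. \<Sum>q\<in>UNIV. scal (f p q) (Row j p (L i q x))) =
    (\<Sum>p\<in>UNIV. \<Sum>q\<in>UNIV. \<Sum>k\<in>UNIV. \<Sum>l\<in>UNIV. scal (f p q * E k l) (L k j (L l p (L i q x))))"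
    by (simp add: Row_def scal_sum)
  also have "\<dots> = (\<Sum>(p, q, k, l)\<in>UNIV. scal (f p q * E k l) (L k j (L l p (L i q x))))"
    by (simp add: sum.cartesian_product UNIV_Times_UNIV[symmetric] del: UNIV_Times_UNIV)
  also have "\<dots> = (\<Sum>(k, l, p, q)\<in>UNIV. scal (f p q * E k l) (L k j (L l p (L i q x))))"
    by (rule sum.reindex_bij_witness[of _ "\<lambda>(k, l, p, q). (p, q, k, l)" "\<lambda>(p, q, k, l). (k, l, p, q)"]) auto
  also have "\<dots> = (\<Sum>k\<in>UNIV. \<Sum>l\<in>UNIV. \<Sum>p\<in>UNIV. \<Sum>q\<in>UNIV. scal (f p q * E k l) (L k j (L l p (L i q x))))"
    by (simp add: sum.cartesian_product UNIV_Times_UNIV[symmetric] del: UNIV_Times_UNIV)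
  also have "\<dots> = (\<Sum>k\<in>UNIV. \<Sum>l\<in>UNIV. scal (E k l) (L k j (Col l i x)))"
    by (simp add: Col_def lf_rules scal_sum mult.commute)
  finally show ?thesis .
qed

lemma Col_Row_overlap:
  "(\<Sum>p\<in>UNIV. \<Sum>q\<in>UNIV. scal (E p q) (Col i p (L q k x))) =
   (\<Sum>j\<in>UNIV. \<Sum>j'\<in>UNIV. scal (f j j') (L i j (Row j' k x)))"
proof -
  have "(\<Sum>p\<in>UNIV. \<Sum>q\<in>UNIV. scal (E p q) (Col i p (L q k x))) =
    (\<Sum>p\<in>UNIV. \<Sum>q\<in>UNIV. \<Sum>j\<in>UNIV. \<Sum>j'\<in>UNIV. scal (E p q * f j j') (L i j (L p j' (L q k x))))"
    by (simp add: Col_def scal_sum)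
  also have "\<dots> = (\<Sum>(p, q, j, j')\<in>UNIV. scal (E p q * f j j') (L i j (L p j' (L q k x))))"
    by (simp add: sum.cartesian_product UNIV_Times_UNIV[symmetric] del: UNIV_Times_UNIV)
  also have "\<dots> = (\<Sum>(j, j', p, q)\<in>UNIV. scal (E p q * f j j') (L i j (L p j' (L q k x))))"
    by (rule sum.reindex_bij_witness[of _ "\<lambda>(k, l, p, q). (p, q, k, l)" "\<lambda>(p, q, k, l). (k, l, p, q)"]) auto
  also have "\<dots> = (\<Sum>j\<in>UNIV. \<Sum>j'\<in>UNIV. \<Sum>p\<in>UNIV. \<Sum>q\<in>UNIV. scal (E p q * f j j') (L i j (L p j' (L q k x))))"
    by (simp add: sum.cartesian_product UNIV_Times_UNIV[symmetric] del: UNIV_Times_UNIV)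
  also have "\<dots> = (\<Sum>j\<in>UNIV. \<Sum>j'\<in>UNIV. scal (f j j') (L i j (Row j' k x)))"
    by (simp add: Row_def lf_rules scal_sum mult.commute)
  finally show ?thesis .
qed

lemma Row_Col_trace:
  "(\<Sum>i\<in>UNIV. \<Sum>i'\<in>UNIV. scal (E i i') (Col i i' x)) =
   (\<Sum>j\<in>UNIV. \<Sum>j'\<in>UNIV. scal (f j j') (Row j j' x))"
proof -
  have "(\<Sum>i\<in>UNIV. \<Sum>i'\<in>UNIV. scal (E i i') (Col i i' x)) =
    (\<Sum>i\<in>UNIV. \<Sum>i'\<in>UNIV. \<Sum>j\<in>UNIV. \<Sum>j'\<in>UNIV. scal (E i i' * f j j') (L i j (L i' j' x)))"
    by (simp add: Col_def scal_sum)
  also have "\<dots> = (\<Sum>(p, q, j, j')\<in>UNIV. scal (E p q * f j j') (L p j (L q j' x)))"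
    by (simp add: sum.cartesian_product UNIV_Times_UNIV[symmetric] del: UNIV_Times_UNIV)
  also have "\<dots> = (\<Sum>(j, j', p, q)\<in>UNIV. scal (E p q * f j j') (L p j (L q j' x)))"
    by (rule sum.reindex_bij_witness[of _ "\<lambda>(k, l, p, q). (p, q, k, l)" "\<lambda>(p, q, k, l). (k, l, p, q)"]) auto
  also have "\<dots> = (\<Sum>j\<in>UNIV. \<Sum>j'\<in>UNIV. \<Sum>i\<in>UNIV. \<Sum>i'\<in>UNIV. scal (E i i' * f j j') (L i j (L i' j' x)))"
    by (simp add: sum.cartesian_product UNIV_Times_UNIV[symmetric] del: UNIV_Times_UNIV)
  also have "\<dots> = (\<Sum>j\<in>UNIV. \<Sum>j'\<in>UNIV. scal (f j j') (Row j j' x))"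
    by (simp add: Row_def scal_sum mult.commute)
  finally show ?thesis .
qed

lemma sum_scal_delta:
  fixes a b :: "'n \<Rightarrow> 'n \<Rightarrow> complex"
  assumes "\<And>k. (\<Sum>l\<in>UNIV. a k l * b l i) = (if k = i then 1 else (0::complex))"
  shows "(\<Sum>k\<in>UNIV. \<Sum>l\<in>UNIV. scal (a k l) (scal (b l i) (g k))) = (g i :: 'a \<Rightarrow>\<^sub>0 complex)"
proof -
  have "(\<Sum>k\<in>UNIV. \<Sum>l\<in>UNIV. scal (a k l) (scal (b l i) (g k))) =
      (\<Sum>k\<in>UNIV. scal (\<Sum>l\<in>UNIV. a k l * b l i) (g k))"
    by (simp add: scal_sum_left)
  also have "\<dots> = (\<Sum>k\<in>UNIV. if k = i then g k else 0)"
    by (intro sum.cong) (auto simp: assms)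
  also have "\<dots> = g i" by simp
  finally show ?thesis .
qed

lemma sum_scal_delta':
  fixes a b :: "'n \<Rightarrow> 'n \<Rightarrow> complex"
  assumes "\<And>k. (\<Sum>l\<in>UNIV. a i l * b l k) = (if i = k then 1 else (0::complex))"
  shows "(\<Sum>k\<in>UNIV. \<Sum>l\<in>UNIV. scal (b l k) (scal (a i l) (g k))) = (g i :: 'a \<Rightarrow>\<^sub>0 complex)"
proof -
  have "(\<Sum>k\<in>UNIV. \<Sum>l\<in>UNIV. scal (b l k) (scal (a i l) (g k))) =
      (\<Sum>k\<in>UNIV. scal (\<Sum>l\<in>UNIV. a i l * b l k) (g k))"
    by (simp add: scal_sum_left mult.commute)
  also have "\<dots> = (\<Sum>k\<in>UNIV. if i = k then g k else 0)"
    by (intro sum.cong) (auto simp: assms)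
  also have "\<dots> = g i" by simp
  finally show ?thesis .
qed

lemma lin_scal_op: "lin (scal c)"
  by (rule linI) (simp_all add: scal_add mult.commute)

text \<open>No rule has a left hand side that begins with a letter in row \<open>r1\<close> outside
  column \<open>c0\<close>, so such a letter can be put in front of every normal word.\<close>

lemma Row_noncritical:
  assumes "v \<in> NV" "j' \<noteq> c0"
  shows "Row j j' v = scal (F j j') v"
proof (rule lin_eq_on_NV[OF assms(1) lin_Row lin_scal_op])
  fix w assume "irred w"
  then show "Row j j' (sgl w) = scal (F j j') (sgl w)"
    using r01 assms by (intro Row_step irred_Some) auto
qed

lemma Col_noncritical:
  assumes "v \<in> NV" "i' \<noteq> r0" "\<not> (i = r0 \<and> i' = r1)"
  shows "Col i i' v = scal (e i i') v"
proof (rule lin_eq_on_NV[OF assms(1) lin_Col lin_scal_op])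
  fix w assume "irred w"
  then show "Col i i' (sgl w) = scal (e i i') (sgl w)"
    using c01 assms by (intro Col_step irred_Some) auto
qed

text \<open>The ambiguous word is \<open>y_r0j y_r1c0 y_ic1 v\<close>. In the equality of
  \<open>(y^t E y) f y^t\<close> with \<open>y^t E (y f y^t)\<close> all summands with
  \<open>p\<close> different from \<open>c0\<close> are already known, and row \<open>c0\<close> of
  \<open>f\<close> contributes a single term, the wanted one.\<close>

lemma Row_overlap:
  assumes w: "irred (Some (i, c1) # v)" and col: "\<And>l. Col l i (sgl v) = scal (e l i) (sgl v)"
  shows "Row j c0 (sgl (Some (i, c1) # v)) = scal (F j c0) (sgl (Some (i, c1) # v))"
proof -
  let ?w = "sgl (Some (i, c1) # v)"
  have Lw: "L i c1 (sgl v) = ?w" by (rule L_sgl[OF w])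
  have "Row j c0 ?w + (\<Sum>p\<in>UNIV - {c0}. \<Sum>q\<in>UNIV. scal (f p q) (scal (F j p) (L i q (sgl v)))) =
      (\<Sum>p\<in>UNIV. \<Sum>q\<in>UNIV. scal (f p q) (Row j p (L i q (sgl v))))"
    unfolding sum_f_split Lw
    by (intro arg_cong2[where f = "(+)"] refl sum.cong) (simp add: Row_noncritical lf_in_NV)
  also have "\<dots> = (\<Sum>k\<in>UNIV. \<Sum>l\<in>UNIV. scal (E k l) (scal (e l i) (L k j (sgl v))))"
    by (simp only: Row_Col_overlap col lf_rules)
  \<comment> \<open>Here \<open>E e = 1\<close> collapses the double sum; the next step expands the
    same vector again by \<open>F f = 1\<close>, so that the known terms can be cancelled.\<close>
  also have "\<dots> = L i j (sgl v)" by (rule sum_scal_delta[OF E_e])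
  also have "\<dots> = (\<Sum>q\<in>UNIV. \<Sum>p\<in>UNIV. scal (f p q) (scal (F j p) (L i q (sgl v))))"
    by (rule sum_scal_delta'[OF F_f, symmetric])
  also have "\<dots> = (\<Sum>p\<in>UNIV. \<Sum>q\<in>UNIV. scal (f p q) (scal (F j p) (L i q (sgl v))))"
    by (rule sum.swap)
  also have "\<dots> = scal (F j c0) ?w +
      (\<Sum>p\<in>UNIV - {c0}. \<Sum>q\<in>UNIV. scal (f p q) (scal (F j p) (L i q (sgl v))))"
    by (simp only: sum_f_split Lw)
  finally show ?thesis by simp
qed

text \<open>The ambiguous word is \<open>y_ic0 y_r0c1 y_r1k v\<close>. The assumption
  \<open>col\<close> concerns vectors that may contain words as long as \<open>y_r1k v\<close>
  itself, so it cannot come from an induction on length and is passed in by the caller.\<close>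

lemma Col_overlap:
  assumes w: "irred (Some (r1, k) # v)" and row: "\<And>j'. Row j' k (sgl v) = scal (F j' k) (sgl v)"
    and col: "\<And>p q. p \<noteq> r0 \<Longrightarrow> Col i p (L q k (sgl v)) = scal (e i p) (L q k (sgl v))"
  shows "Col i r0 (sgl (Some (r1, k) # v)) = scal (e i r0) (sgl (Some (r1, k) # v))"
proof -
  let ?w = "sgl (Some (r1, k) # v)"
  have Lw: "L r1 k (sgl v) = ?w" by (rule L_sgl[OF w])
  have "Col i r0 ?w + (\<Sum>p\<in>UNIV - {r0}. \<Sum>q\<in>UNIV. scal (E p q) (scal (e i p) (L q k (sgl v)))) =
      (\<Sum>p\<in>UNIV. \<Sum>q\<in>UNIV. scal (E p q) (Col i p (L q k (sgl v))))"
    unfolding sum_E_split Lw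
    by (intro arg_cong2[where f = "(+)"] refl sum.cong) (simp add: col)
  also have "\<dots> = (\<Sum>j\<in>UNIV. \<Sum>j'\<in>UNIV. scal (f j j') (scal (F j' k) (L i j (sgl v))))"
    by (simp only: Col_Row_overlap row lf_rules)
  also have "\<dots> = L i k (sgl v)" by (rule sum_scal_delta[OF f_F])
  also have "\<dots> = (\<Sum>q\<in>UNIV. \<Sum>p\<in>UNIV. scal (E p q) (scal (e i p) (L q k (sgl v))))"
    by (rule sum_scal_delta'[OF e_E, symmetric])
  also have "\<dots> = (\<Sum>p\<in>UNIV. \<Sum>q\<in>UNIV. scal (E p q) (scal (e i p) (L q k (sgl v))))"
    by (rule sum.swap)
  also have "\<dots> = scal (e i r0) ?w +
      (\<Sum>p\<in>UNIV - {r0}. \<Sum>q\<in>UNIV. scal (E p q) (scal (e i p) (L q k (sgl v))))"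
    by (simp only: sum_E_split Lw)
  finally show ?thesis by simp
qed

text \<open>Both rules compete for \<open>y_r0c0 y_r1c1\<close>. Contracting the column relations
  with \<open>E\<close> gives the same vector as contracting the row relations with
  \<open>f\<close>, and in that equation only the pair \<open>(r0, r1)\<close> is unknown; the
  scalars match by \<open>trace_eq\<close>.\<close>

lemma Col_trace:
  assumes row: "\<And>j j'. Row j j' x = scal (F j j') x"
    and col: "\<And>i i'. i \<noteq> r0 \<Longrightarrow> Col i i' x = scal (e i i') x"
  shows "Col r0 r1 x = scal (e r0 r1) x"
proof -
  have "Col r0 r1 x + (\<Sum>i\<in>UNIV - {r0}. \<Sum>i'\<in>UNIV. scal (E i i') (scal (e i i') x)) =
      (\<Sum>i\<in>UNIV. \<Sum>i'\<in>UNIV. scal (E i i') (Col i i' x))"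
    unfolding sum_E_split by (intro arg_cong2[where f = "(+)"] refl sum.cong) (simp add: col)
  also have "\<dots> = scal (\<Sum>i\<in>UNIV. \<Sum>j\<in>UNIV. f i j * F i j) x"
    by (simp add: Row_Col_trace row scal_sum_left)
  also have "\<dots> = (\<Sum>i\<in>UNIV. \<Sum>i'\<in>UNIV. scal (E i i') (scal (e i i') x))"
    by (simp add: trace_eq[symmetric] scal_sum_left)
  also have "\<dots> = scal (e r0 r1) x + (\<Sum>i\<in>UNIV - {r0}. \<Sum>i'\<in>UNIV. scal (E i i') (scal (e i i') x))"
    by (rule sum_E_split)
  finally show ?thesis by simp
qed

text \<open>Within one length the order matters: row relations first, then column relations with
  \<open>i\<close> different from \<open>r0\<close>, then the pair \<open>(r0, r1)\<close> by the
  trace, and last the rest of row \<open>r0\<close>, whose overlap uses the pair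
  \<open>(r0, r1)\<close> on words of the same length.\<close>

lemma relations_irred:
  "irred v \<Longrightarrow> length v < n \<Longrightarrow> (\<forall>j j'. Row j j' (sgl v) = scal (F j j') (sgl v)) \<and>
     (\<forall>i i'. Col i i' (sgl v) = scal (e i i') (sgl v))"
proof (induction n arbitrary: v)
  case (Suc n)
  have row: "Row j j' (sgl v) = scal (F j j') (sgl v)" if "irred v" "length v \<le> n" for v j j'
  proof (cases "j' = c0 \<and> (\<exists>i u. v = Some (i, c1) # u)")
    case True
    then obtain i u where v: "v = Some (i, c1) # u" by blast
    then have "irred u" using that irred_tail by blast
    then show ?thesis
      using True Row_overlap[of i u j] Suc.IH[of u] that by (simp add: v del: redex.simps)
  next
    case False
    then show ?thesis using r01 that by (intro Row_step irred_Some) auto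
  qed
  have col_step: "Col i i' (sgl v) = scal (e i i') (sgl v)"
    if v': "irred v" "length v \<le> n"
      and p: "\<And>p q k u. v = Some (r1, k) # u \<Longrightarrow> p \<noteq> r0 \<Longrightarrow>
        Col i p (L q k (sgl u)) = scal (e i p) (L q k (sgl u))"
      and i: "\<not> (i = r0 \<and> i' = r1)" for i i' v
  proof (cases "i' = r0 \<and> (\<exists>k u. v = Some (r1, k) # u)")
    case True
    then obtain k u where v: "v = Some (r1, k) # u" by blast
    then have "irred u" using v' irred_tail by blast
    then show ?thesis
      using True Col_overlap[of k u i] Suc.IH[of u] v' p[OF v] by (simp add: v del: redex.simps)
  next
    case False
    then show ?thesis using c01 v' i by (intro Col_step irred_Some) auto
  qed
  have col1: "Col i i' (sgl v) = scal (e i i') (sgl v)"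
    if "irred v" "length v \<le> n" "i \<noteq> r0" for v i i'
    using that by (intro col_step Col_noncritical lf_in_NV) auto
  have col2: "Col r0 r1 (sgl v) = scal (e r0 r1) (sgl v)" if "irred v" "length v \<le> n" for v
    using that by (intro Col_trace row col1) auto
  have col3: "Col r0 i' (sgl v) = scal (e r0 i') (sgl v)"
    if v': "irred v" "length v \<le> n" for v i'
  proof (cases "i' = r1")
    case False
    show ?thesis
    proof (rule col_step[OF v'])
      fix p q k u assume v: "v = Some (r1, k) # u" and p: "p \<noteq> r0"
      show "Col r0 p (L q k (sgl u)) = scal (e r0 p) (L q k (sgl u))"
      proof (cases "p = r1")
        case True
        \<comment> \<open>The words in \<open>L q k (sgl u)\<close> are no longer than
          \<open>v\<close>, so \<open>col2\<close> applies to each of them.\<close>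
        show ?thesis
        proof (rule lin_eq_on_keys[OF lin_Col lin_scal_op])
          fix w assume w: "w \<in> Poly_Mapping.keys (L q k (sgl u))"
          have "irred w" using lf_in_NV w by (auto simp: span_words_def)
          moreover have "length w \<le> n"
            using w v v'(2) nf_length[of "Some (q, k) # u"] by (auto simp: lf_single span_words_def)
          ultimately show "Col r0 p (sgl w) = scal (e r0 p) (sgl w)"
            unfolding True by (rule col2)
        qed
      next
        case False
        then show ?thesis using p by (intro Col_noncritical lf_in_NV) auto
      qed
    qed (use False in simp)
  qed (simp add: col2 v')
  have "irred v" "length v \<le> n" using Suc.prems by auto
  then show ?case using row col1 col3 by metis
qed simp

lemma Row_eq: "v \<in> NV \<Longrightarrow> Row j j' v = scal (F j j') v"
  by (rule lin_eq_on_NV[OF _ lin_Row lin_scal_op]) (use relations_irred in blast)+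

lemma Col_eq: "v \<in> NV \<Longrightarrow> Col i i' v = scal (e i i') v"
  by (rule lin_eq_on_NV[OF _ lin_Col lin_scal_op]) (use relations_irred in blast)+

text \<open>The only rule involving \<open>g\<close> is \<open>g g = 1\<close>, so either
  \<open>g w\<close> is normal or \<open>w\<close> begins with \<open>g\<close>. The right side is
  \<open>NF v\<close> because arbitrary, not only normal, vectors are allowed.\<close>

lemma lf_None_None: "lf None (lf None v) = NF v"
proof -
  have *: "lf None (lf None (sgl w)) = sgl w" if w: "irred w" for w
  proof (cases "irred (None # w)")
    case True
    have "lf None (lf None (sgl w)) = nf (None # None # w)"
      by (simp add: nf_Cons nf_irred[OF w] del: redex.simps)
    also have "\<dots> = sgl w"
      using nf_irred[OF w] by (simp add: nf_rhs[OF True rhs.simps(2)] append_word_def)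
    finally show ?thesis .
  next
    case False
    then obtain t u where t: "w = t # u" "rhs None t \<noteq> None"
      by (metis (lifting) irred_Cons[OF w, of None] False)
    then have u: "w = None # u" by (cases t) auto
    have "irred u" by (rule irred_tail[OF w[unfolded u]])
    then have "lf None (sgl w) = sgl u"
      unfolding u lf_single nf_rhs[OF w[unfolded u] rhs.simps(2)]
      by (simp add: append_word_def nf_irred del: redex.simps)
    then show ?thesis using L_sgl[OF w[unfolded u]] unfolding u by simp
  qed
  have "lf None (lf None (NF v)) = NF v"
    by (rule lin_eq_on_NV[OF NF_in_NV, where S = "\<lambda>x. lf None (lf None x)" and T = "\<lambda>x. x"])
      (simp_all add: * lin_comp linI)
  then show ?thesis by (simp add: lf_NF)
qed

end

section \<open>The twisted equation\<close>

text \<open>Left division by a letter: words with another first letter are dropped.\<close>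

definition strip :: "'a \<Rightarrow> ('a list \<Rightarrow>\<^sub>0 complex) \<Rightarrow> ('a list \<Rightarrow>\<^sub>0 complex)" where
  "strip s = ext (\<lambda>v. case v of [] \<Rightarrow> 0 | t # u \<Rightarrow> if t = s then Poly_Mapping.single u 1 else 0)"

lemma lin_strip [simp]: "lin (strip s)"
  by (simp add: strip_def)

lemmas strip_rules = lin_rules[OF lin_strip]

lemma lookup_strip: "Poly_Mapping.lookup (strip s f) w = Poly_Mapping.lookup f (s # w)"
proof -
  have "Poly_Mapping.lookup (strip s f) w =
      (\<Sum>v\<in>Poly_Mapping.keys f. if v = s # w then Poly_Mapping.lookup f v else 0)"
    unfolding strip_def ext_def lookup_sum' lookup_scal
    by (intro sum.cong) (auto simp: lookup_single split: list.splits)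
  also have "\<dots> = Poly_Mapping.lookup f (s # w)"
    by (auto simp: in_keys_iff)
  finally show ?thesis .
qed

lemma strip_cons_word: "strip s (cons_word t f) = (if s = t then f else 0)"
  by (rule poly_mapping_eqI) (simp add: lookup_strip lookup_cons_word)

text \<open>The strict bound makes the step 0 of the filtration the zero space, which is the base of
  every induction on length below.\<close>

abbreviation LT :: "nat \<Rightarrow> ('a list \<Rightarrow>\<^sub>0 complex) set" where
  "LT n \<equiv> span_words {u. length u < n}"

lemma LT_0: "v \<in> LT 0 \<Longrightarrow> v = 0"
  by (simp add: span_words_def)

lemma LT_mono: "m \<le> n \<Longrightarrow> v \<in> LT m \<Longrightarrow> v \<in> LT n"
  by (auto simp: span_words_def)

lemma LT_iff: "v \<in> LT n \<longleftrightarrow> (\<forall>w. length w \<ge> n \<longrightarrow> Poly_Mapping.lookup v w = 0)"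
  by (auto simp: span_words_def in_keys_iff not_less[symmetric])

lemma strip_LT: "v \<in> LT (Suc n) \<Longrightarrow> strip s v \<in> LT n"
  by (simp add: LT_iff lookup_strip)

lemma ex_LT: "\<exists>n. v \<in> LT n"
proof (intro exI subsetI CollectI)
  show "v \<in> LT (Suc (Max (length ` Poly_Mapping.keys v)))"
    by (auto simp: span_words_def less_Suc_eq_le)
qed

context rewriting begin

lemma L_LT: "x \<in> LT n \<Longrightarrow> lf s x \<in> LT (Suc n)"
  unfolding lf_def
proof (rule span_words_ext)
  fix w :: "'n word" assume "w \<in> {u. length u < n}"
  then show "nf (s # w) \<in> LT (Suc n)"
    using nf_length[of "s # w"] by (auto simp: span_words_def)
qed

lemma strip_NV: "v \<in> NV \<Longrightarrow> strip s v \<in> NV"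
  unfolding span_words_def using irred_tail[of s]
  by (auto simp: in_keys_iff lookup_strip simp del: redex.simps)

text \<open>Putting back a letter that was there before cannot create a redex.\<close>

lemma L_strip: "v \<in> NV \<Longrightarrow> lf s (strip s v) = cons_word s (strip s v)"
proof (rule lin_eq_on_keys[OF lin_lf lin_cons_word])
  fix w assume "v \<in> NV" "w \<in> Poly_Mapping.keys (strip s v)"
  then have "irred (s # w)" by (auto simp: span_words_def in_keys_iff lookup_strip simp del: redex.simps)
  then show "lf s (sgl w) = cons_word s (sgl w)" by (simp add: L_sgl del: redex.simps)
qed

text \<open>For \<open>i\<close> different from \<open>r0\<close> only the column rule could act on
  the new first letter, and the last assumption rules that out.\<close>

lemma L_cons_word:
  assumes "v \<in> NV" "i \<noteq> r0" "j = c0 \<Longrightarrow> \<forall>k. strip (Some (k, c1)) v = 0"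
  shows "L i j v = cons_word (Some (i, j)) v"
proof (rule lin_eq_on_keys[OF lin_lf lin_cons_word])
  fix w assume w: "w \<in> Poly_Mapping.keys v"
  have "irred (Some (i, j) # w)"
  proof (rule irred_Some)
    show "irred w" using w assms(1) by (auto simp: span_words_def)
    show "\<forall>k u. w \<noteq> Some (k, c1) # u" if "j = c0"
      using assms(3)[OF that] w lookup_strip by (metis in_keys_iff lookup_zero)
  qed (use assms(2) in simp)
  then show "L i j (sgl w) = cons_word (Some (i, j)) (sgl w)" by (simp add: L_sgl del: redex.simps)
qed

text \<open>
  For \<open>i \<noteq> r0\<close> the left multiplications by \<open>y\<^sub>i\<^sub>k\<close> are free on normal words up to the column
  relation; removing from \<open>V\<close> the multiple \<open>f y\<^sup>t a\<close> of that relation, with \<open>a\<close> read off from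
  \<open>V c0\<close>, leaves a vector whose products with \<open>y\<^sub>i\<^sub>k\<close> do not cancel.
\<close>

definition strip_col :: "('n \<Rightarrow> 'n wvec) \<Rightarrow> 'n \<Rightarrow> 'n wvec" where
  "strip_col V r = strip (Some (r, c1)) (V c0)"

definition resid :: "('n \<Rightarrow> 'n wvec) \<Rightarrow> 'n \<Rightarrow> 'n wvec" where
  "resid V p = V p - (\<Sum>r\<in>UNIV. \<Sum>q\<in>UNIV. scal (f p q) (L r q (strip_col V r)))"

text \<open>Row \<open>c0\<close> of \<open>f\<close> is the unit vector at \<open>c1\<close>; hence
  the correction removes from \<open>V c0\<close> precisely the words that begin with a letter of
  column \<open>c1\<close>.\<close>

lemma resid_c0: "resid V c0 = V c0 - (\<Sum>r\<in>UNIV. L r c1 (strip_col V r))"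
proof -
  have "(\<Sum>q\<in>UNIV. scal (f c0 q) (L r q (strip_col V r))) =
      (\<Sum>q\<in>UNIV. if q = c1 then L r q (strip_col V r) else 0)" for r
    by (intro sum.cong) (auto simp: f_c0)
  then show ?thesis by (simp add: resid_def)
qed

lemma NV_closed:
  "(\<And>r. V r \<in> NV) \<Longrightarrow> strip_col V r \<in> NV" "(\<And>r. V r \<in> NV) \<Longrightarrow> resid V r \<in> NV"
  by (auto simp: strip_col_def resid_def intro!: strip_NV span_words_closed span_words_sum lf_in_NV)

text \<open>The subtracted vector is \<open>f y^t a\<close> with \<open>a = strip_col V\<close>, and
  multiplying it by \<open>y\<close> gives \<open>e a\<close> by the column relation.\<close>

lemma sum_L_resid:
  assumes V: "\<And>k. V k \<in> NV"
  shows "(\<Sum>k\<in>UNIV. L i k (V k)) =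
    (\<Sum>k\<in>UNIV. L i k (resid V k)) + (\<Sum>r\<in>UNIV. scal (e i r) (strip_col V r))"
proof -
  have "(\<Sum>k\<in>UNIV. L i k (V k)) - (\<Sum>k\<in>UNIV. L i k (resid V k)) =
      (\<Sum>k\<in>UNIV. \<Sum>r\<in>UNIV. \<Sum>q\<in>UNIV. scal (f k q) (L i k (L r q (strip_col V r))))"
    by (simp add: resid_def lf_rules sum_subtractf)
  also have "\<dots> = (\<Sum>r\<in>UNIV. Col i r (strip_col V r))"
    by (subst sum.swap) (simp add: Col_def)
  also have "\<dots> = (\<Sum>r\<in>UNIV. scal (e i r) (strip_col V r))"
    using V by (simp add: Col_eq NV_closed)
  finally show ?thesis by (simp add: algebra_simps)
qed

text \<open>After the correction no column rule can fire, and \<open>i\<close> different from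
  \<open>r0\<close> excludes the row rule, so the products with \<open>resid V\<close> are plain
  concatenations.\<close>

lemma sum_L_cons_word:
  assumes V: "\<And>k. V k \<in> NV" and i: "i \<noteq> r0"
  shows "(\<Sum>k\<in>UNIV. L i k (V k)) =
    (\<Sum>k\<in>UNIV. cons_word (Some (i, k)) (resid V k)) + (\<Sum>r\<in>UNIV. scal (e i r) (strip_col V r))"
proof -
  have "strip (Some (k, c1)) (resid V c0) = 0" for k
  proof -
    have "L r c1 (strip_col V r) = cons_word (Some (r, c1)) (strip_col V r)" for r
      using V by (simp add: strip_col_def L_strip)
    then have "strip (Some (k, c1)) (resid V c0) =
        strip_col V k - (\<Sum>r\<in>UNIV. if k = r then strip_col V r else 0)"
      by (simp add: resid_c0 strip_rules strip_cons_word) (simp add: strip_col_def)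
    then show ?thesis by simp
  qed
  then have "L i k (resid V k) = cons_word (Some (i, k)) (resid V k)" for k
    using V i by (intro L_cons_word NV_closed) auto
  then show ?thesis by (simp add: sum_L_resid[OF V])
qed

lemma lookup_sum_L:
  assumes V: "\<And>k. V k \<in> NV" and i: "i \<noteq> r0"
  shows "Poly_Mapping.lookup (\<Sum>k\<in>UNIV. L i k (V k)) (Some (i, p) # w) =
    Poly_Mapping.lookup (resid V p) w +
    (\<Sum>r\<in>UNIV. e i r * Poly_Mapping.lookup (strip_col V r) (Some (i, p) # w))"
  by (simp add: sum_L_cons_word[OF V i] lookup_add lookup_sum' lookup_cons_word
    cong: if_cong)

text \<open>If multiplication by row \<open>i\<close> produces no longer words, the top part must
  cancel. Concatenations with different letters cannot cancel, so the top part of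
  \<open>resid V\<close> vanishes, while \<open>strip_col V\<close> is shorter because a letter was
  removed.\<close>

lemma syzygy_LT:
  assumes V: "\<And>k. V k \<in> NV" "\<And>k. V k \<in> LT (Suc d)"
    and i: "i \<noteq> r0" and S: "(\<Sum>k\<in>UNIV. L i k (V k)) \<in> LT (Suc d)"
  shows "strip_col V r \<in> LT d" "resid V p \<in> LT d"
proof -
  show *: "strip_col V r \<in> LT d" for r
    using V(2) by (simp add: strip_col_def strip_LT)
  show "resid V p \<in> LT d"
    unfolding LT_iff
  proof (intro allI impI)
    fix w :: "'n word" assume w: "d \<le> length w"
    have "Poly_Mapping.lookup (\<Sum>k\<in>UNIV. L i k (V k)) (Some (i, p) # w) = 0"
      using S w by (simp add: LT_iff)
    moreover have "Poly_Mapping.lookup (strip_col V r) (Some (i, p) # w) = 0" for r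
      using *[of r] w by (simp add: LT_iff)
    ultimately show "Poly_Mapping.lookup (resid V p) w = 0"
      using lookup_sum_L[where V = V, OF V(1) i] by simp
  qed
qed

end

text \<open>In matrix form the last assumption reads \<open>H^t e H = f\<close>; it is the identity
  that makes the vectors \<open>fund a\<close> solutions.\<close>

locale rewriting_twisted = rewriting E e f F r0 r1 c0 c1
  for E e f F :: "'n::finite \<Rightarrow> 'n \<Rightarrow> complex" and r0 r1 c0 c1 +
  fixes H H' :: "'n \<Rightarrow> 'n \<Rightarrow> complex"
  assumes H_H': "(\<Sum>j\<in>UNIV. H m j * H' j k) = (if m = k then 1 else 0)"
    and H_e_H: "(\<Sum>m\<in>UNIV. H m j * (\<Sum>l\<in>UNIV. e m l * H l k)) = f j k"
begin

text \<open>
  In matrix form the equation is \<open>D + y D\<^sup>t H = 0\<close>, and \<open>fund a\<close> below is \<open>(y f\<^sup>t - e H) a\<close>.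
  After a change of coordinates these become the kernel of \<open>\<Phi>\<^sub>2\<close> and the image of \<open>\<Phi>\<^sub>3\<close>.
\<close>

definition twisted :: "('n \<Rightarrow> 'n \<Rightarrow> 'n wvec) \<Rightarrow> bool" where
  "twisted D \<longleftrightarrow> (\<forall>i j. D i j \<in> NV) \<and>
     (\<forall>i j. D i j = - (\<Sum>m\<in>UNIV. scal (H m j) (\<Sum>k\<in>UNIV. L i k (D m k))))"

lemma twisted_NV: "twisted D \<Longrightarrow> D i j \<in> NV"
  unfolding twisted_def by blast

lemma twisted_eq:
  "twisted D \<Longrightarrow> D i j = - (\<Sum>m\<in>UNIV. scal (H m j) (\<Sum>k\<in>UNIV. L i k (D m k)))"
  unfolding twisted_def by blast

definition fund :: "'n wvec \<Rightarrow> 'n \<Rightarrow> 'n \<Rightarrow> 'n wvec" where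
  "fund a i j = (\<Sum>l\<in>UNIV. scal (f j l) (L i l a)) - scal (\<Sum>m\<in>UNIV. e i m * H m j) a"

lemma lin_fund: "lin (\<lambda>a. fund a i j)"
  by (rule linI) (simp_all add: fund_def lf_rules scal_add scal_diff scal_sum sum.distrib mult.commute)

lemma fund_NV: "a \<in> NV \<Longrightarrow> fund a i j \<in> NV"
  by (auto simp: fund_def intro!: span_words_closed span_words_sum lf_in_NV)

lemma fund_LT: "a \<in> LT d \<Longrightarrow> fund a i j \<in> LT (Suc d)"
  unfolding fund_def
  by (intro span_words_closed span_words_sum L_LT) (auto intro: LT_mono[of d])

text \<open>Substituting \<open>y f^t - e H\<close> for \<open>D\<close>, the term
  \<open>y f y^t H\<close> becomes \<open>e H\<close> by the column relation and
  \<open>y (e H)^t H\<close> becomes \<open>y f^t\<close> by the transpose of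
  \<open>H^t e H = f\<close>.\<close>

lemma fund_twisted:
  assumes a: "a \<in> NV"
  shows "twisted (fund a)"
  unfolding twisted_def
proof (intro conjI allI fund_NV a)
  fix i j
  have "(\<Sum>m\<in>UNIV. scal (H m j) (\<Sum>k\<in>UNIV. L i k (fund a m k))) =
      (\<Sum>m\<in>UNIV. scal (H m j) (Col i m a)) -
      (\<Sum>m\<in>UNIV. \<Sum>k\<in>UNIV. scal (H m j * (\<Sum>l\<in>UNIV. e m l * H l k)) (L i k a))"
    by (simp add: fund_def lf_rules scal_diff scal_sum sum_subtractf Col_def)
  also have "(\<Sum>m\<in>UNIV. \<Sum>k\<in>UNIV. scal (H m j * (\<Sum>l\<in>UNIV. e m l * H l k)) (L i k a)) =
      (\<Sum>k\<in>UNIV. scal (f j k) (L i k a))"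
    by (subst sum.swap) (simp add: scal_sum_left[symmetric] H_e_H)
  also have "(\<Sum>m\<in>UNIV. scal (H m j) (Col i m a)) = scal (\<Sum>m\<in>UNIV. e i m * H m j) a"
    by (simp add: Col_eq[OF a] scal_sum_left mult.commute)
  finally show "fund a i j = - (\<Sum>m\<in>UNIV. scal (H m j) (\<Sum>k\<in>UNIV. L i k (fund a m k)))"
    by (simp add: fund_def)
qed

lemma twisted_diff:
  assumes "twisted D" "twisted D'"
  shows "twisted (\<lambda>i j. D i j - D' i j)"
  unfolding twisted_def
proof (intro conjI allI)
  fix i j
  show "D i j - D' i j \<in> NV" by (intro span_words_closed assms twisted_NV)
  note twisted_eq[OF assms(1), of i j] twisted_eq[OF assms(2), of i j]
  then show "D i j - D' i j = - (\<Sum>m\<in>UNIV. scal (H m j) (\<Sum>k\<in>UNIV. L i k (D m k - D' m k)))"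
    by (simp only: lf_rules sum_subtractf scal_diff) simp
qed

text \<open>Multiplying the equation by \<open>H'\<close> writes the entries of \<open>y D^t\<close>
  as combinations of entries of \<open>D\<close>, so they are no longer than those, and
  \<open>syzygy_LT\<close> applies. The representation by \<open>C\<close> and \<open>b\<close> is
  recorded because the same argument is run once more on the rows of \<open>C\<close>.\<close>

lemma twisted_LT:
  assumes D: "twisted D" "\<And>i j. D i j \<in> LT (Suc d)"
  shows "resid (D m) p \<in> LT d"
    and "\<exists>C b. (\<forall>j k. C j k \<in> NV \<and> C j k \<in> LT d) \<and> (\<forall>i j. b i j \<in> LT d) \<and>
      (\<forall>i j. D i j = (\<Sum>k\<in>UNIV. L i k (C j k)) + b i j)"
proof -
  note NV = twisted_NV[OF D(1)] and eq = twisted_eq[OF D(1)]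
  have "(\<Sum>j\<in>UNIV. scal (H' j k) (D i j)) =
      - (\<Sum>j\<in>UNIV. \<Sum>m\<in>UNIV. scal (H m j * H' j k) (\<Sum>l\<in>UNIV. L i l (D m l)))" for i k
    by (subst eq) (simp add: scal_sum sum_negf mult.commute)
  also have "\<dots> i k = - (\<Sum>m\<in>UNIV. scal (\<Sum>j\<in>UNIV. H m j * H' j k) (\<Sum>l\<in>UNIV. L i l (D m l)))" for i k
    by (subst sum.swap) (simp add: scal_sum_left)
  also have "\<dots> i k = - (\<Sum>m\<in>UNIV. if m = k then (\<Sum>l\<in>UNIV. L i l (D m l)) else 0)" for i k
    by (intro arg_cong[where f = uminus] sum.cong) (auto simp: H_H')
  finally have "(\<Sum>l\<in>UNIV. L i l (D k l)) = - (\<Sum>j\<in>UNIV. scal (H' j k) (D i j))" for i k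
    by simp
  then have S: "(\<Sum>l\<in>UNIV. L i l (D k l)) \<in> LT (Suc d)" for i k
    using D(2) by (auto intro!: span_words_closed span_words_sum)
  \<comment> \<open>Any row index other than \<open>r0\<close> would serve for
    \<open>syzygy_LT\<close>; \<open>r1\<close> is one that is at hand.\<close>
  have r1: "r1 \<noteq> r0" using r01 by simp
  show res: "resid (D m) p \<in> LT d" for m p
    by (rule syzygy_LT(2)[where V = "D m", OF NV D(2) r1 S])
  have str: "strip_col (D m) r \<in> LT d" for m r
    by (rule syzygy_LT(1)[where V = "D m", OF NV D(2) r1 S])
  let ?C = "\<lambda>j k. - (\<Sum>m\<in>UNIV. scal (H m j) (resid (D m) k))"
  let ?b = "\<lambda>i j. - (\<Sum>m\<in>UNIV. scal (H m j) (\<Sum>r\<in>UNIV. scal (e i r) (strip_col (D m) r)))"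
  have "D i j = (\<Sum>k\<in>UNIV. L i k (?C j k)) + ?b i j" for i j
  proof -
    have "(\<Sum>k\<in>UNIV. L i k (?C j k)) = - (\<Sum>m\<in>UNIV. scal (H m j) (\<Sum>k\<in>UNIV. L i k (resid (D m) k)))"
      by (simp add: lf_rules sum_negf scal_sum) (rule sum.swap)
    then show ?thesis
      by (subst eq) (simp add: sum_L_resid[OF NV] scal_add sum.distrib)
  qed
  moreover have "?C j k \<in> NV" "?C j k \<in> LT d" "?b i j \<in> LT d" for i j k
    using res str NV by (auto intro!: span_words_closed span_words_sum NV_closed)
  ultimately show "\<exists>C b. (\<forall>j k. C j k \<in> NV \<and> C j k \<in> LT d) \<and> (\<forall>i j. b i j \<in> LT d) \<and>
      (\<forall>i j. D i j = (\<Sum>k\<in>UNIV. L i k (C j k)) + b i j)"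
    by (intro exI[of _ ?C] exI[of _ ?b]) blast
qed

text \<open>The entry \<open>(i, c0)\<close> of \<open>fund a\<close> has leading part
  \<open>y_ic1 a\<close>, since row \<open>c0\<close> of \<open>f\<close> is a unit vector. So
  \<open>a\<close> must be the coefficient behind \<open>y_ic1\<close> in \<open>D i c0\<close>, and
  it turns out not to depend on \<open>i\<close>, because \<open>C\<close> does not.\<close>

lemma twisted_reduce:
  assumes D: "twisted D" "\<And>i j. D i j \<in> LT (Suc d)"
  shows "\<exists>a\<in>NV. \<forall>i j. D i j - fund a i j \<in> LT d"
proof (cases d)
  \<comment> \<open>Constant entries are impossible unless zero: with \<open>d = 0\<close> the
    pieces \<open>C\<close> and \<open>b\<close> lie in the zero space.\<close>
  case 0
  obtain C b where "\<forall>j k. C j k \<in> LT d" "\<forall>i j. b i j \<in> LT d"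
    and DC: "\<forall>i j. D i j = (\<Sum>k\<in>UNIV. L i k (C j k)) + b i j"
    using twisted_LT(2)[OF D] by blast
  then have "C j k = 0" "b i j = 0" for i j k using LT_0 unfolding 0 by blast+
  then have "D i j = 0" for i j
    using DC by (simp add: lf_rules)
  then show ?thesis
    by (intro bexI[of _ 0]) (auto simp: lin_zero[OF lin_fund] span_words_closed)
next
  case (Suc d')
  obtain C b where C: "\<And>j k. C j k \<in> NV" "\<And>j k. C j k \<in> LT d" and b: "\<And>i j. b i j \<in> LT d"
    and DC: "\<And>i j. D i j = (\<Sum>k\<in>UNIV. L i k (C j k)) + b i j"
    using twisted_LT(2)[OF D] by blast
  have strC: "strip_col (C j) r \<in> LT d'" for j r
    unfolding strip_col_def by (rule strip_LT) (use C(2) Suc in simp)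
  \<comment> \<open>\<open>resid\<close> instead of \<open>C\<close> itself, because only its
    products with \<open>y_ik\<close> are concatenations from which a coefficient can be read
    off.\<close>
  define a where "a = resid (C c0) c1"
  have aNV: "a \<in> NV" unfolding a_def by (rule NV_closed(2)[OF C(1)])
  have aLT: "a \<in> LT d"
    unfolding a_def resid_def using C(2) L_LT[OF strC] Suc
    by (auto intro!: span_words_closed span_words_sum)
  define D' where "D' = (\<lambda>i j. D i j - fund a i j)"
  have D': "twisted D'" "\<And>i j. D' i j \<in> LT (Suc d)"
    using D twisted_diff fund_twisted[OF aNV] fund_LT[OF aLT]
    by (auto simp: D'_def intro!: span_words_closed)
  \<comment> \<open>By the choice of \<open>a\<close> the long words beginning with a letter of
    column \<open>c1\<close> cancel in \<open>D' i c0\<close>. So \<open>strip_col (D' i)\<close>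
    loses one more degree, and \<open>D' i p\<close> is recovered from it and from
    \<open>resid (D' i)\<close>, which is short by \<open>twisted_LT\<close>.\<close>
  have noncrit: "D' i p \<in> LT d" if i: "i \<noteq> r0" for i p
  proof -
    have "strip (Some (r, c1)) (D' i c0) \<in> LT d'" for r
    proof -
      define \<beta> where "\<beta> = (\<Sum>r\<in>UNIV. scal (e i r) (strip_col (C c0) r)) + b i c0 +
        scal (\<Sum>m\<in>UNIV. e i m * H m c0) a"
      have \<beta>: "\<beta> \<in> LT d"
        unfolding \<beta>_def by (intro span_words_closed span_words_sum b aLT LT_mono[OF _ strC]) (simp add: Suc)
      have "(\<Sum>l\<in>UNIV. scal (f c0 l) (L i l a)) = (\<Sum>l\<in>UNIV. if l = c1 then L i l a else 0)"
        by (intro sum.cong) (auto simp: f_c0)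
      also have "\<dots> = cons_word (Some (i, c1)) a"
        using L_cons_word[OF aNV i, of c1] c01 by simp
      finally have "D' i c0 = (\<Sum>k\<in>UNIV. cons_word (Some (i, k)) (resid (C c0) k)) -
          cons_word (Some (i, c1)) a + \<beta>"
        by (simp add: D'_def fund_def DC sum_L_cons_word[OF C(1) i] \<beta>_def)
      moreover have "(\<Sum>k\<in>UNIV. if r = i \<and> c1 = k then resid (C c0) k else 0) = (if r = i then a else 0)"
        by (simp add: a_def)
      ultimately have "strip (Some (r, c1)) (D' i c0) = strip (Some (r, c1)) \<beta>"
        by (simp add: strip_rules strip_cons_word)
      then show ?thesis using strip_LT[OF \<beta>[unfolded Suc]] by simp
    qed
    then have "strip_col (D' i) r \<in> LT d'" for r by (simp add: strip_col_def)
    then have "L r q (strip_col (D' i) r) \<in> LT d" for r q using L_LT unfolding Suc by blast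
    moreover have "D' i p = resid (D' i) p + (\<Sum>r\<in>UNIV. \<Sum>q\<in>UNIV. scal (f p q) (L r q (strip_col (D' i) r)))"
      by (simp add: resid_def)
    ultimately show ?thesis
      using twisted_LT(1)[OF D'] by (auto intro!: span_words_closed span_words_sum)
  qed
  \<comment> \<open>Letters of row \<open>r0\<close> are not free, so this row cannot be inspected
    directly. But all rows share the same \<open>C'\<close>, and the bound for row \<open>r1\<close>
    makes \<open>C'\<close> short enough to bound row \<open>r0\<close>.\<close>
  have "D' r0 j \<in> LT d" for j
  proof -
    obtain C' b' where C': "\<And>j k. C' j k \<in> NV" "\<And>j k. C' j k \<in> LT (Suc d')"
      and b': "\<And>i j. b' i j \<in> LT (Suc d')"
      and DC': "\<And>i j. D' i j = (\<Sum>k\<in>UNIV. L i k (C' j k)) + b' i j"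
      using twisted_LT(2)[OF D'] unfolding Suc by blast
    have r1: "r1 \<noteq> r0" using r01 by simp
    have "(\<Sum>k\<in>UNIV. L r1 k (C' j k)) = D' r1 j - b' r1 j" by (simp add: DC')
    then have S: "(\<Sum>k\<in>UNIV. L r1 k (C' j k)) \<in> LT (Suc d')"
      using noncrit[OF r1] b' Suc by (auto intro!: span_words_closed)
    note * = syzygy_LT[where V = "C' j", OF C' r1 S]
    have "D' r0 j = (\<Sum>k\<in>UNIV. L r0 k (resid (C' j) k)) +
        (\<Sum>r\<in>UNIV. scal (e r0 r) (strip_col (C' j) r)) + b' r0 j"
      by (simp add: DC' sum_L_resid[OF C'(1)])
    then show ?thesis
      unfolding Suc
      by (simp only:) (intro span_words_closed span_words_sum L_LT * b' LT_mono[OF _ *(1)] le_SucI order_refl)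
  qed
  then have "D' i j \<in> LT d" for i j using noncrit by (cases "i = r0") auto
  then show ?thesis using aNV by (auto simp: D'_def)
qed

lemma twisted_LT_imp_fund:
  "twisted D \<Longrightarrow> (\<And>i j. D i j \<in> LT n) \<Longrightarrow> \<exists>a\<in>NV. \<forall>i j. D i j = fund a i j"
proof (induction n arbitrary: D)
  case 0
  then have "D i j = 0" for i j by (intro LT_0)
  then show ?case
    by (intro bexI[of _ 0]) (auto simp: lin_zero[OF lin_fund] span_words_closed)
next
  case (Suc n)
  obtain a where a: "a \<in> NV" "\<And>i j. D i j - fund a i j \<in> LT n"
    using twisted_reduce[OF Suc.prems] by blast
  have "twisted (\<lambda>i j. D i j - fund a i j)"
    by (rule twisted_diff[OF Suc.prems(1) fund_twisted[OF a(1)]])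
  from Suc.IH[OF this a(2)] obtain a' where a': "a' \<in> NV" "\<And>i j. D i j - fund a i j = fund a' i j"
    by blast
  have "D i j = fund (a + a') i j" for i j
    using a'(2)[of i j] by (simp add: lin_add[OF lin_fund] algebra_simps)
  moreover have "a + a' \<in> NV" using a(1) a'(1) by (rule span_words_closed)
  ultimately show ?case by blast
qed

theorem twisted_imp_fund:
  assumes "twisted D"
  shows "\<exists>a\<in>NV. \<forall>i j. D i j = fund a i j"
proof -
  have "\<exists>n. \<forall>i j. D i j \<in> LT n"
  proof -
    \<comment> \<open>The sum of the bounds of the finitely many entries is a common bound.\<close>
    define n where "n i j = (SOME n. D i j \<in> LT n)" for i j
    have n: "D i j \<in> LT (n i j)" for i j unfolding n_def by (rule someI_ex[OF ex_LT])
    have "n i j \<le> (\<Sum>i\<in>UNIV. \<Sum>j\<in>UNIV. n i j)" for i j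
      by (rule order_trans[OF member_le_sum[of j UNIV] member_le_sum[of i UNIV "\<lambda>i. sum (n i) UNIV"]]) auto
    then show ?thesis using n LT_mono by blast
  qed
  then show ?thesis using twisted_LT_imp_fund[OF assms] by blast
qed

text \<open>At the entry \<open>(r1, c0)\<close> the equation says that prefixing the letter
  \<open>y_r1c1\<close> multiplies \<open>a\<close> by a scalar. Prefixing raises the length, so no
  longest word can exist.\<close>

theorem fund_inj:
  assumes a: "a \<in> NV" and zero: "\<And>i j. fund a i j = 0"
  shows "a = 0"
proof -
  have "(\<Sum>l\<in>UNIV. scal (f c0 l) (L r1 l a)) = (\<Sum>l\<in>UNIV. if l = c1 then L r1 l a else 0)"
    by (intro sum.cong) (auto simp: f_c0)
  also have "\<dots> = cons_word (Some (r1, c1)) a"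
    using L_cons_word[OF a, of r1 c1] c01 r01 by simp
  finally have eq: "cons_word (Some (r1, c1)) a = scal (\<Sum>m\<in>UNIV. e r1 m * H m c0) a"
    using zero[of r1 c0] by (simp add: fund_def)
  have "a \<in> LT n \<Longrightarrow> a \<in> LT 0" for n
  proof (induction n)
    case (Suc n)
    have "Poly_Mapping.lookup a w = 0" if "length w \<ge> n" for w
    proof -
      have "Poly_Mapping.lookup a w = Poly_Mapping.lookup (cons_word (Some (r1, c1)) a) (Some (r1, c1) # w)"
        by (simp add: lookup_cons_word)
      also have "\<dots> = 0" using Suc.prems that by (simp add: eq LT_iff)
      finally show ?thesis .
    qed
    then show ?case using Suc.IH by (simp add: LT_iff)
  qed
  then show ?thesis using ex_LT LT_0 by blast
qed

end

section \<open>Choice of coordinates: matrices over the complex numbers\<close>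

section \<open>Congruence normal forms\<close>

lemma invertible_transpose: "invertible (A :: complex^'n::finite^'n) \<Longrightarrow> invertible (transpose A)"
  unfolding invertible_def by (metis matrix_transpose_mul transpose_mat)

lemma matrix_inv_inverse:
  "invertible A \<Longrightarrow> A ** matrix_inv A = mat 1" "invertible A \<Longrightarrow> matrix_inv A ** A = mat 1"
  unfolding invertible_def matrix_inv_def by (metis (mono_tags, lifting) someI_ex)+

lemma entries:
  fixes A B :: "complex^'n::finite^'n"
  assumes "A ** B = mat 1"
  shows "(\<Sum>l\<in>UNIV. A $ k $ l * B $ l $ i) = (if k = i then 1 else 0)"
proof -
  have "(A ** B) $ k $ i = mat 1 $ k $ i" by (simp add: assms)
  then show ?thesis by (simp add: matrix_matrix_mult_def mat_def)
qed

text \<open>On the plane spanned by two coordinate vectors the form is a binary quadratic form,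
  which has a nontrivial zero over an algebraically closed field.\<close>

lemma ex_isotropic_congruence:
  fixes M :: "complex^'n::finite^'n"
  assumes "CARD('n) \<ge> 2"
  shows "\<exists>(R :: complex^'n^'n) r. invertible R \<and> (transpose R ** M ** R) $ r $ r = 0"
proof -
  obtain a b :: 'n where ab: "a \<noteq> b"
    using assms by (metis One_nat_def UNIV_I card_1_singleton_iff card_le_Suc0_iff_eq finite not_less_eq_eq numeral_2_eq_2)
  show ?thesis
  proof (cases "M $ a $ a = 0")
    case True
    then have "(transpose (mat 1) ** M ** mat 1) $ a $ a = 0" by simp
    moreover have "invertible (mat 1 :: complex^'n^'n)" unfolding invertible_def by (intro exI[of _ "mat 1"]) simp
    ultimately show ?thesis by blast
  next
    case False
    define B where "B = M $ a $ b + M $ b $ a"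
    \<comment> \<open>A root of \<open>M(v, v) = 0\<close> for the vector v with entry z at
      \<open>a\<close> and entry 1 at \<open>b\<close>.\<close>
    define z where "z = (- B + csqrt (B\<^sup>2 - 4 * M $ a $ a * M $ b $ b)) / (2 * M $ a $ a)"
    have z: "M $ a $ a * z\<^sup>2 + B * z + M $ b $ b = 0"
    proof -
      let ?A = "M $ a $ a" and ?C = "M $ b $ b"
      have "2 * ?A * z + B = csqrt (B\<^sup>2 - 4 * ?A * ?C)" using False by (simp add: z_def)
      then have "(2 * ?A * z + B)\<^sup>2 = B\<^sup>2 - 4 * ?A * ?C" by simp
      then have "4 * ?A * (?A * z\<^sup>2 + B * z + ?C) = 0" by (simp add: power2_eq_square algebra_simps)
      then show ?thesis using False by simp
    qed
    \<comment> \<open>The elementary matrix whose column \<open>b\<close> is that vector; its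
      inverse has \<open>- w\<close> in place of \<open>w\<close>.\<close>
    define R :: "complex \<Rightarrow> complex^'n^'n"
      where "R w = (\<chi> i j. (if i = j then 1 else 0) + (if i = a \<and> j = b then w else 0))" for w
    have sum_R: "(\<Sum>k\<in>UNIV. R w $ k $ j * g k) = g j + (if j = b then w * g a else 0)" for w j and g :: "'n \<Rightarrow> complex"
      by (simp add: R_def distrib_right sum.distrib if_distrib[where f = "\<lambda>x. x * _"] cong: if_cong)
    have sum_R': "(\<Sum>k\<in>UNIV. R w $ i $ k * g k) = g i + (if i = a then w * g b else 0)" for w i and g :: "'n \<Rightarrow> complex"
      by (simp add: R_def distrib_right sum.distrib if_distrib[where f = "\<lambda>x. x * _"] cong: if_cong)
    have "(\<Sum>k\<in>UNIV. R z $ i $ k * R (- z) $ k $ j) = (if i = j then 1 else 0)" for i j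
      unfolding sum_R' using ab by (auto simp: R_def)
    then have "R z ** R (- z) = mat 1"
      by (simp add: vec_eq_iff matrix_matrix_mult_def mat_def)
    then have "invertible (R z)" by (metis invertible_right_inverse)
    moreover have "(transpose (R z) ** M ** R z) $ b $ b = 0"
    proof -
      have "(transpose (R z) ** M ** R z) $ b $ b =
          (\<Sum>l\<in>UNIV. R z $ l $ b * (\<Sum>k\<in>UNIV. R z $ k $ b * M $ k $ l))"
        by (simp add: matrix_matrix_mult_def transpose_def mult.commute)
      also have "\<dots> = M $ a $ a * z\<^sup>2 + B * z + M $ b $ b"
        unfolding sum_R by (simp add: B_def power2_eq_square algebra_simps)
      finally show ?thesis using z by simp
    qed
    ultimately show ?thesis by blast
  qed
qed

text \<open>Once the diagonal entry at \<open>r0\<close> vanishes, row \<open>r0\<close> still has a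
  nonzero entry at some \<open>r1\<close>, and a second congruence turns this row into the unit
  vector at \<open>r1\<close>.\<close>

lemma ex_congruence_normal_form:
  fixes M :: "complex^'n::finite^'n"
  assumes "CARD('n) \<ge> 2" "invertible M"
  shows "\<exists>(P :: complex^'n^'n) r0 r1. invertible P \<and> r0 \<noteq> r1 \<and>
    (\<forall>l. (transpose P ** M ** P) $ r0 $ l = (if l = r1 then 1 else 0))"
proof -
  obtain R :: "complex^'n^'n" and r0 where R: "invertible R" "(transpose R ** M ** R) $ r0 $ r0 = 0"
    using ex_isotropic_congruence[OF assms(1), of M] by blast
  define N where "N = transpose R ** M ** R"
  have "invertible N"
    unfolding N_def using R(1) assms(2) by (intro invertible_mult) (auto simp: invertible_transpose)
  then obtain N' where "N ** N' = mat 1" unfolding invertible_def by blast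
  then have "(\<Sum>k\<in>UNIV. N $ r0 $ k * N' $ k $ r0) = 1"
    by (simp add: entries)
  then obtain r1 where r1: "N $ r0 $ r1 \<noteq> 0" by (force intro: sum.neutral)
  have r01: "r0 \<noteq> r1" using r1 R(2) by (auto simp: N_def)
  define m where "m = N $ r0"
  have m: "m $ r1 \<noteq> 0" "m $ r0 = 0" using r1 R(2) by (auto simp: m_def N_def)
  \<comment> \<open>\<open>S\<close> is the inverse of \<open>W\<close>, the identity with row
    \<open>r1\<close> replaced by \<open>m\<close>. As \<open>m\<close> is a row of
    \<open>W\<close>, the product of \<open>m\<close> with \<open>S\<close> is the unit vector at
    \<open>r1\<close>.\<close>
  define S :: "complex^'n^'n" where "S = (\<chi> i j. if i = r1 then (if j = r1 then 1 / m $ r1 else - (m $ j / m $ r1))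
      else if i = j then 1 else 0)"
  define W :: "complex^'n^'n" where "W = (\<chi> i j. if i = r1 then m $ j else if i = j then 1 else 0)"
  have "S ** W = mat 1"
  proof -
    have "(\<Sum>k\<in>UNIV. S $ i $ k * W $ k $ j) = (if i = j then 1 else 0)" for i j
    proof (cases "i = r1")
      case True
      have "(\<Sum>k\<in>UNIV. S $ i $ k * W $ k $ j) =
          m $ j / m $ r1 + (\<Sum>k\<in>UNIV - {r1}. if k = j then - (m $ k / m $ r1) else 0)"
        by (subst sum.remove[of _ r1], simp, simp, rule arg_cong2[where f = "(+)"],
            simp add: S_def W_def True, rule sum.cong) (auto simp: S_def W_def True)
      also have "(\<Sum>k\<in>UNIV - {r1}. if k = j then - (m $ k / m $ r1) else 0) =
          (if j \<in> UNIV - {r1} then - (m $ j / m $ r1) else 0)"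
        by (rule sum.delta) simp
      finally show ?thesis using m True by auto
    next
      case False
      have "(\<Sum>k\<in>UNIV. S $ i $ k * W $ k $ j) = (\<Sum>k\<in>UNIV. if i = k then W $ k $ j else 0)"
        by (intro sum.cong) (auto simp: S_def False)
      then show ?thesis using False by (simp add: W_def)
    qed
    then show ?thesis by (simp add: vec_eq_iff matrix_matrix_mult_def mat_def)
  qed
  then have "invertible S" by (metis invertible_right_inverse)
  moreover have "(transpose S ** N ** S) $ r0 $ l = (if l = r1 then 1 else 0)" for l
  proof -
    \<comment> \<open>Isotropy is used here: since \<open>m $ r0 = 0\<close>, column
      \<open>r0\<close> of \<open>S\<close> is still a unit vector and the congruence does not mix
      other rows into row \<open>r0\<close>.\<close>
    have "transpose S $ r0 $ k = (if k = r0 then 1 else 0)" for k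
      using m r01 by (auto simp: S_def transpose_def)
    then have "(transpose S ** N) $ r0 $ k = m $ k" for k
      by (simp add: matrix_matrix_mult_def m_def if_distrib[where f = "\<lambda>x. x * _"] cong: if_cong)
    then have "(transpose S ** N ** S) $ r0 $ l = (\<Sum>k\<in>UNIV. m $ k * S $ k $ l)"
      by (simp add: matrix_matrix_mult_def)
    also have "\<dots> = m $ r1 * S $ r1 $ l + (\<Sum>k\<in>UNIV - {r1}. if k = l then m $ k else 0)"
      by (subst sum.remove[of _ r1], simp, simp, rule arg_cong2[where f = "(+)"],
          simp, rule sum.cong) (auto simp: S_def)
    also have "(\<Sum>k\<in>UNIV - {r1}. if k = l then m $ k else 0) = (if l \<in> UNIV - {r1} then m $ l else 0)"
      by (rule sum.delta) simp
    finally show ?thesis using m by (auto simp: S_def)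
  qed
  moreover have "transpose S ** N ** S = transpose (R ** S) ** M ** (R ** S)"
    by (simp add: N_def matrix_transpose_mul matrix_mul_assoc)
  ultimately show ?thesis
    using invertible_mult[OF R(1)] r01 by metis
qed

text \<open>
  The substitution \<open>x = P y Q\<close> turns the relations of \<open>B(E)\<close> into those of the locale
  \<open>rewriting\<close>.
\<close>

locale normal_form =
  fixes E Ei P Pi Q Qi :: "complex^'n::finite^'n" and r0 r1 c0 c1 :: 'n
  assumes E: "E ** Ei = mat 1" "Ei ** E = mat 1"
    and P: "P ** Pi = mat 1" "Pi ** P = mat 1"
    and Q: "Q ** Qi = mat 1" "Qi ** Q = mat 1"
    and r01: "r0 \<noteq> r1" and c01: "c0 \<noteq> c1"
    and row: "(transpose P ** E ** P) $ r0 $ l = (if l = r1 then 1 else 0)"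
    and col: "(Q ** Ei ** transpose Q) $ c0 $ l = (if l = c1 then 1 else 0)"
begin

lemma cancel:
  "E ** (Ei ** Z) = Z" "Ei ** (E ** Z) = Z" "P ** (Pi ** Z) = Z" "Pi ** (P ** Z) = Z"
  "Q ** (Qi ** Z) = Z" "Qi ** (Q ** Z) = Z"
  by (simp_all add: matrix_mul_assoc E P Q)

lemma transposes:
  "transpose E ** transpose Ei = mat 1" "transpose Ei ** transpose E = mat 1"
  "transpose P ** transpose Pi = mat 1" "transpose Pi ** transpose P = mat 1"
  "transpose Q ** transpose Qi = mat 1" "transpose Qi ** transpose Q = mat 1"
  by (simp_all add: matrix_transpose_mul[symmetric] E P Q)

lemma cancel_transpose:
  "transpose E ** (transpose Ei ** Z) = Z" "transpose Ei ** (transpose E ** Z) = Z"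
  "transpose P ** (transpose Pi ** Z) = Z" "transpose Pi ** (transpose P ** Z) = Z"
  "transpose Q ** (transpose Qi ** Z) = Z" "transpose Qi ** (transpose Q ** Z) = Z"
  by (simp_all add: matrix_mul_assoc transposes)

lemmas mat_simps = matrix_mul_assoc[symmetric] matrix_transpose_mul transpose_transpose
  E P Q cancel transposes cancel_transpose matrix_mul_lid matrix_mul_rid transpose_mat

text \<open>With \<open>x = P y Q\<close> the relation \<open>x^t E x = E\<close> becomes
  \<open>y^t E' y = F\<close>, and \<open>x E^-1 x^t = E^-1\<close> becomes
  \<open>y f y^t = e\<close>.\<close>

definition "E' = transpose P ** E ** P"
definition "e = Pi ** Ei ** transpose Pi"
definition "f = Q ** Ei ** transpose Q"
definition "F = transpose Qi ** E ** Qi"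
text \<open>Comes from rewriting \<open>E^-1 U + x U^t E^-1 = 0\<close> in terms of
  \<open>D = P^-1 E^-1 U Q^t\<close>, which gives \<open>D + y D^t H = 0\<close>.\<close>

definition "H = transpose P ** transpose E ** Ei ** transpose Q"
definition "H' = transpose Qi ** E ** transpose Ei ** transpose Pi"

lemma trace_transpose: "trace (transpose (A :: complex^'n^'n)) = trace A"
  by (simp add: trace_def transpose_def)

text \<open>Cyclicity removes \<open>P\<close> from one side and \<open>Q\<close> from the other;
  what remains are the traces of \<open>E E^-t\<close> and of its transpose.\<close>

lemma trace_E': "trace (E' ** transpose e) = trace (f ** transpose F)"
proof -
  have "trace (E' ** transpose e) = trace ((transpose P ** (E ** transpose Ei)) ** transpose Pi)"
    by (simp add: E'_def e_def mat_simps)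
  also have "\<dots> = trace (E ** transpose Ei)"
    by (subst trace_mul_sym) (simp add: mat_simps)
  also have "\<dots> = trace (transpose (E ** transpose Ei))" by (simp only: trace_transpose)
  also have "\<dots> = trace ((Q ** (Ei ** transpose E)) ** Qi)"
    by (subst trace_mul_sym) (simp add: mat_simps)
  also have "\<dots> = trace (f ** transpose F)" by (simp add: f_def F_def mat_simps)
  finally show ?thesis .
qed

lemma inverses: "E' ** e = mat 1" "e ** E' = mat 1" "f ** F = mat 1" "F ** f = mat 1" "H ** H' = mat 1"
  by (simp_all add: E'_def e_def f_def F_def H_def H'_def mat_simps)

sublocale rewriting_twisted "\<lambda>i j. E' $ i $ j" "\<lambda>i j. e $ i $ j" "\<lambda>i j. f $ i $ j" "\<lambda>i j. F $ i $ j"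
  r0 r1 c0 c1 "\<lambda>i j. H $ i $ j" "\<lambda>i j. H' $ i $ j"
proof
  show "r0 \<noteq> r1" "c0 \<noteq> c1" by (fact r01 c01)+
  show "E' $ r0 $ l = (if l = r1 then 1 else 0)" for l using row by (simp add: E'_def)
  show "f $ c0 $ l = (if l = c1 then 1 else 0)" for l using col by (simp add: f_def)
  show "(\<Sum>i\<in>UNIV. \<Sum>j\<in>UNIV. E' $ i $ j * e $ i $ j) = (\<Sum>i\<in>UNIV. \<Sum>j\<in>UNIV. f $ i $ j * F $ i $ j)"
    using trace_E' by (simp add: trace_def matrix_matrix_mult_def transpose_def)
  show "(\<Sum>m\<in>UNIV. H $ m $ j * (\<Sum>l\<in>UNIV. e $ m $ l * H $ l $ k)) = f $ j $ k" for j k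
  proof -
    have "transpose H ** (e ** H) = f"
      by (simp add: H_def e_def f_def mat_simps)
    then have "(transpose H ** (e ** H)) $ j $ k = f $ j $ k" by simp
    then show ?thesis by (simp add: matrix_matrix_mult_def transpose_def)
  qed
qed (rule entries inverses)+

end

lemma ex_normal_form:
  fixes E :: "complex^'n::finite^'n"
  assumes "CARD('n) \<ge> 2" "invertible E"
  shows "\<exists>P Pi Q Qi r0 r1 c0 c1. normal_form E (matrix_inv E) P Pi Q Qi r0 r1 c0 c1"
proof -
  have E: "E ** matrix_inv E = mat 1" "matrix_inv E ** E = mat 1"
    using assms(2) by (simp_all add: matrix_inv_inverse)
  obtain P :: "complex^'n^'n" and r0 r1 where P: "invertible P" "r0 \<noteq> r1"
    "\<forall>l. (transpose P ** E ** P) $ r0 $ l = (if l = r1 then 1 else 0)"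
    using ex_congruence_normal_form[OF assms] by blast
  have "invertible (matrix_inv E)" using E unfolding invertible_def by blast
  then obtain Q :: "complex^'n^'n" and c0 c1 where Q: "invertible Q" "c0 \<noteq> c1"
    "\<forall>l. (transpose Q ** matrix_inv E ** Q) $ c0 $ l = (if l = c1 then 1 else 0)"
    using ex_congruence_normal_form[OF assms(1)] by blast
  \<comment> \<open>The congruence of the inverse is by \<open>Q^t ... Q\<close>, whereas the locale
    has \<open>Q ... Q^t\<close>; hence the transposes.\<close>
  have "normal_form E (matrix_inv E) P (matrix_inv P) (transpose Q) (transpose (matrix_inv Q)) r0 r1 c0 c1"
    using P Q E
    by unfold_locales
      (auto simp: matrix_inv_inverse matrix_transpose_mul[symmetric] transpose_mat transpose_transpose)
  then show ?thesis by blast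
qed

section \<open>Universal constructions: monoid algebras, quotients, free algebras, free products,
  matrices\<close>

section \<open>Complex algebras\<close>

locale complex_algebra = ring A for A :: "(complex, 'a) module" (structure) +
  assumes smult_closed [simp, intro]: "a \<in> carrier A \<Longrightarrow> c \<odot> a \<in> carrier A"
    and smult_add_left: "a \<in> carrier A \<Longrightarrow> (c + d) \<odot> a = c \<odot> a \<oplus> d \<odot> a"
    and smult_add_right: "a \<in> carrier A \<Longrightarrow> b \<in> carrier A \<Longrightarrow> c \<odot> (a \<oplus> b) = c \<odot> a \<oplus> c \<odot> b"
    and smult_smult: "a \<in> carrier A \<Longrightarrow> c \<odot> (d \<odot> a) = (c * d) \<odot> a"
    and smult_one: "a \<in> carrier A \<Longrightarrow> 1 \<odot> a = a"
    and smult_mult_left: "a \<in> carrier A \<Longrightarrow> b \<in> carrier A \<Longrightarrow> (c \<odot> a) \<otimes> b = c \<odot> (a \<otimes> b)"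
    and smult_mult_right: "a \<in> carrier A \<Longrightarrow> b \<in> carrier A \<Longrightarrow> a \<otimes> (c \<odot> b) = c \<odot> (a \<otimes> b)"

text \<open>Zero and additive inverses are covered by closure under the scalars 0 and -1.\<close>

definition subalgebra_of :: "'a set \<Rightarrow> (complex, 'a) module \<Rightarrow> bool" where
  "subalgebra_of S A \<longleftrightarrow> S \<subseteq> carrier A \<and> \<one>\<^bsub>A\<^esub> \<in> S \<and>
     (\<forall>a\<in>S. \<forall>b\<in>S. a \<oplus>\<^bsub>A\<^esub> b \<in> S \<and> a \<otimes>\<^bsub>A\<^esub> b \<in> S) \<and> (\<forall>c. \<forall>a\<in>S. c \<odot>\<^bsub>A\<^esub> a \<in> S)"

text \<open>Stated as an induction principle, which is how it is applied: a property that defines a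
  subalgebra is checked on generators only.\<close>

definition generates :: "(complex, 'a) module \<Rightarrow> 'a set \<Rightarrow> bool" where
  "generates A G \<longleftrightarrow> (\<forall>S. subalgebra_of S A \<and> G \<subseteq> S \<longrightarrow> carrier A \<subseteq> S)"

lemma generatesD: "generates A G \<Longrightarrow> subalgebra_of S A \<Longrightarrow> G \<subseteq> S \<Longrightarrow> a \<in> carrier A \<Longrightarrow> a \<in> S"
  unfolding generates_def by blast

lemma complex_algebraI:
  fixes A (structure)
  assumes "ring A"
    and "\<And>c a. a \<in> carrier A \<Longrightarrow> c \<odot> a \<in> carrier A"
    and "\<And>c d a. a \<in> carrier A \<Longrightarrow> (c + d) \<odot> a = c \<odot> a \<oplus> d \<odot> a"
    and "\<And>c a b. a \<in> carrier A \<Longrightarrow> b \<in> carrier A \<Longrightarrow> c \<odot> (a \<oplus> b) = c \<odot> a \<oplus> c \<odot> b"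
    and "\<And>c d a. a \<in> carrier A \<Longrightarrow> c \<odot> (d \<odot> a) = (c * d) \<odot> a"
    and "\<And>a. a \<in> carrier A \<Longrightarrow> 1 \<odot> a = a"
    and "\<And>c a b. a \<in> carrier A \<Longrightarrow> b \<in> carrier A \<Longrightarrow> (c \<odot> a) \<otimes> b = c \<odot> (a \<otimes> b)"
    and "\<And>c a b. a \<in> carrier A \<Longrightarrow> b \<in> carrier A \<Longrightarrow> a \<otimes> (c \<odot> b) = c \<odot> (a \<otimes> b)"
  shows "complex_algebra A"
  using assms by (simp add: complex_algebra_def complex_algebra_axioms_def)

lemma alg_homI:
  assumes "\<And>a. a \<in> carrier A \<Longrightarrow> f a \<in> carrier B"
    and "\<And>a b. a \<in> carrier A \<Longrightarrow> b \<in> carrier A \<Longrightarrow> f (a \<oplus>\<^bsub>A\<^esub> b) = f a \<oplus>\<^bsub>B\<^esub> f b"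
    and "\<And>a b. a \<in> carrier A \<Longrightarrow> b \<in> carrier A \<Longrightarrow> f (a \<otimes>\<^bsub>A\<^esub> b) = f a \<otimes>\<^bsub>B\<^esub> f b"
    and "f \<one>\<^bsub>A\<^esub> = \<one>\<^bsub>B\<^esub>"
    and "\<And>c a. a \<in> carrier A \<Longrightarrow> f (c \<odot>\<^bsub>A\<^esub> a) = c \<odot>\<^bsub>B\<^esub> f a"
  shows "f \<in> alg_hom A B"
  using assms by (auto simp: alg_hom_def intro!: ring_hom_memI)

lemma alg_homD:
  assumes "f \<in> alg_hom A B"
  shows "a \<in> carrier A \<Longrightarrow> f a \<in> carrier B"
    and "a \<in> carrier A \<Longrightarrow> b \<in> carrier A \<Longrightarrow> f (a \<oplus>\<^bsub>A\<^esub> b) = f a \<oplus>\<^bsub>B\<^esub> f b"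
    and "a \<in> carrier A \<Longrightarrow> b \<in> carrier A \<Longrightarrow> f (a \<otimes>\<^bsub>A\<^esub> b) = f a \<otimes>\<^bsub>B\<^esub> f b"
    and "f \<one>\<^bsub>A\<^esub> = \<one>\<^bsub>B\<^esub>"
    and "a \<in> carrier A \<Longrightarrow> f (c \<odot>\<^bsub>A\<^esub> a) = c \<odot>\<^bsub>B\<^esub> f a"
  using assms by (auto simp: alg_hom_def ring_hom_def)

context complex_algebra begin

lemma minus_eq_smult: "a \<in> carrier A \<Longrightarrow> \<ominus> a = (- 1) \<odot> a"
proof -
  assume a: "a \<in> carrier A"
  have zero: "0 \<odot> a = \<zero>"
    using smult_add_left[of a 0 0] a by (metis add.l_cancel_one' add_0 smult_closed)
  have "(- 1) \<odot> a \<oplus> a = \<zero>"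
    using smult_add_left[of a "- 1" 1] a zero by (simp add: smult_one)
  then show ?thesis using a minus_equality by blast
qed

lemma smult_zero [simp]: "c \<odot> \<zero> = \<zero>"
  using smult_add_right[of \<zero> \<zero> c] by (metis add.l_cancel_one' l_zero smult_closed zero_closed)

lemma smult_0 [simp]: "a \<in> carrier A \<Longrightarrow> 0 \<odot> a = \<zero>"
  using smult_add_left[of a 0 0] by (metis add.l_cancel_one' add_0 smult_closed)

lemma smult_finsum:
  "f \<in> I \<rightarrow> carrier A \<Longrightarrow> c \<odot> (\<Oplus>i\<in>I. f i) = (\<Oplus>i\<in>I. c \<odot> f i)"
  by (induction I rule: infinite_finite_induct) (auto simp: smult_add_right Pi_def)

lemma smult_sum_left:
  "a \<in> carrier A \<Longrightarrow> (\<Sum>i\<in>I. c i) \<odot> a = (\<Oplus>i\<in>I. c i \<odot> a)"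
  by (induction I rule: infinite_finite_induct) (auto simp: smult_add_left Pi_def)

lemma smult_minus: "a \<in> carrier A \<Longrightarrow> c \<odot> (\<ominus> a) = \<ominus> (c \<odot> a)"
  by (simp add: minus_eq_smult smult_smult)

lemma smult_eq_mult: "a \<in> carrier A \<Longrightarrow> c \<odot> a = (c \<odot> \<one>) \<otimes> a"
  by (simp add: smult_mult_left)

lemma smult_a_minus: "a \<in> carrier A \<Longrightarrow> b \<in> carrier A \<Longrightarrow> c \<odot> (a \<ominus> b) = c \<odot> a \<ominus> c \<odot> b"
  by (simp add: a_minus_def smult_add_right smult_minus)

end

lemma alg_hom_zero:
  assumes "f \<in> alg_hom A B" "complex_algebra A" "complex_algebra B"
  shows "f \<zero>\<^bsub>A\<^esub> = \<zero>\<^bsub>B\<^esub>"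
proof -
  interpret A: complex_algebra A by fact
  interpret B: complex_algebra B by fact
  show ?thesis using assms(1) ring_hom_zero[OF _ A.ring_axioms B.ring_axioms] by (auto simp: alg_hom_def)
qed

lemma alg_hom_minus:
  assumes "f \<in> alg_hom A B" "complex_algebra A" "complex_algebra B" "a \<in> carrier A" "b \<in> carrier A"
  shows "f (a \<ominus>\<^bsub>A\<^esub> b) = f a \<ominus>\<^bsub>B\<^esub> f b"
proof -
  interpret A: complex_algebra A by fact
  interpret B: complex_algebra B by fact
  show ?thesis using assms by (simp add: a_minus_def alg_homD A.minus_eq_smult B.minus_eq_smult)
qed

lemma alg_hom_finsum:
  assumes "f \<in> alg_hom A B" "complex_algebra A" "complex_algebra B" "g \<in> I \<rightarrow> carrier A"
  shows "f (finsum A g I) = finsum B (\<lambda>i. f (g i)) I"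
proof -
  interpret A: complex_algebra A by fact
  interpret B: complex_algebra B by fact
  show ?thesis using assms(4)
    by (induction I rule: infinite_finite_induct)
      (auto simp: alg_homD[OF assms(1)] alg_hom_zero[OF assms(1-3)] Pi_def)
qed

text \<open>All axioms pass along a surjection compatible with the operations; for quotients this
  replaces computations with cosets.\<close>

lemma complex_algebra_image:
  fixes A (structure)
  assumes "complex_algebra A"
    and \<pi>: "\<pi> ` carrier A = carrier Q"
    and \<pi>_add: "\<And>a b. a \<in> carrier A \<Longrightarrow> b \<in> carrier A \<Longrightarrow> \<pi> a \<oplus>\<^bsub>Q\<^esub> \<pi> b = \<pi> (a \<oplus> b)"
    and \<pi>_mult: "\<And>a b. a \<in> carrier A \<Longrightarrow> b \<in> carrier A \<Longrightarrow> \<pi> a \<otimes>\<^bsub>Q\<^esub> \<pi> b = \<pi> (a \<otimes> b)"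
    and \<pi>_one: "\<one>\<^bsub>Q\<^esub> = \<pi> \<one>" and \<pi>_zero: "\<zero>\<^bsub>Q\<^esub> = \<pi> \<zero>"
    and \<pi>_smult: "\<And>c a. a \<in> carrier A \<Longrightarrow> c \<odot>\<^bsub>Q\<^esub> \<pi> a = \<pi> (c \<odot> a)"
  shows "complex_algebra Q"
proof -
  interpret complex_algebra A by fact
  have in_Q: "\<pi> a \<in> carrier Q" if "a \<in> carrier A" for a using that \<pi> by blast
  have Q: "carrier Q = \<pi> ` carrier A" using \<pi> by simp
  show ?thesis
  proof (rule complex_algebraI)
    show "ring Q"
    proof (rule ringI)
      show "abelian_group Q"
      proof (rule abelian_groupI)
        fix x assume "x \<in> carrier Q"
        then obtain a where a: "a \<in> carrier A" "x = \<pi> a" using \<pi> by blast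
        then have "\<pi> (\<ominus> a) \<oplus>\<^bsub>Q\<^esub> x = \<zero>\<^bsub>Q\<^esub>" by (simp add: \<pi>_add \<pi>_zero l_neg)
        then show "\<exists>y\<in>carrier Q. y \<oplus>\<^bsub>Q\<^esub> x = \<zero>\<^bsub>Q\<^esub>" using a in_Q[of "\<ominus> a"] by blast
      qed (unfold Q, auto simp: \<pi>_add \<pi>_zero a_ac)
      show "Group.monoid Q"
        by (rule monoidI; unfold Q, auto simp: \<pi>_mult \<pi>_one m_assoc)
    qed (unfold Q, auto simp: \<pi>_add \<pi>_mult l_distr r_distr)
  qed (unfold Q, auto simp: \<pi>_add \<pi>_mult \<pi>_smult smult_add_left smult_add_right smult_smult smult_one
      smult_mult_left smult_mult_right)
qed

text \<open>The preimage of a subalgebra is a subalgebra.\<close>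

lemma generates_image:
  assumes "generates A G" "f \<in> alg_hom A Q" "f ` carrier A = carrier Q" "complex_algebra A"
    "G \<subseteq> carrier A"
  shows "generates Q (f ` G)"
  unfolding generates_def
proof (intro allI impI)
  interpret complex_algebra A by fact
  fix S assume S: "subalgebra_of S Q \<and> f ` G \<subseteq> S"
  then have "subalgebra_of {a \<in> carrier A. f a \<in> S} A"
    by (auto simp: subalgebra_of_def alg_homD[OF assms(2)])
  moreover have "G \<subseteq> {a \<in> carrier A. f a \<in> S}" using S assms(5) by auto
  ultimately have "carrier A \<subseteq> {a \<in> carrier A. f a \<in> S}"
    using assms(1) unfolding generates_def by blast
  then show "carrier Q \<subseteq> S" unfolding assms(3)[symmetric] by blast
qed

lemma generates_mono: "generates A G \<Longrightarrow> G \<subseteq> G' \<Longrightarrow> generates A G'"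
  unfolding generates_def by blast

text \<open>The elements on which two homomorphisms agree form a subalgebra.\<close>

lemma alg_hom_eqI:
  assumes "generates A G" "complex_algebra A" "f \<in> alg_hom A B" "h \<in> alg_hom A B"
    "\<And>a. a \<in> G \<Longrightarrow> f a = h a" "G \<subseteq> carrier A" "a \<in> carrier A"
  shows "f a = h a"
proof -
  interpret complex_algebra A by fact
  have "subalgebra_of {a \<in> carrier A. f a = h a} A"
    by (auto simp: subalgebra_of_def alg_homD[OF assms(3)] alg_homD[OF assms(4)])
  from generatesD[OF assms(1) this] show ?thesis using assms(5-7) by blast
qed

section \<open>Monoid algebras\<close>

text \<open>Seeing convolution as a twofold linear extension reduces associativity and
  distributivity to \<open>ext_ext\<close> and linearity.\<close>

lemma monoid_alg_mult:
  "f \<otimes>\<^bsub>monoid_alg M\<^esub> h = ext (\<lambda>u. ext (\<lambda>v. Poly_Mapping.single (u \<otimes>\<^bsub>M\<^esub> v) 1) h) f"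
  by (simp add: monoid_alg_def ext_def scal_sum)

lemma monoid_alg_simps [simp]:
  "carrier (monoid_alg M) = span_words (carrier M)"
  "f \<oplus>\<^bsub>monoid_alg M\<^esub> h = f + h" "\<zero>\<^bsub>monoid_alg M\<^esub> = 0"
  "\<one>\<^bsub>monoid_alg M\<^esub> = Poly_Mapping.single \<one>\<^bsub>M\<^esub> 1"
  "c \<odot>\<^bsub>monoid_alg M\<^esub> f = scal c f"
  by (simp_all add: monoid_alg_def span_words_def scal_def)

lemma ext_add_left: "ext (\<lambda>u. \<phi> u + \<psi> u) f = ext \<phi> f + ext \<psi> f"
  by (simp add: ext_def scal_add sum.distrib)

lemma complex_algebra_monoid_alg:
  assumes "Group.monoid M"
  shows "complex_algebra (monoid_alg M)"
proof -
  interpret Group.monoid M by fact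
  have carrier_keys: "u \<in> carrier M" if "f \<in> span_words (carrier M)" "u \<in> Poly_Mapping.keys f"
    for f :: "'a \<Rightarrow>\<^sub>0 complex" and u using that by (auto simp: span_words_def)
  have closed: "f \<otimes>\<^bsub>monoid_alg M\<^esub> h \<in> span_words (carrier M)"
    if "f \<in> span_words (carrier M)" "h \<in> span_words (carrier M)" for f h
    unfolding monoid_alg_mult
    by (intro span_words_ext[OF that(1)] span_words_ext[OF that(2)] span_words_closed) auto
  show ?thesis
  proof (rule complex_algebraI)
    show "ring (monoid_alg M)"
    proof (rule ringI)
      show "abelian_group (monoid_alg M)"
        by (rule abelian_groupI)
          (auto intro: span_words_closed add.assoc add.commute bexI[of _ "- x" for x])
      show "Group.monoid (monoid_alg M)"
      proof (rule monoidI)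
        fix f h k
        assume f: "f \<in> carrier (monoid_alg M)" and h: "h \<in> carrier (monoid_alg M)"
          and k: "k \<in> carrier (monoid_alg M)"
        note [simp] = carrier_keys[OF f[simplified]] carrier_keys[OF h[simplified]] carrier_keys[OF k[simplified]]
        show "f \<otimes>\<^bsub>monoid_alg M\<^esub> h \<otimes>\<^bsub>monoid_alg M\<^esub> k = f \<otimes>\<^bsub>monoid_alg M\<^esub> (h \<otimes>\<^bsub>monoid_alg M\<^esub> k)"
        proof -
          have "f \<otimes>\<^bsub>monoid_alg M\<^esub> h \<otimes>\<^bsub>monoid_alg M\<^esub> k =
              ext (\<lambda>u. ext (\<lambda>v. ext (\<lambda>w. Poly_Mapping.single (u \<otimes>\<^bsub>M\<^esub> v \<otimes>\<^bsub>M\<^esub> w) 1) k) h) f"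
            by (simp add: monoid_alg_mult ext_ext)
          also have "\<dots> = ext (\<lambda>u. ext (\<lambda>v. ext (\<lambda>w. Poly_Mapping.single (u \<otimes>\<^bsub>M\<^esub> (v \<otimes>\<^bsub>M\<^esub> w)) 1) k) h) f"
            by (rule ext_cong[OF refl], rule ext_cong[OF refl], rule ext_cong[OF refl]) (simp add: m_assoc)
          also have "\<dots> = f \<otimes>\<^bsub>monoid_alg M\<^esub> (h \<otimes>\<^bsub>monoid_alg M\<^esub> k)"
            by (simp add: monoid_alg_mult ext_ext)
          finally show ?thesis .
        qed
      next
        fix f assume f: "f \<in> carrier (monoid_alg M)"
        note [simp] = carrier_keys[OF f[simplified]]
        have id: "ext \<phi> f = f" if "\<And>u. u \<in> Poly_Mapping.keys f \<Longrightarrow> \<phi> u = Poly_Mapping.single u 1" for \<phi>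
          using ext_cong[where \<psi> = "\<lambda>u. Poly_Mapping.single u 1", OF refl that] by (simp add: ext_single_id)
        show "\<one>\<^bsub>monoid_alg M\<^esub> \<otimes>\<^bsub>monoid_alg M\<^esub> f = f" "f \<otimes>\<^bsub>monoid_alg M\<^esub> \<one>\<^bsub>monoid_alg M\<^esub> = f"
          unfolding monoid_alg_mult monoid_alg_simps by (auto intro!: id)
      qed (auto simp: closed intro: span_words_closed)
    qed (simp_all add: monoid_alg_mult ext_rules ext_add_left)
  qed (auto simp: monoid_alg_mult ext_rules ext_scal_left scal_add scal_add_left intro: span_words_closed)
qed

lemma generates_monoid_alg:
  assumes "Group.monoid M"
  shows "generates (monoid_alg M) ((\<lambda>u. Poly_Mapping.single u 1) ` carrier M)"
  unfolding generates_def
proof (intro allI impI subsetI)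
  interpret complex_algebra "monoid_alg M" by (rule complex_algebra_monoid_alg[OF assms])
  fix S f assume S: "subalgebra_of S (monoid_alg M) \<and> (\<lambda>u. Poly_Mapping.single u 1) ` carrier M \<subseteq> S"
    and f: "f \<in> carrier (monoid_alg M)"
  have single: "Poly_Mapping.single u c \<in> S" if "u \<in> carrier M" for u c
  proof -
    have "c \<odot>\<^bsub>monoid_alg M\<^esub> Poly_Mapping.single u 1 \<in> S"
      using S that unfolding subalgebra_of_def by blast
    then show ?thesis by simp
  qed
  have zero: "0 \<in> S"
  proof -
    have "0 \<odot>\<^bsub>monoid_alg M\<^esub> \<one>\<^bsub>monoid_alg M\<^esub> \<in> S" using S unfolding subalgebra_of_def by blast
    then show ?thesis by simp
  qed
  have "(\<Sum>u\<in>K. Poly_Mapping.single u (Poly_Mapping.lookup f u)) \<in> S" if "K \<subseteq> carrier M" for K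
    using that
  proof (induction K rule: infinite_finite_induct)
    case (insert u K)
    then have "Poly_Mapping.single u (Poly_Mapping.lookup f u) \<oplus>\<^bsub>monoid_alg M\<^esub>
        (\<Sum>u\<in>K. Poly_Mapping.single u (Poly_Mapping.lookup f u)) \<in> S"
      using S single unfolding subalgebra_of_def by blast
    then show ?case using insert by simp
  qed (simp_all add: zero)
  from this[of "Poly_Mapping.keys f"] show "f \<in> S"
    using f unfolding sum_monomials[of f, symmetric] by (simp add: span_words_def)
qed

text \<open>The counterpart of \<open>ext\<close> for values in an abstract algebra instead of a
  space of finitely supported functions.\<close>

definition lext :: "(complex, 'b) module \<Rightarrow> ('a \<Rightarrow> 'b) \<Rightarrow> ('a \<Rightarrow>\<^sub>0 complex) \<Rightarrow> 'b" where
  "lext R \<phi> f = (\<Oplus>\<^bsub>R\<^esub>u\<in>Poly_Mapping.keys f. Poly_Mapping.lookup f u \<odot>\<^bsub>R\<^esub> \<phi> u)"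

context complex_algebra begin

context
  fixes \<phi> :: "'g \<Rightarrow> 'a" and U :: "'g set"
  assumes \<phi>: "\<phi> \<in> U \<rightarrow> carrier A"
begin

lemma lext_superset:
  assumes "finite K" "Poly_Mapping.keys f \<subseteq> K" "K \<subseteq> U"
  shows "lext A \<phi> f = (\<Oplus>u\<in>K. Poly_Mapping.lookup f u \<odot> \<phi> u)"
  unfolding lext_def using assms \<phi>
  by (intro add.finprod_mono_neutral_cong_left) (auto simp: in_keys_iff Pi_def subset_iff)

lemma lext_closed [simp]: "f \<in> span_words U \<Longrightarrow> lext A \<phi> f \<in> carrier A"
  unfolding lext_def span_words_def using \<phi> by (intro finsum_closed) auto

lemma lext_0 [simp]: "lext A \<phi> 0 = \<zero>"
  by (simp add: lext_def)

lemma lext_single: "u \<in> U \<Longrightarrow> lext A \<phi> (Poly_Mapping.single u c) = c \<odot> \<phi> u"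
  using \<phi> by (subst lext_superset[of "{u}"]) (auto simp: Pi_def)

lemma lext_add:
  assumes "f \<in> span_words U" "h \<in> span_words U"
  shows "lext A \<phi> (f + h) = lext A \<phi> f \<oplus> lext A \<phi> h"
proof -
  let ?K = "Poly_Mapping.keys f \<union> Poly_Mapping.keys h"
  have K: "?K \<subseteq> U" "finite ?K" using assms by (auto simp: span_words_def)
  have "lext A \<phi> (f + h) = (\<Oplus>u\<in>?K. Poly_Mapping.lookup f u \<odot> \<phi> u \<oplus> Poly_Mapping.lookup h u \<odot> \<phi> u)"
    unfolding lext_superset[OF K(2) Poly_Mapping.keys_add K(1)] using K \<phi>
    by (intro finsum_cong') (auto simp: lookup_add smult_add_left Pi_def subset_iff)
  also have "\<dots> = lext A \<phi> f \<oplus> lext A \<phi> h"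
    using K \<phi> by (subst finsum_addf) (auto simp: lext_superset[of ?K] Pi_def subset_iff)
  finally show ?thesis .
qed

lemma lext_scal:
  assumes "f \<in> span_words U"
  shows "lext A \<phi> (scal c f) = c \<odot> lext A \<phi> f"
proof -
  have K: "Poly_Mapping.keys f \<subseteq> U" using assms by (simp add: span_words_def)
  have "lext A \<phi> (scal c f) = (\<Oplus>u\<in>Poly_Mapping.keys f. c \<odot> (Poly_Mapping.lookup f u \<odot> \<phi> u))"
    using K \<phi> keys_scal[of c f]
    by (subst lext_superset[of "Poly_Mapping.keys f"]) (auto simp: smult_smult Pi_def subset_iff intro!: finsum_cong')
  also have "\<dots> = c \<odot> lext A \<phi> f"
    unfolding lext_def using K \<phi> by (subst smult_finsum) auto
  finally show ?thesis .
qed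

lemma lext_ext:
  assumes f: "f \<in> span_words V" and \<psi>: "\<And>v. v \<in> V \<Longrightarrow> \<psi> v \<in> span_words U"
  shows "lext A \<phi> (ext \<psi> f) = lext A (\<lambda>v. lext A \<phi> (\<psi> v)) f"
proof -
  have "lext A \<phi> (\<Sum>v\<in>K. scal (Poly_Mapping.lookup f v) (\<psi> v)) =
      (\<Oplus>v\<in>K. Poly_Mapping.lookup f v \<odot> lext A \<phi> (\<psi> v))"
    if "K \<subseteq> V" for K
    using that
  proof (induction K rule: infinite_finite_induct)
    case (insert v K)
    have "(\<Sum>v\<in>K. scal (Poly_Mapping.lookup f v) (\<psi> v)) \<in> span_words U"
      using insert.prems \<psi> by (intro span_words_sum span_words_closed) auto
    then show ?case
      using insert \<psi> by (subst finsum_insert) (auto simp: lext_add lext_scal span_words_closed Pi_def subset_iff)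
  qed simp_all
  then show ?thesis using f by (simp add: ext_def lext_def[of _ "\<lambda>v. lext A \<phi> (\<psi> v)"] span_words_def)
qed

end

lemma lext_cong:
  assumes "f \<in> span_words U" "\<And>u. u \<in> U \<Longrightarrow> \<phi> u = \<psi> u" "\<And>u. u \<in> U \<Longrightarrow> \<psi> u \<in> carrier A"
  shows "lext A \<phi> f = lext A \<psi> f"
  unfolding lext_def using assms by (intro finsum_cong') (auto simp: span_words_def subset_iff)

lemma lext_mult_right:
  assumes "f \<in> span_words U" "\<phi> \<in> U \<rightarrow> carrier A" "a \<in> carrier A"
  shows "lext A (\<lambda>u. \<phi> u \<otimes> a) f = lext A \<phi> f \<otimes> a"
proof -
  have "lext A (\<lambda>u. \<phi> u \<otimes> a) f = (\<Oplus>u\<in>Poly_Mapping.keys f. (Poly_Mapping.lookup f u \<odot> \<phi> u) \<otimes> a)"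
    unfolding lext_def using assms
    by (intro finsum_cong') (auto simp: smult_mult_left span_words_def subset_iff Pi_def)
  then show ?thesis
    unfolding lext_def using assms by (subst finsum_ldistr) (auto simp: span_words_def)
qed

lemma lext_mult_left:
  assumes "f \<in> span_words U" "\<phi> \<in> U \<rightarrow> carrier A" "a \<in> carrier A"
  shows "lext A (\<lambda>u. a \<otimes> \<phi> u) f = a \<otimes> lext A \<phi> f"
proof -
  have "lext A (\<lambda>u. a \<otimes> \<phi> u) f = (\<Oplus>u\<in>Poly_Mapping.keys f. a \<otimes> (Poly_Mapping.lookup f u \<odot> \<phi> u))"
    unfolding lext_def using assms
    by (intro finsum_cong') (auto simp: smult_mult_right span_words_def subset_iff Pi_def)
  then show ?thesis
    unfolding lext_def using assms by (subst finsum_rdistr) (auto simp: span_words_def)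
qed

lemma monoid_alg_lift:
  assumes "Group.monoid M" and \<phi>: "\<phi> \<in> carrier M \<rightarrow> carrier A"
    and one: "\<phi> \<one>\<^bsub>M\<^esub> = \<one>"
    and mult: "\<And>u v. u \<in> carrier M \<Longrightarrow> v \<in> carrier M \<Longrightarrow> \<phi> (u \<otimes>\<^bsub>M\<^esub> v) = \<phi> u \<otimes> \<phi> v"
  shows "lext A \<phi> \<in> alg_hom (monoid_alg M) A"
proof (rule alg_homI)
  interpret M: Group.monoid M by fact
  note \<phi>' = funcset_mem[OF \<phi>]
  fix f h assume f: "f \<in> carrier (monoid_alg M)" and h: "h \<in> carrier (monoid_alg M)"
  have inner: "ext (\<lambda>v. Poly_Mapping.single (u \<otimes>\<^bsub>M\<^esub> v) 1) h \<in> span_words (carrier M)"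
    if "u \<in> carrier M" for u
    using h that by (intro span_words_ext[of h "carrier M"] span_words_closed) auto
  have "lext A \<phi> (f \<otimes>\<^bsub>monoid_alg M\<^esub> h) =
      lext A (\<lambda>u. lext A \<phi> (ext (\<lambda>v. Poly_Mapping.single (u \<otimes>\<^bsub>M\<^esub> v) 1) h)) f"
    unfolding monoid_alg_mult using f by (intro lext_ext[OF \<phi>] inner) auto
  also have "\<dots> = lext A (\<lambda>u. \<phi> u \<otimes> lext A \<phi> h) f"
  proof (rule lext_cong)
    fix u assume u: "u \<in> carrier M"
    have "lext A \<phi> (ext (\<lambda>v. Poly_Mapping.single (u \<otimes>\<^bsub>M\<^esub> v) 1) h) =
        lext A (\<lambda>v. lext A \<phi> (Poly_Mapping.single (u \<otimes>\<^bsub>M\<^esub> v) 1)) h"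
      using h u by (intro lext_ext[OF \<phi>, of h "carrier M"] span_words_closed) auto
    also have "\<dots> = lext A (\<lambda>v. \<phi> u \<otimes> \<phi> v) h"
      using h u \<phi>' by (intro lext_cong[of h "carrier M"]) (auto simp: lext_single[OF \<phi>] mult smult_one)
    also have "\<dots> = \<phi> u \<otimes> lext A \<phi> h"
      using h u \<phi>' by (intro lext_mult_left[of _ "carrier M"] \<phi>) auto
    finally show "lext A \<phi> (ext (\<lambda>v. Poly_Mapping.single (u \<otimes>\<^bsub>M\<^esub> v) 1) h) = \<phi> u \<otimes> lext A \<phi> h" .
  qed (use f h \<phi>' lext_closed[OF \<phi>] in auto)
  also have "\<dots> = lext A \<phi> f \<otimes> lext A \<phi> h"
    using f h by (intro lext_mult_right[OF _ \<phi>] lext_closed[OF \<phi>]) auto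
  finally show "lext A \<phi> (f \<otimes>\<^bsub>monoid_alg M\<^esub> h) = lext A \<phi> f \<otimes> lext A \<phi> h" .
qed (auto simp: lext_closed[OF \<phi>] lext_add[OF \<phi>] lext_scal[OF \<phi>] lext_single[OF \<phi>]
    monoid.one_closed[OF assms(1)] one smult_one)

end

section \<open>Quotients\<close>

abbreviation qmap :: "(complex, 'a) module \<Rightarrow> 'a set \<Rightarrow> 'a \<Rightarrow> 'a set" where
  "qmap A I a \<equiv> I +>\<^bsub>A\<^esub> a"

context
  fixes A :: "(complex, 'a) module" (structure) and I
  assumes A: "complex_algebra A" and I: "ideal I A"
begin

interpretation complex_algebra A by (rule A)
interpretation I: ideal I A by (rule I)

lemma qmap_eq_iff: "a \<in> carrier A \<Longrightarrow> b \<in> carrier A \<Longrightarrow> qmap A I a = qmap A I b \<longleftrightarrow> a \<ominus> b \<in> I"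
  using quotient_eq_iff_same_a_r_cos[OF I] by simp

lemma ideal_smult: "a \<in> I \<Longrightarrow> c \<odot> a \<in> I"
  using I.I_l_closed[of a "c \<odot> \<one>"] I.a_subset by (auto simp: smult_eq_mult[symmetric])

lemma quot_alg_simps:
  "carrier (quot_alg A I) = qmap A I ` carrier A"
  "a \<in> carrier A \<Longrightarrow> b \<in> carrier A \<Longrightarrow> qmap A I a \<oplus>\<^bsub>quot_alg A I\<^esub> qmap A I b = qmap A I (a \<oplus> b)"
  "a \<in> carrier A \<Longrightarrow> b \<in> carrier A \<Longrightarrow> qmap A I a \<otimes>\<^bsub>quot_alg A I\<^esub> qmap A I b = qmap A I (a \<otimes> b)"
  "\<one>\<^bsub>quot_alg A I\<^esub> = qmap A I \<one>"
  "\<zero>\<^bsub>quot_alg A I\<^esub> = qmap A I \<zero>"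
  "a \<in> carrier A \<Longrightarrow> c \<odot>\<^bsub>quot_alg A I\<^esub> qmap A I a = qmap A I (c \<odot> a)"
proof -
  show "carrier (quot_alg A I) = qmap A I ` carrier A"
    by (auto simp: quot_alg_def FactRing_def A_RCOSETS_def')
  show "\<one>\<^bsub>quot_alg A I\<^esub> = qmap A I \<one>" by (simp add: quot_alg_def FactRing_def)
  show "\<zero>\<^bsub>quot_alg A I\<^esub> = qmap A I \<zero>"
    using a_coset_add_zero[OF I.a_subset] by (simp add: quot_alg_def FactRing_def)
  show "qmap A I a \<oplus>\<^bsub>quot_alg A I\<^esub> qmap A I b = qmap A I (a \<oplus> b)" if "a \<in> carrier A" "b \<in> carrier A"
    using that by (simp add: quot_alg_def FactRing_def I.a_rcos_sum)
  show "qmap A I a \<otimes>\<^bsub>quot_alg A I\<^esub> qmap A I b = qmap A I (a \<otimes> b)" if "a \<in> carrier A" "b \<in> carrier A"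
    using that by (simp add: quot_alg_def FactRing_def I.rcoset_mult_add)
  show "c \<odot>\<^bsub>quot_alg A I\<^esub> qmap A I a = qmap A I (c \<odot> a)" if a: "a \<in> carrier A"
  proof -
    \<comment> \<open>The scalar multiplication of \<open>quot_alg\<close> is a union over all
      representatives, which is a single coset only because each of them gives the same one.\<close>
    have "qmap A I (c \<odot> b) = qmap A I (c \<odot> a)" if b: "b \<in> qmap A I a" for b
    proof -
      obtain i where i: "i \<in> I" "b = i \<oplus> a" using b by (auto simp: a_r_coset_def')
      have i': "i \<in> carrier A" using i(1) I.a_subset by blast
      have "c \<odot> b \<ominus> c \<odot> a = c \<odot> i"
        using a i' by (simp add: i(2) smult_add_right a_minus_def a_assoc r_neg)
      then show ?thesis using a i' i ideal_smult by (subst qmap_eq_iff) auto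
    qed
    moreover have "a \<in> qmap A I a" using I.a_rcos_self[OF a] by simp
    ultimately have "(\<Union>b\<in>qmap A I a. qmap A I (c \<odot> b)) = qmap A I (c \<odot> a)" by blast
    then show ?thesis by (simp add: quot_alg_def)
  qed
qed

lemma complex_algebra_quot: "complex_algebra (quot_alg A I)"
  by (rule complex_algebra_image[OF A, where \<pi> = "qmap A I"]) (simp_all add: quot_alg_simps)

lemma qmap_hom: "qmap A I \<in> alg_hom A (quot_alg A I)"
  by (rule alg_homI) (simp_all add: quot_alg_simps)

lemma qmap_eq_zero_iff: "a \<in> carrier A \<Longrightarrow> qmap A I a = \<zero>\<^bsub>quot_alg A I\<^esub> \<longleftrightarrow> a \<in> I"
  by (simp add: quot_alg_simps qmap_eq_iff a_minus_def)

lemma quot_alg_lift: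
  assumes R: "complex_algebra R" and f: "f \<in> alg_hom A R" and kill: "\<And>a. a \<in> I \<Longrightarrow> f a = \<zero>\<^bsub>R\<^esub>"
  shows "\<exists>h\<in>alg_hom (quot_alg A I) R. \<forall>a\<in>carrier A. h (qmap A I a) = f a"
proof -
  interpret R: complex_algebra R by (rule R)
  \<comment> \<open>An arbitrary representative is chosen; vanishing of \<open>f\<close> on
    \<open>I\<close> makes the value independent of it.\<close>
  define h where "h U = f (SOME a. a \<in> carrier A \<and> qmap A I a = U)" for U
  have h: "h (qmap A I a) = f a" if a: "a \<in> carrier A" for a
  proof -
    define b where "b = (SOME b. b \<in> carrier A \<and> qmap A I b = qmap A I a)"
    have b: "b \<in> carrier A \<and> qmap A I b = qmap A I a"
      unfolding b_def by (rule someI[of _ a]) (simp add: a)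
    then have "b \<ominus> a \<in> I" using a qmap_eq_iff by blast
    then have "f b \<ominus>\<^bsub>R\<^esub> f a = \<zero>\<^bsub>R\<^esub>" using kill alg_hom_minus[OF f A R] a b by metis
    then have "f b = f a" using alg_homD(1)[OF f] a b by simp
    then show ?thesis by (simp add: h_def b_def)
  qed
  have "h \<in> alg_hom (quot_alg A I) R"
  proof (rule alg_homI)
    show "h \<one>\<^bsub>quot_alg A I\<^esub> = \<one>\<^bsub>R\<^esub>" by (simp add: quot_alg_simps h alg_homD[OF f])
  qed (auto simp: quot_alg_simps h alg_homD[OF f])
  then show ?thesis using h by blast
qed

end

text \<open>The kernel of \<open>f\<close> is an ideal containing \<open>S\<close>, hence contains
  the ideal generated by \<open>S\<close>; so only the generators have to be checked.\<close>

lemma genideal_quot_alg_lift: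
  assumes A: "complex_algebra A" and S: "S \<subseteq> carrier A" and R: "complex_algebra R"
    and f: "f \<in> alg_hom A R" and kill: "\<And>a. a \<in> S \<Longrightarrow> f a = \<zero>\<^bsub>R\<^esub>"
  shows "\<exists>h\<in>alg_hom (quot_alg A (genideal A S)) R. \<forall>a\<in>carrier A. h (qmap A (genideal A S) a) = f a"
proof -
  interpret A: complex_algebra A by (rule A)
  interpret R: complex_algebra R by (rule R)
  interpret ring_hom_ring A R f
    using f A.ring_axioms R.ring_axioms by (intro ring_hom_ringI2) (auto simp: alg_hom_def)
  have "genideal A S \<subseteq> a_kernel A R f"
  proof (rule A.genideal_minimal[OF kernel_is_ideal], rule subsetI)
    fix a assume "a \<in> S"
    with S have "a \<in> carrier A" "f a = \<zero>\<^bsub>R\<^esub>" by (blast intro: kill)+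
    then show "a \<in> a_kernel A R f" unfolding a_kernel_def' by blast
  qed
  then show ?thesis
    unfolding a_kernel_def' by (intro quot_alg_lift[OF A A.genideal_ideal[OF S] R f]) blast
qed

section \<open>Free algebras\<close>

lemma monoid_free_monoid: "Group.monoid (free_monoid U)"
  by (rule monoidI) (auto simp: free_monoid_def)

lemma complex_algebra_free_alg: "complex_algebra (free_alg U)"
  unfolding free_alg_def by (rule complex_algebra_monoid_alg[OF monoid_free_monoid])

lemma free_gen_closed: "s \<in> U \<Longrightarrow> free_gen s \<in> carrier (free_alg U)"
  by (auto simp: free_alg_def free_gen_def free_monoid_def intro!: span_words_closed)

lemma generates_free_alg: "generates (free_alg U) (free_gen ` U)"
  unfolding generates_def
proof (intro allI impI)
  fix S assume S: "subalgebra_of S (free_alg U) \<and> free_gen ` U \<subseteq> S"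
  have "Poly_Mapping.single w 1 \<in> S" if "w \<in> lists U" for w
    using that
  proof (induction w)
    case Nil
    have "\<one>\<^bsub>free_alg U\<^esub> \<in> S" using S unfolding subalgebra_of_def by blast
    then show ?case by (simp add: free_alg_def free_monoid_def)
  next
    case (Cons s w)
    then have "free_gen s \<otimes>\<^bsub>free_alg U\<^esub> Poly_Mapping.single w 1 \<in> S"
      using S unfolding subalgebra_of_def by blast
    then show ?case by (simp add: free_alg_def monoid_alg_mult free_gen_def free_monoid_def)
  qed
  then have "(\<lambda>u. Poly_Mapping.single u 1) ` carrier (free_monoid U) \<subseteq> S"
    by (auto simp: free_monoid_def)
  then show "carrier (free_alg U) \<subseteq> S"
    using S generates_monoid_alg[OF monoid_free_monoid, of U]
    unfolding generates_def free_alg_def by blast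
qed

lemma free_alg_lift:
  assumes R: "complex_algebra R" and y: "y \<in> U \<rightarrow> carrier R"
  shows "\<exists>h\<in>alg_hom (free_alg U) R. \<forall>s\<in>U. h (free_gen s) = y s"
proof -
  interpret complex_algebra R by (rule R)
  define \<phi> where "\<phi> w = foldr (\<lambda>s a. y s \<otimes>\<^bsub>R\<^esub> a) w \<one>\<^bsub>R\<^esub>" for w
  have closed: "\<phi> w \<in> carrier R" if "w \<in> lists U" for w
    using that y by (induction w) (auto simp: \<phi>_def)
  have app: "\<phi> (v @ w) = \<phi> v \<otimes>\<^bsub>R\<^esub> \<phi> w" if "v \<in> lists U" "w \<in> lists U" for v w
    using that
  proof (induction v)
    case (Cons s v)
    have "\<phi> (s # x) = y s \<otimes>\<^bsub>R\<^esub> \<phi> x" for x by (simp add: \<phi>_def)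
    moreover have "y s \<in> carrier R" "\<phi> v \<in> carrier R" "\<phi> w \<in> carrier R"
      using Cons y by (auto intro: closed)
    ultimately show ?case using Cons by (simp add: m_assoc)
  qed (simp add: closed, simp add: \<phi>_def closed[unfolded \<phi>_def])
  have c: "\<phi> \<in> carrier (free_monoid U) \<rightarrow> carrier R" using closed by (auto simp: free_monoid_def)
  have "lext R \<phi> \<in> alg_hom (free_alg U) R"
    unfolding free_alg_def
    by (rule monoid_alg_lift[OF monoid_free_monoid c]) (auto simp: free_monoid_def app, simp add: \<phi>_def)
  moreover have "lext R \<phi> (free_gen s) = y s" if "s \<in> U" for s
    using that funcset_mem[OF y that] lext_single[OF c, of "[s]"]
    by (auto simp: free_gen_def free_monoid_def \<phi>_def smult_one)
  ultimately show ?thesis by blast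
qed

section \<open>Free products\<close>

context
  fixes A :: "(complex, 'a) module" and B :: "(complex, 'b) module"
  assumes A: "complex_algebra A" and B: "complex_algebra B"
begin

interpretation A: complex_algebra A by (rule A)
interpretation B: complex_algebra B by (rule B)
interpretation C: complex_algebra "free_prod_cover A B"
  unfolding free_prod_cover_def by (rule complex_algebra_free_alg)

lemma free_prod_gen_closed:
  "a \<in> carrier A \<Longrightarrow> free_gen (Inl a) \<in> carrier (free_prod_cover A B)"
  "b \<in> carrier B \<Longrightarrow> free_gen (Inr b) \<in> carrier (free_prod_cover A B)"
  unfolding free_prod_cover_def by (auto intro!: free_gen_closed)

lemma hom_relations_closed:
  "hom_relations A (free_prod_cover A B) (\<lambda>a. free_gen (Inl a)) \<union>
   hom_relations B (free_prod_cover A B) (\<lambda>b. free_gen (Inr b)) \<subseteq> carrier (free_prod_cover A B)"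
  unfolding hom_relations_def using free_prod_gen_closed by auto

lemma free_prod_ideal: "ideal (free_prod_ideal A B) (free_prod_cover A B)"
  unfolding free_prod_ideal_def by (rule C.genideal_ideal[OF hom_relations_closed])

lemma complex_algebra_free_prod: "complex_algebra (free_prod A B)"
  unfolding free_prod_def by (rule complex_algebra_quot[OF C.complex_algebra_axioms free_prod_ideal])

lemma qmap_free_prod_hom:
  "qmap (free_prod_cover A B) (free_prod_ideal A B) \<in> alg_hom (free_prod_cover A B) (free_prod A B)"
  unfolding free_prod_def by (rule qmap_hom[OF C.complex_algebra_axioms free_prod_ideal])

text \<open>Formulated for an auxiliary algebra \<open>D\<close> so that it serves both inclusions
  into the free product.\<close>

lemma hom_relations_alg_hom:
  fixes D :: "(complex, 'd) module"
  assumes D: "complex_algebra D"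
    and f: "\<And>a. a \<in> carrier D \<Longrightarrow> f a \<in> carrier (free_prod_cover A B)"
    and sub: "hom_relations D (free_prod_cover A B) f \<subseteq> free_prod_ideal A B"
  shows "(\<lambda>a. qmap (free_prod_cover A B) (free_prod_ideal A B) (f a)) \<in> alg_hom D (free_prod A B)"
proof -
  interpret D: complex_algebra D by (rule D)
  note q = qmap_free_prod_hom
  have eq: "qmap (free_prod_cover A B) (free_prod_ideal A B) x = qmap (free_prod_cover A B) (free_prod_ideal A B) y"
    if "x \<in> carrier (free_prod_cover A B)" "y \<in> carrier (free_prod_cover A B)"
      "x \<ominus>\<^bsub>free_prod_cover A B\<^esub> y \<in> hom_relations D (free_prod_cover A B) f" for x y
    using that sub by (subst qmap_eq_iff[OF C.complex_algebra_axioms free_prod_ideal]) auto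
  show ?thesis
  proof (rule alg_homI)
    fix a b assume ab: "a \<in> carrier D" "b \<in> carrier D"
    have "qmap (free_prod_cover A B) (free_prod_ideal A B) (f (a \<oplus>\<^bsub>D\<^esub> b)) =
      qmap (free_prod_cover A B) (free_prod_ideal A B) (f a \<oplus>\<^bsub>free_prod_cover A B\<^esub> f b)"
      using ab f by (intro eq) (auto simp: hom_relations_def)
    then show "qmap (free_prod_cover A B) (free_prod_ideal A B) (f (a \<oplus>\<^bsub>D\<^esub> b)) =
      qmap (free_prod_cover A B) (free_prod_ideal A B) (f a) \<oplus>\<^bsub>free_prod A B\<^esub>
      qmap (free_prod_cover A B) (free_prod_ideal A B) (f b)"
      using ab f by (simp add: alg_homD[OF q])
    have "qmap (free_prod_cover A B) (free_prod_ideal A B) (f (a \<otimes>\<^bsub>D\<^esub> b)) =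
      qmap (free_prod_cover A B) (free_prod_ideal A B) (f a \<otimes>\<^bsub>free_prod_cover A B\<^esub> f b)"
      using ab f by (intro eq) (auto simp: hom_relations_def)
    then show "qmap (free_prod_cover A B) (free_prod_ideal A B) (f (a \<otimes>\<^bsub>D\<^esub> b)) =
      qmap (free_prod_cover A B) (free_prod_ideal A B) (f a) \<otimes>\<^bsub>free_prod A B\<^esub>
      qmap (free_prod_cover A B) (free_prod_ideal A B) (f b)"
      using ab f by (simp add: alg_homD[OF q])
  next
    fix c a assume a: "a \<in> carrier D"
    have "qmap (free_prod_cover A B) (free_prod_ideal A B) (f (c \<odot>\<^bsub>D\<^esub> a)) =
      qmap (free_prod_cover A B) (free_prod_ideal A B) (c \<odot>\<^bsub>free_prod_cover A B\<^esub> f a)"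
      using a f by (intro eq) (auto simp: hom_relations_def)
    then show "qmap (free_prod_cover A B) (free_prod_ideal A B) (f (c \<odot>\<^bsub>D\<^esub> a)) =
      c \<odot>\<^bsub>free_prod A B\<^esub> qmap (free_prod_cover A B) (free_prod_ideal A B) (f a)"
      using a f by (simp add: alg_homD[OF q])
  next
    have "qmap (free_prod_cover A B) (free_prod_ideal A B) (f \<one>\<^bsub>D\<^esub>) =
      qmap (free_prod_cover A B) (free_prod_ideal A B) \<one>\<^bsub>free_prod_cover A B\<^esub>"
      using f by (intro eq) (auto simp: hom_relations_def)
    then show "qmap (free_prod_cover A B) (free_prod_ideal A B) (f \<one>\<^bsub>D\<^esub>) = \<one>\<^bsub>free_prod A B\<^esub>"
      by (simp add: alg_homD[OF q])
  qed (simp add: f alg_homD[OF q])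
qed

lemma genideal_free_prod_self:
  "hom_relations A (free_prod_cover A B) (\<lambda>a. free_gen (Inl a)) \<union>
   hom_relations B (free_prod_cover A B) (\<lambda>b. free_gen (Inr b)) \<subseteq> free_prod_ideal A B"
  unfolding free_prod_ideal_def by (rule C.genideal_self[OF hom_relations_closed])

lemma free_prod_inl_hom: "free_prod_inl A B \<in> alg_hom A (free_prod A B)"
  using hom_relations_alg_hom[OF A, of "\<lambda>a. free_gen (Inl a)"] genideal_free_prod_self free_prod_gen_closed
  by (simp add: free_prod_inl_def[abs_def])

lemma free_prod_inr_hom: "free_prod_inr A B \<in> alg_hom B (free_prod A B)"
  using hom_relations_alg_hom[OF B, of "\<lambda>b. free_gen (Inr b)"] genideal_free_prod_self free_prod_gen_closed
  by (simp add: free_prod_inr_def[abs_def])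

lemma generates_free_prod_carriers:
  "generates (free_prod A B) (free_prod_inl A B ` carrier A \<union> free_prod_inr A B ` carrier B)"
proof -
  have "generates (free_prod A B) (qmap (free_prod_cover A B) (free_prod_ideal A B) `
      free_gen ` (Inl ` carrier A \<union> Inr ` carrier B))"
  proof (rule generates_image[OF _ qmap_free_prod_hom _ C.complex_algebra_axioms])
    show "generates (free_prod_cover A B) (free_gen ` (Inl ` carrier A \<union> Inr ` carrier B))"
      unfolding free_prod_cover_def by (rule generates_free_alg)
    show "qmap (free_prod_cover A B) (free_prod_ideal A B) ` carrier (free_prod_cover A B) =
        carrier (free_prod A B)"
      unfolding free_prod_def by (simp add: quot_alg_simps[OF C.complex_algebra_axioms free_prod_ideal])
  qed (auto intro: free_prod_gen_closed)
  then show ?thesis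
    by (simp add: image_Un image_image free_prod_inl_def[abs_def] free_prod_inr_def[abs_def])
qed

lemma generates_free_prod:
  assumes "generates A G" "generates B G'" "G \<subseteq> carrier A" "G' \<subseteq> carrier B"
  shows "generates (free_prod A B) (free_prod_inl A B ` G \<union> free_prod_inr A B ` G')"
  unfolding generates_def
proof (intro allI impI)
  interpret FP: complex_algebra "free_prod A B" by (rule complex_algebra_free_prod)
  fix S assume S: "subalgebra_of S (free_prod A B) \<and>
    free_prod_inl A B ` G \<union> free_prod_inr A B ` G' \<subseteq> S"
  have "subalgebra_of {a \<in> carrier A. free_prod_inl A B a \<in> S} A"
    using S by (auto simp: subalgebra_of_def alg_homD[OF free_prod_inl_hom])
  moreover have "G \<subseteq> {a \<in> carrier A. free_prod_inl A B a \<in> S}" using S assms(3) by blast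
  ultimately have "carrier A \<subseteq> {a \<in> carrier A. free_prod_inl A B a \<in> S}"
    using assms(1) unfolding generates_def by blast
  have "subalgebra_of {b \<in> carrier B. free_prod_inr A B b \<in> S} B"
    using S by (auto simp: subalgebra_of_def alg_homD[OF free_prod_inr_hom])
  moreover have "G' \<subseteq> {b \<in> carrier B. free_prod_inr A B b \<in> S}" using S assms(4) by blast
  ultimately have "carrier B \<subseteq> {b \<in> carrier B. free_prod_inr A B b \<in> S}"
    using assms(2) unfolding generates_def by blast
  with \<open>carrier A \<subseteq> _\<close> have "free_prod_inl A B ` carrier A \<union> free_prod_inr A B ` carrier B \<subseteq> S" by blast
  then show "carrier (free_prod A B) \<subseteq> S"
    using generates_free_prod_carriers S unfolding generates_def by blast
qed

lemma free_prod_lift: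
  assumes R: "complex_algebra R" and f: "f \<in> alg_hom A R" and h: "h \<in> alg_hom B R"
  shows "\<exists>k\<in>alg_hom (free_prod A B) R. (\<forall>a\<in>carrier A. k (free_prod_inl A B a) = f a) \<and>
    (\<forall>b\<in>carrier B. k (free_prod_inr A B b) = h b)"
proof -
  interpret R: complex_algebra R by (rule R)
  have "case_sum f h \<in> (Inl ` carrier A \<union> Inr ` carrier B) \<rightarrow> carrier R"
    by (auto simp: alg_homD[OF f] alg_homD[OF h])
  from free_alg_lift[OF R this] obtain k where k: "k \<in> alg_hom (free_prod_cover A B) R"
    "\<forall>s\<in>Inl ` carrier A \<union> Inr ` carrier B. k (free_gen s) = case_sum f h s"
    unfolding free_prod_cover_def by blast
  have kA: "k (free_gen (Inl a)) = f a" if "a \<in> carrier A" for a using k(2) that by auto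
  have kB: "k (free_gen (Inr b)) = h b" if "b \<in> carrier B" for b using k(2) that by auto
  note km = alg_hom_minus[OF k(1) C.complex_algebra_axioms R]
  have kill: "k r = \<zero>\<^bsub>R\<^esub>" if "r \<in> hom_relations A (free_prod_cover A B) (\<lambda>a. free_gen (Inl a)) \<union>
     hom_relations B (free_prod_cover A B) (\<lambda>b. free_gen (Inr b))" for r
    using that unfolding hom_relations_def
    by (auto simp: km kA kB alg_homD[OF k(1)] alg_homD[OF f] alg_homD[OF h] free_prod_gen_closed)
  obtain k' where k': "k' \<in> alg_hom (free_prod A B) R"
    "\<forall>a\<in>carrier (free_prod_cover A B). k' (qmap (free_prod_cover A B) (free_prod_ideal A B) a) = k a"
    using genideal_quot_alg_lift[OF C.complex_algebra_axioms hom_relations_closed R k(1) kill]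
    unfolding free_prod_def free_prod_ideal_def by blast
  then show ?thesis
    by (intro bexI[of _ k'])
      (auto simp: free_prod_inl_def free_prod_inr_def free_prod_gen_closed kA kB)
qed

end

section \<open>Matrices\<close>

lemma (in abelian_monoid) finsum_swap:
  assumes "finite I" "finite J" "\<And>i j. i \<in> I \<Longrightarrow> j \<in> J \<Longrightarrow> f i j \<in> carrier G"
  shows "(\<Oplus>i\<in>I. \<Oplus>j\<in>J. f i j) = (\<Oplus>j\<in>J. \<Oplus>i\<in>I. f i j)"
  using assms(1,3)
proof (induction I rule: finite_induct)
  case empty
  then show ?case by simp
next
  case (insert i I)
  have "(\<Oplus>j\<in>J. \<Oplus>i\<in>insert i I. f i j) = (\<Oplus>j\<in>J. f i j \<oplus> (\<Oplus>i\<in>I. f i j))"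
    using insert by (intro finsum_cong') auto
  also have "\<dots> = (\<Oplus>j\<in>J. f i j) \<oplus> (\<Oplus>j\<in>J. \<Oplus>i\<in>I. f i j)"
    using insert by (intro finsum_addf) auto
  finally show ?case using insert by (simp add: Pi_def)
qed

lemma (in abelian_monoid) finsum_delta:
  assumes "finite I" "i \<in> I" "f i \<in> carrier G"
  shows "(\<Oplus>j\<in>I. if j = i then f j else \<zero>) = f i" "(\<Oplus>j\<in>I. if i = j then f j else \<zero>) = f i"
proof -
  show "(\<Oplus>j\<in>I. if j = i then f j else \<zero>) = f i"
    using add.finprod_singleton[of i I f] assms
    by (subst add.finprod_mono_neutral_cong_right[of I "{i}"]) auto
  then show "(\<Oplus>j\<in>I. if i = j then f j else \<zero>) = f i" by (simp add: eq_commute)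
qed

lemma matr_module_simps:
  "U \<in> carrier (matr_module A) \<longleftrightarrow> (\<forall>i j. U i j \<in> carrier A)"
  "\<zero>\<^bsub>matr_module A\<^esub> = (\<lambda>i j. \<zero>\<^bsub>A\<^esub>)"
  "U \<oplus>\<^bsub>matr_module A\<^esub> V = matr_add A U V"
  "a \<odot>\<^bsub>matr_module A\<^esub> U = (\<lambda>i j. U i j \<otimes>\<^bsub>A\<^esub> a)"
  by (simp_all add: matr_module_def)

context complex_algebra begin

abbreviation mats :: "('n::finite, 'a) matr set" where
  "mats \<equiv> carrier (matr_module A)"

abbreviation matr_times :: "('n::finite, 'a) matr \<Rightarrow> ('n, 'a) matr \<Rightarrow> ('n, 'a) matr"
  (infixl \<open>\<star>\<close> 70) where
  "U \<star> V \<equiv> matr_mult A U V"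

abbreviation cm :: "complex^'n::finite^'n \<Rightarrow> ('n, 'a) matr" where
  "cm C \<equiv> matr_const A C"

lemma matsI: "(\<And>i j. U i j \<in> carrier A) \<Longrightarrow> U \<in> mats"
  by (simp add: matr_module_simps)

lemma matsD [simp, intro]: "U \<in> mats \<Longrightarrow> U i j \<in> carrier A"
  by (simp add: matr_module_simps)

lemma mats_closed [simp]:
  "U \<in> mats \<Longrightarrow> V \<in> mats \<Longrightarrow> U \<star> V \<in> mats"
  "U \<in> mats \<Longrightarrow> V \<in> mats \<Longrightarrow> matr_add A U V \<in> mats"
  "U \<in> mats \<Longrightarrow> V \<in> mats \<Longrightarrow> matr_minus A U V \<in> mats"
  "U \<in> mats \<Longrightarrow> matr_transpose U \<in> mats"
  "cm C \<in> mats"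
  by (auto simp: matr_mult_def matr_add_def matr_minus_def matr_transpose_def matr_const_def
    intro!: matsI finsum_closed)

lemma matr_mult_assoc:
  assumes "U \<in> mats" "V \<in> mats" "W \<in> mats"
  shows "(U \<star> V) \<star> W = U \<star> (V \<star> W)"
proof (intro ext)
  fix i j
  have "((U \<star> V) \<star> W) i j = (\<Oplus>k\<in>UNIV. \<Oplus>l\<in>UNIV. U i l \<otimes> V l k \<otimes> W k j)"
    using assms by (simp add: matr_mult_def finsum_ldistr)
  also have "\<dots> = (\<Oplus>l\<in>UNIV. \<Oplus>k\<in>UNIV. U i l \<otimes> V l k \<otimes> W k j)"
    using assms by (intro finsum_swap) auto
  also have "\<dots> = (U \<star> (V \<star> W)) i j"
    using assms by (simp add: matr_mult_def finsum_rdistr m_assoc)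
  finally show "((U \<star> V) \<star> W) i j = (U \<star> (V \<star> W)) i j" .
qed

lemma cm_mult_entry: "U \<in> mats \<Longrightarrow> (cm C \<star> U) i j = (\<Oplus>k\<in>UNIV. (C $ i $ k) \<odot> U k j)"
  unfolding matr_mult_def matr_const_def
  by (intro finsum_cong') (auto simp: smult_mult_left)

lemma mult_cm_entry: "U \<in> mats \<Longrightarrow> (U \<star> cm C) i j = (\<Oplus>k\<in>UNIV. (C $ k $ j) \<odot> U i k)"
  unfolding matr_mult_def matr_const_def
  by (intro finsum_cong') (auto simp: smult_mult_right)

lemma cm_mult_cm: "cm C \<star> cm D = cm (C ** D)"
proof (intro ext)
  fix i j
  have "(cm C \<star> cm D) i j = (\<Oplus>k\<in>UNIV. (C $ i $ k * D $ k $ j) \<odot> \<one>)"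
    unfolding cm_mult_entry[OF mats_closed(5)] by (simp add: matr_const_def smult_smult)
  then show "(cm C \<star> cm D) i j = cm (C ** D) i j"
    by (simp add: matr_const_def matrix_matrix_mult_def smult_sum_left)
qed

lemma cm_mult_cm_mult: "U \<in> mats \<Longrightarrow> cm C \<star> (cm D \<star> U) = cm (C ** D) \<star> U"
  by (simp add: matr_mult_assoc[symmetric] cm_mult_cm)

lemma cm_1_mult: "U \<in> mats \<Longrightarrow> cm (mat 1) \<star> U = U"
proof (intro ext)
  fix i j assume U: "U \<in> mats"
  have "(cm (mat 1) \<star> U) i j = (\<Oplus>k\<in>UNIV. if i = k then U k j else \<zero>)"
    unfolding cm_mult_entry[OF U] using U by (intro finsum_cong') (auto simp: mat_def smult_one)
  then show "(cm (mat 1) \<star> U) i j = U i j"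
    using U finsum_delta(2)[of UNIV i "\<lambda>k. U k j"] by simp
qed

lemma mult_cm_1: "U \<in> mats \<Longrightarrow> U \<star> cm (mat 1) = U"
proof (intro ext)
  fix i j assume U: "U \<in> mats"
  have "(U \<star> cm (mat 1)) i j = (\<Oplus>k\<in>UNIV. if k = j then U i k else \<zero>)"
    unfolding mult_cm_entry[OF U] using U by (intro finsum_cong') (auto simp: mat_def smult_one)
  then show "(U \<star> cm (mat 1)) i j = U i j"
    using U finsum_delta(1)[of UNIV j "\<lambda>k. U i k"] by simp
qed

lemma matr_transpose_transpose [simp]: "matr_transpose (matr_transpose U) = U"
  by (simp add: matr_transpose_def)

lemma matr_transpose_cm [simp]: "matr_transpose (cm C) = cm (transpose C)"
  by (simp add: matr_transpose_def matr_const_def transpose_def)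

lemma matr_transpose_cm_mult: "U \<in> mats \<Longrightarrow> matr_transpose (cm C \<star> U) = matr_transpose U \<star> cm (transpose C)"
proof (intro ext)
  fix i j assume U: "U \<in> mats"
  then have "matr_transpose U \<in> mats" by simp
  from mult_cm_entry[OF this] cm_mult_entry[OF U]
  show "matr_transpose (cm C \<star> U) i j = (matr_transpose U \<star> cm (transpose C)) i j"
    by (simp add: matr_transpose_def transpose_def)
qed

lemma matr_transpose_mult_cm: "U \<in> mats \<Longrightarrow> matr_transpose (U \<star> cm C) = cm (transpose C) \<star> matr_transpose U"
  using matr_transpose_cm_mult[of "matr_transpose U" "transpose C"]
  by (metis mats_closed(4) matr_transpose_transpose transpose_transpose)

lemma matr_add_mult:
  "U \<in> mats \<Longrightarrow> V \<in> mats \<Longrightarrow> W \<in> mats \<Longrightarrow> matr_add A U V \<star> W = matr_add A (U \<star> W) (V \<star> W)"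
  "U \<in> mats \<Longrightarrow> V \<in> mats \<Longrightarrow> W \<in> mats \<Longrightarrow> W \<star> matr_add A U V = matr_add A (W \<star> U) (W \<star> V)"
  by (auto simp: matr_add_def matr_mult_def l_distr r_distr intro!: ext finsum_addf)

lemma smult_eq_matr:
  "U \<in> mats \<Longrightarrow> V \<in> mats \<Longrightarrow> a \<in> carrier A \<Longrightarrow>
    U \<star> (a \<odot>\<^bsub>matr_module A\<^esub> V) = a \<odot>\<^bsub>matr_module A\<^esub> (U \<star> V)"
  by (auto simp: matr_module_simps matr_mult_def finsum_ldistr m_assoc intro!: ext finsum_cong')

lemma matr_transpose_smult:
  "matr_transpose (a \<odot>\<^bsub>matr_module A\<^esub> V) = a \<odot>\<^bsub>matr_module A\<^esub> matr_transpose V"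
  by (simp add: matr_module_simps matr_transpose_def)

end

lemma alg_hom_matr_mult:
  assumes "f \<in> alg_hom A B" "complex_algebra A" "complex_algebra B"
    "U \<in> carrier (matr_module A)" "V \<in> carrier (matr_module A)"
  shows "f (matr_mult A U V i j) = matr_mult B (\<lambda>i j. f (U i j)) (\<lambda>i j. f (V i j)) i j"
proof -
  interpret A: complex_algebra A by fact
  interpret B: complex_algebra B by fact
  have "f (matr_mult A U V i j) = finsum B (\<lambda>k. f (U i k \<otimes>\<^bsub>A\<^esub> V k j)) UNIV"
    unfolding matr_mult_def using assms by (intro alg_hom_finsum) auto
  also have "\<dots> = matr_mult B (\<lambda>i j. f (U i j)) (\<lambda>i j. f (V i j)) i j"
    unfolding matr_mult_def using assms by (intro B.finsum_cong') (auto simp: alg_homD[OF assms(1)])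
  finally show ?thesis .
qed

lemma alg_hom_matr_const:
  assumes "f \<in> alg_hom A B" "complex_algebra A"
  shows "f (matr_const A C i j) = matr_const B C i j"
proof -
  interpret A: complex_algebra A by fact
  show ?thesis by (simp add: matr_const_def alg_homD[OF assms(1)])
qed

section \<open>The algebras B(E), CZ2 and A(E): generators, homomorphisms out of them,
  counits\<close>

section \<open>The defining relations\<close>

text \<open>The product \<open>S(x) x\<close>, and with \<open>B_right\<close> the product
  \<open>x S(x)\<close>, for a matrix over any algebra. The relations can then be tested in every
  target of a homomorphism: complex numbers, operators, triangular algebras and their
  quotients.\<close>

definition B_left :: "(complex, 'a) module \<Rightarrow> complex^'n^'n \<Rightarrow> ('n::finite, 'a) matr \<Rightarrow> ('n, 'a) matr" where
  "B_left A E x = matr_mult A (matr_mult A (matr_mult A (matr_const A (matrix_inv E)) (matr_transpose x))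
     (matr_const A E)) x"

definition B_right :: "(complex, 'a) module \<Rightarrow> complex^'n^'n \<Rightarrow> ('n::finite, 'a) matr \<Rightarrow> ('n, 'a) matr" where
  "B_right A E x = matr_mult A (matr_mult A (matr_mult A x (matr_const A (matrix_inv E))) (matr_transpose x))
     (matr_const A E)"

definition B_rel :: "(complex, 'a) module \<Rightarrow> complex^'n^'n \<Rightarrow> ('n::finite, 'a) matr \<Rightarrow> bool" where
  "B_rel A E x \<longleftrightarrow> x \<in> carrier (matr_module A) \<and>
     B_left A E x = matr_const A (mat 1) \<and> B_right A E x = matr_const A (mat 1)"

lemma alg_hom_B_left_right:
  fixes E :: "complex^'n::finite^'n"
  assumes f: "f \<in> alg_hom A B" and A: "complex_algebra A" and B: "complex_algebra B"
    and x: "x \<in> carrier (matr_module A)"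
  shows "f (B_left A E x i j) = B_left B E (\<lambda>i j. f (x i j)) i j"
    and "f (B_right A E x i j) = B_right B E (\<lambda>i j. f (x i j)) i j"
proof -
  interpret A: complex_algebra A by fact
  have t: "(\<lambda>i j. f (matr_transpose x i j)) = matr_transpose (\<lambda>i j. f (x i j))"
    by (simp add: matr_transpose_def)
  have c: "(\<lambda>i j. f (matr_const A C i j)) = matr_const B C" for C :: "complex^'n^'n"
    by (simp add: alg_hom_matr_const[OF f A])
  show "f (B_left A E x i j) = B_left B E (\<lambda>i j. f (x i j)) i j"
    "f (B_right A E x i j) = B_right B E (\<lambda>i j. f (x i j)) i j"
    using x by (simp_all add: B_left_def B_right_def alg_hom_matr_mult[OF f A B] t c)
qed

lemma alg_hom_B_rel:
  assumes f: "f \<in> alg_hom A B" and A: "complex_algebra A" and B: "complex_algebra B"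
    and x: "B_rel A E x"
  shows "B_rel B E (\<lambda>i j. f (x i j))"
proof -
  interpret A: complex_algebra A by fact
  have x': "x \<in> carrier (matr_module A)" using x by (simp add: B_rel_def)
  have "f (B_left A E x i j) = f (matr_const A (mat 1) i j)"
    "f (B_right A E x i j) = f (matr_const A (mat 1) i j)" for i j
    using x by (simp_all add: B_rel_def)
  then have "B_left B E (\<lambda>i j. f (x i j)) i j = matr_const B (mat 1) i j"
    "B_right B E (\<lambda>i j. f (x i j)) i j = matr_const B (mat 1) i j" for i j
    by (simp_all only: alg_hom_B_left_right[OF f A B x'] alg_hom_matr_const[OF f A])
  moreover have "(\<lambda>i j. f (x i j)) \<in> carrier (matr_module B)"
    using x' by (simp add: matr_module_simps alg_homD[OF f])
  ultimately show ?thesis unfolding B_rel_def by blast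
qed

text \<open>This is what makes the counit of B(E) exist.\<close>

lemma (in complex_algebra) B_rel_1:
  assumes "E ** matrix_inv E = mat 1" "matrix_inv E ** E = mat 1"
  shows "B_rel A E (cm (mat 1))"
  using assms by (simp add: B_rel_def B_left_def B_right_def transpose_mat cm_mult_cm)

section \<open>The algebra B(E)\<close>

lemma complex_algebra_B_cover: "complex_algebra B_cover"
  unfolding B_cover_def by (rule complex_algebra_free_alg)

lemma B_cover_gen: "(\<lambda>i j. free_gen (i, j)) \<in> carrier (matr_module B_cover)"
  by (simp add: matr_module_simps B_cover_def free_gen_closed)

lemma B_relations_eq:
  "B_relations E = {B_left B_cover E (\<lambda>i j. free_gen (i, j)) i j \<ominus>\<^bsub>B_cover\<^esub> matr_const B_cover (mat 1) i j |i j. True} \<union>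
    {B_right B_cover E (\<lambda>i j. free_gen (i, j)) i j \<ominus>\<^bsub>B_cover\<^esub> matr_const B_cover (mat 1) i j |i j. True}"
  by (simp add: B_relations_def Let_def B_left_def B_right_def matr_minus_def)

lemma B_left_right_cover:
  "B_left B_cover E (\<lambda>i j. free_gen (i, j)) \<in> carrier (matr_module B_cover)"
  "B_right B_cover E (\<lambda>i j. free_gen (i, j)) \<in> carrier (matr_module B_cover)"
proof -
  interpret complex_algebra B_cover by (rule complex_algebra_B_cover)
  show "B_left B_cover E (\<lambda>i j. free_gen (i, j)) \<in> mats"
    "B_right B_cover E (\<lambda>i j. free_gen (i, j)) \<in> mats"
    unfolding B_left_def B_right_def by (simp_all add: B_cover_gen)
qed

lemma B_relations_closed: "B_relations E \<subseteq> carrier B_cover"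
proof -
  interpret complex_algebra B_cover by (rule complex_algebra_B_cover)
  have "B_left B_cover E (\<lambda>i j. free_gen (i, j)) i j \<in> carrier B_cover"
    "B_right B_cover E (\<lambda>i j. free_gen (i, j)) i j \<in> carrier B_cover"
    "matr_const B_cover (mat 1) i j \<in> carrier B_cover" for i j
    using B_left_right_cover[of E] mats_closed(5) by (blast intro: matsD)+
  then show ?thesis
    unfolding B_relations_eq by auto
qed

lemma B_ideal: "ideal (B_ideal E) B_cover"
proof -
  interpret complex_algebra B_cover by (rule complex_algebra_B_cover)
  show ?thesis unfolding B_ideal_def by (rule genideal_ideal[OF B_relations_closed])
qed

lemma complex_algebra_B_alg: "complex_algebra (B_alg E)"
  unfolding B_alg_def by (rule complex_algebra_quot[OF complex_algebra_B_cover B_ideal])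

lemma qmap_B_hom: "qmap B_cover (B_ideal E) \<in> alg_hom B_cover (B_alg E)"
  unfolding B_alg_def by (rule qmap_hom[OF complex_algebra_B_cover B_ideal])

lemma B_gen_closed: "B_gen E i j \<in> carrier (B_alg E)"
  unfolding B_gen_def
  by (intro alg_homD(1)[OF qmap_B_hom]) (simp add: B_cover_def free_gen_closed)

lemma B_rel_B_gen: "B_rel (B_alg E) E (B_gen E)"
proof -
  interpret C: complex_algebra B_cover by (rule complex_algebra_B_cover)
  interpret complex_algebra "B_alg E" by (rule complex_algebra_B_alg)
  have eq: "qmap B_cover (B_ideal E) a = qmap B_cover (B_ideal E) b"
    if "a \<in> carrier B_cover" "b \<in> carrier B_cover" "a \<ominus>\<^bsub>B_cover\<^esub> b \<in> B_relations E" for a b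
    using that C.genideal_self[OF B_relations_closed[of E]]
    by (subst qmap_eq_iff[OF complex_algebra_B_cover B_ideal]) (auto simp: B_ideal_def)
  note closed = C.matsD[OF B_left_right_cover(1)[of E]] C.matsD[OF B_left_right_cover(2)[of E]]
    C.matsD[OF C.mats_closed(5)]
  have "qmap B_cover (B_ideal E) (B_left B_cover E (\<lambda>i j. free_gen (i, j)) i j) =
      qmap B_cover (B_ideal E) (matr_const B_cover (mat 1) i j)"
    "qmap B_cover (B_ideal E) (B_right B_cover E (\<lambda>i j. free_gen (i, j)) i j) =
      qmap B_cover (B_ideal E) (matr_const B_cover (mat 1) i j)" for i j
    unfolding atomize_conj by (intro conjI eq closed) (auto simp: B_relations_eq)
  then have "B_left (B_alg E) E (B_gen E) i j = cm (mat 1) i j"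
    "B_right (B_alg E) E (B_gen E) i j = cm (mat 1) i j" for i j
    unfolding B_gen_def
    by (simp_all only: alg_hom_B_left_right[OF qmap_B_hom complex_algebra_B_cover complex_algebra_B_alg B_cover_gen]
        alg_hom_matr_const[OF qmap_B_hom complex_algebra_B_cover])
  then show ?thesis unfolding B_rel_def by (intro conjI HOL.ext matsI B_gen_closed)
qed

lemma generates_B_alg: "generates (B_alg E) {B_gen E i j |i j. True}"
proof -
  have "generates (B_alg E) (qmap B_cover (B_ideal E) ` free_gen ` UNIV)"
  proof (rule generates_image[OF _ qmap_B_hom _ complex_algebra_B_cover])
    show "generates B_cover (free_gen ` UNIV)"
      unfolding B_cover_def by (rule generates_free_alg)
    show "qmap B_cover (B_ideal E) ` carrier B_cover = carrier (B_alg E)"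
      unfolding B_alg_def by (simp add: quot_alg_simps[OF complex_algebra_B_cover B_ideal])
  qed (auto simp: B_cover_def free_gen_closed)
  then show ?thesis by (rule generates_mono) (auto simp: B_gen_def)
qed

lemma B_alg_lift:
  assumes R: "complex_algebra R" and y: "B_rel R E y"
  shows "\<exists>h\<in>alg_hom (B_alg E) R. \<forall>i j. h (B_gen E i j) = y i j"
proof -
  interpret C: complex_algebra B_cover by (rule complex_algebra_B_cover)
  interpret R: complex_algebra R by (rule R)
  have y': "y \<in> R.mats" using y by (simp add: B_rel_def)
  then have "case_prod y \<in> UNIV \<rightarrow> carrier R" by auto
  from free_alg_lift[OF R this] obtain k where k: "k \<in> alg_hom B_cover R"
    "\<forall>s. k (free_gen s) = case_prod y s" unfolding B_cover_def by blast
  have ky: "(\<lambda>i j. k (free_gen (i, j))) = y" using k(2) by simp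
  note closed = C.matsD[OF B_left_right_cover(1)[of E]] C.matsD[OF B_left_right_cover(2)[of E]]
    C.matsD[OF C.mats_closed(5)]
  note hom = alg_hom_B_left_right[OF k(1) complex_algebra_B_cover R B_cover_gen, unfolded ky]
    alg_hom_matr_const[OF k(1) complex_algebra_B_cover]
  have "k (B_left B_cover E (\<lambda>i j. free_gen (i, j)) i j \<ominus>\<^bsub>B_cover\<^esub> matr_const B_cover (mat 1) i j) = \<zero>\<^bsub>R\<^esub>"
    "k (B_right B_cover E (\<lambda>i j. free_gen (i, j)) i j \<ominus>\<^bsub>B_cover\<^esub> matr_const B_cover (mat 1) i j) = \<zero>\<^bsub>R\<^esub>" for i j
    using y closed
    by (simp_all add: alg_hom_minus[OF k(1) complex_algebra_B_cover R] hom B_rel_def)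
  then have kill: "k r = \<zero>\<^bsub>R\<^esub>" if "r \<in> B_relations E" for r
    using that unfolding B_relations_eq by blast
  obtain h where "h \<in> alg_hom (B_alg E) R" "\<forall>a\<in>carrier B_cover. h (qmap B_cover (B_ideal E) a) = k a"
    using genideal_quot_alg_lift[OF complex_algebra_B_cover B_relations_closed R k(1) kill]
    unfolding B_alg_def B_ideal_def by blast
  then show ?thesis
    using k(2) by (intro bexI[of _ h]) (auto simp: B_gen_def B_cover_def free_gen_closed)
qed

section \<open>The group algebra of order two\<close>

lemma monoid_Z2: "Group.monoid (integer_mod_group 2)"
  using group_integer_mod_group[of 2] by (simp add: group_def)

lemma carrier_Z2: "carrier (integer_mod_group 2) = {0, 1}"
  by (auto simp: carrier_integer_mod_group)

lemma complex_algebra_Z2: "complex_algebra Z2_alg"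
  unfolding Z2_alg_def by (rule complex_algebra_monoid_alg[OF monoid_Z2])

lemma Z2_gen_closed: "Z2_gen \<in> carrier Z2_alg"
  by (auto simp: Z2_alg_def Z2_gen_def carrier_Z2 intro!: span_words_closed)

lemma Z2_gen_square: "Z2_gen \<otimes>\<^bsub>Z2_alg\<^esub> Z2_gen = \<one>\<^bsub>Z2_alg\<^esub>"
  by (simp add: Z2_alg_def Z2_gen_def monoid_alg_mult)

lemma generates_Z2: "generates Z2_alg {Z2_gen}"
  unfolding generates_def
proof (intro allI impI)
  fix S assume S: "subalgebra_of S Z2_alg \<and> {Z2_gen} \<subseteq> S"
  then have "\<one>\<^bsub>Z2_alg\<^esub> \<in> S" unfolding subalgebra_of_def by blast
  then have "(\<lambda>u. Poly_Mapping.single u 1) ` carrier (integer_mod_group 2) \<subseteq> S"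
    using S by (auto simp: carrier_Z2 Z2_alg_def Z2_gen_def)
  then show "carrier Z2_alg \<subseteq> S"
    using S generates_monoid_alg[OF monoid_Z2] unfolding generates_def Z2_alg_def by blast
qed

lemma Z2_alg_lift:
  assumes R: "complex_algebra R" and h: "h \<in> carrier R" "h \<otimes>\<^bsub>R\<^esub> h = \<one>\<^bsub>R\<^esub>"
  shows "\<exists>k\<in>alg_hom Z2_alg R. k Z2_gen = h"
proof -
  interpret complex_algebra R by (rule R)
  define \<phi> where "\<phi> u = (if u = 0 then \<one>\<^bsub>R\<^esub> else h)" for u :: int
  have c: "\<phi> \<in> carrier (integer_mod_group 2) \<rightarrow> carrier R" using h by (auto simp: \<phi>_def)
  have "lext R \<phi> \<in> alg_hom Z2_alg R"
    unfolding Z2_alg_def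
    by (rule monoid_alg_lift[OF monoid_Z2 c]) (use h in \<open>auto simp: carrier_Z2 \<phi>_def\<close>)
  moreover have "lext R \<phi> Z2_gen = h"
    using lext_single[OF c, of 1 1] h by (simp add: Z2_gen_def carrier_Z2 \<phi>_def smult_one)
  ultimately show ?thesis by blast
qed

section \<open>The algebra A(E)\<close>

lemma complex_algebra_A_alg: "complex_algebra (A_alg E)"
  unfolding A_alg_def by (rule complex_algebra_free_prod[OF complex_algebra_B_alg complex_algebra_Z2])

lemma inl_hom: "free_prod_inl (B_alg E) Z2_alg \<in> alg_hom (B_alg E) (A_alg E)"
  unfolding A_alg_def by (rule free_prod_inl_hom[OF complex_algebra_B_alg complex_algebra_Z2])

lemma inr_hom: "Z2_to_A E \<in> alg_hom Z2_alg (A_alg E)"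
  unfolding A_alg_def Z2_to_A_def by (rule free_prod_inr_hom[OF complex_algebra_B_alg complex_algebra_Z2])

lemma B_rel_A_x: "B_rel (A_alg E) E (A_x E)"
  using alg_hom_B_rel[OF inl_hom complex_algebra_B_alg complex_algebra_A_alg B_rel_B_gen]
  by (simp add: A_x_def[abs_def])

lemma A_x_closed: "A_x E \<in> carrier (matr_module (A_alg E))"
  using B_rel_A_x[of E] by (simp add: B_rel_def)

lemma A_g_closed: "A_g E \<in> carrier (A_alg E)"
  by (simp add: A_g_def alg_homD[OF inr_hom] Z2_gen_closed)

lemma A_g_square: "A_g E \<otimes>\<^bsub>A_alg E\<^esub> A_g E = \<one>\<^bsub>A_alg E\<^esub>"
  unfolding A_g_def
  by (simp add: alg_homD(3)[OF inr_hom, symmetric] Z2_gen_closed Z2_gen_square alg_homD(4)[OF inr_hom])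

lemma generates_A_alg: "generates (A_alg E) (insert (A_g E) {A_x E i j |i j. True})"
  using generates_free_prod[OF complex_algebra_B_alg complex_algebra_Z2 generates_B_alg[of E] generates_Z2]
  unfolding A_alg_def[symmetric]
  by (rule generates_mono) (auto simp: B_gen_closed Z2_gen_closed A_x_def A_g_def Z2_to_A_def)

lemma A_alg_induct [consumes 1, case_names gen_x gen_g one add mult smult]:
  assumes "a \<in> carrier (A_alg E)" "\<And>i j. P (A_x E i j)" "P (A_g E)" "P \<one>\<^bsub>A_alg E\<^esub>"
    and "\<And>a b. a \<in> carrier (A_alg E) \<Longrightarrow> b \<in> carrier (A_alg E) \<Longrightarrow> P a \<Longrightarrow> P b \<Longrightarrow> P (a \<oplus>\<^bsub>A_alg E\<^esub> b)"
    and "\<And>a b. a \<in> carrier (A_alg E) \<Longrightarrow> b \<in> carrier (A_alg E) \<Longrightarrow> P a \<Longrightarrow> P b \<Longrightarrow> P (a \<otimes>\<^bsub>A_alg E\<^esub> b)"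
    and "\<And>c a. a \<in> carrier (A_alg E) \<Longrightarrow> P a \<Longrightarrow> P (c \<odot>\<^bsub>A_alg E\<^esub> a)"
  shows "P a"
proof -
  interpret complex_algebra "A_alg E" by (rule complex_algebra_A_alg)
  have "subalgebra_of {a \<in> carrier (A_alg E). P a} (A_alg E)"
    using assms(4-) by (auto simp: subalgebra_of_def)
  moreover have "insert (A_g E) {A_x E i j |i j. True} \<subseteq> {a \<in> carrier (A_alg E). P a}"
    using assms(2,3) A_g_closed[of E] matsD[OF A_x_closed[of E]] by auto
  ultimately show ?thesis using generatesD[OF generates_A_alg _ _ assms(1)] by blast
qed

lemma A_alg_lift:
  assumes R: "complex_algebra R" and y: "B_rel R E y" and h: "h \<in> carrier R" "h \<otimes>\<^bsub>R\<^esub> h = \<one>\<^bsub>R\<^esub>"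
  shows "\<exists>k\<in>alg_hom (A_alg E) R. (\<forall>i j. k (A_x E i j) = y i j) \<and> k (A_g E) = h"
proof -
  obtain kB where kB: "kB \<in> alg_hom (B_alg E) R" "\<forall>i j. kB (B_gen E i j) = y i j"
    using B_alg_lift[OF R y] by blast
  obtain kZ where kZ: "kZ \<in> alg_hom Z2_alg R" "kZ Z2_gen = h"
    using Z2_alg_lift[OF R h] by blast
  obtain k where "k \<in> alg_hom (A_alg E) R" "\<forall>a\<in>carrier (B_alg E). k (free_prod_inl (B_alg E) Z2_alg a) = kB a"
    "\<forall>b\<in>carrier Z2_alg. k (free_prod_inr (B_alg E) Z2_alg b) = kZ b"
    using free_prod_lift[OF complex_algebra_B_alg complex_algebra_Z2 R kB(1) kZ(1)]
    unfolding A_alg_def by blast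
  then show ?thesis
    using kB(2) kZ(2) by (intro bexI[of _ k]) (auto simp: A_x_def A_g_def Z2_to_A_def B_gen_closed Z2_gen_closed)
qed

section \<open>The counit\<close>

lemma complex_algebra_complex_alg: "complex_algebra complex_alg"
  by (rule complex_algebraI)
    (auto simp: complex_alg_def algebra_simps intro!: ringI abelian_groupI monoidI exI[of _ "- x" for x])

lemma restrict_alg_hom: "complex_algebra A \<Longrightarrow> f \<in> alg_hom A B \<Longrightarrow> restrict f (carrier A) \<in> alg_hom A B"
  unfolding complex_algebra_def complex_algebra_axioms_def
  by (rule alg_homI) (auto simp: alg_homD ring.ring_simprules)

text \<open>Generators determine a homomorphism on the carrier and extensionality determines it
  elsewhere, so the description is unique; the restriction of \<open>f\<close> shows that it is
  satisfied. All three counits are obtained this way.\<close>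

lemma the_alg_hom:
  assumes A: "complex_algebra A" and gen: "generates A G" "G \<subseteq> carrier A"
    and f: "f \<in> alg_hom A B" and P: "\<And>h. P h \<longleftrightarrow> (\<forall>a\<in>G. h a = f a)"
  shows "(THE h. h \<in> alg_hom A B \<and> h \<in> extensional (carrier A) \<and> P h) \<in> alg_hom A B"
    and "P (THE h. h \<in> alg_hom A B \<and> h \<in> extensional (carrier A) \<and> P h)"
proof -
  have "\<exists>!h. h \<in> alg_hom A B \<and> h \<in> extensional (carrier A) \<and> P h"
  proof (rule ex1I[of _ "restrict f (carrier A)"])
    show "restrict f (carrier A) \<in> alg_hom A B \<and> restrict f (carrier A) \<in> extensional (carrier A) \<and>
        P (restrict f (carrier A))"
      using restrict_alg_hom[OF A f] gen(2) by (auto simp: P)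
    fix h assume h: "h \<in> alg_hom A B \<and> h \<in> extensional (carrier A) \<and> P h"
    then have "h a = f a" if "a \<in> carrier A" for a
      using alg_hom_eqI[OF gen(1) A _ f _ gen(2) that] by (auto simp: P)
    then show "h = restrict f (carrier A)"
      using h by (intro extensionalityI[of h "carrier A"]) auto
  qed
  from theI'[OF this] show "(THE h. h \<in> alg_hom A B \<and> h \<in> extensional (carrier A) \<and> P h) \<in> alg_hom A B"
    "P (THE h. h \<in> alg_hom A B \<and> h \<in> extensional (carrier A) \<and> P h)" by blast+
qed

context
  fixes E :: "complex^'n::finite^'n"
  assumes E: "E ** matrix_inv E = mat 1" "matrix_inv E ** E = mat 1"
begin

lemma B_counit: "B_counit E \<in> alg_hom (B_alg E) complex_alg"
  "B_counit E (B_gen E i j) = (if i = j then 1 else 0)"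
proof -
  interpret complex_algebra complex_alg by (rule complex_algebra_complex_alg)
  obtain f where f: "f \<in> alg_hom (B_alg E) complex_alg"
    "\<forall>i j. f (B_gen E i j) = matr_const complex_alg (mat 1) i j"
    using B_alg_lift[OF complex_algebra_complex_alg B_rel_1[OF E]] by blast
  have f2: "f (B_gen E i j) = (if i = j then 1 else 0)" for i j
    using f(2) by (simp add: matr_const_def complex_alg_def mat_def)
  have sub: "{B_gen E i j |i j. True} \<subseteq> carrier (B_alg E)" using B_gen_closed by blast
  have P: "(\<forall>i j. h (B_gen E i j) = (if i = j then 1 else 0)) \<longleftrightarrow>
      (\<forall>a\<in>{B_gen E i j |i j. True}. h a = f a)" for h
    unfolding f2[symmetric] by blast
  note * = the_alg_hom[OF complex_algebra_B_alg generates_B_alg sub f(1) P]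
  show "B_counit E \<in> alg_hom (B_alg E) complex_alg" unfolding B_counit_def by (rule *(1))
  show "B_counit E (B_gen E i j) = (if i = j then 1 else 0)"
    using *(2) unfolding B_counit_def by blast
qed

lemma Z2_counit: "Z2_counit \<in> alg_hom Z2_alg complex_alg" "Z2_counit Z2_gen = 1"
proof -
  obtain f where f: "f \<in> alg_hom Z2_alg complex_alg" "f Z2_gen = 1"
    using Z2_alg_lift[OF complex_algebra_complex_alg, of 1] by (auto simp: complex_alg_def)
  have P: "h Z2_gen = 1 \<longleftrightarrow> (\<forall>a\<in>{Z2_gen}. h a = f a)" for h
    by (simp add: f)
  note * = the_alg_hom[OF complex_algebra_Z2 generates_Z2 _ f(1) P]
  show "Z2_counit \<in> alg_hom Z2_alg complex_alg" "Z2_counit Z2_gen = 1"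
    unfolding Z2_counit_def using * Z2_gen_closed by auto
qed

lemma A_counit: "A_counit E \<in> alg_hom (A_alg E) complex_alg"
  "A_counit E (A_x E i j) = (if i = j then 1 else 0)" "A_counit E (A_g E) = 1"
proof -
  obtain f where f: "f \<in> alg_hom (A_alg E) complex_alg"
    "\<forall>a\<in>carrier (B_alg E). f (free_prod_inl (B_alg E) Z2_alg a) = B_counit E a"
    "\<forall>b\<in>carrier Z2_alg. f (free_prod_inr (B_alg E) Z2_alg b) = Z2_counit b"
    using free_prod_lift[OF complex_algebra_B_alg complex_algebra_Z2 complex_algebra_complex_alg
        B_counit(1) Z2_counit(1)] unfolding A_alg_def by blast
  \<comment> \<open>The definition of \<open>A_counit\<close> prescribes its restrictions to both
    factors, so the generating set consists of their full images and not just of the entries of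
    \<open>x\<close> and \<open>g\<close>.\<close>
  define G where "G = free_prod_inl (B_alg E) Z2_alg ` carrier (B_alg E) \<union>
    free_prod_inr (B_alg E) Z2_alg ` carrier Z2_alg"
  have gen: "generates (A_alg E) G"
    unfolding G_def A_alg_def by (rule generates_free_prod_carriers[OF complex_algebra_B_alg complex_algebra_Z2])
  have sub: "G \<subseteq> carrier (A_alg E)"
    unfolding G_def using alg_homD(1)[OF inl_hom] alg_homD(1)[OF inr_hom] by (auto simp: Z2_to_A_def)
  have P: "((\<forall>b\<in>carrier (B_alg E). h (free_prod_inl (B_alg E) Z2_alg b) = B_counit E b) \<and>
        (\<forall>z\<in>carrier Z2_alg. h (free_prod_inr (B_alg E) Z2_alg z) = Z2_counit z)) \<longleftrightarrow>
      (\<forall>a\<in>G. h a = f a)" for h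
    using f(2,3) by (auto simp: G_def)
  note * = the_alg_hom[OF complex_algebra_A_alg gen sub f(1) P]
  show "A_counit E \<in> alg_hom (A_alg E) complex_alg" unfolding A_counit_def by (rule *(1))
  show "A_counit E (A_x E i j) = (if i = j then 1 else 0)" "A_counit E (A_g E) = 1"
    using *(2) unfolding A_counit_def[symmetric]
    by (auto simp: A_x_def A_g_def Z2_to_A_def B_gen_closed Z2_gen_closed B_counit Z2_counit)
qed

end

section \<open>A basis of A(E) and the twisted equation in A(E)\<close>

section \<open>Normal forms in A(E)\<close>

context rewriting begin

text \<open>
  The endomorphism algebra of the space of normal forms, realised by operators on all words that
  are unchanged by composition with the projection \<open>NF\<close>; hence \<open>NF\<close> is the unit.
\<close>

definition NF_end :: "(complex, 'n wvec \<Rightarrow> 'n wvec) module" where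
  "NF_end = \<lparr>carrier = {T. lin T \<and> (\<forall>v. NF (T v) = T v \<and> T (NF v) = T v)},
     monoid.mult = (\<lambda>S T v. S (T v)), monoid.one = NF, ring.zero = (\<lambda>_. 0),
     ring.add = (\<lambda>S T v. S v + T v), smult = (\<lambda>c T v. scal c (T v))\<rparr>"

lemma NF_end_simps:
  "T \<in> carrier NF_end \<longleftrightarrow> lin T \<and> (\<forall>v. NF (T v) = T v \<and> T (NF v) = T v)"
  "S \<otimes>\<^bsub>NF_end\<^esub> T = (\<lambda>v. S (T v))" "\<one>\<^bsub>NF_end\<^esub> = NF" "\<zero>\<^bsub>NF_end\<^esub> = (\<lambda>_. 0)"
  "S \<oplus>\<^bsub>NF_end\<^esub> T = (\<lambda>v. S v + T v)" "c \<odot>\<^bsub>NF_end\<^esub> T = (\<lambda>v. scal c (T v))"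
  by (simp_all add: NF_end_def)

lemma NF_NF: "NF (NF v) = NF v"
  by (rule NF_id[OF NF_in_NV])

lemma complex_algebra_NF_end: "complex_algebra NF_end"
proof (rule complex_algebraI)
  show "ring NF_end"
  proof (rule ringI)
    show "abelian_group NF_end"
    proof (rule abelian_groupI)
      fix T assume "T \<in> carrier NF_end"
      then show "\<exists>S\<in>carrier NF_end. S \<oplus>\<^bsub>NF_end\<^esub> T = \<zero>\<^bsub>NF_end\<^esub>"
        by (intro bexI[of _ "\<lambda>v. - T v"]) (auto simp: NF_end_simps lin_def ext_rules)
    qed (auto simp: NF_end_simps lin_def ext_rules scal_add algebra_simps)
    show "Group.monoid NF_end"
      by (rule monoidI) (auto simp: NF_end_simps lin_comp NF_NF)
  qed (auto simp: NF_end_simps lin_def)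
qed (auto simp: NF_end_simps lin_def ext_rules scal_add scal_add_left mult.commute)

lemma lf_in_NF_end: "lf t \<in> carrier NF_end"
  by (simp add: NF_end_simps NF_lf lf_NF)

lemma NF_end_finsum:
  assumes "T \<in> I \<rightarrow> carrier NF_end"
  shows "finsum NF_end T I v = (\<Sum>i\<in>I. T i v)"
proof -
  interpret complex_algebra NF_end by (rule complex_algebra_NF_end)
  show ?thesis using assms
  proof (induction I rule: infinite_finite_induct)
    case (insert i I)
    then show ?case by (simp add: Pi_def) (simp add: NF_end_simps)
  qed (simp_all add: NF_end_simps)
qed

lemma NF_end_matr_mult:
  assumes "U \<in> carrier (matr_module NF_end)" "V \<in> carrier (matr_module NF_end)"
  shows "matr_mult NF_end U V i j v = (\<Sum>k\<in>UNIV. U i k (V k j v))"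
proof -
  interpret complex_algebra NF_end by (rule complex_algebra_NF_end)
  have "(\<lambda>k. U i k \<otimes>\<^bsub>NF_end\<^esub> V k j) \<in> UNIV \<rightarrow> carrier NF_end" using assms by simp
  from NF_end_finsum[OF this] show ?thesis by (simp add: matr_mult_def NF_end_simps(2))
qed

lemma NF_end_cm_mult:
  assumes U: "U \<in> carrier (matr_module NF_end)"
  shows "matr_mult NF_end (matr_const NF_end C) U i j v = (\<Sum>k\<in>UNIV. scal (C $ i $ k) (U k j v))"
proof -
  interpret complex_algebra NF_end by (rule complex_algebra_NF_end)
  have "(\<lambda>k. (C $ i $ k) \<odot>\<^bsub>NF_end\<^esub> U k j) \<in> UNIV \<rightarrow> carrier NF_end" using U by simp
  from NF_end_finsum[OF this] show ?thesis by (simp add: cm_mult_entry[OF U] NF_end_simps(6))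
qed

lemma L_matr_in_mats: "L \<in> carrier (matr_module NF_end)"
  by (simp add: matr_module_simps lf_in_NF_end)

end

context complex_algebra begin

lemma matr_mult_entry_apply:
  "(U \<star> V) i j = (\<Oplus>k\<in>UNIV. U i k \<otimes> V k j)"
  by (simp add: matr_mult_def)

end

locale congruence_form = normal_form E "matrix_inv E" P Pi Q Qi r0 r1 c0 c1
  for E P Pi Q Qi :: "complex^'n::finite^'n" and r0 r1 c0 c1
begin

text \<open>The relations of the rewriting system for a matrix over any algebra. They are needed in
  two places: for the generators of A(E), and for the operators \<open>L\<close> on normal
  words.\<close>

definition yrel :: "(complex, 'a) module \<Rightarrow> ('n, 'a) matr \<Rightarrow> bool" where
  "yrel A y \<longleftrightarrow> y \<in> carrier (matr_module A) \<and>
    matr_mult A (matr_transpose y) (matr_mult A (matr_const A E') y) = matr_const A F \<and>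
    matr_mult A y (matr_mult A (matr_const A f) (matr_transpose y)) = matr_const A e"

definition xy :: "(complex, 'a) module \<Rightarrow> ('n, 'a) matr \<Rightarrow> ('n, 'a) matr" where
  "xy A y = matr_mult A (matr_const A P) (matr_mult A y (matr_const A Q))"

definition yx :: "(complex, 'a) module \<Rightarrow> ('n, 'a) matr \<Rightarrow> ('n, 'a) matr" where
  "yx A x = matr_mult A (matr_const A Pi) (matr_mult A x (matr_const A Qi))"

lemma yrel_imp_B_rel:
  assumes A: "complex_algebra A" and y: "yrel A y"
  shows "B_rel A E (xy A y)"
proof -
  interpret complex_algebra A by (rule A)
  note [simp] = cm_mult_cm cm_mult_cm_mult matr_mult_assoc matr_transpose_mult_cm matr_transpose_cm_mult
  have ym [simp]: "y \<in> mats" using y by (simp add: yrel_def)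
  have row: "matr_transpose y \<star> (cm E' \<star> (y \<star> Z)) = cm F \<star> Z" if Z: "Z \<in> mats" for Z
  proof -
    have "matr_transpose y \<star> (cm E' \<star> y) \<star> Z = cm F \<star> Z" using y by (simp add: yrel_def)
    then show ?thesis using Z by simp
  qed
  have col: "y \<star> (cm f \<star> (matr_transpose y \<star> Z)) = cm e \<star> Z" if Z: "Z \<in> mats" for Z
  proof -
    have "y \<star> (cm f \<star> matr_transpose y) \<star> Z = cm e \<star> Z" using y by (simp add: yrel_def)
    then show ?thesis using Z by simp
  qed
  have "B_left A E (xy A y) = cm (matrix_inv E ** transpose Q) \<star>
      (matr_transpose y \<star> (cm E' \<star> (y \<star> cm Q)))"
    by (simp add: B_left_def xy_def E'_def matrix_mul_assoc)
  also have "\<dots> = cm (mat 1)"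
    by (simp add: row) (simp add: F_def mat_simps)
  finally have 1: "B_left A E (xy A y) = cm (mat 1)" .
  have "B_right A E (xy A y) = cm P \<star> (y \<star> (cm f \<star> (matr_transpose y \<star> cm (transpose P ** E))))"
    by (simp add: B_right_def xy_def f_def matrix_mul_assoc)
  also have "\<dots> = cm (mat 1)"
    by (simp add: col) (simp add: e_def mat_simps)
  finally show ?thesis using 1 by (simp add: B_rel_def) (simp add: xy_def)
qed

lemma B_rel_imp_yrel:
  assumes A: "complex_algebra A" and x: "B_rel A E x"
  shows "yrel A (yx A x)"
proof -
  interpret complex_algebra A by (rule A)
  note [simp] = cm_mult_cm cm_mult_cm_mult matr_mult_assoc matr_transpose_mult_cm matr_transpose_cm_mult
  have xm [simp]: "x \<in> mats" using x by (simp add: B_rel_def)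
  \<comment> \<open>Multiplying the defining relations by E and by its inverse brings them to the
    symmetric form \<open>x^t E x = E\<close>, \<open>x E^-1 x^t = E^-1\<close>.\<close>
  have "cm E \<star> B_left A E x = cm E \<star> cm (mat 1)" "B_right A E x \<star> cm (matrix_inv E) = cm (mat 1) \<star> cm (matrix_inv E)"
    using x by (simp_all only: B_rel_def)
  then have 1: "matr_transpose x \<star> (cm E \<star> x) = cm E"
    "x \<star> (cm (matrix_inv E) \<star> matr_transpose x) = cm (matrix_inv E)"
    by (simp_all add: B_left_def B_right_def mat_simps cm_1_mult mult_cm_1)
  have row: "matr_transpose x \<star> (cm E \<star> (x \<star> Z)) = cm E \<star> Z" if Z: "Z \<in> mats" for Z
  proof -
    have "matr_transpose x \<star> (cm E \<star> x) \<star> Z = cm E \<star> Z" by (simp only: 1)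
    then show ?thesis using Z by simp
  qed
  have col: "x \<star> (cm (matrix_inv E) \<star> (matr_transpose x \<star> Z)) = cm (matrix_inv E) \<star> Z"
    if Z: "Z \<in> mats" for Z
  proof -
    have "x \<star> (cm (matrix_inv E) \<star> matr_transpose x) \<star> Z = cm (matrix_inv E) \<star> Z" by (simp only: 1)
    then show ?thesis using Z by simp
  qed
  have "matr_transpose (yx A x) \<star> (cm E' \<star> yx A x) =
      cm (transpose Qi) \<star> (matr_transpose x \<star> (cm E \<star> (x \<star> cm Qi)))"
    by (simp add: yx_def E'_def mat_simps)
  also have "\<dots> = cm F" by (simp add: row F_def mat_simps)
  finally have 2: "matr_transpose (yx A x) \<star> (cm E' \<star> yx A x) = cm F" .
  have "yx A x \<star> (cm f \<star> matr_transpose (yx A x)) =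
      cm Pi \<star> (x \<star> (cm (matrix_inv E) \<star> (matr_transpose x \<star> cm (transpose Pi))))"
    by (simp add: yx_def f_def mat_simps)
  also have "\<dots> = cm e" by (simp add: col e_def mat_simps)
  finally show ?thesis using 2 by (simp add: yrel_def) (simp add: yx_def)
qed

lemma xy_yx:
  assumes A: "complex_algebra A" and x: "x \<in> carrier (matr_module A)"
  shows "xy A (yx A x) = x" "yx A (xy A x) = x"
proof -
  interpret complex_algebra A by (rule A)
  show "xy A (yx A x) = x" "yx A (xy A x) = x" using x
    by (simp_all add: xy_def yx_def cm_mult_cm cm_mult_cm_mult matr_mult_assoc mat_simps cm_1_mult mult_cm_1)
qed

lemma alg_hom_yx:
  assumes \<phi>: "\<phi> \<in> alg_hom A B" and A: "complex_algebra A" and B: "complex_algebra B"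
    and x: "x \<in> carrier (matr_module A)"
  shows "\<phi> (yx A x i j) = yx B (\<lambda>i j. \<phi> (x i j)) i j"
proof -
  interpret A: complex_algebra A by (rule A)
  have c: "(\<lambda>i j. \<phi> (matr_const A C i j)) = matr_const B C" for C :: "complex^'n^'n"
    by (simp add: alg_hom_matr_const[OF \<phi> A])
  show ?thesis using x by (simp add: yx_def alg_hom_matr_mult[OF \<phi> A B] c)
qed

end

text \<open>The algebra is a parameter tied to \<open>A_alg E\<close> by an equation, so that the
  structure notation of \<open>complex_algebra\<close> applies to it.\<close>

locale A_algebra = complex_algebra A
  for A :: "(complex, 'n::finite A_elem) module" (structure) +
  fixes E :: "complex^'n^'n"
  assumes A_eq: "A = A_alg E"
begin

abbreviation x :: "('n, 'n A_elem) matr" where "x \<equiv> A_x E"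

lemma B_rel_x: "B_rel A E x"
  unfolding A_eq by (rule B_rel_A_x)

lemma x_mats [simp]: "x \<in> mats"
  using B_rel_x by (simp add: B_rel_def)

abbreviation g :: "'n A_elem" where "g \<equiv> A_g E"

lemma g_closed [simp]: "g \<in> carrier A"
  unfolding A_eq by (rule A_g_closed)

lemma g_square: "g \<otimes> g = \<one>"
  unfolding A_eq by (rule A_g_square)

end

locale A_normal_form = congruence_form E P Pi Q Qi r0 r1 c0 c1 + A_algebra A E
  for E P Pi Q Qi :: "complex^'n::finite^'n" and r0 r1 c0 c1
    and A :: "(complex, 'n A_elem) module" (structure)
begin

definition y :: "('n, 'n A_elem) matr" where "y = yx A x"

lemma yrel_y: "yrel A y"
  unfolding y_def by (rule B_rel_imp_yrel[OF complex_algebra_axioms B_rel_x])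

lemma y_mats [simp]: "y \<in> mats"
  using yrel_y by (simp add: yrel_def)

lemma x_eq: "x = xy A y"
  unfolding y_def using xy_yx(1)[OF complex_algebra_axioms x_mats] by simp

lemma subalgebra_finsum:
  assumes "subalgebra_of S A" "\<And>i. i \<in> I \<Longrightarrow> h i \<in> S"
  shows "(\<Oplus>i\<in>I. h i) \<in> S"
proof -
  have S: "S \<subseteq> carrier A" "\<one> \<in> S" "\<And>a b. a \<in> S \<Longrightarrow> b \<in> S \<Longrightarrow> a \<oplus> b \<in> S" "\<And>c a. a \<in> S \<Longrightarrow> c \<odot> a \<in> S"
    using assms(1) by (auto simp: subalgebra_of_def)
  have z: "\<zero> \<in> S" using S(4)[OF S(2), of 0] by simp
  show ?thesis using assms(2)
  proof (induction I rule: infinite_finite_induct)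
    case (insert i I)
    moreover have "h \<in> insert i I \<rightarrow> carrier A" using insert.prems S(1) by auto
    ultimately show ?case using S(3) by (auto simp: Pi_def)
  qed (simp_all add: z)
qed

lemma generates_y: "generates A (insert g {y i j |i j. True})"
  unfolding generates_def
proof (intro allI impI)
  fix S assume S: "subalgebra_of S A \<and> insert g {y i j |i j. True} \<subseteq> S"
  have "x i j \<in> S" for i j
  proof -
    have "x i j = (\<Oplus>k\<in>UNIV. (P $ i $ k) \<odot> (\<Oplus>l\<in>UNIV. (Q $ l $ j) \<odot> y k l))"
      by (subst x_eq) (simp add: xy_def cm_mult_entry mult_cm_entry)
    also have "\<dots> \<in> S"
    proof -
      have sm: "c \<odot> a \<in> S" if "a \<in> S" for c a using S that by (auto simp: subalgebra_of_def)
      have yS: "y k l \<in> S" for k l using S by blast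
      show ?thesis using S by (intro subalgebra_finsum sm yS) auto
    qed
    finally show ?thesis .
  qed
  then have "insert g {x i j |i j. True} \<subseteq> S" using S by blast
  then show "carrier A \<subseteq> S"
    using conjunct1[OF S] generates_A_alg[of E, folded A_eq, unfolded generates_def] by blast
qed

text \<open>The representation of A(E) on normal words. \<open>A_alg_lift\<close> asserts existence
  only, hence the choice.\<close>

definition \<rho> :: "'n A_elem \<Rightarrow> 'n wvec \<Rightarrow> 'n wvec" where
  "\<rho> = (SOME \<rho>. \<rho> \<in> alg_hom A NF_end \<and> (\<forall>i j. \<rho> (y i j) = L i j) \<and> \<rho> g = lf None)"

lemma yrel_L: "yrel NF_end L"
proof -
  interpret N: complex_algebra NF_end by (rule complex_algebra_NF_end)
  have LT: "matr_transpose L \<in> N.mats" by (simp add: L_matr_in_mats)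
  have "matr_mult NF_end (matr_transpose L) (matr_mult NF_end (N.cm E') L) i j v = N.cm F i j v" for i j v
  proof -
    have "matr_mult NF_end (matr_transpose L) (matr_mult NF_end (N.cm E') L) i j v = Row i j v"
      unfolding NF_end_matr_mult[OF LT N.mats_closed(1)[OF N.mats_closed(5) L_matr_in_mats]]
        NF_end_cm_mult[OF L_matr_in_mats] Row_def
      by (simp add: matr_transpose_def lf_rules)
    \<comment> \<open>\<open>Row_eq\<close> is available for normal vectors only; since
      \<open>lf\<close> absorbs \<open>NF\<close>, the operator identity holds on all
      vectors.\<close>
    also have "\<dots> = Row i j (NF v)" by (simp add: Row_def lf_NF)
    also have "\<dots> = N.cm F i j v" by (simp add: Row_eq NF_in_NV matr_const_def NF_end_simps)
    finally show ?thesis .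
  qed
  moreover have "matr_mult NF_end L (matr_mult NF_end (N.cm f) (matr_transpose L)) i j v = N.cm e i j v" for i j v
  proof -
    have "matr_mult NF_end L (matr_mult NF_end (N.cm f) (matr_transpose L)) i j v = Col i j v"
      unfolding NF_end_matr_mult[OF L_matr_in_mats N.mats_closed(1)[OF N.mats_closed(5) LT]]
        NF_end_cm_mult[OF LT] Col_def
      by (simp add: matr_transpose_def lf_rules)
    also have "\<dots> = Col i j (NF v)" by (simp add: Col_def lf_NF)
    also have "\<dots> = N.cm e i j v" by (simp add: Col_eq NF_in_NV matr_const_def NF_end_simps)
    finally show ?thesis .
  qed
  ultimately show ?thesis unfolding yrel_def by (intro conjI HOL.ext L_matr_in_mats) blast+
qed

lemma \<rho>: "\<rho> \<in> alg_hom A NF_end" "\<rho> (y i j) = L i j" "\<rho> g = lf None"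
proof -
  obtain k where k: "k \<in> alg_hom A NF_end" "\<forall>i j. k (x i j) = xy NF_end L i j" "k g = lf None"
    using A_alg_lift[of _ E, folded A_eq, OF complex_algebra_NF_end yrel_imp_B_rel[OF complex_algebra_NF_end yrel_L]
        lf_in_NF_end[of None]] by (auto simp: NF_end_simps lf_None_None)
  have "k (y i j) = L i j" for i j
  proof -
    have "k (y i j) = yx NF_end (xy NF_end L) i j"
      unfolding y_def using k(2)
      by (simp add: alg_hom_yx[OF k(1) complex_algebra_axioms complex_algebra_NF_end x_mats])
    then show ?thesis by (simp add: xy_yx(2)[OF complex_algebra_NF_end L_matr_in_mats])
  qed
  then have "\<exists>\<rho>. \<rho> \<in> alg_hom A NF_end \<and> (\<forall>i j. \<rho> (y i j) = L i j) \<and> \<rho> g = lf None"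
    using k by blast
  from someI_ex[OF this] show "\<rho> \<in> alg_hom A NF_end" "\<rho> (y i j) = L i j" "\<rho> g = lf None"
    unfolding \<rho>_def[symmetric] by blast+
qed

text \<open>Coordinates of an element in the basis of normal words: it acts on the empty word. The
  inverse map \<open>\<eta>\<close> evaluates words in the algebra.\<close>

definition \<theta> :: "'n A_elem \<Rightarrow> 'n wvec" where
  "\<theta> a = \<rho> a (sgl [])"

lemma \<rho>_NF: "a \<in> carrier A \<Longrightarrow> NF (\<rho> a v) = \<rho> a v" "a \<in> carrier A \<Longrightarrow> lin (\<rho> a)"
  using alg_homD(1)[OF \<rho>(1), of a] by (simp_all add: NF_end_simps)

lemma \<theta>_NV: "a \<in> carrier A \<Longrightarrow> \<theta> a \<in> NV"
  unfolding \<theta>_def using \<rho>_NF(1) NF_in_NV by metis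

lemma \<theta>_simps:
  "a \<in> carrier A \<Longrightarrow> b \<in> carrier A \<Longrightarrow> \<theta> (a \<oplus> b) = \<theta> a + \<theta> b"
  "a \<in> carrier A \<Longrightarrow> \<theta> (c \<odot> a) = scal c (\<theta> a)"
  "a \<in> carrier A \<Longrightarrow> b \<in> carrier A \<Longrightarrow> \<theta> (a \<otimes> b) = \<rho> a (\<theta> b)"
  "\<theta> \<zero> = 0" "\<theta> \<one> = sgl []"
  using alg_hom_zero[OF \<rho>(1) complex_algebra_axioms complex_algebra_NF_end] nf_irred[of "[]"]
  by (simp_all add: \<theta>_def alg_homD[OF \<rho>(1)] NF_end_simps)

lemma \<theta>_minus: "a \<in> carrier A \<Longrightarrow> b \<in> carrier A \<Longrightarrow> \<theta> (a \<ominus> b) = \<theta> a - \<theta> b"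
  by (simp add: a_minus_def \<theta>_simps minus_eq_smult)

lemma \<theta>_finsum: "h \<in> I \<rightarrow> carrier A \<Longrightarrow> \<theta> (\<Oplus>i\<in>I. h i) = (\<Sum>i\<in>I. \<theta> (h i))"
  by (induction I rule: infinite_finite_induct) (auto simp: \<theta>_simps Pi_def)

definition letter :: "('n \<times> 'n) option \<Rightarrow> 'n A_elem" where
  "letter t = (case t of None \<Rightarrow> g | Some (i, j) \<Rightarrow> y i j)"

definition \<omega> :: "'n word \<Rightarrow> 'n A_elem" where
  "\<omega> w = foldr (\<lambda>t a. letter t \<otimes> a) w \<one>"

lemma letter_closed [simp]: "letter t \<in> carrier A"
  by (auto simp: letter_def g_closed split: option.splits)

lemma \<omega>_simps [simp]: "\<omega> [] = \<one>" "\<omega> (t # w) = letter t \<otimes> \<omega> w"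
  by (simp_all add: \<omega>_def)

lemma \<omega>_closed [simp]: "\<omega> w \<in> carrier A"
  by (induction w) auto

lemma \<omega>_append: "\<omega> (v @ w) = \<omega> v \<otimes> \<omega> w"
  by (induction v) (simp_all add: m_assoc)

lemma \<rho>_letter: "\<rho> (letter t) = lf t"
  by (auto simp: letter_def \<rho> split: option.splits)

definition \<eta> :: "'n wvec \<Rightarrow> 'n A_elem" where
  "\<eta> = lext A \<omega>"

lemma \<omega>_Pi: "\<omega> \<in> UNIV \<rightarrow> carrier A"
  by simp

lemma in_span_UNIV: "v \<in> span_words UNIV"
  by (simp add: span_words_def)

lemma \<eta>_closed [simp]: "\<eta> v \<in> carrier A"
  unfolding \<eta>_def by (rule lext_closed[OF \<omega>_Pi in_span_UNIV])

lemma \<eta>_simps: "\<eta> (u + v) = \<eta> u \<oplus> \<eta> v" "\<eta> (scal c v) = c \<odot> \<eta> v" "\<eta> 0 = \<zero>"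
  "\<eta> (Poly_Mapping.single w c) = c \<odot> \<omega> w"
  unfolding \<eta>_def
  using lext_add[OF \<omega>_Pi in_span_UNIV in_span_UNIV] lext_scal[OF \<omega>_Pi in_span_UNIV]
    lext_single[OF \<omega>_Pi UNIV_I] lext_0[OF \<omega>_Pi] by auto

lemma \<eta>_diff: "\<eta> (u - v) = \<eta> u \<ominus> \<eta> v"
proof -
  have "\<eta> (u - v) = \<eta> (u + scal (- 1) v)" by simp
  then show ?thesis unfolding \<eta>_simps by (simp add: a_minus_def minus_eq_smult)
qed

lemma \<eta>_sum: "\<eta> (\<Sum>i\<in>I. h i) = (\<Oplus>i\<in>I. \<eta> (h i))"
  by (induction I rule: infinite_finite_induct) (auto simp: \<eta>_simps)

lemma \<eta>_ext: "\<eta> (ext \<psi> v) = lext A (\<lambda>w. \<eta> (\<psi> w)) v"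
  unfolding \<eta>_def by (rule lext_ext[OF \<omega>_Pi in_span_UNIV in_span_UNIV])

lemma letter_rel_row:
  "letter (Some (r0, j)) \<otimes> letter (Some (r1, l)) =
    (F $ j $ l) \<odot> \<one> \<ominus> (\<Oplus>p\<in>UNIV - {r0}. \<Oplus>q\<in>UNIV. (E' $ p $ q) \<odot> (y p j \<otimes> y q l))"
proof -
  have row_r0: "(\<Oplus>q\<in>UNIV. (E' $ r0 $ q) \<odot> (y r0 j \<otimes> y q l)) = y r0 j \<otimes> y r1 l"
  proof -
    have "(\<Oplus>q\<in>UNIV. (E' $ r0 $ q) \<odot> (y r0 j \<otimes> y q l)) = (\<Oplus>q\<in>UNIV. if q = r1 then y r0 j \<otimes> y q l else \<zero>)"
      by (intro finsum_cong') (auto simp: E_r0 smult_one)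
    then show ?thesis using finsum_delta(1)[of UNIV r1 "\<lambda>q. y r0 j \<otimes> y q l"] by simp
  qed
  have "(F $ j $ l) \<odot> \<one> = (matr_transpose y \<star> (cm E' \<star> y)) j l"
    using yrel_y by (simp add: yrel_def matr_const_def)
  also have "\<dots> = (\<Oplus>p\<in>UNIV. \<Oplus>q\<in>UNIV. (E' $ p $ q) \<odot> (y p j \<otimes> y q l))"
    unfolding matr_mult_entry_apply[of "matr_transpose y"] cm_mult_entry[OF y_mats]
    by (intro finsum_cong') (auto simp: matr_transpose_def finsum_rdistr smult_mult_right)
  also have "\<dots> = y r0 j \<otimes> y r1 l \<oplus> (\<Oplus>p\<in>UNIV - {r0}. \<Oplus>q\<in>UNIV. (E' $ p $ q) \<odot> (y p j \<otimes> y q l))"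
    using finsum_insert[of "UNIV - {r0}" r0 "\<lambda>p. \<Oplus>q\<in>UNIV. (E' $ p $ q) \<odot> (y p j \<otimes> y q l)"]
    by (simp add: row_r0 insert_UNIV insert_Diff_if)
  finally show ?thesis
    by (simp add: letter_def a_minus_def a_assoc r_neg)
qed

lemma letter_rel_col:
  "letter (Some (i, c0)) \<otimes> letter (Some (k, c1)) =
    (e $ i $ k) \<odot> \<one> \<ominus> (\<Oplus>p\<in>UNIV - {c0}. \<Oplus>q\<in>UNIV. (f $ p $ q) \<odot> (y i p \<otimes> y k q))"
proof -
  have col_c0: "(\<Oplus>q\<in>UNIV. (f $ c0 $ q) \<odot> (y i c0 \<otimes> y k q)) = y i c0 \<otimes> y k c1"
  proof -
    have "(\<Oplus>q\<in>UNIV. (f $ c0 $ q) \<odot> (y i c0 \<otimes> y k q)) = (\<Oplus>q\<in>UNIV. if q = c1 then y i c0 \<otimes> y k q else \<zero>)"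
      by (intro finsum_cong') (auto simp: f_c0 smult_one)
    then show ?thesis using finsum_delta(1)[of UNIV c1 "\<lambda>q. y i c0 \<otimes> y k q"] by simp
  qed
  have "(e $ i $ k) \<odot> \<one> = (y \<star> (cm f \<star> matr_transpose y)) i k"
    using yrel_y by (simp add: yrel_def matr_const_def)
  also have "\<dots> = (\<Oplus>p\<in>UNIV. \<Oplus>q\<in>UNIV. (f $ p $ q) \<odot> (y i p \<otimes> y k q))"
    unfolding matr_mult_entry_apply[of y] cm_mult_entry[OF mats_closed(4)[OF y_mats]]
    by (intro finsum_cong') (auto simp: matr_transpose_def finsum_rdistr smult_mult_right)
  also have "\<dots> = y i c0 \<otimes> y k c1 \<oplus> (\<Oplus>p\<in>UNIV - {c0}. \<Oplus>q\<in>UNIV. (f $ p $ q) \<odot> (y i p \<otimes> y k q))"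
    using finsum_insert[of "UNIV - {c0}" c0 "\<lambda>p. \<Oplus>q\<in>UNIV. (f $ p $ q) \<odot> (y i p \<otimes> y k q)"]
    by (simp add: col_c0 insert_UNIV insert_Diff_if)
  finally show ?thesis
    by (simp add: letter_def a_minus_def a_assoc r_neg)
qed

text \<open>Each rule is an identity in A(E), so evaluation is invariant under reduction.\<close>

lemma \<eta>_rhs: "rhs s t = Some h \<Longrightarrow> \<eta> h = letter s \<otimes> letter t"
proof (cases "(s, t)" rule: rhs.cases)
  case (1 i j k l)
  assume h: "rhs s t = Some h"
  have y2: "\<omega> [Some (i, j), Some (k, l)] = y i j \<otimes> y k l" for i j k l
    by (simp add: letter_def)
  show ?thesis
  proof (cases "i = r0 \<and> k = r1")
    case True
    then have "h = Poly_Mapping.single [] (F $ j $ l) -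
         (\<Sum>p\<in>UNIV - {r0}. \<Sum>q\<in>UNIV. Poly_Mapping.single [Some (p, j), Some (q, l)] (E' $ p $ q))"
      using h 1 by simp
    then have "\<eta> h = (F $ j $ l) \<odot> \<one> \<ominus> (\<Oplus>p\<in>UNIV - {r0}. \<Oplus>q\<in>UNIV. (E' $ p $ q) \<odot> (y p j \<otimes> y q l))"
      by (simp only: \<eta>_diff \<eta>_sum \<eta>_simps y2 \<omega>_simps(1))
    then show ?thesis using True 1 by (simp add: letter_rel_row)
  next
    case False
    then have jl: "j = c0 \<and> l = c1" and "h = Poly_Mapping.single [] (e $ i $ k) -
         (\<Sum>p\<in>UNIV - {c0}. \<Sum>q\<in>UNIV. Poly_Mapping.single [Some (i, p), Some (k, q)] (f $ p $ q))"
      using h 1 by (auto split: if_splits)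
    then have "\<eta> h = (e $ i $ k) \<odot> \<one> \<ominus> (\<Oplus>p\<in>UNIV - {c0}. \<Oplus>q\<in>UNIV. (f $ p $ q) \<odot> (y i p \<otimes> y k q))"
      by (simp only: \<eta>_diff \<eta>_sum \<eta>_simps y2 \<omega>_simps(1))
    then show ?thesis using jl 1 by (simp add: letter_rel_col)
  qed
next
  case 2
  assume "rhs s t = Some h"
  then have "h = sgl []" using 2 by simp
  then show ?thesis using 2 by (simp add: \<eta>_simps letter_def g_square smult_one)
qed auto

lemma \<eta>_redex: "redex w = Some p \<Longrightarrow> \<eta> p = \<omega> w"
proof (induction w arbitrary: p)
  case (Cons s w)
  show ?case
  proof (cases "redex w")
    case (Some q)
    then have p: "p = cons_word s q" using Cons.prems by simp
    have "\<eta> p = lext A (\<lambda>u. letter s \<otimes> \<omega> u) q"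
      unfolding p cons_word_def \<eta>_ext by (simp add: \<eta>_simps smult_one)
    also have "\<dots> = letter s \<otimes> \<eta> q"
      unfolding \<eta>_def by (rule lext_mult_left[OF in_span_UNIV \<omega>_Pi letter_closed])
    finally show ?thesis using Cons.IH[OF Some] by simp
  next
    case None
    then obtain t v h where w: "w = t # v" "rhs s t = Some h" "p = append_word h v"
      using Cons.prems by (auto split: list.splits)
    have "\<eta> p = lext A (\<lambda>u. \<omega> u \<otimes> \<omega> v) h"
      unfolding w(3) append_word_def \<eta>_ext by (simp add: \<eta>_simps smult_one \<omega>_append)
    also have "\<dots> = \<eta> h \<otimes> \<omega> v"
      unfolding \<eta>_def by (rule lext_mult_right[OF in_span_UNIV \<omega>_Pi \<omega>_closed])
    finally show ?thesis using w(1) by (simp add: \<eta>_rhs[OF w(2)] m_assoc)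
  qed
qed simp

lemma \<eta>_nf: "\<eta> (nf w) = \<omega> w"
proof (induction w rule: nf.induct)
  case (1 w)
  show ?case
  proof (cases "redex w")
    case None
    then show ?thesis by (simp add: nf_irred \<eta>_simps smult_one)
  next
    case (Some p)
    have "\<eta> (nf w) = lext A (\<lambda>u. \<eta> (nf u)) p" by (simp add: nf_redex Some \<eta>_ext)
    also have "\<dots> = \<eta> p"
      unfolding \<eta>_def using 1[OF Some]
      by (intro lext_cong[of p "Poly_Mapping.keys p"]) (auto simp: span_words_def \<eta>_def)
    finally show ?thesis by (simp add: \<eta>_redex[OF Some])
  qed
qed

lemma \<eta>_lf: "\<eta> (lf t v) = letter t \<otimes> \<eta> v"
proof -
  have "\<eta> (lf t v) = lext A (\<lambda>w. letter t \<otimes> \<omega> w) v"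
    unfolding lf_def \<eta>_ext by (simp add: \<eta>_nf)
  also have "\<dots> = letter t \<otimes> \<eta> v"
    unfolding \<eta>_def by (rule lext_mult_left[OF in_span_UNIV \<omega>_Pi letter_closed])
  finally show ?thesis .
qed

lemma \<eta>_NF: "\<eta> (NF v) = \<eta> v"
  unfolding \<eta>_ext \<eta>_nf by (simp add: \<eta>_def)

text \<open>True for letters and stable under the algebra operations. At the empty word it gives
  \<open>\<eta> (\<theta> a) = a\<close>, that is, the normal words span A(E).\<close>

lemma \<eta>_\<rho>:
  assumes "a \<in> carrier A"
  shows "\<eta> (\<rho> a v) = a \<otimes> \<eta> v"
proof -
  have "subalgebra_of {a \<in> carrier A. \<forall>v. \<eta> (\<rho> a v) = a \<otimes> \<eta> v} A"
    by (auto simp: subalgebra_of_def alg_homD[OF \<rho>(1)] NF_end_simps \<eta>_NF \<eta>_simps l_distr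
      smult_mult_left m_assoc)
  moreover have "insert g {y i j |i j. True} \<subseteq> {a \<in> carrier A. \<forall>v. \<eta> (\<rho> a v) = a \<otimes> \<eta> v}"
  proof -
    have "letter t \<in> {a \<in> carrier A. \<forall>v. \<eta> (\<rho> a v) = a \<otimes> \<eta> v}" for t
      by (simp add: \<rho>_letter \<eta>_lf)
    from this[of None] this[of "Some (i, j)" for i j] show ?thesis by (auto simp: letter_def)
  qed
  ultimately show ?thesis using generatesD[OF generates_y _ _ assms] by blast
qed

lemma \<eta>_\<theta>: "a \<in> carrier A \<Longrightarrow> \<eta> (\<theta> a) = a"
  by (simp add: \<theta>_def \<eta>_\<rho> \<eta>_simps smult_one)

lemma \<theta>_eq_iff: "a \<in> carrier A \<Longrightarrow> b \<in> carrier A \<Longrightarrow> \<theta> a = \<theta> b \<longleftrightarrow> a = b"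
  using \<eta>_\<theta> by metis

lemma \<theta>_\<omega>: "\<theta> (\<omega> w) = nf w"
  by (induction w) (simp_all add: \<theta>_simps nf_irred \<rho>_letter nf_Cons)

text \<open>The other half of the basis statement: the normal words are linearly independent in
  A(E).\<close>

lemma \<theta>_\<eta>:
  assumes "v \<in> NV"
  shows "\<theta> (\<eta> v) = v"
proof -
  have "\<theta> (\<eta> v) = NF v"
    unfolding \<eta>_def lext_def by (subst \<theta>_finsum) (auto simp: \<theta>_simps \<theta>_\<omega> ext_def)
  then show ?thesis using NF_id[OF assms] by simp
qed

text \<open>The matrix \<open>y f^t - e H\<close> over A(E); its right multiples have the vectors
  \<open>fund\<close> as coordinates.\<close>

definition fund_matr :: "('n, 'n A_elem) matr" where
  "fund_matr = matr_minus A (y \<star> cm (transpose f)) (cm (e ** H))"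

lemma fund_matr_mats [simp]: "fund_matr \<in> mats"
  by (simp add: fund_matr_def)

lemma \<theta>_fund_matr:
  assumes a: "a \<in> carrier A"
  shows "\<theta> (fund_matr i j \<otimes> a) = fund (\<theta> a) i j"
proof -
  have "(y \<star> cm (transpose f)) i j \<otimes> a = (\<Oplus>l\<in>UNIV. (f $ j $ l) \<odot> (y i l \<otimes> a))"
    using a by (simp add: mult_cm_entry transpose_def finsum_ldistr smult_mult_left)
  moreover have "\<theta> \<dots> = (\<Sum>l\<in>UNIV. scal (f $ j $ l) (L i l (\<theta> a)))"
    using a by (subst \<theta>_finsum) (auto simp: \<theta>_simps \<rho>)
  moreover have "cm (e ** H) i j \<otimes> a = (\<Sum>m\<in>UNIV. e $ i $ m * H $ m $ j) \<odot> a"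
    using a by (simp add: matr_const_def smult_mult_left matrix_matrix_mult_def)
  moreover have "fund_matr i j \<otimes> a = (y \<star> cm (transpose f)) i j \<otimes> a \<ominus> cm (e ** H) i j \<otimes> a"
    using a matsD[OF mats_closed(1)[OF y_mats mats_closed(5)]] matsD[OF mats_closed(5)]
    unfolding fund_matr_def matr_minus_def minus_eq by (subst l_distr) (auto simp: l_minus)
  moreover have "(\<Oplus>l\<in>UNIV. (f $ j $ l) \<odot> (y i l \<otimes> a)) \<in> carrier A"
    using a by (intro finsum_closed) auto
  ultimately show ?thesis
    using a by (simp only: \<theta>_minus smult_closed \<theta>_simps(2) fund_def)
qed

text \<open>In coordinates the hypothesis is \<open>twisted\<close>, whose solutions are known;
  \<open>\<eta>\<close> carries the parameter of the solution back to A(E).\<close>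

lemma kernel_twisted:
  assumes D: "D \<in> mats" and eq: "matr_add A D (y \<star> (matr_transpose D \<star> cm H)) = (\<lambda>i j. \<zero>)"
  shows "\<exists>a\<in>carrier A. D = (\<lambda>i j. fund_matr i j \<otimes> a)"
proof -
  have entry: "\<theta> ((y \<star> (matr_transpose D \<star> cm H)) i j) =
      (\<Sum>m\<in>UNIV. scal (H $ m $ j) (\<Sum>k\<in>UNIV. L i k (\<theta> (D m k))))" for i j
  proof -
    have "\<theta> ((y \<star> (matr_transpose D \<star> cm H)) i j) = \<theta> (\<Oplus>k\<in>UNIV. y i k \<otimes> (\<Oplus>m\<in>UNIV. (H $ m $ j) \<odot> D m k))"
      unfolding matr_mult_entry_apply[of y] mult_cm_entry[OF mats_closed(4)[OF D]]
      by (simp add: matr_transpose_def)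
    also have "\<dots> = (\<Sum>k\<in>UNIV. L i k (\<Sum>m\<in>UNIV. scal (H $ m $ j) (\<theta> (D m k))))"
    proof -
      have c: "(\<Oplus>m\<in>UNIV. (H $ m $ j) \<odot> D m k) \<in> carrier A" for k
        using D by (intro finsum_closed) auto
      have inner: "\<theta> (\<Oplus>m\<in>UNIV. (H $ m $ j) \<odot> D m k) = (\<Sum>m\<in>UNIV. scal (H $ m $ j) (\<theta> (D m k)))" for k
        using D by (subst \<theta>_finsum) (auto simp: \<theta>_simps(2))
      have "\<theta> (\<Oplus>k\<in>UNIV. y i k \<otimes> (\<Oplus>m\<in>UNIV. (H $ m $ j) \<odot> D m k)) =
          (\<Sum>k\<in>UNIV. \<theta> (y i k \<otimes> (\<Oplus>m\<in>UNIV. (H $ m $ j) \<odot> D m k)))"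
        by (rule \<theta>_finsum) (use c in simp)
      also have "\<dots> = (\<Sum>k\<in>UNIV. L i k (\<theta> (\<Oplus>m\<in>UNIV. (H $ m $ j) \<odot> D m k)))"
        by (intro sum.cong refl, subst \<theta>_simps(3)[OF matsD[OF y_mats] c], subst \<rho>(2)) (rule refl)
      finally show ?thesis unfolding inner .
    qed
    also have "\<dots> = (\<Sum>k\<in>UNIV. \<Sum>m\<in>UNIV. scal (H $ m $ j) (L i k (\<theta> (D m k))))"
      by (simp only: lf_rules)
    also have "\<dots> = (\<Sum>m\<in>UNIV. \<Sum>k\<in>UNIV. scal (H $ m $ j) (L i k (\<theta> (D m k))))"
      by (rule sum.swap)
    finally show ?thesis by (simp only: scal_sum)
  qed
  have "twisted (\<lambda>i j. \<theta> (D i j))"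
    unfolding twisted_def
  proof (intro conjI allI)
    show "\<theta> (D i j) \<in> NV" for i j using D by (simp add: \<theta>_NV)
    fix i j
    have "\<theta> (D i j) + \<theta> ((y \<star> (matr_transpose D \<star> cm H)) i j) = 0"
    proof -
      have "matr_transpose D \<star> cm H \<in> mats" using D by simp
      then have "(y \<star> (matr_transpose D \<star> cm H)) i j \<in> carrier A" by (intro matsD) simp
      moreover have "D i j \<oplus> (y \<star> (matr_transpose D \<star> cm H)) i j = \<zero>"
        using fun_cong[OF fun_cong[OF eq]] by (simp add: matr_add_def)
      ultimately show ?thesis
        using \<theta>_simps(1)[OF matsD[OF D, of i j], of "(y \<star> (matr_transpose D \<star> cm H)) i j"]
        by (simp add: \<theta>_simps(4))
    qed
    then show "\<theta> (D i j) = - (\<Sum>m\<in>UNIV. scal (H $ m $ j) (\<Sum>k\<in>UNIV. L i k (\<theta> (D m k))))"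
      unfolding entry by (simp add: eq_neg_iff_add_eq_0)
  qed
  then obtain v where v: "v \<in> NV" "\<And>i j. \<theta> (D i j) = fund v i j"
    using twisted_imp_fund by blast
  have "D i j = fund_matr i j \<otimes> \<eta> v" for i j
  proof -
    have "\<theta> (D i j) = \<theta> (fund_matr i j \<otimes> \<eta> v)"
      by (simp add: v \<theta>_fund_matr \<theta>_\<eta>)
    then show ?thesis by (subst (asm) \<theta>_eq_iff) (simp_all add: D)
  qed
  then show ?thesis using \<eta>_closed by blast
qed

lemma fund_matr_inj:
  assumes "a \<in> carrier A" "\<And>i j. fund_matr i j \<otimes> a = \<zero>"
  shows "a = \<zero>"
proof -
  have "fund (\<theta> a) i j = 0" for i j
    using \<theta>_fund_matr[OF assms(1), of i j] assms(2) by (simp add: \<theta>_simps)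
  then have "\<theta> a = 0" using fund_inj[OF \<theta>_NV[OF assms(1)]] by blast
  then show ?thesis using \<theta>_eq_iff[OF assms(1) zero_closed] by (simp add: \<theta>_simps)
qed

end

section \<open>Right modules, projectivity and the tensor product\<close>

section \<open>Right modules\<close>

lemma right_moduleI:
  assumes "ring R" "abelian_group M"
    and "\<And>r m. \<lbrakk>r \<in> carrier R; m \<in> carrier M\<rbrakk> \<Longrightarrow> r \<odot>\<^bsub>M\<^esub> m \<in> carrier M"
    and "\<And>r s m. \<lbrakk>r \<in> carrier R; s \<in> carrier R; m \<in> carrier M\<rbrakk> \<Longrightarrow>
          (r \<oplus>\<^bsub>R\<^esub> s) \<odot>\<^bsub>M\<^esub> m = r \<odot>\<^bsub>M\<^esub> m \<oplus>\<^bsub>M\<^esub> s \<odot>\<^bsub>M\<^esub> m"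
    and "\<And>r m m'. \<lbrakk>r \<in> carrier R; m \<in> carrier M; m' \<in> carrier M\<rbrakk> \<Longrightarrow>
          r \<odot>\<^bsub>M\<^esub> (m \<oplus>\<^bsub>M\<^esub> m') = r \<odot>\<^bsub>M\<^esub> m \<oplus>\<^bsub>M\<^esub> r \<odot>\<^bsub>M\<^esub> m'"
    and "\<And>r s m. \<lbrakk>r \<in> carrier R; s \<in> carrier R; m \<in> carrier M\<rbrakk> \<Longrightarrow>
          (r \<otimes>\<^bsub>R\<^esub> s) \<odot>\<^bsub>M\<^esub> m = s \<odot>\<^bsub>M\<^esub> (r \<odot>\<^bsub>M\<^esub> m)"
    and "\<And>m. m \<in> carrier M \<Longrightarrow> \<one>\<^bsub>R\<^esub> \<odot>\<^bsub>M\<^esub> m = m"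
  shows "right_module R M"
  using assms by (simp add: right_module_def right_module_axioms_def)

lemma right_module_homI:
  assumes "\<And>m. m \<in> carrier M \<Longrightarrow> f m \<in> carrier N"
    and "\<And>m m'. m \<in> carrier M \<Longrightarrow> m' \<in> carrier M \<Longrightarrow> f (m \<oplus>\<^bsub>M\<^esub> m') = f m \<oplus>\<^bsub>N\<^esub> f m'"
    and "\<And>r m. r \<in> carrier R \<Longrightarrow> m \<in> carrier M \<Longrightarrow> f (r \<odot>\<^bsub>M\<^esub> m) = r \<odot>\<^bsub>N\<^esub> f m"
  shows "f \<in> right_module_hom R M N"
  using assms by (auto simp: right_module_hom_def)

lemma right_module_homD:
  assumes "f \<in> right_module_hom R M N"
  shows "m \<in> carrier M \<Longrightarrow> f m \<in> carrier N"
    and "m \<in> carrier M \<Longrightarrow> m' \<in> carrier M \<Longrightarrow> f (m \<oplus>\<^bsub>M\<^esub> m') = f m \<oplus>\<^bsub>N\<^esub> f m'"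
    and "r \<in> carrier R \<Longrightarrow> m \<in> carrier M \<Longrightarrow> f (r \<odot>\<^bsub>M\<^esub> m) = r \<odot>\<^bsub>N\<^esub> f m"
  using assms by (auto simp: right_module_hom_def)

lemma right_module_hom_comp:
  "f \<in> right_module_hom R M N \<Longrightarrow> h \<in> right_module_hom R N K \<Longrightarrow> (\<lambda>m. h (f m)) \<in> right_module_hom R M K"
  by (rule right_module_homI) (simp_all add: right_module_homD)

context right_module begin

lemma rsmult_zero_ring: "m \<in> carrier M \<Longrightarrow> \<zero>\<^bsub>R\<^esub> \<odot>\<^bsub>M\<^esub> m = \<zero>\<^bsub>M\<^esub>"
proof -
  assume m: "m \<in> carrier M"
  then have "\<zero>\<^bsub>R\<^esub> \<odot>\<^bsub>M\<^esub> m \<oplus>\<^bsub>M\<^esub> \<zero>\<^bsub>R\<^esub> \<odot>\<^bsub>M\<^esub> m = \<zero>\<^bsub>R\<^esub> \<odot>\<^bsub>M\<^esub> m"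
    using rsmult_distr_ring[of "\<zero>\<^bsub>R\<^esub>" "\<zero>\<^bsub>R\<^esub>" m] by simp
  then show ?thesis using m rsmult_closed[of "\<zero>\<^bsub>R\<^esub>" m] by simp
qed

lemma rsmult_zero_module: "r \<in> carrier R \<Longrightarrow> r \<odot>\<^bsub>M\<^esub> \<zero>\<^bsub>M\<^esub> = \<zero>\<^bsub>M\<^esub>"
proof -
  assume r: "r \<in> carrier R"
  then have "r \<odot>\<^bsub>M\<^esub> \<zero>\<^bsub>M\<^esub> \<oplus>\<^bsub>M\<^esub> r \<odot>\<^bsub>M\<^esub> \<zero>\<^bsub>M\<^esub> = r \<odot>\<^bsub>M\<^esub> \<zero>\<^bsub>M\<^esub>"
    using rsmult_distr_module[of r "\<zero>\<^bsub>M\<^esub>" "\<zero>\<^bsub>M\<^esub>"] by simp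
  then show ?thesis using r rsmult_closed[of r "\<zero>\<^bsub>M\<^esub>"] by simp
qed

lemma rsmult_finsum_module:
  "r \<in> carrier R \<Longrightarrow> f \<in> I \<rightarrow> carrier M \<Longrightarrow> r \<odot>\<^bsub>M\<^esub> (finsum M f I) = finsum M (\<lambda>i. r \<odot>\<^bsub>M\<^esub> f i) I"
  by (induction I rule: infinite_finite_induct)
    (auto simp: rsmult_zero_module rsmult_distr_module rsmult_closed Pi_def)

end

lemma right_module_hom_zero:
  assumes "f \<in> right_module_hom R M N" "right_module R M" "right_module R N"
  shows "f \<zero>\<^bsub>M\<^esub> = \<zero>\<^bsub>N\<^esub>"
proof -
  interpret M: right_module R M by fact
  interpret N: right_module R N by fact
  have "f \<zero>\<^bsub>M\<^esub> \<oplus>\<^bsub>N\<^esub> f \<zero>\<^bsub>M\<^esub> = f \<zero>\<^bsub>M\<^esub>"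
    using right_module_homD(2)[OF assms(1), of "\<zero>\<^bsub>M\<^esub>" "\<zero>\<^bsub>M\<^esub>"] by simp
  then show ?thesis using right_module_homD(1)[OF assms(1), of "\<zero>\<^bsub>M\<^esub>"] by simp
qed

lemma right_module_hom_finsum:
  assumes "f \<in> right_module_hom R M N" "right_module R M" "right_module R N" "h \<in> I \<rightarrow> carrier M"
  shows "f (finsum M h I) = finsum N (\<lambda>i. f (h i)) I"
proof -
  interpret M: right_module R M by fact
  interpret N: right_module R N by fact
  show ?thesis using assms(4)
    by (induction I rule: infinite_finite_induct)
      (auto simp: right_module_homD[OF assms(1)] right_module_hom_zero[OF assms(1-3)] Pi_def)
qed

lemma right_module_image:
  assumes M: "right_module R M" and \<pi>: "\<pi> ` carrier M = carrier N"
    and \<pi>_add: "\<And>a b. a \<in> carrier M \<Longrightarrow> b \<in> carrier M \<Longrightarrow> \<pi> a \<oplus>\<^bsub>N\<^esub> \<pi> b = \<pi> (a \<oplus>\<^bsub>M\<^esub> b)"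
    and \<pi>_zero: "\<zero>\<^bsub>N\<^esub> = \<pi> \<zero>\<^bsub>M\<^esub>"
    and \<pi>_smult: "\<And>r a. r \<in> carrier R \<Longrightarrow> a \<in> carrier M \<Longrightarrow> r \<odot>\<^bsub>N\<^esub> \<pi> a = \<pi> (r \<odot>\<^bsub>M\<^esub> a)"
  shows "right_module R N"
proof -
  interpret right_module R M by fact
  have N: "carrier N = \<pi> ` carrier M" using \<pi> by simp
  show ?thesis
  proof (rule right_moduleI)
    show "ring R" by (rule R.ring_axioms)
    show "abelian_group N"
    proof (rule abelian_groupI)
      fix x assume "x \<in> carrier N"
      then obtain a where a: "a \<in> carrier M" "x = \<pi> a" unfolding N by blast
      then have "\<pi> (\<ominus>\<^bsub>M\<^esub> a) \<oplus>\<^bsub>N\<^esub> x = \<zero>\<^bsub>N\<^esub>" by (simp add: \<pi>_add \<pi>_zero M.l_neg)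
      then show "\<exists>y\<in>carrier N. y \<oplus>\<^bsub>N\<^esub> x = \<zero>\<^bsub>N\<^esub>" using a(1) unfolding N by blast
    qed (unfold N, auto simp: \<pi>_add \<pi>_zero M.a_ac)
  qed (unfold N, auto simp: \<pi>_add \<pi>_smult rsmult_closed rsmult_distr_ring rsmult_distr_module
      rsmult_assoc rsmult_one)
qed

lemma regular_module_simps [simp]:
  "carrier (regular_module A) = carrier A" "a \<oplus>\<^bsub>regular_module A\<^esub> b = a \<oplus>\<^bsub>A\<^esub> b"
  "\<zero>\<^bsub>regular_module A\<^esub> = \<zero>\<^bsub>A\<^esub>" "r \<odot>\<^bsub>regular_module A\<^esub> a = a \<otimes>\<^bsub>A\<^esub> r"
  by (simp_all add: regular_module_def)

lemma direct_sum_module_simps [simp]: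
  "carrier (direct_sum_module M N) = carrier M \<times> carrier N"
  "p \<oplus>\<^bsub>direct_sum_module M N\<^esub> q = (fst p \<oplus>\<^bsub>M\<^esub> fst q, snd p \<oplus>\<^bsub>N\<^esub> snd q)"
  "\<zero>\<^bsub>direct_sum_module M N\<^esub> = (\<zero>\<^bsub>M\<^esub>, \<zero>\<^bsub>N\<^esub>)"
  "r \<odot>\<^bsub>direct_sum_module M N\<^esub> p = (r \<odot>\<^bsub>M\<^esub> fst p, r \<odot>\<^bsub>N\<^esub> snd p)"
  by (simp_all add: direct_sum_module_def split: prod.splits)

lemma right_module_direct_sum:
  assumes "right_module R M" "right_module R N"
  shows "right_module R (direct_sum_module M N)"
proof -
  interpret M: right_module R M by fact
  interpret N: right_module R N by fact
  show ?thesis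
  proof (rule right_moduleI)
    show "abelian_group (direct_sum_module M N)"
    proof (rule abelian_groupI)
      fix p assume p: "p \<in> carrier (direct_sum_module M N)"
      then show "\<exists>q\<in>carrier (direct_sum_module M N). q \<oplus>\<^bsub>direct_sum_module M N\<^esub> p = \<zero>\<^bsub>direct_sum_module M N\<^esub>"
        by (intro bexI[of _ "(\<ominus>\<^bsub>M\<^esub> fst p, \<ominus>\<^bsub>N\<^esub> snd p)"]) (auto simp: M.M.l_neg N.M.l_neg)
    qed (auto simp: M.M.a_ac N.M.a_ac)
  qed (auto simp: M.R.ring_axioms M.rsmult_closed N.rsmult_closed M.rsmult_distr_ring N.rsmult_distr_ring
      M.rsmult_distr_module N.rsmult_distr_module M.rsmult_assoc N.rsmult_assoc M.rsmult_one N.rsmult_one)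
qed

context complex_algebra begin

lemma right_module_regular: "right_module A (regular_module A)"
proof (rule right_moduleI)
  show "abelian_group (regular_module A)"
    by (rule abelian_groupI) (simp_all add: a_ac add.l_inv_ex)
qed (auto simp: ring_axioms l_distr r_distr m_assoc)

lemma right_module_matr: "right_module A (matr_module A)"
proof (rule right_moduleI)
  show "abelian_group (matr_module A)"
  proof (rule abelian_groupI)
    fix U assume "U \<in> mats"
    then show "\<exists>V\<in>mats. V \<oplus>\<^bsub>matr_module A\<^esub> U = \<zero>\<^bsub>matr_module A\<^esub>"
      by (intro bexI[of _ "\<lambda>i j. \<ominus> U i j"]) (auto simp: matr_module_simps matr_add_def l_neg)
  qed (auto simp: matr_module_simps matr_add_def a_ac)
qed (auto simp: ring_axioms matr_module_simps matr_add_def l_distr r_distr m_assoc)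

lemma right_module_character:
  assumes "\<epsilon> \<in> alg_hom A complex_alg"
  shows "right_module A (character_module \<epsilon>)"
proof (rule right_moduleI)
  show "abelian_group (character_module \<epsilon>)"
    by (rule abelian_groupI)
      (auto simp: character_module_def algebra_simps intro!: exI[of _ "- x" for x])
qed (auto simp: ring_axioms character_module_def complex_alg_def algebra_simps alg_homD[OF assms])

end

section \<open>Projectivity\<close>

lemma projectiveI:
  assumes "right_module R P"
    and "\<And>(M :: ('r, 'm) module) (N :: ('r, 'k) module) e f. right_module R M \<Longrightarrow> right_module R N \<Longrightarrow>
        e \<in> right_module_hom R M N \<Longrightarrow> e ` carrier M = carrier N \<Longrightarrow> f \<in> right_module_hom R P N \<Longrightarrow>
        \<exists>h\<in>right_module_hom R P M. \<forall>p\<in>carrier P. e (h p) = f p"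
  shows "projective_right_module TYPE('m) TYPE('k) R P"
  using assms unfolding projective_right_module_def by blast

lemma projectiveD:
  fixes M :: "('r, 'm) module" and N :: "('r, 'k) module"
  assumes "projective_right_module TYPE('m) TYPE('k) R P" "right_module R M" "right_module R N"
    "e \<in> right_module_hom R M N" "e ` carrier M = carrier N" "f \<in> right_module_hom R P N"
  shows "\<exists>h\<in>right_module_hom R P M. \<forall>p\<in>carrier P. e (h p) = f p"
  using assms unfolding projective_right_module_def by blast

lemma projective_direct_sum:
  assumes P: "projective_right_module TYPE('m) TYPE('k) R P"
    and Q: "projective_right_module TYPE('m) TYPE('k) R Q"
  shows "projective_right_module TYPE('m) TYPE('k) R (direct_sum_module P Q)"
proof (rule projectiveI)
  have PQ: "right_module R P" "right_module R Q"
    using P Q by (auto simp: projective_right_module_def)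
  interpret P: right_module R P by fact
  interpret Q: right_module R Q by fact
  show "right_module R (direct_sum_module P Q)" by (rule right_module_direct_sum[OF PQ])
  fix M :: "('a, 'm) module" and N :: "('a, 'k) module" and e f
  assume M: "right_module R M" and N: "right_module R N" and e: "e \<in> right_module_hom R M N"
    and surj: "e ` carrier M = carrier N" and f: "f \<in> right_module_hom R (direct_sum_module P Q) N"
  interpret M: right_module R M by fact
  interpret N: right_module R N by fact
  have "(\<lambda>p. (p, \<zero>\<^bsub>Q\<^esub>)) \<in> right_module_hom R P (direct_sum_module P Q)"
    by (rule right_module_homI) (auto simp: Q.rsmult_zero_module)
  from right_module_hom_comp[OF this f] projectiveD[OF P M N e surj]
  obtain h1 where h1: "h1 \<in> right_module_hom R P M" "\<forall>p\<in>carrier P. e (h1 p) = f (p, \<zero>\<^bsub>Q\<^esub>)" by blast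
  have "(\<lambda>q. (\<zero>\<^bsub>P\<^esub>, q)) \<in> right_module_hom R Q (direct_sum_module P Q)"
    by (rule right_module_homI) (auto simp: P.rsmult_zero_module)
  from right_module_hom_comp[OF this f] projectiveD[OF Q M N e surj]
  obtain h2 where h2: "h2 \<in> right_module_hom R Q M" "\<forall>q\<in>carrier Q. e (h2 q) = f (\<zero>\<^bsub>P\<^esub>, q)" by blast
  let ?h = "\<lambda>p. h1 (fst p) \<oplus>\<^bsub>M\<^esub> h2 (snd p)"
  have "?h \<in> right_module_hom R (direct_sum_module P Q) M"
    by (rule right_module_homI)
      (auto simp: right_module_homD[OF h1(1)] right_module_homD[OF h2(1)] M.M.a_ac M.rsmult_distr_module)
  moreover have "e (?h p) = f p" if "p \<in> carrier (direct_sum_module P Q)" for p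
  proof -
    have p: "fst p \<in> carrier P" "snd p \<in> carrier Q" using that by auto
    then have "e (?h p) = f (fst p, \<zero>\<^bsub>Q\<^esub>) \<oplus>\<^bsub>N\<^esub> f (\<zero>\<^bsub>P\<^esub>, snd p)"
      using h1 h2 by (simp add: right_module_homD[OF e] right_module_homD[OF h1(1)] right_module_homD[OF h2(1)])
    also have "\<dots> = f p"
      using p right_module_homD(2)[OF f, of "(fst p, \<zero>\<^bsub>Q\<^esub>)" "(\<zero>\<^bsub>P\<^esub>, snd p)"] by simp
    finally show ?thesis .
  qed
  ultimately show "\<exists>h\<in>right_module_hom R (direct_sum_module P Q) M.
      \<forall>p\<in>carrier (direct_sum_module P Q). e (h p) = f p" by (intro bexI[of _ ?h] ballI)
qed

lemma projective_retract:
  assumes P: "projective_right_module TYPE('m) TYPE('k) R P" and Q: "right_module R Q"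
    and i: "i \<in> right_module_hom R Q P" and p: "p \<in> right_module_hom R P Q"
    and pi: "\<And>q. q \<in> carrier Q \<Longrightarrow> p (i q) = q"
  shows "projective_right_module TYPE('m) TYPE('k) R Q"
proof (rule projectiveI[OF Q])
  fix M :: "('a, 'm) module" and N :: "('a, 'k) module" and e f
  assume M: "right_module R M" and N: "right_module R N" and e: "e \<in> right_module_hom R M N"
    and surj: "e ` carrier M = carrier N" and f: "f \<in> right_module_hom R Q N"
  obtain h where "h \<in> right_module_hom R P M" "\<forall>x\<in>carrier P. e (h x) = f (p x)"
    using projectiveD[OF P M N e surj right_module_hom_comp[OF p f]] by blast
  then show "\<exists>h\<in>right_module_hom R Q M. \<forall>q\<in>carrier Q. e (h q) = f q"
    using pi right_module_homD(1)[OF i] right_module_hom_comp[OF i] by (intro bexI[of _ "\<lambda>q. h (i q)"]) auto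
qed

context complex_algebra begin

lemma projective_regular: "projective_right_module TYPE('m) TYPE('k) A (regular_module A)"
proof (rule projectiveI[OF right_module_regular])
  fix M :: "('a, 'm) module" and N :: "('a, 'k) module" and e f
  assume M: "right_module A M" and N: "right_module A N" and e: "e \<in> right_module_hom A M N"
    and surj: "e ` carrier M = carrier N" and f: "f \<in> right_module_hom A (regular_module A) N"
  interpret M: right_module A M by fact
  have "f \<one> \<in> e ` carrier M"
    unfolding surj using right_module_homD(1)[OF f, of \<one>] by simp
  then obtain m where m: "m \<in> carrier M" "e m = f \<one>" by (metis imageE)
  have "(\<lambda>a. a \<odot>\<^bsub>M\<^esub> m) \<in> right_module_hom A (regular_module A) M"
    using m by (intro right_module_homI) (auto simp: M.rsmult_closed M.rsmult_distr_ring M.rsmult_assoc)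
  moreover have "e (a \<odot>\<^bsub>M\<^esub> m) = f a" if "a \<in> carrier A" for a
    using that m right_module_homD(3)[OF f, of a \<one>] by (simp add: right_module_homD[OF e])
  ultimately show "\<exists>h\<in>right_module_hom A (regular_module A) M. \<forall>p\<in>carrier (regular_module A). e (h p) = f p"
    by (intro bexI[of _ "\<lambda>a. a \<odot>\<^bsub>M\<^esub> m"] ballI) simp_all
qed

definition unit_matr :: "'n \<Rightarrow> 'n \<Rightarrow> ('n, 'a) matr" where
  "unit_matr k l = (\<lambda>i j. if i = k \<and> j = l then \<one> else \<zero>)"

lemma unit_matr_mats [simp]: "unit_matr k l \<in> mats"
  by (simp add: unit_matr_def matr_module_simps)

lemma matr_expand:
  assumes U: "U \<in> (mats :: ('n::finite, 'a) matr set)"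
  shows "(\<Oplus>\<^bsub>matr_module A\<^esub>p\<in>UNIV. U (fst p) (snd p) \<odot>\<^bsub>matr_module A\<^esub> unit_matr (fst p) (snd p)) = U"
proof -
  interpret M: right_module A "matr_module A" by (rule right_module_matr)
  have entry: "(finsum (matr_module A) h I) i j = finsum A (\<lambda>p. h p i j) I" if "h \<in> I \<rightarrow> mats" for h :: "'n \<times> 'n \<Rightarrow> _" and I i j
    using that
    by (induction I rule: infinite_finite_induct) (auto simp: matr_module_simps(2,3) matr_add_def Pi_def)
  show ?thesis
  proof (intro HOL.ext)
    fix i j
    have "(\<Oplus>\<^bsub>matr_module A\<^esub>p\<in>UNIV. U (fst p) (snd p) \<odot>\<^bsub>matr_module A\<^esub> unit_matr (fst p) (snd p)) i j =
        (\<Oplus>p\<in>UNIV. (U (fst p) (snd p) \<odot>\<^bsub>matr_module A\<^esub> unit_matr (fst p) (snd p)) i j)"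
      using U by (intro entry) (auto intro!: M.rsmult_closed)
    also have "\<dots> = (\<Oplus>p\<in>UNIV. if p = (i, j) then U (fst p) (snd p) else \<zero>)"
      using U by (intro finsum_cong') (auto simp: matr_module_simps(4) unit_matr_def)
    also have "\<dots> = U i j"
      using U finsum_delta(1)[of UNIV "(i, j)" "\<lambda>p. U (fst p) (snd p)"] by simp
    finally show "(\<Oplus>\<^bsub>matr_module A\<^esub>p\<in>UNIV. U (fst p) (snd p) \<odot>\<^bsub>matr_module A\<^esub> unit_matr (fst p) (snd p)) i j = U i j" .
  qed
qed

lemma projective_matr:
  "projective_right_module TYPE('m) TYPE('k) A (matr_module A :: ('a, ('n::finite, 'a) matr) module)"
proof (rule projectiveI[OF right_module_matr])
  fix M :: "('a, 'm) module" and N :: "('a, 'k) module" and e and f :: "('n, 'a) matr \<Rightarrow> 'k"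
  assume M: "right_module A M" and N: "right_module A N" and e: "e \<in> right_module_hom A M N"
    and surj: "e ` carrier M = carrier N" and f: "f \<in> right_module_hom A (matr_module A) N"
  interpret M: right_module A M by fact
  interpret N: right_module A N by fact
  define m where "m p = (SOME m. m \<in> carrier M \<and> e m = f (unit_matr (fst p) (snd p)))" for p
  have m: "m p \<in> carrier M \<and> e (m p) = f (unit_matr (fst p) (snd p))" for p
  proof -
    have "f (unit_matr (fst p) (snd p)) \<in> e ` carrier M"
      unfolding surj by (rule right_module_homD(1)[OF f unit_matr_mats])
    then have "\<exists>m. m \<in> carrier M \<and> e m = f (unit_matr (fst p) (snd p))" by (metis imageE)
    then show ?thesis unfolding m_def by (rule someI_ex)
  qed
  let ?h = "\<lambda>U :: ('n, 'a) matr. finsum M (\<lambda>p. U (fst p) (snd p) \<odot>\<^bsub>M\<^esub> m p) UNIV"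
  have "?h \<in> right_module_hom A (matr_module A) M"
  proof (rule right_module_homI)
    fix U :: "('n, 'a) matr" assume U: "U \<in> mats"
    show "?h U \<in> carrier M" using U m by (intro M.M.finsum_closed) (auto intro: M.rsmult_closed)
  next
    fix U V :: "('n, 'a) matr" assume U: "U \<in> mats" and V: "V \<in> mats"
    have "?h (U \<oplus>\<^bsub>matr_module A\<^esub> V) =
        finsum M (\<lambda>p. U (fst p) (snd p) \<odot>\<^bsub>M\<^esub> m p \<oplus>\<^bsub>M\<^esub> V (fst p) (snd p) \<odot>\<^bsub>M\<^esub> m p) UNIV"
      using U V m by (simp add: matr_module_simps(3) matr_add_def M.rsmult_distr_ring)
    also have "\<dots> = ?h U \<oplus>\<^bsub>M\<^esub> ?h V"
      using U V m by (intro M.M.finsum_addf) (auto intro: M.rsmult_closed)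
    finally show "?h (U \<oplus>\<^bsub>matr_module A\<^esub> V) = ?h U \<oplus>\<^bsub>M\<^esub> ?h V" .
  next
    fix U :: "('n, 'a) matr" and r assume U: "U \<in> mats" and r: "r \<in> carrier A"
    show "?h (r \<odot>\<^bsub>matr_module A\<^esub> U) = r \<odot>\<^bsub>M\<^esub> ?h U"
      using U m r by (subst M.rsmult_finsum_module)
        (auto simp: matr_module_simps(4) M.rsmult_assoc intro!: M.rsmult_closed)
  qed
  moreover have "e (?h U) = f U" if U: "U \<in> mats" for U
  proof -
    have "e (?h U) = finsum N (\<lambda>p. e (U (fst p) (snd p) \<odot>\<^bsub>M\<^esub> m p)) UNIV"
      using U m by (intro right_module_hom_finsum[OF e M N]) (auto intro: M.rsmult_closed)
    also have "\<dots> = finsum N (\<lambda>p. f (U (fst p) (snd p) \<odot>\<^bsub>matr_module A\<^esub> unit_matr (fst p) (snd p))) UNIV"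
      using U m by (simp add: right_module_homD[OF e] right_module_homD(3)[OF f])
    also have "\<dots> = f (\<Oplus>\<^bsub>matr_module A\<^esub>p\<in>UNIV. U (fst p) (snd p) \<odot>\<^bsub>matr_module A\<^esub> unit_matr (fst p) (snd p))"
      using U by (intro right_module_hom_finsum[OF f right_module_matr N, symmetric])
        (auto intro: right_module.rsmult_closed[OF right_module_matr])
    finally show ?thesis by (simp add: matr_expand[OF U])
  qed
  ultimately show "\<exists>h\<in>right_module_hom A (matr_module A) M. \<forall>p\<in>mats. e (h p) = f p"
    by (intro bexI[of _ ?h] ballI)
qed

end

section \<open>The tensor product\<close>

context A_algebra begin

definition omg :: "'n A_elem" where "omg = \<one> \<ominus> g"

lemma omg_closed [simp]: "omg \<in> carrier A"
  by (simp add: omg_def)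

interpretation Z: complex_algebra Z2_alg by (rule complex_algebra_Z2)

abbreviation "\<phi> \<equiv> Z2_to_A E"
abbreviation "m0 \<equiv> Z2_one_minus_g"
abbreviation "G \<equiv> tensor_cover Z2_line A"
abbreviation "K \<equiv> tensor_kernel Z2_alg Z2_line \<phi> A"

lemma \<phi>: "\<phi> \<in> alg_hom Z2_alg A"
  unfolding A_eq by (rule inr_hom)

lemma m0_closed [simp]: "m0 \<in> carrier Z2_alg"
  by (simp add: Z2_one_minus_g_def Z2_gen_closed)

lemma \<phi>_m0: "\<phi> m0 = omg"
  by (simp add: Z2_one_minus_g_def omg_def alg_hom_minus[OF \<phi> complex_algebra_Z2 complex_algebra_axioms]
    Z2_gen_closed alg_homD[OF \<phi>] A_g_def)

lemma Z2_line_simps: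
  "carrier Z2_line = {c \<odot>\<^bsub>Z2_alg\<^esub> m0 |c. True}" "a \<oplus>\<^bsub>Z2_line\<^esub> b = a \<oplus>\<^bsub>Z2_alg\<^esub> b"
  "r \<odot>\<^bsub>Z2_line\<^esub> m = m \<otimes>\<^bsub>Z2_alg\<^esub> r"
  by (simp_all add: Z2_line_def regular_module_def)

lemma Z2_line_subset: "m \<in> carrier Z2_line \<Longrightarrow> m \<in> carrier Z2_alg"
  by (auto simp: Z2_line_simps)

lemma m0_line: "m0 \<in> carrier Z2_line"
  unfolding Z2_line_simps(1) using Z.smult_one[OF m0_closed] by (metis (mono_tags, lifting) mem_Collect_eq)

text \<open>The source of all factors 1/2 below: half of \<open>1 - g\<close> is idempotent.\<close>

lemma m0_square: "m0 \<otimes>\<^bsub>Z2_alg\<^esub> m0 = 2 \<odot>\<^bsub>Z2_alg\<^esub> m0"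
proof -
  have "Z2_gen \<otimes>\<^bsub>Z2_alg\<^esub> m0 = \<ominus>\<^bsub>Z2_alg\<^esub> m0"
    by (simp add: Z2_one_minus_g_def Z.minus_eq Z.r_distr Z.r_minus Z2_gen_closed Z2_gen_square
      Z.minus_add Z.a_comm)
  moreover have "m0 \<otimes>\<^bsub>Z2_alg\<^esub> m0 = m0 \<ominus>\<^bsub>Z2_alg\<^esub> Z2_gen \<otimes>\<^bsub>Z2_alg\<^esub> m0"
    by (subst (1) Z2_one_minus_g_def) (simp add: Z.minus_eq Z.l_distr Z.l_minus Z2_gen_closed)
  ultimately show ?thesis
    using Z.smult_add_left[of m0 1 1] by (simp add: Z.minus_eq Z.smult_one)
qed

lemma comm_group_G: "comm_group G"
  by (simp add: tensor_cover_def abelian_free_Abelian_group)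

lemma group_G: "group G"
  using comm_group_G by (simp add: comm_group_def)

lemma G_simps:
  "c \<in> carrier G \<longleftrightarrow> Poly_Mapping.keys c \<subseteq> carrier Z2_line \<times> carrier A"
  "c \<otimes>\<^bsub>G\<^esub> d = c + d" "\<one>\<^bsub>G\<^esub> = 0" "c \<in> carrier G \<Longrightarrow> inv\<^bsub>G\<^esub> c = - c"
  by (simp_all add: tensor_cover_def)

lemma frag_in_G: "m \<in> carrier Z2_line \<Longrightarrow> a \<in> carrier A \<Longrightarrow> frag_of (m, a) \<in> carrier G"
  by (simp add: G_simps)

lemma G_closed: "c \<in> carrier G \<Longrightarrow> d \<in> carrier G \<Longrightarrow> c + d \<in> carrier G"
  "c \<in> carrier G \<Longrightarrow> d \<in> carrier G \<Longrightarrow> c - d \<in> carrier G"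
  unfolding G_simps using Poly_Mapping.keys_add[of c d] keys_diff[of c d] by blast+

text \<open>The elements that act on \<open>1 - g\<close> by a scalar form a subalgebra containing
  \<open>g\<close>, hence everything.\<close>

lemma Z2_line_smult_closed:
  "m \<in> carrier Z2_line \<Longrightarrow> r \<in> carrier Z2_alg \<Longrightarrow> m \<otimes>\<^bsub>Z2_alg\<^esub> r \<in> carrier Z2_line"
proof -
  assume m: "m \<in> carrier Z2_line" and r: "r \<in> carrier Z2_alg"
  have "subalgebra_of {r \<in> carrier Z2_alg. \<exists>c. m0 \<otimes>\<^bsub>Z2_alg\<^esub> r = c \<odot>\<^bsub>Z2_alg\<^esub> m0} Z2_alg"
    unfolding subalgebra_of_def
  proof (intro conjI ballI allI)
    show "\<one>\<^bsub>Z2_alg\<^esub> \<in> {r \<in> carrier Z2_alg. \<exists>c. m0 \<otimes>\<^bsub>Z2_alg\<^esub> r = c \<odot>\<^bsub>Z2_alg\<^esub> m0}"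
      using Z.smult_one[OF m0_closed] by (auto intro!: exI[of _ 1])
    fix a b
    assume a: "a \<in> {r \<in> carrier Z2_alg. \<exists>c. m0 \<otimes>\<^bsub>Z2_alg\<^esub> r = c \<odot>\<^bsub>Z2_alg\<^esub> m0}"
      and b: "b \<in> {r \<in> carrier Z2_alg. \<exists>c. m0 \<otimes>\<^bsub>Z2_alg\<^esub> r = c \<odot>\<^bsub>Z2_alg\<^esub> m0}"
    obtain c d where cd: "m0 \<otimes>\<^bsub>Z2_alg\<^esub> a = c \<odot>\<^bsub>Z2_alg\<^esub> m0" "m0 \<otimes>\<^bsub>Z2_alg\<^esub> b = d \<odot>\<^bsub>Z2_alg\<^esub> m0"
      using a b by blast
    have "m0 \<otimes>\<^bsub>Z2_alg\<^esub> (a \<oplus>\<^bsub>Z2_alg\<^esub> b) = (c + d) \<odot>\<^bsub>Z2_alg\<^esub> m0"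
      using a b cd by (simp add: Z.r_distr Z.smult_add_left)
    then show "a \<oplus>\<^bsub>Z2_alg\<^esub> b \<in> {r \<in> carrier Z2_alg. \<exists>c. m0 \<otimes>\<^bsub>Z2_alg\<^esub> r = c \<odot>\<^bsub>Z2_alg\<^esub> m0}"
      using a b by blast
    have "m0 \<otimes>\<^bsub>Z2_alg\<^esub> (a \<otimes>\<^bsub>Z2_alg\<^esub> b) = (c * d) \<odot>\<^bsub>Z2_alg\<^esub> m0"
      using a b cd by (simp add: Z.m_assoc[symmetric] Z.smult_mult_left Z.smult_smult)
    then show "a \<otimes>\<^bsub>Z2_alg\<^esub> b \<in> {r \<in> carrier Z2_alg. \<exists>c. m0 \<otimes>\<^bsub>Z2_alg\<^esub> r = c \<odot>\<^bsub>Z2_alg\<^esub> m0}"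
      using a b by blast
  next
    fix k a
    assume a: "a \<in> {r \<in> carrier Z2_alg. \<exists>c. m0 \<otimes>\<^bsub>Z2_alg\<^esub> r = c \<odot>\<^bsub>Z2_alg\<^esub> m0}"
    then obtain c where c: "m0 \<otimes>\<^bsub>Z2_alg\<^esub> a = c \<odot>\<^bsub>Z2_alg\<^esub> m0" by blast
    have "m0 \<otimes>\<^bsub>Z2_alg\<^esub> (k \<odot>\<^bsub>Z2_alg\<^esub> a) = (k * c) \<odot>\<^bsub>Z2_alg\<^esub> m0"
      using a c by (simp add: Z.smult_mult_right Z.smult_smult)
    then show "k \<odot>\<^bsub>Z2_alg\<^esub> a \<in> {r \<in> carrier Z2_alg. \<exists>c. m0 \<otimes>\<^bsub>Z2_alg\<^esub> r = c \<odot>\<^bsub>Z2_alg\<^esub> m0}"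
      using a by blast
  qed auto
  moreover have "m0 \<otimes>\<^bsub>Z2_alg\<^esub> Z2_gen = (- 1) \<odot>\<^bsub>Z2_alg\<^esub> m0"
  proof -
    have "m0 \<otimes>\<^bsub>Z2_alg\<^esub> Z2_gen = \<ominus>\<^bsub>Z2_alg\<^esub> m0"
      by (simp add: Z2_one_minus_g_def Z.minus_eq Z.l_distr Z.l_minus Z2_gen_closed Z2_gen_square
        Z.minus_add Z.a_comm)
    then show ?thesis by (simp add: Z.minus_eq_smult)
  qed
  then have "{Z2_gen} \<subseteq> {r \<in> carrier Z2_alg. \<exists>c. m0 \<otimes>\<^bsub>Z2_alg\<^esub> r = c \<odot>\<^bsub>Z2_alg\<^esub> m0}"
    using Z2_gen_closed by blast
  ultimately obtain c where "m0 \<otimes>\<^bsub>Z2_alg\<^esub> r = c \<odot>\<^bsub>Z2_alg\<^esub> m0"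
    using generatesD[OF generates_Z2 _ _ r] by blast
  then show ?thesis
    using m r by (auto simp: Z2_line_simps Z.smult_mult_left Z.smult_smult)
qed

lemma Z2_line_add_closed: "m \<in> carrier Z2_line \<Longrightarrow> m' \<in> carrier Z2_line \<Longrightarrow> m \<oplus>\<^bsub>Z2_alg\<^esub> m' \<in> carrier Z2_line"
  unfolding Z2_line_simps(1) using Z.smult_add_left[OF m0_closed] by (auto simp: Z.smult_add_left[symmetric])

lemma relations_in_G: "tensor_relations Z2_alg Z2_line \<phi> A \<subseteq> carrier G"
  unfolding tensor_relations_def Z2_line_simps(2,3)
  by (auto intro!: G_closed frag_in_G Z2_line_add_closed Z2_line_smult_closed simp: alg_homD[OF \<phi>])

lemma subgroup_K: "subgroup K G"
  unfolding tensor_kernel_def by (rule group.generate_is_subgroup[OF group_G relations_in_G])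

lemma normal_K: "normal K G"
  by (rule comm_group.subgroup_imp_normal[OF comm_group_G subgroup_K])

lemma K_subset: "c \<in> K \<Longrightarrow> c \<in> carrier G"
  using subgroup.subset[OF subgroup_K] by blast

lemma K_closed: "c \<in> K \<Longrightarrow> d \<in> K \<Longrightarrow> c + d \<in> K" "c \<in> K \<Longrightarrow> d \<in> K \<Longrightarrow> c - d \<in> K" "0 \<in> K" "c \<in> K \<Longrightarrow> - c \<in> K"
proof -
  show 1: "c + d \<in> K" if "c \<in> K" "d \<in> K" for c d
    using subgroup.m_closed[OF subgroup_K that] by (simp add: G_simps)
  show 2: "- c \<in> K" if "c \<in> K" for c
    using subgroup.m_inv_closed[OF subgroup_K that] K_subset[OF that] by (simp add: G_simps)
  show "c - d \<in> K" if "c \<in> K" "d \<in> K" using 1[OF that(1) 2[OF that(2)]] by simp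
  show "0 \<in> K" using subgroup.one_closed[OF subgroup_K] by (simp add: G_simps)
qed

lemma relation_in_K: "c \<in> tensor_relations Z2_alg Z2_line \<phi> A \<Longrightarrow> c \<in> K"
  unfolding tensor_kernel_def by (rule generate.incl)

lemma K_relations:
  "m \<in> carrier Z2_line \<Longrightarrow> a \<in> carrier A \<Longrightarrow> a' \<in> carrier A \<Longrightarrow>
    frag_of (m, a \<oplus> a') - frag_of (m, a) - frag_of (m, a') \<in> K"
  "r \<in> carrier Z2_alg \<Longrightarrow> m \<in> carrier Z2_line \<Longrightarrow> a \<in> carrier A \<Longrightarrow>
    frag_of (m \<otimes>\<^bsub>Z2_alg\<^esub> r, a) - frag_of (m, \<phi> r \<otimes> a) \<in> K"
  by (rule relation_in_K; auto simp: tensor_relations_def Z2_line_simps(3))+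

abbreviation coset :: "(Z2_elem \<times> 'n A_elem \<Rightarrow>\<^sub>0 int) \<Rightarrow> 'n T_elem" where
  "coset c \<equiv> K #>\<^bsub>G\<^esub> c"

lemma coset_eqI: "c \<in> carrier G \<Longrightarrow> d \<in> carrier G \<Longrightarrow> c - d \<in> K \<Longrightarrow> coset c = coset d"
proof -
  assume c: "c \<in> carrier G" and d: "d \<in> carrier G" and cd: "c - d \<in> K"
  have "c \<in> coset d" using cd unfolding r_coset_def G_simps by force
  then show ?thesis using group.repr_independence[OF group_G _ d subgroup_K] by simp
qed

definition Tp :: "'n A_elem \<Rightarrow> 'n T_elem" where "Tp = T_pure E"

lemma Tp_eq: "Tp a = coset (frag_of (m0, a))"
  by (simp add: Tp_def T_pure_def pure_tensor_def A_eq)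

abbreviation T where "T \<equiv> T_module E"

lemma T_simps:
  "carrier T = carrier (G Mod K)" "s \<oplus>\<^bsub>T\<^esub> t = s \<otimes>\<^bsub>G Mod K\<^esub> t" "\<zero>\<^bsub>T\<^esub> = \<one>\<^bsub>G Mod K\<^esub>"
  "b \<odot>\<^bsub>T\<^esub> t = (\<Union>c\<in>t. coset (frag_extend (\<lambda>(m, a). frag_of (m, a \<otimes> b)) c))"
  by (simp_all add: T_module_def tensor_module_def Let_def A_eq)

text \<open>A scalar in the left factor is right multiplication by a multiple of 1 and can be moved
  across the tensor sign; after that, sums and differences are collected in the right
  factor.\<close>

lemma ex_frag_m0:
  "c \<in> carrier G \<Longrightarrow> \<exists>a\<in>carrier A. c - frag_of (m0, a) \<in> K"
proof -
  assume "c \<in> carrier G"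
  then have "Poly_Mapping.keys c \<subseteq> carrier Z2_line \<times> carrier A" by (simp add: G_simps)
  then show ?thesis
  proof (induction c rule: frag_induction)
    case zero
    have "frag_of (m0, \<zero> \<oplus> \<zero>) - frag_of (m0, \<zero>) - frag_of (m0, \<zero>) \<in> K"
      by (rule K_relations(1)[OF m0_line]) auto
    then show ?case by (intro bexI[of _ \<zero>]) auto
  next
    case (one p)
    then obtain k a where p: "p = (k \<odot>\<^bsub>Z2_alg\<^esub> m0, a)" "a \<in> carrier A" by (auto simp: Z2_line_simps)
    have "m0 \<otimes>\<^bsub>Z2_alg\<^esub> (k \<odot>\<^bsub>Z2_alg\<^esub> \<one>\<^bsub>Z2_alg\<^esub>) = k \<odot>\<^bsub>Z2_alg\<^esub> m0"
      by (simp add: Z.smult_mult_right)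
    then have "frag_of p - frag_of (m0, \<phi> (k \<odot>\<^bsub>Z2_alg\<^esub> \<one>\<^bsub>Z2_alg\<^esub>) \<otimes> a) \<in> K"
      using K_relations(2)[OF _ m0_line p(2), of "k \<odot>\<^bsub>Z2_alg\<^esub> \<one>\<^bsub>Z2_alg\<^esub>"] by (simp add: p)
    then show ?case by (rule bexI) (simp add: alg_homD[OF \<phi>] p(2))
  next
    case (diff c d)
    then obtain a b where ab: "a \<in> carrier A" "b \<in> carrier A"
      "c - frag_of (m0, a) \<in> K" "d - frag_of (m0, b) \<in> K" by blast
    have "frag_of (m0, (a \<ominus> b) \<oplus> b) - frag_of (m0, a \<ominus> b) - frag_of (m0, b) \<in> K"
      using ab by (intro K_relations(1)[OF m0_line]) auto
    moreover have "(a \<ominus> b) \<oplus> b = a" using ab by (simp add: minus_eq a_assoc l_neg)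
    ultimately have "frag_of (m0, a) - frag_of (m0, a \<ominus> b) - frag_of (m0, b) \<in> K" by simp
    from K_closed(1)[OF K_closed(2)[OF ab(3,4)] this]
    have "c - frag_of (m0, a) - (d - frag_of (m0, b)) +
        (frag_of (m0, a) - frag_of (m0, a \<ominus> b) - frag_of (m0, b)) \<in> K" .
    moreover have "c - frag_of (m0, a) - (d - frag_of (m0, b)) +
        (frag_of (m0, a) - frag_of (m0, a \<ominus> b) - frag_of (m0, b)) = c - d - frag_of (m0, a \<ominus> b)"
      by (simp add: algebra_simps)
    ultimately show ?case using ab by (intro bexI[of _ "a \<ominus> b"]) auto
  qed
qed

lemma Tp_in_T: "a \<in> carrier A \<Longrightarrow> Tp a \<in> carrier T"
  unfolding T_simps(1) FactGroup_def Tp_eq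
  using group.rcosetsI[OF group_G subgroup.subset[OF subgroup_K] frag_in_G[OF m0_line]] by simp

lemma Tp_surj: "Tp ` carrier A = carrier T"
proof
  show "Tp ` carrier A \<subseteq> carrier T" using Tp_in_T by blast
  show "carrier T \<subseteq> Tp ` carrier A"
  proof
    fix t assume "t \<in> carrier T"
    then obtain c where c: "c \<in> carrier G" "t = coset c"
      by (auto simp: T_simps FactGroup_def RCOSETS_def)
    obtain a where a: "a \<in> carrier A" "c - frag_of (m0, a) \<in> K" using ex_frag_m0[OF c(1)] by blast
    then have "t = Tp a" unfolding c(2) Tp_eq by (intro coset_eqI c(1) frag_in_G m0_line)
    then show "t \<in> Tp ` carrier A" using a(1) by blast
  qed
qed

lemma Tp_add: "a \<in> carrier A \<Longrightarrow> b \<in> carrier A \<Longrightarrow> Tp a \<oplus>\<^bsub>T\<^esub> Tp b = Tp (a \<oplus> b)"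
proof -
  assume a: "a \<in> carrier A" and b: "b \<in> carrier A"
  have "Tp a \<oplus>\<^bsub>T\<^esub> Tp b = coset (frag_of (m0, a) + frag_of (m0, b))"
    unfolding Tp_eq T_simps
    using normal.rcos_sum[OF normal_K frag_in_G[OF m0_line a] frag_in_G[OF m0_line b]]
    by (simp add: FactGroup_def G_simps)
  also have "\<dots> = Tp (a \<oplus> b)"
    unfolding Tp_eq
  proof (rule coset_eqI)
    have "- (frag_of (m0, a \<oplus> b) - frag_of (m0, a) - frag_of (m0, b)) \<in> K"
      by (intro K_closed(4) K_relations(1) m0_line a b)
    then show "frag_of (m0, a) + frag_of (m0, b) - frag_of (m0, a \<oplus> b) \<in> K" by (simp add: algebra_simps)
  qed (use a b in \<open>auto intro!: G_closed frag_in_G m0_line\<close>)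
  finally show ?thesis .
qed

lemma Tp_zero: "\<zero>\<^bsub>T\<^esub> = Tp \<zero>"
proof -
  have "\<zero>\<^bsub>T\<^esub> = K" by (simp add: T_simps FactGroup_def)
  also have "\<dots> = coset 0"
    using group.coset_mult_one[OF group_G subgroup.subset[OF subgroup_K]] by (simp add: G_simps)
  also have "\<dots> = Tp \<zero>"
    unfolding Tp_eq
  proof (rule coset_eqI)
    have "frag_of (m0, \<zero> \<oplus> \<zero>) - frag_of (m0, \<zero>) - frag_of (m0, \<zero>) \<in> K"
      by (rule K_relations(1)[OF m0_line]) auto
    then show "0 - frag_of (m0, \<zero>) \<in> K" by simp
  qed (auto intro!: frag_in_G m0_line simp: G_simps(1)[of 0])
  finally show ?thesis .
qed

lemma Tp_smult:
  assumes a: "a \<in> carrier A" and b: "b \<in> carrier A"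
  shows "b \<odot>\<^bsub>T\<^esub> Tp a = Tp (a \<otimes> b)"
proof -
  \<comment> \<open>Right multiplication on the free abelian group. It maps each kind of defining
    relation to a relation of the same kind, so it descends to the tensor product.\<close>
  define R where "R = frag_extend (\<lambda>(m :: Z2_elem, a). frag_of (m, a \<otimes> b))"
  have R_of: "R (frag_of (m, a)) = frag_of (m, a \<otimes> b)" for m a by (simp add: R_def)
  have R_add: "R (c + d) = R c + R d" "R (c - d) = R c - R d" "R 0 = 0" "R (- c) = - R c" for c d
    by (simp_all add: R_def frag_extend_add frag_extend_diff frag_extend_minus)
  have R_rel: "R c \<in> K" if "c \<in> tensor_relations Z2_alg Z2_line \<phi> A" for c
    using that unfolding tensor_relations_def
  proof (elim UnE CollectE exE conjE)
    fix m m' a assume "c = frag_of (m \<oplus>\<^bsub>Z2_line\<^esub> m', a) - frag_of (m, a) - frag_of (m', a)"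
      "m \<in> carrier Z2_line" "m' \<in> carrier Z2_line" "a \<in> carrier A"
    then show ?thesis
      using b unfolding R_add by (intro relation_in_K) (auto simp: R_add R_of tensor_relations_def)
  next
    fix m a a' assume "c = frag_of (m, a \<oplus> a') - frag_of (m, a) - frag_of (m, a')"
      "m \<in> carrier Z2_line" "a \<in> carrier A" "a' \<in> carrier A"
    then show ?thesis
      using b K_relations(1)[of m "a \<otimes> b" "a' \<otimes> b"] by (simp add: R_add R_of l_distr)
  next
    fix r m a assume "c = frag_of (r \<odot>\<^bsub>Z2_line\<^esub> m, a) - frag_of (m, \<phi> r \<otimes> a)"
      "r \<in> carrier Z2_alg" "m \<in> carrier Z2_line" "a \<in> carrier A"
    then show ?thesis
      using b K_relations(2)[of r m "a \<otimes> b"] by (simp add: R_add R_of m_assoc alg_homD[OF \<phi>] Z2_line_simps)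
  qed
  have R_K: "R c \<in> K" if "c \<in> K" for c
    using that unfolding tensor_kernel_def
  proof (induction c rule: generate.induct)
    case one
    then show ?case by (metis G_simps(3) K_closed(3) R_add(3) tensor_kernel_def)
  next
    case (incl h)
    then show ?case using R_rel by (simp add: tensor_kernel_def)
  next
    case (inv h)
    then have "inv\<^bsub>G\<^esub> h = - h" using relations_in_G by (intro G_simps(4)) blast
    then show ?case using K_closed(4)[OF R_rel[OF inv]] by (simp add: R_add tensor_kernel_def)
  next
    case (eng h1 h2)
    then show ?case using K_closed(1)[of "R h1" "R h2"] by (simp add: R_add G_simps tensor_kernel_def)
  qed
  have "coset (R c) = Tp (a \<otimes> b)" if c: "c \<in> Tp a" for c
  proof -
    obtain k where k: "k \<in> K" "c = k + frag_of (m0, a)"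
      using c unfolding Tp_eq r_coset_def G_simps by blast
    have "R c - frag_of (m0, a \<otimes> b) = R k" by (simp add: k R_add R_of)
    moreover have "R c = R k + frag_of (m0, a \<otimes> b)" by (simp add: k R_add R_of)
    moreover have "frag_of (m0, a \<otimes> b) \<in> carrier G" using a b by (intro frag_in_G m0_line) auto
    ultimately show ?thesis
      unfolding Tp_eq using R_K[OF k(1)] K_subset by (intro coset_eqI) (auto intro: G_closed)
  qed
  moreover have "frag_of (m0, a) \<in> Tp a"
    unfolding Tp_eq by (rule group.rcos_self[OF group_G frag_in_G[OF m0_line a] subgroup_K])
  ultimately have "(\<Union>c\<in>Tp a. coset (R c)) = Tp (a \<otimes> b)" by blast
  then show ?thesis unfolding T_simps(4) R_def .
qed

lemma right_module_T: "right_module A T"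
  by (rule right_module_image[OF right_module_regular, where \<pi> = Tp])
    (simp_all add: Tp_surj Tp_add Tp_zero Tp_smult)

lemma Tp_hom: "Tp \<in> right_module_hom A (regular_module A) T"
  by (rule right_module_homI) (simp_all add: Tp_in_T Tp_add Tp_smult)

text \<open>Since \<open>1 - g\<close> equals itself times half of \<open>1 - g\<close>, that second
  factor can be moved to the right of the tensor sign.\<close>

lemma Tp_omg: "a \<in> carrier A \<Longrightarrow> Tp ((1 / 2) \<odot> (omg \<otimes> a)) = Tp a"
proof -
  assume a: "a \<in> carrier A"
  let ?r = "(1 / 2) \<odot>\<^bsub>Z2_alg\<^esub> m0"
  have "m0 \<otimes>\<^bsub>Z2_alg\<^esub> ?r = m0"
    by (simp add: Z.smult_mult_right m0_square Z.smult_smult Z.smult_one)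
  moreover have "\<phi> ?r \<otimes> a = (1 / 2) \<odot> (omg \<otimes> a)"
    using a by (simp add: alg_homD[OF \<phi>] \<phi>_m0 smult_mult_left)
  ultimately have "frag_of (m0, a) - frag_of (m0, (1 / 2) \<odot> (omg \<otimes> a)) \<in> K"
    using K_relations(2)[OF _ m0_line a, of ?r] by simp
  then have "coset (frag_of (m0, a)) = coset (frag_of (m0, (1 / 2) \<odot> (omg \<otimes> a)))"
    using a by (intro coset_eqI frag_in_G m0_line) auto
  then show ?thesis by (simp add: Tp_eq)
qed

text \<open>The multiplication map sending a pure tensor of \<open>m\<close> and \<open>a\<close> to
  \<open>\<phi> m \<otimes> a\<close> kills all defining relations, so its value depends on the
  tensor only. This is also what makes the description in \<open>Phi1\<close> unambiguous.\<close>

lemma Tp_eq_imp: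
  assumes a: "a \<in> carrier A" and b: "b \<in> carrier A" and eq: "Tp a = Tp b"
  shows "omg \<otimes> a = omg \<otimes> b"
proof -
  define u where "u = (\<lambda>(m, a). \<phi> m \<otimes> a)"
  have u: "u ` (carrier Z2_line \<times> carrier A) \<subseteq> carrier (add_monoid A)"
    by (auto simp: u_def alg_homD[OF \<phi>] Z2_line_subset)
  obtain h where h: "h \<in> hom G (add_monoid A)" "\<And>p. p \<in> carrier Z2_line \<times> carrier A \<Longrightarrow> h (frag_of p) = u p"
    using comm_group.free_Abelian_group_universal[OF a_comm_group u] unfolding tensor_cover_def by blast
  interpret h: group_hom G "add_monoid A" h
    using h(1) group_G a_comm_group by (simp add: group_hom_def group_hom_axioms_def comm_group_def)
  have h_add: "h (c + d) = h c \<oplus> h d" if "c \<in> carrier G" "d \<in> carrier G" for c d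
    using h.hom_mult[OF that] by (simp add: G_simps)
  have h_diff: "h (c - d) = h c \<ominus> h d" if "c \<in> carrier G" "d \<in> carrier G" for c d
  proof -
    have "h c = h (c - d) \<oplus> h d" using h_add[OF G_closed(2)[OF that] that(2)] by simp
    then show ?thesis using h.hom_closed[OF that(2)] h.hom_closed[OF G_closed(2)[OF that]]
      by (simp add: minus_eq a_assoc r_neg)
  qed
  have h_frag: "h (frag_of (m, a)) = \<phi> m \<otimes> a" if "m \<in> carrier Z2_line" "a \<in> carrier A" for m a
    using h(2)[of "(m, a)"] that by (simp add: u_def)
  note [simp] = frag_in_G G_closed Z2_line_add_closed Z2_line_smult_closed h_diff h_frag
    Z2_line_subset alg_homD[OF \<phi>]
  have rel: "h c = \<zero>" if "c \<in> tensor_relations Z2_alg Z2_line \<phi> A" for c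
    using that unfolding tensor_relations_def Z2_line_simps(2,3)
  proof (elim UnE CollectE exE conjE)
    fix m m' a assume "c = frag_of (m \<oplus>\<^bsub>Z2_alg\<^esub> m', a) - frag_of (m, a) - frag_of (m', a)"
      "m \<in> carrier Z2_line" "m' \<in> carrier Z2_line" "a \<in> carrier A"
    then show ?thesis by (simp add: l_distr minus_eq a_ac r_neg)
  next
    fix m a a' assume "c = frag_of (m, a \<oplus> a') - frag_of (m, a) - frag_of (m, a')"
      "m \<in> carrier Z2_line" "a \<in> carrier A" "a' \<in> carrier A"
    then show ?thesis by (simp add: r_distr minus_eq a_ac r_neg)
  next
    fix r m a assume "c = frag_of (m \<otimes>\<^bsub>Z2_alg\<^esub> r, a) - frag_of (m, \<phi> r \<otimes> a)"
      "r \<in> carrier Z2_alg" "m \<in> carrier Z2_line" "a \<in> carrier A"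
    then show ?thesis by (simp add: m_assoc)
  qed
  have "K \<subseteq> kernel G (add_monoid A) h"
    unfolding tensor_kernel_def
    by (rule group.generate_subgroup_incl[OF group_G _ h.subgroup_kernel])
      (use relations_in_G rel in \<open>auto simp: kernel_def\<close>)
  moreover have "frag_of (m0, a) \<in> coset (frag_of (m0, b))"
    using eq group.rcos_self[OF group_G frag_in_G[OF m0_line a] subgroup_K] unfolding Tp_eq by simp
  then obtain k where "k \<in> K" "frag_of (m0, a) = k + frag_of (m0, b)"
    unfolding r_coset_def G_simps by blast
  ultimately have "h (frag_of (m0, a)) = h k \<oplus> h (frag_of (m0, b))" "h k = \<zero>"
    using h_add K_subset b by (auto simp: kernel_def m0_line)
  then show ?thesis using a b by (simp add: m0_line \<phi>_m0)
qed

lemma Tp_eq_iff: "a \<in> carrier A \<Longrightarrow> b \<in> carrier A \<Longrightarrow> Tp a = Tp b \<longleftrightarrow> omg \<otimes> a = omg \<otimes> b"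
  using Tp_eq_imp Tp_omg by metis

text \<open>\<open>Tp\<close> maps A(E) onto the module, and
  \<open>Tp a \<mapsto> (1 / 2) \<odot> (omg \<otimes> a)\<close> is a section of it.\<close>

lemma projective_T: "projective_right_module TYPE('m) TYPE('k) A T"
proof -
  define i where "i t = (1 / 2) \<odot> (omg \<otimes> (SOME a. a \<in> carrier A \<and> Tp a = t))" for t
  have i: "i (Tp a) = (1 / 2) \<odot> (omg \<otimes> a)" if a: "a \<in> carrier A" for a
  proof -
    define b where "b = (SOME b. b \<in> carrier A \<and> Tp b = Tp a)"
    have "b \<in> carrier A \<and> Tp b = Tp a"
      unfolding b_def by (rule someI[of _ a]) (simp add: a)
    then have "omg \<otimes> b = omg \<otimes> a" using a by (intro Tp_eq_imp) auto
    then show ?thesis unfolding i_def b_def[symmetric] by simp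
  qed
  have all: "P t" if "t \<in> carrier T" "\<And>a. a \<in> carrier A \<Longrightarrow> P (Tp a)" for P t
    using that Tp_surj by (metis imageE)
  show ?thesis
  proof (rule projective_retract[OF projective_regular right_module_T _ Tp_hom])
    show "Tp (i t) = t" if "t \<in> carrier T" for t
      by (rule all[OF that]) (simp add: i Tp_omg)
    show "i \<in> right_module_hom A T (regular_module A)"
    proof (rule right_module_homI)
      show "i t \<in> carrier (regular_module A)" if "t \<in> carrier T" for t
        by (rule all[OF that]) (simp add: i)
      show "i (s \<oplus>\<^bsub>T\<^esub> t) = i s \<oplus>\<^bsub>regular_module A\<^esub> i t" if "s \<in> carrier T" "t \<in> carrier T" for s t
        by (rule all[OF that(1)], rule all[OF that(2)]) (simp add: i Tp_add r_distr smult_add_right)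
      show "i (r \<odot>\<^bsub>T\<^esub> t) = r \<odot>\<^bsub>regular_module A\<^esub> i t" if "r \<in> carrier A" "t \<in> carrier T" for r t
        by (rule all[OF that(2)]) (use that(1) in \<open>simp add: i Tp_smult m_assoc smult_mult_left\<close>)
    qed
  qed
qed

end

section \<open>Derivations out of A(E), obtained from triangular algebras\<close>

section \<open>Triangular algebras and derivations\<close>

text \<open>
  The matrices with rows \<open>(z, m)\<close> and \<open>(0, a)\<close>. A homomorphism from \<open>A\<close> of the form
  \<open>a \<mapsto> (\<epsilon>(a), d(a), a)\<close> is the same as an \<open>\<epsilon>\<close>-derivation \<open>d\<close> into the right module \<open>M\<close>, so the
  universal property of \<open>A(E)\<close> yields derivations with prescribed values on the generators.
\<close>

definition tri_alg ::
  "(complex, 'a) module \<Rightarrow> ('a, 'm) module \<Rightarrow> (complex, complex \<times> 'm \<times> 'a) module" where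
  "tri_alg A M =
     \<lparr>carrier = UNIV \<times> carrier M \<times> carrier A,
      monoid.mult = (\<lambda>(z, m, a) (z', m', a').
        (z * z', (z \<odot>\<^bsub>A\<^esub> \<one>\<^bsub>A\<^esub>) \<odot>\<^bsub>M\<^esub> m' \<oplus>\<^bsub>M\<^esub> a' \<odot>\<^bsub>M\<^esub> m, a \<otimes>\<^bsub>A\<^esub> a')),
      monoid.one = (1, \<zero>\<^bsub>M\<^esub>, \<one>\<^bsub>A\<^esub>), ring.zero = (0, \<zero>\<^bsub>M\<^esub>, \<zero>\<^bsub>A\<^esub>),
      ring.add = (\<lambda>(z, m, a) (z', m', a'). (z + z', m \<oplus>\<^bsub>M\<^esub> m', a \<oplus>\<^bsub>A\<^esub> a')),
      smult = (\<lambda>c (z, m, a). (c * z, (c \<odot>\<^bsub>A\<^esub> \<one>\<^bsub>A\<^esub>) \<odot>\<^bsub>M\<^esub> m, c \<odot>\<^bsub>A\<^esub> a))\<rparr>"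

lemma tri_alg_simps:
  "p \<in> carrier (tri_alg A M) \<longleftrightarrow> fst (snd p) \<in> carrier M \<and> snd (snd p) \<in> carrier A"
  "(z, m, a) \<otimes>\<^bsub>tri_alg A M\<^esub> (z', m', a') =
     (z * z', (z \<odot>\<^bsub>A\<^esub> \<one>\<^bsub>A\<^esub>) \<odot>\<^bsub>M\<^esub> m' \<oplus>\<^bsub>M\<^esub> a' \<odot>\<^bsub>M\<^esub> m, a \<otimes>\<^bsub>A\<^esub> a')"
  "(z, m, a) \<oplus>\<^bsub>tri_alg A M\<^esub> (z', m', a') = (z + z', m \<oplus>\<^bsub>M\<^esub> m', a \<oplus>\<^bsub>A\<^esub> a')"
  "\<one>\<^bsub>tri_alg A M\<^esub> = (1, \<zero>\<^bsub>M\<^esub>, \<one>\<^bsub>A\<^esub>)" "\<zero>\<^bsub>tri_alg A M\<^esub> = (0, \<zero>\<^bsub>M\<^esub>, \<zero>\<^bsub>A\<^esub>)"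
  "c \<odot>\<^bsub>tri_alg A M\<^esub> (z, m, a) = (c * z, (c \<odot>\<^bsub>A\<^esub> \<one>\<^bsub>A\<^esub>) \<odot>\<^bsub>M\<^esub> m, c \<odot>\<^bsub>A\<^esub> a)"
  by (cases p) (auto simp: tri_alg_def)

lemma (in abelian_monoid) finsum_pair:
  fixes h :: "'i::finite \<Rightarrow> 'j::finite \<Rightarrow> 'a"
  assumes h: "\<And>i j. h i j \<in> carrier G"
  shows "(\<Oplus>p\<in>UNIV. h (fst p) (snd p)) = (\<Oplus>i\<in>UNIV. \<Oplus>j\<in>UNIV. h i j)"
proof -
  have "(\<Oplus>p\<in>I \<times> UNIV. h (fst p) (snd p)) = (\<Oplus>i\<in>I. \<Oplus>j\<in>UNIV. h i j)" for I :: "'i set"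
  proof (induction I rule: infinite_finite_induct)
    case (insert i I)
    have "insert i I \<times> (UNIV :: 'j set) = Pair i ` UNIV \<union> I \<times> UNIV" by auto
    then have "(\<Oplus>p\<in>insert i I \<times> UNIV. h (fst p) (snd p)) =
        (\<Oplus>p\<in>Pair i ` UNIV. h (fst p) (snd p)) \<oplus> (\<Oplus>p\<in>I \<times> UNIV. h (fst p) (snd p))"
      using insert h by (simp only:) (subst finsum_Un_disjoint, auto)
    moreover have "(\<Oplus>p\<in>Pair i ` UNIV. h (fst p) (snd p)) = (\<Oplus>j\<in>UNIV. h i j)"
      using h by (subst finsum_reindex) (auto simp: inj_on_def)
    ultimately show ?case using insert h by simp
  qed simp_all
  from this[of UNIV] show ?thesis by simp
qed

context complex_algebra begin

context
  fixes M :: "('a, 'm) module"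
  assumes M: "right_module A M"
begin

interpretation M: right_module A M by (rule M)

lemma scalar_action:
  assumes "m \<in> carrier M"
  shows "((z + w) \<odot> \<one>) \<odot>\<^bsub>M\<^esub> m = (z \<odot> \<one>) \<odot>\<^bsub>M\<^esub> m \<oplus>\<^bsub>M\<^esub> (w \<odot> \<one>) \<odot>\<^bsub>M\<^esub> m"
    and "(z \<odot> \<one>) \<odot>\<^bsub>M\<^esub> ((w \<odot> \<one>) \<odot>\<^bsub>M\<^esub> m) = ((z * w) \<odot> \<one>) \<odot>\<^bsub>M\<^esub> m"
    and "(1 \<odot> \<one>) \<odot>\<^bsub>M\<^esub> m = m"
    and "a \<in> carrier A \<Longrightarrow> (z \<odot> \<one>) \<odot>\<^bsub>M\<^esub> (a \<odot>\<^bsub>M\<^esub> m) = (z \<odot> a) \<odot>\<^bsub>M\<^esub> m"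
    and "a \<in> carrier A \<Longrightarrow> a \<odot>\<^bsub>M\<^esub> ((z \<odot> \<one>) \<odot>\<^bsub>M\<^esub> m) = (z \<odot> a) \<odot>\<^bsub>M\<^esub> m"
  using assms
  by (simp_all add: smult_add_left M.rsmult_distr_ring M.rsmult_assoc[symmetric] smult_mult_left
      smult_mult_right smult_smult smult_one M.rsmult_one mult.commute)

lemma complex_algebra_tri: "complex_algebra (tri_alg A M)"
proof (rule complex_algebraI)
  note [simp] = M.rsmult_closed
  show "ring (tri_alg A M)"
  proof (rule ringI)
    show "abelian_group (tri_alg A M)"
    proof (rule abelian_groupI)
      fix p assume "p \<in> carrier (tri_alg A M)"
      then show "\<exists>q\<in>carrier (tri_alg A M). q \<oplus>\<^bsub>tri_alg A M\<^esub> p = \<zero>\<^bsub>tri_alg A M\<^esub>"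
        by (cases p) (auto simp: tri_alg_simps M.M.l_neg l_neg
          intro!: bexI[of _ "(- fst p, \<ominus>\<^bsub>M\<^esub> fst (snd p), \<ominus> snd (snd p))"])
    qed (auto simp: tri_alg_simps a_ac M.M.a_ac)
    show "Group.monoid (tri_alg A M)"
    proof (rule monoidI)
      fix p q r assume "p \<in> carrier (tri_alg A M)" "q \<in> carrier (tri_alg A M)" "r \<in> carrier (tri_alg A M)"
      then show "p \<otimes>\<^bsub>tri_alg A M\<^esub> q \<otimes>\<^bsub>tri_alg A M\<^esub> r = p \<otimes>\<^bsub>tri_alg A M\<^esub> (q \<otimes>\<^bsub>tri_alg A M\<^esub> r)"
        by (cases p; cases q; cases r)
          (auto simp: tri_alg_simps m_assoc M.rsmult_distr_module scalar_action smult_smult M.rsmult_assoc M.M.a_ac mult.commute)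
    qed (auto simp: tri_alg_simps M.rsmult_zero_module scalar_action M.rsmult_one)
  qed (auto simp: tri_alg_simps M.rsmult_distr_module M.rsmult_distr_ring scalar_action l_distr r_distr
      M.M.a_ac algebra_simps)
qed (auto simp: tri_alg_simps M.rsmult_closed smult_add_left smult_add_right smult_smult smult_one smult_mult_left
    smult_mult_right scalar_action M.rsmult_distr_module M.rsmult_distr_ring M.rsmult_one M.rsmult_assoc algebra_simps)

text \<open>The third homomorphism is the first one followed by the unit of A. It lets both sides of
  the Leibniz rule be written with values in A.\<close>

lemma tri_alg_homs:
  "fst \<in> alg_hom (tri_alg A M) complex_alg" "(\<lambda>p. snd (snd p)) \<in> alg_hom (tri_alg A M) A"
  "(\<lambda>p. fst p \<odot> \<one>) \<in> alg_hom (tri_alg A M) A"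
  by (rule alg_homI; auto simp: tri_alg_simps complex_alg_def smult_add_left smult_mult_left
      smult_mult_right smult_smult smult_one mult.commute)+

end

lemma add_minus_cancel: "a \<in> carrier A \<Longrightarrow> b \<in> carrier A \<Longrightarrow> (a \<oplus> b) \<ominus> b = a"
  by (simp add: minus_eq a_assoc r_neg)

lemma matr_add_zero:
  "U \<in> mats \<Longrightarrow> matr_add A U (\<lambda>i j. \<zero>) = U" "U \<in> mats \<Longrightarrow> matr_add A (\<lambda>i j. \<zero>) U = U"
  by (simp_all add: matr_add_def)

lemma matr_mult_zero:
  "U \<in> mats \<Longrightarrow> U \<star> (\<lambda>i j. \<zero>) = (\<lambda>i j. \<zero>)" "U \<in> mats \<Longrightarrow> (\<lambda>i j. \<zero>) \<star> U = (\<lambda>i j. \<zero>)"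
  by (simp_all add: matr_mult_def)

lemma zero_mats [simp]: "(\<lambda>i j. \<zero>) \<in> mats"
  by (simp add: matr_module_simps)

text \<open>A twisted derivation with values in A rather than in a module, since it will be applied
  to a single matrix entry of the middle component of a triangular algebra.\<close>

context
  fixes R :: "(complex, 'r) module" and z al d :: "'r \<Rightarrow> 'a"
  assumes R: "complex_algebra R" and z: "z \<in> alg_hom R A" and al: "al \<in> alg_hom R A"
    and d_closed: "\<And>s. s \<in> carrier R \<Longrightarrow> d s \<in> carrier A"
    and d_add: "\<And>s t. s \<in> carrier R \<Longrightarrow> t \<in> carrier R \<Longrightarrow> d (s \<oplus>\<^bsub>R\<^esub> t) = d s \<oplus> d t"
    and d_mult: "\<And>s t. s \<in> carrier R \<Longrightarrow> t \<in> carrier R \<Longrightarrow> d (s \<otimes>\<^bsub>R\<^esub> t) = z s \<otimes> d t \<oplus> d s \<otimes> al t"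
    and d_const: "\<And>c. d (c \<odot>\<^bsub>R\<^esub> \<one>\<^bsub>R\<^esub>) = \<zero>"
begin

interpretation R: complex_algebra R by (rule R)

lemma d_zero: "d \<zero>\<^bsub>R\<^esub> = \<zero>"
  using d_add[of "\<zero>\<^bsub>R\<^esub>" "\<zero>\<^bsub>R\<^esub>"] d_closed[of "\<zero>\<^bsub>R\<^esub>"] by simp

lemma d_finsum: "h \<in> I \<rightarrow> carrier R \<Longrightarrow> d (finsum R h I) = (\<Oplus>i\<in>I. d (h i))"
  by (induction I rule: infinite_finite_induct) (auto simp: d_zero d_add d_closed Pi_def)

lemma d_matr_mult:
  assumes U: "U \<in> R.mats" and V: "V \<in> R.mats"
  shows "(\<lambda>i j. d (matr_mult R U V i j)) =
    matr_add A ((\<lambda>i j. z (U i j)) \<star> (\<lambda>i j. d (V i j))) ((\<lambda>i j. d (U i j)) \<star> (\<lambda>i j. al (V i j)))"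
proof (intro HOL.ext)
  fix i j
  have "d (matr_mult R U V i j) = (\<Oplus>k\<in>UNIV. z (U i k) \<otimes> d (V k j) \<oplus> d (U i k) \<otimes> al (V k j))"
    unfolding matr_mult_def using U V
    by (subst d_finsum) (auto simp: d_mult d_closed alg_homD[OF z] alg_homD[OF al] simp del: finsum_addf intro!: finsum_cong')
  also have "\<dots> = (\<Oplus>k\<in>UNIV. z (U i k) \<otimes> d (V k j)) \<oplus> (\<Oplus>k\<in>UNIV. d (U i k) \<otimes> al (V k j))"
    using U V by (intro finsum_addf) (auto simp: d_closed alg_homD[OF z] alg_homD[OF al])
  finally show "d (matr_mult R U V i j) = matr_add A ((\<lambda>i j. z (U i j)) \<star> (\<lambda>i j. d (V i j)))
      ((\<lambda>i j. d (U i j)) \<star> (\<lambda>i j. al (V i j))) i j"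
    by (simp add: matr_add_def matr_mult_def)
qed

context
  fixes E :: "complex^'n::finite^'n" and Y :: "('n, 'r) matr"
  assumes E: "E ** matrix_inv E = mat 1" "matrix_inv E ** E = mat 1"
    and Y: "Y \<in> R.mats" and zY: "(\<lambda>i j. z (Y i j)) = cm (mat 1)"
begin

text \<open>The Leibniz rule at a point that \<open>z\<close> sends to the identity matrix:
  constants are killed, so one term remains for each occurrence of \<open>Y\<close>.\<close>

lemma d_B_left_right:
  assumes S: "S = (\<lambda>i j. d (Y i j))" and W: "W = (\<lambda>i j. al (Y i j))"
  shows "(\<lambda>i j. d (B_left R E Y i j)) =
    matr_add A S (cm (matrix_inv E) \<star> matr_transpose S \<star> cm E \<star> W)"
    and "(\<lambda>i j. d (B_right R E Y i j)) = matr_add A (cm (matrix_inv E) \<star> matr_transpose S \<star> cm E)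
      (S \<star> cm (matrix_inv E) \<star> matr_transpose W \<star> cm E)"
proof -
  let ?Ei = "matrix_inv E"
  have Sm [simp]: "S \<in> mats" and Xm [simp]: "W \<in> mats"
    using Y by (auto simp: S W d_closed alg_homD[OF al] intro!: matsI)
  have dc: "(\<lambda>i j. d (matr_const R C i j)) = (\<lambda>i j. \<zero>)" for C :: "complex^'n^'n"
    by (simp add: matr_const_def d_const)
  have zc: "(\<lambda>i j. z (matr_const R C i j)) = cm C" "(\<lambda>i j. al (matr_const R C i j)) = cm C" for C :: "complex^'n^'n"
    by (simp_all add: alg_hom_matr_const[OF z R] alg_hom_matr_const[OF al R])
  have zm: "(\<lambda>i j. z (matr_mult R U V i j)) = (\<lambda>i j. z (U i j)) \<star> (\<lambda>i j. z (V i j))"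
    if "U \<in> R.mats" "V \<in> R.mats" for U V :: "('n, 'r) matr"
    by (intro HOL.ext alg_hom_matr_mult[OF z R complex_algebra_axioms that])
  have t: "(\<lambda>i j. d (matr_transpose Y i j)) = matr_transpose S"
    "(\<lambda>i j. al (matr_transpose Y i j)) = matr_transpose W"
    "(\<lambda>i j. z (matr_transpose Y i j)) = cm (mat 1)"
    using fun_cong[OF fun_cong[OF zY]]
    by (auto simp: matr_transpose_def S W matr_const_def mat_def fun_eq_iff)
  note simps = d_matr_mult dc zc zm zY t S[symmetric] W[symmetric] Y matr_mult_zero matr_add_zero
    cm_mult_cm cm_1_mult mult_cm_1 E
  show "(\<lambda>i j. d (B_left R E Y i j)) =
      matr_add A S (cm (matrix_inv E) \<star> matr_transpose S \<star> cm E \<star> W)"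
    unfolding B_left_def by (simp add: simps)
  show "(\<lambda>i j. d (B_right R E Y i j)) = matr_add A (cm (matrix_inv E) \<star> matr_transpose S \<star> cm E)
      (S \<star> cm (matrix_inv E) \<star> matr_transpose W \<star> cm E)"
    unfolding B_right_def by (simp add: simps matr_add_mult)
qed

end

end

end

context A_algebra begin

text \<open>\<open>Phi1\<close> on representatives, free of the definite description and of the
  tensor product.\<close>

definition phi1 :: "('n, 'n A_elem) matr \<Rightarrow> 'n A_elem \<Rightarrow> 'n A_elem" where
  "phi1 U a = (matr_trace A (matr_transpose x \<star> U) \<ominus> matr_trace A U) \<oplus> omg \<otimes> a"

text \<open>In this form the image is visibly the right ideal generated by the
  \<open>x_ij - \<delta>_ij\<close> and \<open>1 - g\<close>.\<close>

lemma phi1_expand: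
  assumes U: "U \<in> mats" and a: "a \<in> carrier A"
  shows "phi1 U a = (\<Oplus>p\<in>UNIV. (x (fst p) (snd p) \<ominus> matr_const A (mat 1) (fst p) (snd p)) \<otimes> U (fst p) (snd p))
    \<oplus> omg \<otimes> a"
proof -
  have c: "cm (mat 1) i j \<in> carrier A" "x i j \<in> carrier A" "U i j \<in> carrier A" for i j :: 'n
    using U by (auto intro!: matsD)
  have tr1: "matr_trace A (matr_transpose x \<star> U) = (\<Oplus>k\<in>UNIV. \<Oplus>i\<in>UNIV. x k i \<otimes> U k i)"
    unfolding matr_trace_def matr_mult_def matr_transpose_def
    using c by (intro finsum_swap) auto
  have tr2: "matr_trace A U = (\<Oplus>k\<in>UNIV. \<Oplus>i\<in>UNIV. cm (mat 1) k i \<otimes> U k i)"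
  proof -
    have "(\<Oplus>i\<in>UNIV. cm (mat 1) k i \<otimes> U k i) = U k k" for k
    proof -
      have "(\<Oplus>i\<in>UNIV. cm (mat 1) k i \<otimes> U k i) = (\<Oplus>i\<in>UNIV. if k = i then U k i else \<zero>)"
        using c by (intro finsum_cong') (auto simp: matr_const_def mat_def smult_one)
      then show ?thesis using finsum_delta(2)[of UNIV k "\<lambda>i. U k i"] c by simp
    qed
    then show ?thesis by (simp add: matr_trace_def)
  qed
  have sum: "(\<Oplus>p\<in>UNIV. (x (fst p) (snd p) \<ominus> cm (mat 1) (fst p) (snd p)) \<otimes> U (fst p) (snd p)) \<oplus>
      (\<Oplus>k\<in>UNIV. \<Oplus>i\<in>UNIV. cm (mat 1) k i \<otimes> U k i) = (\<Oplus>k\<in>UNIV. \<Oplus>i\<in>UNIV. x k i \<otimes> U k i)"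
  proof -
    have "(x k i \<ominus> cm (mat 1) k i) \<otimes> U k i \<oplus> cm (mat 1) k i \<otimes> U k i = x k i \<otimes> U k i" for k i
    proof -
      have "(x k i \<ominus> cm (mat 1) k i) \<otimes> U k i \<oplus> cm (mat 1) k i \<otimes> U k i =
          (x k i \<ominus> cm (mat 1) k i \<oplus> cm (mat 1) k i) \<otimes> U k i"
        using c by (simp only: l_distr minus_closed)
      also have "x k i \<ominus> cm (mat 1) k i \<oplus> cm (mat 1) k i = x k i"
        using c[of k i] by (simp add: minus_eq a_assoc l_neg)
      finally show ?thesis .
    qed
    then have "(\<Oplus>k\<in>UNIV. \<Oplus>i\<in>UNIV. x k i \<otimes> U k i) =
        (\<Oplus>k\<in>UNIV. \<Oplus>i\<in>UNIV. (x k i \<ominus> cm (mat 1) k i) \<otimes> U k i \<oplus> cm (mat 1) k i \<otimes> U k i)" by simp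
    also have "\<dots> = (\<Oplus>k\<in>UNIV. (\<Oplus>i\<in>UNIV. (x k i \<ominus> cm (mat 1) k i) \<otimes> U k i) \<oplus> (\<Oplus>i\<in>UNIV. cm (mat 1) k i \<otimes> U k i))"
      using c by (intro finsum_cong' finsum_addf) auto
    also have "\<dots> = (\<Oplus>k\<in>UNIV. \<Oplus>i\<in>UNIV. (x k i \<ominus> cm (mat 1) k i) \<otimes> U k i) \<oplus>
        (\<Oplus>k\<in>UNIV. \<Oplus>i\<in>UNIV. cm (mat 1) k i \<otimes> U k i)"
      using c by (intro finsum_addf) auto
    finally show ?thesis using finsum_pair[of "\<lambda>k i. (x k i \<ominus> cm (mat 1) k i) \<otimes> U k i"] c by simp
  qed
  have closed: "(\<Oplus>p\<in>UNIV. (x (fst p) (snd p) \<ominus> cm (mat 1) (fst p) (snd p)) \<otimes> U (fst p) (snd p)) \<in> carrier A"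
    "(\<Oplus>k\<in>UNIV. \<Oplus>i\<in>UNIV. cm (mat 1) k i \<otimes> U k i) \<in> carrier A"
    using c by (auto intro!: finsum_closed)
  have "matr_trace A (matr_transpose x \<star> U) \<ominus> matr_trace A U =
      (\<Oplus>p\<in>UNIV. (x (fst p) (snd p) \<ominus> cm (mat 1) (fst p) (snd p)) \<otimes> U (fst p) (snd p))"
    unfolding tr1 tr2 sum[symmetric] by (rule add_minus_cancel[OF closed])
  then show ?thesis by (simp add: phi1_def)
qed

text \<open>With \<open>q\<close> the identity this is the value of a derivation on a combination of
  the augmentation generators. A general \<open>q\<close> is allowed because later the relations of
  B(E) hold only modulo an ideal of the triangular algebra. The sign at \<open>g\<close> makes
  \<open>1 - g\<close> go to \<open>\<nu>\<close>.\<close>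

lemma tri_hom_phi1:
  fixes M :: "('n A_elem, 'm) module"
  assumes M: "right_module A M" and R: "complex_algebra R"
    and q: "q \<in> alg_hom (tri_alg A M) R" and k: "k \<in> alg_hom A R"
    and \<mu>: "\<And>i j. \<mu> i j \<in> carrier M" and \<nu>: "\<nu> \<in> carrier M"
    and kx: "\<And>i j. k (x i j) = q ((mat 1 :: complex^'n^'n) $ i $ j, \<mu> i j, x i j)"
    and kg: "k g = q (1, \<ominus>\<^bsub>M\<^esub> \<nu>, g)"
    and U: "U \<in> mats" and a: "a \<in> carrier A"
  shows "k (phi1 U a) =
    q (0, (\<Oplus>\<^bsub>M\<^esub>p\<in>UNIV. U (fst p) (snd p) \<odot>\<^bsub>M\<^esub> \<mu> (fst p) (snd p)) \<oplus>\<^bsub>M\<^esub> a \<odot>\<^bsub>M\<^esub> \<nu>, phi1 U a)"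
proof -
  interpret M: right_module A M by (rule M)
  interpret R: complex_algebra R by (rule R)
  interpret T: complex_algebra "tri_alg A M" by (rule complex_algebra_tri[OF M])
  note tsimps = tri_alg_simps M.rsmult_closed M.rsmult_zero_module M.rsmult_zero_ring
  \<comment> \<open>By induction over the generators, each value of \<open>k\<close> comes from a
    triangular matrix whose last diagonal entry is the argument itself.\<close>
  have ex: "\<exists>z m. m \<in> carrier M \<and> k s = q (z, m, s)" if s: "s \<in> carrier A" for s
    using s unfolding A_eq
  proof (induction s rule: A_alg_induct)
    case (gen_x i j)
    then show ?case using kx \<mu> by blast
  next
    case gen_g
    then show ?case using kg \<nu> by blast
  next
    case one
    have "k \<one> = q \<one>\<^bsub>tri_alg A M\<^esub>" by (simp only: alg_homD(4)[OF k] alg_homD(4)[OF q])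
    then show ?case unfolding A_eq[symmetric] by (auto simp: tri_alg_simps)
  next
    case (add s t)
    then obtain z m z' m' where m: "m \<in> carrier M" "k s = q (z, m, s)" "m' \<in> carrier M" "k t = q (z', m', t)" by blast
    have "k (s \<oplus> t) = q ((z, m, s) \<oplus>\<^bsub>tri_alg A M\<^esub> (z', m', t))"
      using add m unfolding A_eq[symmetric] by (simp add: alg_homD(2)[OF k] alg_homD(2)[OF q] tri_alg_simps(1))
    then have "k (s \<oplus> t) = q (z + z', m \<oplus>\<^bsub>M\<^esub> m', s \<oplus> t)" by (simp add: tri_alg_simps)
    then show ?case using m M.M.a_closed unfolding A_eq[symmetric] by blast
  next
    case (mult s t)
    then obtain z m z' m' where m: "m \<in> carrier M" "k s = q (z, m, s)" "m' \<in> carrier M" "k t = q (z', m', t)" by blast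
    have "k (s \<otimes> t) = q ((z, m, s) \<otimes>\<^bsub>tri_alg A M\<^esub> (z', m', t))"
      using mult m unfolding A_eq[symmetric] by (simp add: alg_homD(3)[OF k] alg_homD(3)[OF q] tri_alg_simps(1))
    then have "k (s \<otimes> t) = q (z * z', (z \<odot> \<one>) \<odot>\<^bsub>M\<^esub> m' \<oplus>\<^bsub>M\<^esub> t \<odot>\<^bsub>M\<^esub> m, s \<otimes> t)"
      by (simp add: tri_alg_simps)
    moreover have "(z \<odot> \<one>) \<odot>\<^bsub>M\<^esub> m' \<oplus>\<^bsub>M\<^esub> t \<odot>\<^bsub>M\<^esub> m \<in> carrier M"
      using m mult unfolding A_eq[symmetric] by (simp add: M.rsmult_closed)
    ultimately show ?case unfolding A_eq[symmetric] by blast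
  next
    case (smult c s)
    then obtain z m where m: "m \<in> carrier M" "k s = q (z, m, s)" by blast
    have "k (c \<odot> s) = q (c \<odot>\<^bsub>tri_alg A M\<^esub> (z, m, s))"
      using smult m unfolding A_eq[symmetric] by (simp add: alg_homD(5)[OF k] alg_homD(5)[OF q] tri_alg_simps(1))
    then have "k (c \<odot> s) = q (c * z, (c \<odot> \<one>) \<odot>\<^bsub>M\<^esub> m, c \<odot> s)" by (simp add: tri_alg_simps)
    then show ?case using M.rsmult_closed[OF smult_closed[OF one_closed] m(1)]
      unfolding A_eq[symmetric] by blast
  qed
  \<comment> \<open>With first component zero the middle component of the right factor is multiplied
    by zero, so the unspecified one supplied by \<open>ex\<close> drops out.\<close>
  have left: "k (s \<otimes> t) = q (0, t \<odot>\<^bsub>M\<^esub> m, s \<otimes> t)"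
    if ks: "k s = q (0, m, s)" and s: "s \<in> carrier A" and t: "t \<in> carrier A" and m: "m \<in> carrier M" for s t m
  proof -
    obtain z' m' where m': "m' \<in> carrier M" "k t = q (z', m', t)" using ex[OF t] by blast
    have "k (s \<otimes> t) = q ((0, m, s) \<otimes>\<^bsub>tri_alg A M\<^esub> (z', m', t))"
      using s t m m' ks by (simp add: alg_homD(3)[OF k] alg_homD(3)[OF q] tri_alg_simps(1))
    then show ?thesis using s t m m' by (simp add: tsimps)
  qed
  have kdiff: "k (s \<ominus> t) = q (0, m \<ominus>\<^bsub>M\<^esub> m', s \<ominus> t)"
    if "k s = q (z, m, s)" "k t = q (z, m', t)" "m \<in> carrier M" "m' \<in> carrier M" "s \<in> carrier A" "t \<in> carrier A"
    for s t z m m'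
  proof -
    have "(z, m, s) \<ominus>\<^bsub>tri_alg A M\<^esub> (z, m', t) = (0, m \<ominus>\<^bsub>M\<^esub> m', s \<ominus> t)"
    proof -
      have "(0, m \<ominus>\<^bsub>M\<^esub> m', s \<ominus> t) \<oplus>\<^bsub>tri_alg A M\<^esub> (z, m', t) = (z, m, s)"
        using that by (simp add: tri_alg_simps minus_eq a_assoc l_neg M.M.minus_eq M.M.a_assoc M.M.l_neg)
      moreover have "(0, m \<ominus>\<^bsub>M\<^esub> m', s \<ominus> t) \<in> carrier (tri_alg A M)" "(z, m', t) \<in> carrier (tri_alg A M)"
        using that by (auto simp: tri_alg_simps)
      ultimately show ?thesis by (metis T.add_minus_cancel)
    qed
    moreover have "k (s \<ominus> t) = q ((z, m, s) \<ominus>\<^bsub>tri_alg A M\<^esub> (z, m', t))"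
      using that alg_hom_minus[OF k complex_algebra_axioms R]
        alg_hom_minus[OF q T.complex_algebra_axioms R] by (simp add: tri_alg_simps(1))
    ultimately show ?thesis by simp
  qed
  have kone: "k (c \<odot> \<one>) = q (c, \<zero>\<^bsub>M\<^esub>, c \<odot> \<one>)" for c
  proof -
    have "k (c \<odot> \<one>) = q (c \<odot>\<^bsub>tri_alg A M\<^esub> \<one>\<^bsub>tri_alg A M\<^esub>)"
      by (simp add: alg_homD[OF k] alg_homD[OF q])
    then show ?thesis by (simp add: tsimps)
  qed
  have mz: "m \<ominus>\<^bsub>M\<^esub> \<zero>\<^bsub>M\<^esub> = m" if "m \<in> carrier M" for m
    using that M.M.add.inv_unique'[OF M.M.zero_closed M.M.zero_closed]
    by (simp add: M.M.minus_eq a_inv_def)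
  have kx': "k (x i j \<ominus> cm (mat 1) i j) = q (0, \<mu> i j, x i j \<ominus> cm (mat 1) i j)" for i j
    using kdiff[OF kx kone, of i j] \<mu> by (simp add: matr_const_def mz)
  have komg: "k omg = q (0, \<nu>, omg)"
  proof -
    have "k \<one> = q (1, \<zero>\<^bsub>M\<^esub>, \<one>)" using kone[of 1] by (simp add: smult_one)
    from kdiff[OF this kg] show ?thesis using \<nu> by (simp add: omg_def M.M.minus_eq M.M.minus_minus)
  qed
  define h where "h p = (x (fst p) (snd p) \<ominus> cm (mat 1) (fst p) (snd p)) \<otimes> U (fst p) (snd p)" for p
  define \<mu>' where "\<mu>' p = U (fst p) (snd p) \<odot>\<^bsub>M\<^esub> \<mu> (fst p) (snd p)" for p
  have c: "x i j \<ominus> cm (mat 1) i j \<in> carrier A" "U i j \<in> carrier A" for i j :: 'n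
    using U by (auto intro!: matsD minus_closed)
  have h: "h p \<in> carrier A" "\<mu>' p \<in> carrier M" "k (h p) = q (0, \<mu>' p, h p)" for p
    using c \<mu> by (auto simp: h_def \<mu>'_def left[OF kx'] M.rsmult_closed)
  have sums: "k (finsum A h I) = q (0, finsum M \<mu>' I, finsum A h I)" for I
  proof (induction I rule: infinite_finite_induct)
    case (insert p I)
    have "h \<in> I \<rightarrow> carrier A" "\<mu>' \<in> I \<rightarrow> carrier M" using h by auto
    then have "k (finsum A h (insert p I)) =
        q ((0, \<mu>' p, h p) \<oplus>\<^bsub>tri_alg A M\<^esub> (0, finsum M \<mu>' I, finsum A h I))"
      using insert h by (simp add: alg_homD(2)[OF k] alg_homD(2)[OF q] tri_alg_simps(1))
    then show ?case using insert h \<open>h \<in> _\<close> \<open>\<mu>' \<in> _\<close> by (simp add: tri_alg_simps)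
  qed (use kone[of 0] in simp_all)
  have "finsum A h UNIV \<in> carrier A" "finsum M \<mu>' UNIV \<in> carrier M" using h by auto
  then have "k (finsum A h UNIV \<oplus> omg \<otimes> a) =
      q ((0, finsum M \<mu>' UNIV, finsum A h UNIV) \<oplus>\<^bsub>tri_alg A M\<^esub> (0, a \<odot>\<^bsub>M\<^esub> \<nu>, omg \<otimes> a))"
    using a \<nu> sums by (simp add: alg_homD(2)[OF k] alg_homD(2)[OF q] tri_alg_simps(1) left[OF komg] M.rsmult_closed)
  also have "\<dots> = q (0, finsum M \<mu>' UNIV \<oplus>\<^bsub>M\<^esub> a \<odot>\<^bsub>M\<^esub> \<nu>, finsum A h UNIV \<oplus> omg \<otimes> a)"
    by (simp add: tri_alg_simps)
  finally show ?thesis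
    unfolding phi1_expand[OF U a] h_def \<mu>'_def .
qed

end

section \<open>Formal properties of the three maps\<close>

section \<open>The maps of the resolution\<close>

context complex_algebra begin

definition phi2 :: "complex^'n::finite^'n \<Rightarrow> ('n, 'a) matr \<Rightarrow> ('n, 'a) matr \<Rightarrow> ('n, 'a) matr" where
  "phi2 E x U = matr_add A U (matr_transpose (cm (matrix_inv E) \<star> matr_transpose x \<star> U \<star> cm E))"

definition phi3_matr :: "complex^'n::finite^'n \<Rightarrow> ('n, 'a) matr \<Rightarrow> ('n, 'a) matr" where
  "phi3_matr E x = matr_minus A (cm E \<star> x \<star> cm (transpose (matrix_inv E))) (cm (transpose E) \<star> cm (matrix_inv E))"

lemma matr_minus_mult:
  "U \<in> mats \<Longrightarrow> V \<in> mats \<Longrightarrow> W \<in> mats \<Longrightarrow> matr_minus A U V \<star> W = matr_minus A (U \<star> W) (V \<star> W)"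
  "U \<in> mats \<Longrightarrow> V \<in> mats \<Longrightarrow> W \<in> mats \<Longrightarrow> W \<star> matr_minus A U V = matr_minus A (W \<star> U) (W \<star> V)"
proof -
  have add: "matr_add A (matr_minus A U V) V = U" if "U \<in> mats" "V \<in> mats" for U V :: "('n::finite, 'a) matr"
    using that by (intro HOL.ext) (simp add: matr_add_def matr_minus_def minus_eq a_assoc l_neg)
  have minus: "matr_minus A (matr_add A U V) V = U" if "U \<in> mats" "V \<in> mats" for U V :: "('n::finite, 'a) matr"
    using that by (intro HOL.ext) (simp add: matr_add_def matr_minus_def add_minus_cancel)
  assume U: "U \<in> mats" and V: "V \<in> mats" and W: "W \<in> mats"
  have "matr_add A (matr_minus A U V \<star> W) (V \<star> W) = U \<star> W"
    using U V W by (simp add: matr_add_mult(1)[symmetric] add)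
  then show "matr_minus A U V \<star> W = matr_minus A (U \<star> W) (V \<star> W)"
    using minus[of "matr_minus A U V \<star> W" "V \<star> W"] U V W by simp
  have "matr_add A (W \<star> matr_minus A U V) (W \<star> V) = W \<star> U"
    using U V W by (simp add: matr_add_mult(2)[symmetric] add)
  then show "W \<star> matr_minus A U V = matr_minus A (W \<star> U) (W \<star> V)"
    using minus[of "W \<star> matr_minus A U V" "W \<star> V"] U V W by simp
qed

lemma smult_mult_cm:
  assumes "U \<in> mats" "a \<in> carrier A"
  shows "(a \<odot>\<^bsub>matr_module A\<^esub> U) \<star> cm C = a \<odot>\<^bsub>matr_module A\<^esub> (U \<star> cm C)"
proof (intro HOL.ext)
  fix i j
  have "a \<odot>\<^bsub>matr_module A\<^esub> U \<in> mats" using assms by (simp add: matr_module_simps)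
  then have "((a \<odot>\<^bsub>matr_module A\<^esub> U) \<star> cm C) i j = (\<Oplus>k\<in>UNIV. (C $ k $ j) \<odot> U i k \<otimes> a)"
    using assms by (simp add: mult_cm_entry smult_mult_left) (simp add: matr_module_simps)
  then show "((a \<odot>\<^bsub>matr_module A\<^esub> U) \<star> cm C) i j = (a \<odot>\<^bsub>matr_module A\<^esub> (U \<star> cm C)) i j"
    using assms by (simp add: matr_module_simps(4) mult_cm_entry finsum_ldistr)
qed

lemma matr_smult_mats [simp]: "U \<in> mats \<Longrightarrow> a \<in> carrier A \<Longrightarrow> a \<odot>\<^bsub>matr_module A\<^esub> U \<in> mats"
  by (simp add: matr_module_simps)

lemma matr_transpose_add: "matr_transpose (matr_add A U V) = matr_add A (matr_transpose U) (matr_transpose V)"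
  "matr_transpose (matr_minus A U V) = matr_minus A (matr_transpose U) (matr_transpose V)"
  by (simp_all add: matr_transpose_def matr_add_def matr_minus_def)

lemma B_rel_cancel:
  assumes x: "B_rel A E x" and E: "E ** matrix_inv E = mat 1" "matrix_inv E ** E = mat 1"
  shows "matr_transpose x \<star> (cm E \<star> x) = cm E"
    and "x \<star> (cm (matrix_inv E) \<star> matr_transpose x) = cm (matrix_inv E)"
    and "Z \<in> mats \<Longrightarrow> matr_transpose x \<star> (cm E \<star> (x \<star> Z)) = cm E \<star> Z"
    and "Z \<in> mats \<Longrightarrow> x \<star> (cm (matrix_inv E) \<star> (matr_transpose x \<star> Z)) = cm (matrix_inv E) \<star> Z"
proof -
  have xm [simp]: "x \<in> mats" using x by (simp add: B_rel_def)
  have "cm E \<star> B_left A E x = cm E \<star> cm (mat 1)" "B_right A E x \<star> cm (matrix_inv E) = cm (mat 1) \<star> cm (matrix_inv E)"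
    using x by (simp_all only: B_rel_def)
  then show 1: "matr_transpose x \<star> (cm E \<star> x) = cm E"
    "x \<star> (cm (matrix_inv E) \<star> matr_transpose x) = cm (matrix_inv E)"
    by (simp_all add: B_left_def B_right_def cm_mult_cm cm_mult_cm_mult matr_mult_assoc E cm_1_mult mult_cm_1)
  show "matr_transpose x \<star> (cm E \<star> (x \<star> Z)) = cm E \<star> Z" if "Z \<in> mats"
  proof -
    have "matr_transpose x \<star> (cm E \<star> x) \<star> Z = cm E \<star> Z" by (simp only: 1)
    then show ?thesis using that by (simp add: matr_mult_assoc)
  qed
  show "x \<star> (cm (matrix_inv E) \<star> (matr_transpose x \<star> Z)) = cm (matrix_inv E) \<star> Z" if "Z \<in> mats"
  proof -
    have "x \<star> (cm (matrix_inv E) \<star> matr_transpose x) \<star> Z = cm (matrix_inv E) \<star> Z" by (simp only: 1)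
    then show ?thesis using that by (simp add: matr_mult_assoc)
  qed
qed

lemma phi2_mats [simp]: "x \<in> mats \<Longrightarrow> U \<in> mats \<Longrightarrow> phi2 E x U \<in> mats"
  by (simp add: phi2_def)

lemma phi3_matr_mats [simp]: "x \<in> mats \<Longrightarrow> phi3_matr E x \<in> mats"
  by (simp add: phi3_matr_def)

lemma matr_add_add:
  "U \<in> mats \<Longrightarrow> V \<in> mats \<Longrightarrow> U' \<in> mats \<Longrightarrow> V' \<in> mats \<Longrightarrow>
    matr_add A (matr_add A U V) (matr_add A U' V') = matr_add A (matr_add A U U') (matr_add A V V')"
  by (intro HOL.ext) (simp add: matr_add_def a_ac)

lemma phi2_add:
  assumes "x \<in> mats" "U \<in> mats" "V \<in> mats"
  shows "phi2 E x (matr_add A U V) = matr_add A (phi2 E x U) (phi2 E x V)"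
  using assms by (simp add: phi2_def matr_add_mult matr_transpose_add matr_add_add)

lemma matr_add_smult:
  "U \<in> mats \<Longrightarrow> V \<in> mats \<Longrightarrow> a \<in> carrier A \<Longrightarrow>
    a \<odot>\<^bsub>matr_module A\<^esub> matr_add A U V = matr_add A (a \<odot>\<^bsub>matr_module A\<^esub> U) (a \<odot>\<^bsub>matr_module A\<^esub> V)"
  by (intro HOL.ext) (simp add: matr_module_simps matr_add_def l_distr)

lemma phi2_smult:
  assumes "x \<in> mats" "U \<in> mats" "a \<in> carrier A"
  shows "phi2 E x (a \<odot>\<^bsub>matr_module A\<^esub> U) = a \<odot>\<^bsub>matr_module A\<^esub> phi2 E x U"
  using assms
  by (simp add: phi2_def matr_add_smult smult_eq_matr smult_mult_cm matr_transpose_smult)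

text \<open>The map \<open>U \<mapsto> (E^-1 x^t U E)^t\<close> exchanges the two matrices
  \<open>E x E^-t\<close> and \<open>E^t E^-1\<close>, so their difference is sent to its
  negative.\<close>

lemma phi2_phi3_matr:
  fixes E :: "complex^'n::finite^'n"
  assumes x: "B_rel A E x" and E: "E ** matrix_inv E = mat 1" "matrix_inv E ** E = mat 1"
  shows "phi2 E x (phi3_matr E x) = (\<lambda>i j. \<zero>)"
proof -
  have xm [simp]: "x \<in> mats" using x by (simp add: B_rel_def)
  let ?Ei = "matrix_inv E"
  have cancel: "?Ei ** (E ** Z) = Z" "E ** (?Ei ** Z) = Z" for Z :: "complex^'n^'n"
    by (simp_all add: matrix_mul_assoc E)
  note simps = cm_mult_cm cm_mult_cm_mult matr_mult_assoc matrix_mul_assoc[symmetric] E cancel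
    matrix_mul_lid matrix_mul_rid cm_1_mult mult_cm_1 B_rel_cancel[OF x E]
  define K1 where "K1 = cm E \<star> (x \<star> cm (transpose ?Ei))"
  define K2 :: "('n, 'a) matr" where "K2 = cm (transpose E ** ?Ei)"
  have K: "K1 \<in> mats" "K2 \<in> mats" by (simp_all add: K1_def K2_def)
  have 3: "phi3_matr E x = matr_minus A K1 K2"
    by (simp add: phi3_matr_def K1_def K2_def simps)
  have "cm ?Ei \<star> matr_transpose x \<star> phi3_matr E x \<star> cm E =
      matr_minus A (cm ?Ei \<star> matr_transpose x \<star> K1 \<star> cm E) (cm ?Ei \<star> matr_transpose x \<star> K2 \<star> cm E)"
    using K unfolding 3 by (simp add: matr_minus_mult)
  also have "cm ?Ei \<star> matr_transpose x \<star> K1 \<star> cm E = cm (transpose ?Ei ** E)"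
    by (simp add: K1_def simps)
  also have "cm ?Ei \<star> matr_transpose x \<star> K2 \<star> cm E = cm ?Ei \<star> (matr_transpose x \<star> cm (transpose E))"
    by (simp add: K2_def simps)
  finally have "matr_transpose (cm ?Ei \<star> matr_transpose x \<star> phi3_matr E x \<star> cm E) = matr_minus A K2 K1"
    by (simp add: matr_transpose_add matr_transpose_cm_mult matr_transpose_mult_cm K1_def K2_def
      matr_mult_assoc matrix_transpose_mul transpose_transpose)
  then show ?thesis
    using K unfolding phi2_def 3
    by (intro HOL.ext) (simp add: matr_add_def matr_minus_def minus_eq a_ac r_neg r_neg1 r_neg2 l_neg)
qed

lemma matr_trace_closed [simp]: "U \<in> mats \<Longrightarrow> matr_trace A U \<in> carrier A"
  unfolding matr_trace_def by (intro finsum_closed) auto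

lemma matr_trace_add: "U \<in> mats \<Longrightarrow> V \<in> mats \<Longrightarrow> matr_trace A (matr_add A U V) = matr_trace A U \<oplus> matr_trace A V"
  unfolding matr_trace_def matr_add_def by (intro finsum_addf) auto

lemma matr_trace_smult: "U \<in> mats \<Longrightarrow> a \<in> carrier A \<Longrightarrow> matr_trace A (a \<odot>\<^bsub>matr_module A\<^esub> U) = matr_trace A U \<otimes> a"
  by (simp add: matr_trace_def matr_module_simps(4) finsum_ldistr)

lemma matr_trace_transpose: "matr_trace A (matr_transpose U) = matr_trace A U"
  by (simp add: matr_trace_def matr_transpose_def)

lemma matr_trace_cm:
  assumes U: "U \<in> mats"
  shows "matr_trace A (cm C \<star> U) = matr_trace A (U \<star> cm C)"
proof -
  have "matr_trace A (cm C \<star> U) = (\<Oplus>i\<in>UNIV. \<Oplus>k\<in>UNIV. (C $ i $ k) \<odot> U k i)"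
    by (simp add: matr_trace_def cm_mult_entry[OF U])
  also have "\<dots> = (\<Oplus>k\<in>UNIV. \<Oplus>i\<in>UNIV. (C $ i $ k) \<odot> U k i)"
    using U by (intro finsum_swap) auto
  also have "\<dots> = matr_trace A (U \<star> cm C)"
    by (simp add: matr_trace_def mult_cm_entry[OF U])
  finally show ?thesis .
qed

text \<open>Valid although the entries do not commute: the order of the factors is kept and only the
  summation indices trade places.\<close>

lemma matr_trace_transpose_mult:
  assumes U: "U \<in> mats" and V: "V \<in> mats"
  shows "matr_trace A (matr_transpose U \<star> matr_transpose V) = matr_trace A (U \<star> V)"
  unfolding matr_trace_def matr_mult_def matr_transpose_def
  using U V by (intro finsum_swap) auto

end

context A_algebra begin

lemma phi1_closed [simp]: "U \<in> mats \<Longrightarrow> a \<in> carrier A \<Longrightarrow> phi1 U a \<in> carrier A"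
  by (simp add: phi1_def)

lemma phi1_add:
  assumes "U \<in> mats" "V \<in> mats" "a \<in> carrier A" "b \<in> carrier A"
  shows "phi1 (matr_add A U V) (a \<oplus> b) = phi1 U a \<oplus> phi1 V b"
proof -
  have ac: "(p \<oplus> q) \<ominus> (r \<oplus> s) \<oplus> (t \<oplus> u) = (p \<ominus> r \<oplus> t) \<oplus> (q \<ominus> s \<oplus> u)"
    if "p \<in> carrier A" "q \<in> carrier A" "r \<in> carrier A" "s \<in> carrier A" "t \<in> carrier A" "u \<in> carrier A" for p q r s t u
    using that by (simp add: minus_eq minus_add a_ac)
  show ?thesis
    using assms by (simp add: phi1_def matr_add_mult matr_trace_add r_distr ac)
qed

lemma phi1_smult:
  assumes "U \<in> mats" "a \<in> carrier A" "r \<in> carrier A"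
  shows "phi1 (r \<odot>\<^bsub>matr_module A\<^esub> U) (a \<otimes> r) = phi1 U a \<otimes> r"
  using assms by (simp add: phi1_def smult_eq_matr matr_trace_smult minus_eq l_distr l_minus m_assoc)

lemma phi1_unit_matr: "phi1 (unit_matr i j) \<zero> = x i j \<ominus> cm (mat 1) i j"
proof -
  have c: "x k l \<ominus> cm (mat 1) k l \<in> carrier A" for k l by (auto intro!: minus_closed matsD)
  have "(\<Oplus>p\<in>UNIV. (x (fst p) (snd p) \<ominus> cm (mat 1) (fst p) (snd p)) \<otimes> unit_matr i j (fst p) (snd p)) =
      (\<Oplus>p\<in>UNIV. if p = (i, j) then x (fst p) (snd p) \<ominus> cm (mat 1) (fst p) (snd p) else \<zero>)"
    using c by (intro finsum_cong') (auto simp: unit_matr_def)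
  also have "\<dots> = x i j \<ominus> cm (mat 1) i j"
    using finsum_delta(1)[of UNIV "(i, j)" "\<lambda>p. x (fst p) (snd p) \<ominus> cm (mat 1) (fst p) (snd p)"] c by simp
  finally show ?thesis using c by (simp add: phi1_expand)
qed

lemma phi1_zero_matr: "a \<in> carrier A \<Longrightarrow> phi1 (\<lambda>i j. \<zero>) a = omg \<otimes> a"
  by (simp add: phi1_def matr_mult_zero matr_trace_def minus_eq)

lemma unit_matr_zero: "unit_matr i j a b = cm (\<chi> k l. if k = a \<and> l = b then 1 else 0) i j"
  by (simp add: unit_matr_def matr_const_def smult_one)

end

locale A_invertible = A_algebra A E for A :: "(complex, 'n::finite A_elem) module" (structure) and E +
  assumes E: "E ** matrix_inv E = mat 1" "matrix_inv E ** E = mat 1"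
begin

abbreviation Ei where "Ei \<equiv> matrix_inv E"

text \<open>Cyclicity of the trace is available for constant matrices only. With
  \<open>W = E^-1 x^t U E\<close> it gives \<open>tr W = tr (x^t U)\<close>, and
  \<open>x W = E^-1 U E\<close> gives \<open>tr (x^t W^t) = tr U\<close>, so the four terms
  cancel.\<close>

lemma phi1_phi2:
  assumes U: "U \<in> mats"
  shows "phi1 (phi2 E x U) \<zero> = \<zero>"
proof -
  define W where "W = cm Ei \<star> matr_transpose x \<star> U \<star> cm E"
  have W: "W \<in> mats" using U by (simp add: W_def)
  have 1: "matr_trace A W = matr_trace A (matr_transpose x \<star> U)"
  proof -
    have "W = cm Ei \<star> (matr_transpose x \<star> U \<star> cm E)" using U by (simp add: W_def matr_mult_assoc)
    then have "matr_trace A W = matr_trace A (matr_transpose x \<star> U \<star> cm E \<star> cm Ei)"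
      using U by (simp add: matr_trace_cm)
    then show ?thesis using U by (simp add: matr_mult_assoc cm_mult_cm E mult_cm_1)
  qed
  have 2: "matr_trace A (matr_transpose x \<star> matr_transpose W) = matr_trace A U"
  proof -
    have "x \<star> W = cm Ei \<star> (U \<star> cm E)"
      using U by (simp add: W_def matr_mult_assoc B_rel_cancel[OF B_rel_x E])
    then have "matr_trace A (matr_transpose x \<star> matr_transpose W) = matr_trace A (U \<star> cm E \<star> cm Ei)"
      using U W by (simp add: matr_trace_transpose_mult matr_trace_cm)
    then show ?thesis using U by (simp add: matr_mult_assoc cm_mult_cm E mult_cm_1)
  qed
  have "phi2 E x U = matr_add A U (matr_transpose W)" by (simp add: phi2_def W_def)
  then show ?thesis
    using U W by (simp add: phi1_def matr_add_mult matr_trace_add matr_trace_transpose 1 2 a_comm[of "matr_trace A U"] minus_eq r_neg)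
qed

lemma counit: "A_counit E \<in> alg_hom A complex_alg" "A_counit E (x i j) = (if i = j then 1 else 0)"
  "A_counit E g = 1"
  unfolding A_eq by (rule A_counit[OF E])+

lemma counit_phi1:
  assumes U: "U \<in> mats" and a: "a \<in> carrier A"
  shows "A_counit E (phi1 U a) = 0"
proof -
  note C = complex_algebra_complex_alg
  interpret C: complex_algebra complex_alg by (rule C)
  have z: "\<zero>\<^bsub>complex_alg\<^esub> = 0" by (simp add: complex_alg_def)
  have c: "x i j \<ominus> cm (mat 1) i j \<in> carrier A" for i j by (auto intro!: minus_closed matsD)
  have "A_counit E (x i j \<ominus> cm (mat 1) i j) = \<zero>\<^bsub>complex_alg\<^esub>" for i j
  proof -
    have "A_counit E (cm (mat 1) i j) = A_counit E (x i j)"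
      by (simp add: matr_const_def alg_homD[OF counit(1)] counit(2)) (simp add: complex_alg_def mat_def)
    then show ?thesis
      using alg_homD(1)[OF counit(1), of "x i j"]
      by (simp add: alg_hom_minus[OF counit(1) complex_algebra_axioms C] matsD)
  qed
  then have 1: "A_counit E ((x i j \<ominus> cm (mat 1) i j) \<otimes> U i j) = \<zero>\<^bsub>complex_alg\<^esub>" for i j
    using c U alg_homD(1)[OF counit(1), of "U i j"] by (simp add: alg_homD(3)[OF counit(1)])
  have "A_counit E omg = \<zero>\<^bsub>complex_alg\<^esub>"
    using alg_homD(1)[OF counit(1) g_closed]
    by (simp add: omg_def alg_hom_minus[OF counit(1) complex_algebra_axioms C] alg_homD(4)[OF counit(1)] counit(3))
      (simp add: complex_alg_def a_minus_def[symmetric] flip: counit(3))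
  then have 2: "A_counit E (omg \<otimes> a) = \<zero>\<^bsub>complex_alg\<^esub>"
    using a alg_homD(1)[OF counit(1) a] by (simp add: alg_homD(3)[OF counit(1)])
  have "A_counit E (\<Oplus>p\<in>UNIV. (x (fst p) (snd p) \<ominus> cm (mat 1) (fst p) (snd p)) \<otimes> U (fst p) (snd p)) = \<zero>\<^bsub>complex_alg\<^esub>"
    using c U by (subst alg_hom_finsum[OF counit(1) complex_algebra_axioms C]) (auto simp: 1)
  moreover have "(\<Oplus>p\<in>UNIV. (x (fst p) (snd p) \<ominus> cm (mat 1) (fst p) (snd p)) \<otimes> U (fst p) (snd p)) \<in> carrier A"
    using c U by (intro finsum_closed) auto
  ultimately show ?thesis
    using a 2 by (simp add: phi1_expand[OF U a] alg_homD(2)[OF counit(1)]) (simp add: z)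
qed

text \<open>Exactness at A(E): the augmentation ideal is generated, as a right ideal, by the
  augmentations of the generators.\<close>

lemma ex_phi1:
  assumes "a \<in> carrier A"
  shows "\<exists>U\<in>mats. \<exists>b\<in>carrier A. phi1 U b = a \<ominus> A_counit E a \<odot> \<one>"
  using assms unfolding A_eq
proof (induction a rule: A_alg_induct)
  case (gen_x i j)
  have "phi1 (unit_matr i j) \<zero> = x i j \<ominus> A_counit E (x i j) \<odot> \<one>"
    by (simp add: phi1_unit_matr counit matr_const_def mat_def)
  then show ?case unfolding A_eq[symmetric] by (intro bexI[of _ "unit_matr i j"] bexI[of _ \<zero>]) auto
next
  case gen_g
  have "phi1 (\<lambda>i j. \<zero>) (\<ominus> \<one>) = g \<ominus> A_counit E g \<odot> \<one>"
    by (simp add: phi1_zero_matr counit smult_one r_minus omg_def minus_eq minus_add a_comm)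
  then show ?case unfolding A_eq[symmetric]
    by (intro bexI[of _ "\<lambda>i j. \<zero>"] bexI[of _ "\<ominus> \<one>"]) auto
next
  case one
  have "A_counit E \<one> = 1" using alg_homD(4)[OF counit(1)] by (simp add: complex_alg_def)
  then have "phi1 (\<lambda>i j. \<zero>) \<zero> = \<one> \<ominus> A_counit E \<one> \<odot> \<one>"
    by (simp add: phi1_zero_matr smult_one minus_eq r_neg)
  then show ?case unfolding A_eq[symmetric]
    by (intro bexI[of _ "\<lambda>i j. \<zero>"] bexI[of _ \<zero>]) auto
next
  case (add a b)
  note ab = add(1,2)[folded A_eq]
  from add obtain U u V v where *: "U \<in> mats" "u \<in> carrier A" "phi1 U u = a \<ominus> A_counit E a \<odot> \<one>"
    "V \<in> mats" "v \<in> carrier A" "phi1 V v = b \<ominus> A_counit E b \<odot> \<one>" unfolding A_eq[symmetric] by blast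
  have "A_counit E (a \<oplus> b) = A_counit E a + A_counit E b"
    using ab by (simp add: alg_homD(2)[OF counit(1)]) (simp add: complex_alg_def)
  then have "phi1 (matr_add A U V) (u \<oplus> v) = (a \<oplus> b) \<ominus> A_counit E (a \<oplus> b) \<odot> \<one>"
    using * ab by (simp add: phi1_add smult_add_left minus_eq minus_add a_ac)
  then show ?case using * unfolding A_eq[symmetric]
    by (intro bexI[of _ "matr_add A U V"] bexI[of _ "u \<oplus> v"]) auto
next
  case (mult a b)
  note ab = mult(1,2)[folded A_eq]
  from mult obtain U u V v where *: "U \<in> mats" "u \<in> carrier A" "phi1 U u = a \<ominus> A_counit E a \<odot> \<one>"
    "V \<in> mats" "v \<in> carrier A" "phi1 V v = b \<ominus> A_counit E b \<odot> \<one>" unfolding A_eq[symmetric] by blast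
  let ?s = "A_counit E a" and ?t = "A_counit E b"
  have "A_counit E (a \<otimes> b) = ?s * ?t"
    using ab by (simp add: alg_homD(3)[OF counit(1)]) (simp add: complex_alg_def)
  \<comment> \<open>The expression for \<open>a\<close> is multiplied by \<open>b\<close> on the
    right and the one for \<open>b\<close> only by a scalar, so both stay in the right
    ideal.\<close>
  moreover have "(a \<ominus> ?s \<odot> \<one>) \<otimes> b \<oplus> (b \<ominus> ?t \<odot> \<one>) \<otimes> (?s \<odot> \<one>) = a \<otimes> b \<ominus> (?s * ?t) \<odot> \<one>"
    using ab by (simp add: minus_eq l_distr l_minus smult_mult_left smult_mult_right smult_smult smult_add_right smult_minus mult.commute a_assoc r_neg1 r_neg2)
  ultimately have "phi1 (matr_add A (b \<odot>\<^bsub>matr_module A\<^esub> U) ((?s \<odot> \<one>) \<odot>\<^bsub>matr_module A\<^esub> V)) (u \<otimes> b \<oplus> v \<otimes> (?s \<odot> \<one>)) =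
      (a \<otimes> b) \<ominus> A_counit E (a \<otimes> b) \<odot> \<one>"
    using * ab by (simp only: phi1_add phi1_smult matr_smult_mats m_closed smult_closed one_closed)
  then show ?case using * ab unfolding A_eq[symmetric]
    by (intro bexI[of _ "matr_add A (b \<odot>\<^bsub>matr_module A\<^esub> U) ((?s \<odot> \<one>) \<odot>\<^bsub>matr_module A\<^esub> V)"]
        bexI[of _ "u \<otimes> b \<oplus> v \<otimes> (?s \<odot> \<one>)"]) auto
next
  case (smult c a)
  note a = smult(1)[folded A_eq]
  from smult obtain U u where *: "U \<in> mats" "u \<in> carrier A" "phi1 U u = a \<ominus> A_counit E a \<odot> \<one>"
    unfolding A_eq[symmetric] by blast
  have "A_counit E (c \<odot> a) = c * A_counit E a"
    using a by (simp add: alg_homD(5)[OF counit(1)]) (simp add: complex_alg_def)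
  then have "phi1 ((c \<odot> \<one>) \<odot>\<^bsub>matr_module A\<^esub> U) (u \<otimes> (c \<odot> \<one>)) = c \<odot> a \<ominus> A_counit E (c \<odot> a) \<odot> \<one>"
    using * a phi1_smult[of U u "c \<odot> \<one>"] by (simp add: smult_mult_right smult_a_minus smult_smult)
  then show ?case using * unfolding A_eq[symmetric]
    by (intro bexI[of _ "(c \<odot> \<one>) \<odot>\<^bsub>matr_module A\<^esub> U"] bexI[of _ "u \<otimes> (c \<odot> \<one>)"]) auto
qed

text \<open>Both diagonal projections are homomorphisms, and the relations hold at the identity
  matrix and at \<open>x\<close>. Only the middle component of each relation remains to be
  examined.\<close>

lemma tri_components:
  fixes M :: "('n A_elem, 'm) module"
  assumes M: "right_module A M" and \<mu>: "\<And>i j. \<mu> i j \<in> carrier M"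
  defines "Y \<equiv> \<lambda>i j. ((mat 1 :: complex^'n^'n) $ i $ j, \<mu> i j, x i j)"
  shows "Y \<in> carrier (matr_module (tri_alg A M))"
    and "fst (B_left (tri_alg A M) E Y i j) = mat 1 $ i $ j"
    and "fst (B_right (tri_alg A M) E Y i j) = mat 1 $ i $ j"
    and "snd (snd (B_left (tri_alg A M) E Y i j)) = cm (mat 1) i j"
    and "snd (snd (B_right (tri_alg A M) E Y i j)) = cm (mat 1) i j"
proof -
  interpret C: complex_algebra complex_alg by (rule complex_algebra_complex_alg)
  note T = complex_algebra_tri[OF M]
  show Y: "Y \<in> carrier (matr_module (tri_alg A M))"
    using \<mu> matsD[OF x_mats] by (auto simp: Y_def matr_module_simps(1) tri_alg_simps)
  have 1: "(\<lambda>i j. fst (Y i j)) = matr_const complex_alg (mat 1)"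
    by (simp add: Y_def matr_const_def complex_alg_def)
  have 2: "(\<lambda>i j. snd (snd (Y i j))) = x" by (simp add: Y_def)
  have 3: "matr_const complex_alg (mat 1) i j = mat 1 $ i $ j"
    by (simp add: matr_const_def complex_alg_def)
  show "fst (B_left (tri_alg A M) E Y i j) = mat 1 $ i $ j" "fst (B_right (tri_alg A M) E Y i j) = mat 1 $ i $ j"
    using C.B_rel_1[OF E]
    by (simp_all add: alg_hom_B_left_right[OF tri_alg_homs(1)[OF M] T complex_algebra_complex_alg Y] 1 B_rel_def 3)
  show "snd (snd (B_left (tri_alg A M) E Y i j)) = cm (mat 1) i j"
    "snd (snd (B_right (tri_alg A M) E Y i j)) = cm (mat 1) i j"
    using B_rel_x
    by (simp_all add: alg_hom_B_left_right[OF tri_alg_homs(2)[OF M] T complex_algebra_axioms Y] 2 B_rel_def)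
qed

lemma phi1_eq_zero_imp_omg:
  assumes U: "U \<in> mats" and a: "a \<in> carrier A" and zero: "phi1 U a = \<zero>"
  shows "omg \<otimes> a = \<zero>"
proof -
  let ?M = "regular_module A"
  let ?T = "tri_alg A ?M"
  note M = right_module_regular
  interpret M: right_module A ?M by (rule M)
  interpret T: complex_algebra ?T by (rule complex_algebra_tri[OF M])
  define Y where "Y = (\<lambda>i j. ((mat 1 :: complex^'n^'n) $ i $ j, \<zero>, x i j))"
  note comp = tri_components[OF M, where \<mu> = "\<lambda>i j. \<zero>", folded Y_def, simplified]
  let ?d = "\<lambda>p :: complex \<times> 'n A_elem \<times> 'n A_elem. fst (snd p)"
  have S: "(\<lambda>i j. \<zero>) = (\<lambda>i j. ?d (Y i j))" and X: "x = (\<lambda>i j. snd (snd (Y i j)))"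
    by (simp_all add: Y_def)
  have zY: "(\<lambda>i j. fst (Y i j) \<odot> \<one>) = cm (mat 1)" by (simp add: Y_def matr_const_def)
  have d: "(\<lambda>i j. ?d (B_left ?T E Y i j)) = (\<lambda>i j. \<zero>)" "(\<lambda>i j. ?d (B_right ?T E Y i j)) = (\<lambda>i j. \<zero>)"
  proof -
    have "matr_transpose (\<lambda>i j. \<zero>) = (\<lambda>i j. \<zero>)" by (simp add: matr_transpose_def)
    note simps = this matr_mult_zero matr_add_zero
    have "(\<lambda>i j. ?d (B_left ?T E Y i j)) =
        matr_add A (\<lambda>i j. \<zero>) (cm Ei \<star> matr_transpose (\<lambda>i j. \<zero>) \<star> cm E \<star> x)"
      "(\<lambda>i j. ?d (B_right ?T E Y i j)) =
        matr_add A (cm Ei \<star> matr_transpose (\<lambda>i j. \<zero>) \<star> cm E) ((\<lambda>i j. \<zero>) \<star> cm Ei \<star> matr_transpose x \<star> cm E)"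
      by (rule d_B_left_right[OF T.complex_algebra_axioms tri_alg_homs(3)[OF M] tri_alg_homs(2)[OF M]
            _ _ _ _ E comp(1) zY S X];
          force simp: tri_alg_simps smult_mult_left smult_mult_right)+
    then show "(\<lambda>i j. ?d (B_left ?T E Y i j)) = (\<lambda>i j. \<zero>)" "(\<lambda>i j. ?d (B_right ?T E Y i j)) = (\<lambda>i j. \<zero>)"
      by (simp_all add: simps)
  qed
  have c: "matr_const ?T (mat 1) i j = (mat 1 $ i $ j, \<zero>, cm (mat 1) i j)" for i j :: 'n
    by (simp add: matr_const_def tri_alg_simps)
  have "B_rel ?T E Y"
    unfolding B_rel_def
    using comp fun_cong[OF fun_cong[OF d(1)]] fun_cong[OF fun_cong[OF d(2)]]
    by (intro conjI HOL.ext prod_eqI) (simp_all add: c)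
  moreover have "(1, \<ominus> omg, g) \<in> carrier ?T" by (simp add: tri_alg_simps)
  moreover have "(1, \<ominus> omg, g) \<otimes>\<^bsub>?T\<^esub> (1, \<ominus> omg, g) = \<one>\<^bsub>?T\<^esub>"
  proof -
    \<comment> \<open>The middle component of the square is \<open>- omg - omg g\<close>, so this is
      what makes the prescribed value at \<open>g\<close> an involution.\<close>
    have "omg \<otimes> g = \<ominus> omg"
      by (simp add: omg_def minus_eq l_distr l_minus g_square minus_add a_comm)
    then show ?thesis by (simp add: tri_alg_simps smult_one g_square l_minus l_neg)
  qed
  ultimately obtain k where k: "k \<in> alg_hom A ?T" "\<forall>i j. k (x i j) = Y i j" "k g = (1, \<ominus> omg, g)"
    using A_alg_lift[OF T.complex_algebra_axioms, of E Y "(1, \<ominus> omg, g)", folded A_eq] by blast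
  have id: "(\<lambda>p. p) \<in> alg_hom ?T ?T" by (rule alg_homI) auto
  have mm: "\<ominus>\<^bsub>?M\<^esub> omg = \<ominus> omg"
    using M.M.minus_equality[of "\<ominus> omg" omg] by (simp add: l_neg)
  have "k (phi1 U a) = (0, (\<Oplus>\<^bsub>?M\<^esub>p\<in>UNIV. U (fst p) (snd p) \<odot>\<^bsub>?M\<^esub> \<zero>) \<oplus>\<^bsub>?M\<^esub> a \<odot>\<^bsub>?M\<^esub> omg, phi1 U a)"
    by (rule tri_hom_phi1[OF M T.complex_algebra_axioms id k(1), where \<mu> = "\<lambda>i j. \<zero>"])
      (use k U a mm in \<open>auto simp: Y_def\<close>)
  moreover have "(\<Oplus>\<^bsub>?M\<^esub>p\<in>UNIV. U (fst p) (snd p) \<odot>\<^bsub>?M\<^esub> \<zero>) = \<zero>"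
    using U M.M.finsum_zero[of "UNIV :: ('n \<times> 'n) set"] by simp
  moreover have "k \<zero> = (0, \<zero>, \<zero>)"
    using alg_hom_zero[OF k(1) complex_algebra_axioms T.complex_algebra_axioms] by (simp add: tri_alg_simps)
  ultimately show ?thesis using a zero by simp
qed

end

section \<open>Exactness at the middle term\<close>

section \<open>Exactness\<close>

definition unit_const :: "'n \<Rightarrow> 'n \<Rightarrow> complex^'n::finite^'n" where
  "unit_const a b = (\<chi> k l. if k = a \<and> l = b then 1 else 0)"

lemma transpose_unit_const: "transpose (unit_const a b) = unit_const b a"
  by (simp add: unit_const_def transpose_def vec_eq_iff conj_commute)

context complex_algebra begin

lemma unit_const_mult_entry:
  assumes Z: "Z \<in> mats"
  shows "(cm (unit_const a b) \<star> Z) i j = (if i = a then Z b j else \<zero>)"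
    and "(Z \<star> cm (unit_const b a)) j i = (if i = a then Z j b else \<zero>)"
proof -
  have "(cm (unit_const a b) \<star> Z) i j = (\<Oplus>k\<in>UNIV. if k = b then (if i = a then Z k j else \<zero>) else \<zero>)"
    unfolding cm_mult_entry[OF Z]
    using Z by (intro finsum_cong') (auto simp: unit_const_def smult_one)
  also have "\<dots> = (if i = a then Z b j else \<zero>)"
    using Z by (subst finsum_delta(1)) auto
  finally show "(cm (unit_const a b) \<star> Z) i j = (if i = a then Z b j else \<zero>)" .
  have "(Z \<star> cm (unit_const b a)) j i = (\<Oplus>k\<in>UNIV. if k = b then (if i = a then Z j k else \<zero>) else \<zero>)"
    unfolding mult_cm_entry[OF Z]
    using Z by (intro finsum_cong') (auto simp: unit_const_def smult_one)
  also have "\<dots> = (if i = a then Z j b else \<zero>)"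
    using Z by (subst finsum_delta(1)) auto
  finally show "(Z \<star> cm (unit_const b a)) j i = (if i = a then Z j b else \<zero>)" .
qed

text \<open>Both sides equal \<open>C_ib Z_aj\<close>. This turns the index of a relation into the
  position of a matrix entry and conversely.\<close>

lemma unit_const_exchange:
  assumes Z: "Z \<in> mats"
  shows "(cm C \<star> (cm (unit_const b a) \<star> Z)) i j = (Z \<star> cm (unit_const j i) \<star> cm C) a b"
proof -
  have "(cm C \<star> (cm (unit_const b a) \<star> Z)) i j = (\<Oplus>k\<in>UNIV. if k = b then (C $ i $ k) \<odot> Z a j else \<zero>)"
    unfolding cm_mult_entry[OF mats_closed(1)[OF mats_closed(5) Z]] unit_const_mult_entry[OF Z]
    using Z by (intro finsum_cong') auto
  also have "\<dots> = (C $ i $ b) \<odot> Z a j" using Z by (subst finsum_delta(1)) auto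
  also have "\<dots> = (\<Oplus>k\<in>UNIV. if k = i then (C $ k $ b) \<odot> Z a j else \<zero>)"
    using Z by (subst finsum_delta(1)) auto
  also have "\<dots> = (Z \<star> cm (unit_const j i) \<star> cm C) a b"
    unfolding mult_cm_entry[OF mats_closed(1)[OF Z mats_closed(5)]] unit_const_mult_entry[OF Z]
    using Z by (intro finsum_cong') auto
  finally show ?thesis .
qed

end

context A_invertible begin

text \<open>The quotient by this ideal stands in for the triangular algebra over the cokernel of
  \<open>phi2\<close>, so no quotient module has to be constructed.\<close>

definition phi2_ideal :: "(complex \<times> ('n, 'n A_elem) matr \<times> 'n A_elem) set" where
  "phi2_ideal = {(0, phi2 E x V, \<zero>) |V. V \<in> mats}"

lemma ideal_phi2_ideal: "ideal phi2_ideal (tri_alg A (matr_module A))"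
proof -
  let ?M = "matr_module A :: ('n A_elem, ('n, 'n A_elem) matr) module"
  let ?T = "tri_alg A ?M"
  interpret M: right_module A ?M by (rule right_module_matr)
  interpret T: complex_algebra ?T by (rule complex_algebra_tri[OF right_module_matr])
  note tsimps = tri_alg_simps M.rsmult_zero_module M.rsmult_zero_ring
  have JI: "(0, a \<odot>\<^bsub>?M\<^esub> phi2 E x V, \<zero>) \<in> phi2_ideal" if "V \<in> mats" "a \<in> carrier A" for a V
    using that unfolding phi2_ideal_def by (auto simp: phi2_smult[symmetric])
  have sub: "phi2_ideal \<subseteq> carrier ?T" by (auto simp: phi2_ideal_def tri_alg_simps)
  have zero: "phi2 E x \<zero>\<^bsub>?M\<^esub> = \<zero>\<^bsub>?M\<^esub>"
    using phi2_smult[OF x_mats M.zero_closed zero_closed, of E]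
      M.rsmult_zero_ring[OF M.zero_closed] M.rsmult_zero_ring[OF phi2_mats[OF x_mats M.zero_closed, of E]] by simp
  show ?thesis
  proof (rule idealI)
    show "ring ?T" by (rule T.ring_axioms)
    show "subgroup phi2_ideal (add_monoid ?T)"
    proof (rule subgroup.intro)
      show "phi2_ideal \<subseteq> carrier (add_monoid ?T)" using sub by simp
      show "\<one>\<^bsub>add_monoid ?T\<^esub> \<in> phi2_ideal"
        unfolding phi2_ideal_def mem_Collect_eq
        by (intro exI[of _ "\<zero>\<^bsub>?M\<^esub>"] conjI M.zero_closed) (simp add: tri_alg_simps zero)
    next
      fix p q assume "p \<in> phi2_ideal" "q \<in> phi2_ideal"
      then obtain U V where *: "U \<in> mats" "V \<in> mats" "p = (0, phi2 E x U, \<zero>)" "q = (0, phi2 E x V, \<zero>)"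
        unfolding phi2_ideal_def by blast
      have "p \<oplus>\<^bsub>?T\<^esub> q = (0, phi2 E x (matr_add A U V), \<zero>)"
        unfolding *(3,4) by (simp add: tri_alg_simps phi2_add *(1,2) matr_module_simps(3))
      then show "p \<otimes>\<^bsub>add_monoid ?T\<^esub> q \<in> phi2_ideal"
        using *(1,2) unfolding phi2_ideal_def by auto
    next
      fix p assume p: "p \<in> phi2_ideal"
      then obtain U where *: "U \<in> mats" "p = (0, phi2 E x U, \<zero>)"
        unfolding phi2_ideal_def by blast
      have "\<ominus>\<^bsub>?T\<^esub> p = (0, ((- 1) \<odot> \<one>) \<odot>\<^bsub>?M\<^esub> phi2 E x U, \<zero>)"
        using p sub by (subst T.minus_eq_smult) (auto simp: *(2) tri_alg_simps)
      then show "inv\<^bsub>add_monoid ?T\<^esub> p \<in> phi2_ideal"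
        using JI[OF *(1), of "(- 1) \<odot> \<one>"] by (simp add: a_inv_def)
    qed
  next
    fix p q assume p: "p \<in> phi2_ideal" and q: "q \<in> carrier ?T"
    then obtain U where *: "U \<in> mats" "p = (0, phi2 E x U, \<zero>)"
      unfolding phi2_ideal_def by blast
    obtain z m a where q': "q = (z, m, a)" "m \<in> mats" "a \<in> carrier A"
      using q by (cases q) (auto simp: tri_alg_simps)
    have "q \<otimes>\<^bsub>?T\<^esub> p = (0, (z \<odot> \<one>) \<odot>\<^bsub>?M\<^esub> phi2 E x U, \<zero>)"
      using *(1) q'(2,3) unfolding *(2) q'(1) by (simp add: tsimps M.rsmult_closed del: smult_0)
    then show "q \<otimes>\<^bsub>?T\<^esub> p \<in> phi2_ideal" using JI[OF *(1), of "z \<odot> \<one>"] by simp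
    have "p \<otimes>\<^bsub>?T\<^esub> q = (0, a \<odot>\<^bsub>?M\<^esub> phi2 E x U, \<zero>)"
      using *(1) q'(2,3) unfolding *(2) q'(1) by (simp add: tsimps M.rsmult_closed)
    then show "p \<otimes>\<^bsub>?T\<^esub> q \<in> phi2_ideal" using JI[OF *(1) q'(3)] by simp
  qed
qed

text \<open>
  The two matrices are the middle components of the defining relations of \<open>B(E)\<close> at the matrix
  with entries \<open>(\<delta>\<^sub>i\<^sub>j, e\<^sub>i\<^sub>j, x\<^sub>i\<^sub>j)\<close> of the triangular algebra.
\<close>

lemma relations_phi2:
  defines "Y \<equiv> \<lambda>i j. ((mat 1 :: complex^'n^'n) $ i $ j, unit_matr i j :: ('n, 'n A_elem) matr, x i j)"
  shows "fst (snd (B_left (tri_alg A (matr_module A)) E Y i j)) =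
      phi2 E x (cm E \<star> x \<star> cm (unit_const j i) \<star> cm Ei)"
    and "fst (snd (B_right (tri_alg A (matr_module A)) E Y i j)) =
      phi2 E x (cm E \<star> cm (unit_const j i) \<star> cm Ei)"
proof -
  let ?M = "matr_module A :: ('n A_elem, ('n, 'n A_elem) matr) module"
  let ?T = "tri_alg A ?M"
  interpret M: right_module A ?M by (rule right_module_matr)
  interpret T: complex_algebra ?T by (rule complex_algebra_tri[OF right_module_matr])
  note comp = tri_components[OF right_module_matr, where \<mu> = unit_matr, folded Y_def, simplified]
  have X: "x = (\<lambda>i j. snd (snd (Y i j)))" by (simp add: Y_def)
  have zY: "(\<lambda>i j. fst (Y i j) \<odot> \<one>) = cm (mat 1)" by (simp add: Y_def matr_const_def)
  \<comment> \<open>For a fixed position \<open>(a, b)\<close>, that entry of the matrix units, seen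
    as a function of their index, is again a matrix unit.\<close>
  have S: "cm (unit_const a b) = (\<lambda>i j. fst (snd (Y i j)) a b)" for a b
    by (simp add: Y_def unit_matr_zero unit_const_def)
  have d: "(\<lambda>i j. fst (snd (B_left ?T E Y i j)) a b) =
        matr_add A (cm (unit_const a b)) (cm Ei \<star> matr_transpose (cm (unit_const a b)) \<star> cm E \<star> x)"
      "(\<lambda>i j. fst (snd (B_right ?T E Y i j)) a b) =
        matr_add A (cm Ei \<star> matr_transpose (cm (unit_const a b)) \<star> cm E)
          (cm (unit_const a b) \<star> cm Ei \<star> matr_transpose x \<star> cm E)" for a b
    by (rule d_B_left_right[where d = "\<lambda>p. fst (snd p) a b", OF T.complex_algebra_axioms
          tri_alg_homs(3)[OF right_module_matr] tri_alg_homs(2)[OF right_module_matr]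
          _ _ _ _ E comp(1) zY S X];
        force simp: tri_alg_simps matr_module_simps matr_add_def smult_mult_left smult_mult_right)+
  note simps = matr_mult_assoc cm_mult_cm_mult[symmetric] cm_mult_cm[symmetric] transpose_unit_const
  have cancel: "cm Ei \<star> (cm E \<star> Z) = Z" if "Z \<in> mats" for Z :: "('n, 'n A_elem) matr"
    using that by (simp add: cm_mult_cm_mult E cm_1_mult)
  have cm1: "cm Ei \<star> cm E = cm (mat 1)" by (simp add: cm_mult_cm E)
  show "fst (snd (B_left ?T E Y i j)) = phi2 E x (cm E \<star> x \<star> cm (unit_const j i) \<star> cm Ei)"
  proof (intro HOL.ext)
    fix a b
    have 1: "cm Ei \<star> matr_transpose x \<star> (cm E \<star> x \<star> cm (unit_const j i) \<star> cm Ei) \<star> cm E = cm (unit_const j i)"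
      by (simp add: matr_mult_assoc B_rel_cancel[OF B_rel_x E] cancel cm1 mult_cm_1)
    have "fst (snd (B_left ?T E Y i j)) a b = cm (unit_const a b) i j \<oplus>
        (cm Ei \<star> (cm (unit_const b a) \<star> (cm E \<star> x))) i j"
      using fun_cong[OF fun_cong[OF d(1)]] by (simp add: matr_add_def matr_mult_assoc transpose_unit_const)
    also have "(cm Ei \<star> (cm (unit_const b a) \<star> (cm E \<star> x))) i j =
        (cm E \<star> x \<star> cm (unit_const j i) \<star> cm Ei) a b"
      by (rule unit_const_exchange) simp
    also have "cm (unit_const a b) i j = cm (unit_const j i) b a"
      by (auto simp: matr_const_def unit_const_def)
    finally show "fst (snd (B_left ?T E Y i j)) a b = phi2 E x (cm E \<star> x \<star> cm (unit_const j i) \<star> cm Ei) a b"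
      unfolding phi2_def 1 by (simp add: matr_add_def matr_transpose_def a_comm)
  qed
  show "fst (snd (B_right ?T E Y i j)) = phi2 E x (cm E \<star> cm (unit_const j i) \<star> cm Ei)"
  proof (intro HOL.ext)
    fix a b
    let ?Z = "cm Ei \<star> matr_transpose x \<star> cm E"
    have 1: "cm Ei \<star> matr_transpose x \<star> (cm E \<star> cm (unit_const j i) \<star> cm Ei) \<star> cm E = ?Z \<star> cm (unit_const j i)"
      by (simp add: matr_mult_assoc cm1 mult_cm_1)
    have "fst (snd (B_right ?T E Y i j)) a b = (cm Ei \<star> (cm (unit_const b a) \<star> cm E)) i j \<oplus>
        (cm (unit_const a b) \<star> ?Z) i j"
      using fun_cong[OF fun_cong[OF d(2)]] by (simp add: matr_add_def matr_mult_assoc transpose_unit_const)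
    also have "(cm Ei \<star> (cm (unit_const b a) \<star> cm E)) i j = (cm E \<star> cm (unit_const j i) \<star> cm Ei) a b"
      by (rule unit_const_exchange) simp
    also have "(cm (unit_const a b) \<star> ?Z) i j = (?Z \<star> cm (unit_const j i)) b a"
      by (simp add: unit_const_mult_entry eq_commute)
    finally show "fst (snd (B_right ?T E Y i j)) a b = phi2 E x (cm E \<star> cm (unit_const j i) \<star> cm Ei) a b"
      unfolding phi2_def 1 by (simp add: matr_add_def matr_transpose_def)
  qed
qed

lemma phi1_eq_zero_imp_phi2:
  assumes U: "U \<in> mats" and a: "a \<in> carrier A" and zero: "phi1 U a = \<zero>"
  shows "\<exists>V\<in>mats. U = phi2 E x V"
proof -
  let ?M = "matr_module A :: ('n A_elem, ('n, 'n A_elem) matr) module"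
  let ?T = "tri_alg A ?M"
  let ?R = "quot_alg ?T phi2_ideal"
  let ?q = "qmap ?T phi2_ideal"
  interpret M: right_module A ?M by (rule right_module_matr)
  interpret T: complex_algebra ?T by (rule complex_algebra_tri[OF right_module_matr])
  note TJ = T.complex_algebra_axioms ideal_phi2_ideal
  interpret R: complex_algebra ?R by (rule complex_algebra_quot[OF TJ])
  note q = qmap_hom[OF TJ]
  define Y where "Y = (\<lambda>i j. ((mat 1 :: complex^'n^'n) $ i $ j, unit_matr i j :: ('n, 'n A_elem) matr, x i j))"
  note comp = tri_components[OF right_module_matr, where \<mu> = unit_matr, folded Y_def, simplified]
  note rel = relations_phi2[folded Y_def]
  \<comment> \<open>The diagonal components are right by \<open>tri_components\<close>, and the
    middle one lies in the image of \<open>phi2\<close>; hence the relation holds modulo the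
    ideal.\<close>
  have entry: "?q p = matr_const ?R (mat 1) i j"
    if "fst p = mat 1 $ i $ j" "snd (snd p) = cm (mat 1) i j" "fst (snd p) = phi2 E x V" "V \<in> mats" for p i j V
  proof -
    have p: "p = (mat 1 $ i $ j, phi2 E x V, cm (mat 1) i j)" using that by (intro prod_eqI) simp_all
    have J: "(0, phi2 E x V, \<zero>) \<in> phi2_ideal" using that(4) by (auto simp: phi2_ideal_def)
    have c: "matr_const ?T (mat 1) i j = (mat 1 $ i $ j, \<zero>\<^bsub>?M\<^esub>, cm (mat 1) i j)"
      by (simp add: matr_const_def tri_alg_simps M.rsmult_zero_module)
    have "p = matr_const ?T (mat 1) i j \<oplus>\<^bsub>?T\<^esub> (0, phi2 E x V, \<zero>)"
      unfolding p c using that(4) by (simp add: tri_alg_simps matsD)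
    moreover have "(0, phi2 E x V, \<zero>) \<in> carrier ?T" "matr_const ?T (mat 1) i j \<in> carrier ?T"
      using that(4) by (simp_all add: tri_alg_simps c matsD)
    moreover from this have "?q (0, phi2 E x V, \<zero>) = \<zero>\<^bsub>?R\<^esub>"
      using J by (subst qmap_eq_zero_iff[OF TJ]) simp_all
    ultimately have "?q p = ?q (matr_const ?T (mat 1) i j)"
      by (simp add: alg_homD[OF q])
    then show ?thesis by (simp only: alg_hom_matr_const[OF q T.complex_algebra_axioms])
  qed
  have B: "B_rel ?R E (\<lambda>i j. ?q (Y i j))"
    unfolding B_rel_def
  proof (intro conjI HOL.ext)
    show "(\<lambda>i j. ?q (Y i j)) \<in> carrier (matr_module ?R)"
      using alg_homD(1)[OF q] T.matsD[OF comp(1)] by (simp add: matr_module_simps(1))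
  next
    fix i j
    show "B_left ?R E (\<lambda>i j. ?q (Y i j)) i j = matr_const ?R (mat 1) i j"
      unfolding alg_hom_B_left_right(1)[OF q T.complex_algebra_axioms R.complex_algebra_axioms comp(1), symmetric]
      by (rule entry[OF comp(2) comp(4) rel(1)]) simp
    show "B_right ?R E (\<lambda>i j. ?q (Y i j)) i j = matr_const ?R (mat 1) i j"
      unfolding alg_hom_B_left_right(2)[OF q T.complex_algebra_axioms R.complex_algebra_axioms comp(1), symmetric]
      by (rule entry[OF comp(3) comp(5) rel(2)]) simp
  qed
  have gT: "(1, \<zero>\<^bsub>?M\<^esub>, g) \<in> carrier ?T" by (simp add: tri_alg_simps)
  have "(1, \<zero>\<^bsub>?M\<^esub>, g) \<otimes>\<^bsub>?T\<^esub> (1, \<zero>\<^bsub>?M\<^esub>, g) = \<one>\<^bsub>?T\<^esub>"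
    by (simp add: tri_alg_simps M.rsmult_zero_module g_square)
  then have gq: "?q (1, \<zero>\<^bsub>?M\<^esub>, g) \<otimes>\<^bsub>?R\<^esub> ?q (1, \<zero>\<^bsub>?M\<^esub>, g) = \<one>\<^bsub>?R\<^esub>"
    using gT by (simp add: alg_homD(3,4)[OF q, symmetric])
  from A_alg_lift[OF R.complex_algebra_axioms B alg_homD(1)[OF q gT] gq, folded A_eq]
  obtain k where k: "k \<in> alg_hom A ?R" "\<forall>i j. k (x i j) = ?q (Y i j)" "k g = ?q (1, \<zero>\<^bsub>?M\<^esub>, g)"
    by (elim bexE conjE)
  have mz: "\<ominus>\<^bsub>?M\<^esub> \<zero>\<^bsub>?M\<^esub> = \<zero>\<^bsub>?M\<^esub>" using M.M.minus_equality[of "\<zero>\<^bsub>?M\<^esub>" "\<zero>\<^bsub>?M\<^esub>"] by simp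
  have kg: "k g = ?q (1, \<ominus>\<^bsub>?M\<^esub> \<zero>\<^bsub>?M\<^esub>, g)" by (simp only: mz k(3))
  \<comment> \<open>The middle component is the expansion of \<open>U\<close> in matrix units, so a
    vanishing left side puts \<open>U\<close> into the image of \<open>phi2\<close>.\<close>
  have "k (phi1 U a) = ?q (0, (\<Oplus>\<^bsub>?M\<^esub>p\<in>UNIV. U (fst p) (snd p) \<odot>\<^bsub>?M\<^esub> unit_matr (fst p) (snd p)) \<oplus>\<^bsub>?M\<^esub> a \<odot>\<^bsub>?M\<^esub> \<zero>\<^bsub>?M\<^esub>, phi1 U a)"
    by (rule tri_hom_phi1[OF right_module_matr R.complex_algebra_axioms q k(1) _ _ _ kg U a])
      (use k(2) in \<open>simp_all add: Y_def\<close>)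
  then have "k \<zero> = ?q (0, U, \<zero>)"
    using U a by (simp add: zero matr_expand M.rsmult_zero_module)
  then have "?q (0, U, \<zero>) = \<zero>\<^bsub>?R\<^esub>"
    using alg_hom_zero[OF k(1) complex_algebra_axioms R.complex_algebra_axioms] by simp
  then have "(0, U, \<zero>) \<in> phi2_ideal"
    using U by (subst (asm) qmap_eq_zero_iff[OF TJ]) (simp_all add: tri_alg_simps)
  then show ?thesis by (auto simp: phi2_ideal_def)
qed

end

section \<open>The two leftmost maps in normal form coordinates, and the final assembly\<close>

context A_normal_form begin

text \<open>The two matrices differ by invertible constant factors. The first form transfers the
  description of the kernel, the second the injectivity.\<close>

lemma phi3_fund_matr:
  "phi3_matr E x = cm (E ** P) \<star> (fund_matr \<star> cm (transpose Qi))"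
  "fund_matr = cm (Pi ** matrix_inv E) \<star> (phi3_matr E x \<star> cm (transpose Q))"
proof -
  have c: "y \<star> cm (transpose f) \<in> mats" "cm E \<star> x \<star> cm (transpose (matrix_inv E)) \<in> mats" by simp_all
  have y: "y = cm Pi \<star> (x \<star> cm Qi)" by (simp add: y_def yx_def)
  note simps = matr_mult_assoc cm_mult_cm cm_mult_cm_mult mat_simps cm_1_mult mult_cm_1
  have "fund_matr \<star> cm (transpose Qi) =
      matr_minus A (y \<star> cm (transpose f) \<star> cm (transpose Qi)) (cm (e ** H) \<star> cm (transpose Qi))"
    unfolding fund_matr_def using c by (intro matr_minus_mult(1)) simp_all
  then have "cm (E ** P) \<star> (fund_matr \<star> cm (transpose Qi)) =
      matr_minus A (cm (E ** P) \<star> (y \<star> cm (transpose f) \<star> cm (transpose Qi)))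
        (cm (E ** P) \<star> (cm (e ** H) \<star> cm (transpose Qi)))"
    using c by (simp only: matr_minus_mult(2) mats_closed)
  also have "cm (E ** P) \<star> (y \<star> cm (transpose f) \<star> cm (transpose Qi)) = cm E \<star> x \<star> cm (transpose (matrix_inv E))"
    unfolding y f_def by (simp add: simps)
  also have "cm (E ** P) \<star> (cm (e ** H) \<star> cm (transpose Qi)) = cm (transpose E) \<star> cm (matrix_inv E)"
    unfolding e_def H_def by (simp add: simps)
  finally show 1: "phi3_matr E x = cm (E ** P) \<star> (fund_matr \<star> cm (transpose Qi))"
    by (simp add: phi3_matr_def)
  have "fund_matr \<in> mats" by (rule fund_matr_mats)
  then show "fund_matr = cm (Pi ** matrix_inv E) \<star> (phi3_matr E x \<star> cm (transpose Q))"
    unfolding 1 by (simp add: simps)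
qed

text \<open>The equation says \<open>W = - U^t\<close> for \<open>W = E^-1 x^t U E\<close>.
  Multiplying by \<open>x\<close> on the left clears \<open>x^t\<close> and leaves
  \<open>E^-1 U E = - x U^t\<close>, where \<open>x\<close> occurs once and on the left, as in the
  twisted equation.\<close>

lemma phi2_eq_zero_imp_phi3:
  assumes U: "U \<in> mats" and zero: "phi2 E x U = (\<lambda>i j. \<zero>)"
  shows "\<exists>a\<in>carrier A. U = a \<odot>\<^bsub>matr_module A\<^esub> phi3_matr E x"
proof -
  note E' = E
  note simps = matr_mult_assoc cm_mult_cm cm_mult_cm_mult mat_simps cm_1_mult mult_cm_1
    matr_transpose_mult_cm matr_transpose_cm_mult
  define W where "W = cm (matrix_inv E) \<star> matr_transpose x \<star> U \<star> cm E"
  \<comment> \<open>\<open>P^-1\<close> and \<open>Q^t\<close> turn \<open>x\<close> into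
    \<open>y\<close>; this is the substitution that defines \<open>H\<close>.\<close>
  define D where "D = cm (Pi ** matrix_inv E) \<star> (U \<star> cm (transpose Q))"
  have W: "W \<in> mats" and D: "D \<in> mats" using U by (simp_all add: W_def D_def)
  have y: "y = cm Pi \<star> (x \<star> cm Qi)" by (simp add: y_def yx_def)
  have xW: "x \<star> W = cm (matrix_inv E) \<star> (U \<star> cm E)"
    using U by (simp add: W_def matr_mult_assoc B_rel_cancel[OF B_rel_x E'])
  have "cm Pi \<star> (x \<star> (W \<star> cm (matrix_inv E ** transpose Q))) =
      cm Pi \<star> (x \<star> W \<star> cm (matrix_inv E ** transpose Q))"
    using W by (simp add: matr_mult_assoc)
  then have 1: "D = cm Pi \<star> (x \<star> (W \<star> cm (matrix_inv E ** transpose Q)))"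
    using U by (simp add: xW D_def simps)
  have 2: "y \<star> (matr_transpose D \<star> cm H) = cm Pi \<star> (x \<star> (matr_transpose U \<star> cm (matrix_inv E ** transpose Q)))"
    using U unfolding y D_def H_def by (simp add: simps)
  have "matr_add A W (matr_transpose U) = matr_transpose (phi2 E x U)"
    using U W by (simp add: phi2_def W_def[symmetric] matr_transpose_add) (simp add: matr_add_def a_comm matr_transpose_def)
  also have "\<dots> = (\<lambda>i j. \<zero>)" by (simp add: zero matr_transpose_def)
  finally have WU: "matr_add A W (matr_transpose U) = (\<lambda>i j. \<zero>)" .
  have "matr_add A D (y \<star> (matr_transpose D \<star> cm H)) =
      cm Pi \<star> (x \<star> (matr_add A W (matr_transpose U) \<star> cm (matrix_inv E ** transpose Q)))"
    unfolding 2 using U W by (subst 1) (simp add: matr_add_mult)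
  then have "matr_add A D (y \<star> (matr_transpose D \<star> cm H)) = (\<lambda>i j. \<zero>)"
    by (simp add: WU matr_mult_zero)
  from kernel_twisted[OF D this] obtain a where a: "a \<in> carrier A" "D = a \<odot>\<^bsub>matr_module A\<^esub> fund_matr"
    by (auto simp: matr_module_simps(4))
  have "U = cm (E ** P) \<star> (D \<star> cm (transpose Qi))"
    using U unfolding D_def by (simp add: simps)
  also have "\<dots> = a \<odot>\<^bsub>matr_module A\<^esub> phi3_matr E x"
    using a(1) fund_matr_mats unfolding a(2) phi3_fund_matr(1) by (simp add: smult_mult_cm smult_eq_matr)
  finally show ?thesis using a(1) by blast
qed

lemma phi3_matr_inj:
  assumes a: "a \<in> carrier A" and zero: "a \<odot>\<^bsub>matr_module A\<^esub> phi3_matr E x = (\<lambda>i j. \<zero>)"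
  shows "a = \<zero>"
proof (rule fund_matr_inj[OF a])
  fix i j
  have "a \<odot>\<^bsub>matr_module A\<^esub> fund_matr =
      cm (Pi ** matrix_inv E) \<star> (a \<odot>\<^bsub>matr_module A\<^esub> phi3_matr E x \<star> cm (transpose Q))"
    using a by (subst phi3_fund_matr(2)) (simp add: smult_mult_cm smult_eq_matr)
  also have "\<dots> = (\<lambda>i j. \<zero>)" by (simp add: zero matr_mult_zero)
  finally show "fund_matr i j \<otimes> a = \<zero>"
    by (simp add: matr_module_simps(4) fun_eq_iff)
qed

end

context A_invertible begin

lemma Phi_simps:
  "Phi3 E a = a \<odot>\<^bsub>matr_module A\<^esub> phi3_matr E x"
  "Phi2 E U = (phi2 E x U, \<zero>\<^bsub>T\<^esub>)"
  "U \<in> mats \<Longrightarrow> a \<in> carrier A \<Longrightarrow> Phi1 E (U, Tp a) = phi1 U a"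
proof -
  show "Phi3 E a = a \<odot>\<^bsub>matr_module A\<^esub> phi3_matr E x"
    unfolding Phi3_def phi3_matr_def Let_def A_eq[symmetric] by (rule refl)
  show "Phi2 E U = (phi2 E x U, \<zero>\<^bsub>T\<^esub>)"
    unfolding Phi2_def phi2_def Let_def A_eq[symmetric] by (rule refl)
  assume U: "U \<in> mats" and a: "a \<in> carrier A"
  have "Phi1 E (U, Tp a) = (THE b. \<exists>a'\<in>carrier A. Tp a = Tp a' \<and>
      b = matr_trace A (matr_transpose x \<star> U) \<ominus> matr_trace A U \<oplus> (\<one> \<ominus> g) \<otimes> a')"
    unfolding Phi1_def A_eq[symmetric] Tp_def by (simp add: Let_def)
  also have "\<dots> = phi1 U a"
  proof (rule the_equality)
    show "\<exists>a'\<in>carrier A. Tp a = Tp a' \<and>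
        phi1 U a = matr_trace A (matr_transpose x \<star> U) \<ominus> matr_trace A U \<oplus> (\<one> \<ominus> g) \<otimes> a'"
      using a by (intro bexI[of _ a]) (simp_all add: phi1_def omg_def)
    fix b
    assume "\<exists>a'\<in>carrier A. Tp a = Tp a' \<and>
        b = matr_trace A (matr_transpose x \<star> U) \<ominus> matr_trace A U \<oplus> (\<one> \<ominus> g) \<otimes> a'"
    then obtain a' where a': "a' \<in> carrier A" "Tp a = Tp a'"
      "b = matr_trace A (matr_transpose x \<star> U) \<ominus> matr_trace A U \<oplus> (\<one> \<ominus> g) \<otimes> a'" by (elim bexE conjE)
    \<comment> \<open>Different choices of the right tensor factor give the same product with
      \<open>1 - g\<close>, so the definite description has exactly one solution.\<close>
    have "omg \<otimes> a = omg \<otimes> a'" using Tp_eq_iff[OF a a'(1)] a'(2) by simp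
    then show "b = phi1 U a" by (simp add: a'(3) phi1_def omg_def[symmetric])
  qed
  finally show "Phi1 E (U, Tp a) = phi1 U a" .
qed

abbreviation P1 :: "('n A_elem, ('n, 'n A_elem) matr \<times> 'n T_elem) module" where
  "P1 \<equiv> direct_sum_module (matr_module A) T"

lemma P1_cases:
  assumes "p \<in> carrier P1"
  obtains U a where "U \<in> mats" "a \<in> carrier A" "p = (U, Tp a)"
proof -
  obtain U t where p: "p = (U, t)" "U \<in> mats" "t \<in> carrier T" using assms by (cases p) auto
  then have "t \<in> Tp ` carrier A" by (simp only: Tp_surj)
  then obtain a where "t = Tp a" "a \<in> carrier A" by (rule imageE)
  then show thesis using p that by simp
qed

lemma P1_memI: "U \<in> mats \<Longrightarrow> a \<in> carrier A \<Longrightarrow> (U, Tp a) \<in> carrier P1"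
  using Tp_in_T by simp

lemma Phi_homs:
  "Phi3 E \<in> right_module_hom A (regular_module A) (matr_module A)"
  "Phi2 E \<in> right_module_hom A (matr_module A) P1"
  "Phi1 E \<in> right_module_hom A P1 (regular_module A)"
  "A_counit E \<in> right_module_hom A (regular_module A) (character_module (A_counit E))"
proof -
  interpret M: right_module A "matr_module A" by (rule right_module_matr)
  interpret T: right_module A T by (rule right_module_T)
  have K: "phi3_matr E x \<in> mats" by simp
  show "Phi3 E \<in> right_module_hom A (regular_module A) (matr_module A)"
    unfolding Phi_simps(1)[abs_def]
    by (rule right_module_homI)
      (simp_all only: regular_module_simps M.rsmult_closed[OF _ K] M.rsmult_distr_ring[OF _ _ K] M.rsmult_assoc[OF _ _ K])
  show "Phi2 E \<in> right_module_hom A (matr_module A) P1"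
  proof (rule right_module_homI)
    fix U :: "('n, 'n A_elem) matr" assume "U \<in> mats"
    then show "Phi2 E U \<in> carrier P1" by (simp add: Phi_simps(2))
  next
    fix U V :: "('n, 'n A_elem) matr" assume "U \<in> mats" "V \<in> mats"
    then show "Phi2 E (U \<oplus>\<^bsub>matr_module A\<^esub> V) = Phi2 E U \<oplus>\<^bsub>P1\<^esub> Phi2 E V"
      by (simp add: Phi_simps(2) matr_module_simps(3) phi2_add)
  next
    fix a and U :: "('n, 'n A_elem) matr" assume "a \<in> carrier A" "U \<in> mats"
    then show "Phi2 E (a \<odot>\<^bsub>matr_module A\<^esub> U) = a \<odot>\<^bsub>P1\<^esub> Phi2 E U"
      by (simp add: Phi_simps(2) phi2_smult T.rsmult_zero_module)
  qed
  show "Phi1 E \<in> right_module_hom A P1 (regular_module A)"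
  proof (rule right_module_homI)
    fix p assume "p \<in> carrier P1"
    then obtain U a where "U \<in> mats" "a \<in> carrier A" "p = (U, Tp a)" by (rule P1_cases)
    then show "Phi1 E p \<in> carrier (regular_module A)" by (simp add: Phi_simps(3))
  next
    fix p q assume pq: "p \<in> carrier P1" "q \<in> carrier P1"
    from pq(1) obtain U a where p: "U \<in> mats" "a \<in> carrier A" "p = (U, Tp a)" by (rule P1_cases)
    from pq(2) obtain V b where q: "V \<in> mats" "b \<in> carrier A" "q = (V, Tp b)" by (rule P1_cases)
    have "p \<oplus>\<^bsub>P1\<^esub> q = (matr_add A U V, Tp (a \<oplus> b))"
      unfolding p(3) q(3) using p(2) q(2) by (simp add: Tp_add matr_module_simps(3))
    moreover have "Phi1 E (matr_add A U V, Tp (a \<oplus> b)) = phi1 U a \<oplus> phi1 V b"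
      using p(1,2) q(1,2) by (simp add: Phi_simps(3) phi1_add)
    ultimately show "Phi1 E (p \<oplus>\<^bsub>P1\<^esub> q) = Phi1 E p \<oplus>\<^bsub>regular_module A\<^esub> Phi1 E q"
      unfolding p(3) q(3) using p(1,2) q(1,2) by (simp only: Phi_simps(3) regular_module_simps)
  next
    fix r p assume r: "r \<in> carrier A" and "p \<in> carrier P1"
    from this(2) obtain U a where p: "U \<in> mats" "a \<in> carrier A" "p = (U, Tp a)" by (rule P1_cases)
    have "r \<odot>\<^bsub>P1\<^esub> p = (r \<odot>\<^bsub>matr_module A\<^esub> U, Tp (a \<otimes> r))"
      unfolding p(3) using r p(2) by (simp add: Tp_smult)
    moreover have "Phi1 E (r \<odot>\<^bsub>matr_module A\<^esub> U, Tp (a \<otimes> r)) = phi1 U a \<otimes> r"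
      using p(1,2) r by (simp add: Phi_simps(3) phi1_smult)
    ultimately show "Phi1 E (r \<odot>\<^bsub>P1\<^esub> p) = r \<odot>\<^bsub>regular_module A\<^esub> Phi1 E p"
      unfolding p(3) using p(1,2) by (simp only: Phi_simps(3) regular_module_simps)
  qed
  show "A_counit E \<in> right_module_hom A (regular_module A) (character_module (A_counit E))"
  proof (rule right_module_homI)
    fix a assume "a \<in> carrier (regular_module A)"
    then show "A_counit E a \<in> carrier (character_module (A_counit E))"
      by (simp add: character_module_def)
  next
    fix a b assume "a \<in> carrier (regular_module A)" "b \<in> carrier (regular_module A)"
    then show "A_counit E (a \<oplus>\<^bsub>regular_module A\<^esub> b) =
        A_counit E a \<oplus>\<^bsub>character_module (A_counit E)\<^esub> A_counit E b"
      using alg_homD(2)[OF counit(1), of a b] by (simp add: character_module_def complex_alg_def)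
  next
    fix r a assume "r \<in> carrier A" "a \<in> carrier (regular_module A)"
    then show "A_counit E (r \<odot>\<^bsub>regular_module A\<^esub> a) = r \<odot>\<^bsub>character_module (A_counit E)\<^esub> A_counit E a"
      using alg_homD(3)[OF counit(1), of a r] by (simp add: character_module_def complex_alg_def)
  qed
qed

lemma exact_Phi2_Phi1: "exact_at (matr_module A) (Phi2 E) P1 (Phi1 E) (regular_module A)"
  unfolding exact_at_def
proof (intro subset_antisym subsetI)
  fix p assume "p \<in> Phi2 E ` mats"
  then obtain U where U: "p = Phi2 E U" "U \<in> mats" by (rule imageE)
  then have p: "p = (phi2 E x U, Tp \<zero>)" by (simp add: Phi_simps(2) Tp_zero)
  then have "Phi1 E p = \<zero>" using U(2) by (simp add: Phi_simps(3) phi1_phi2)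
  moreover have "p \<in> carrier P1" unfolding p using U(2) by (intro P1_memI) simp_all
  ultimately show "p \<in> a_kernel P1 (regular_module A) (Phi1 E)" by (simp add: a_kernel_def')
next
  fix p assume "p \<in> a_kernel P1 (regular_module A) (Phi1 E)"
  then have p: "p \<in> carrier P1" "Phi1 E p = \<zero>" by (simp_all add: a_kernel_def')
  from p(1) obtain U a where U: "U \<in> mats" "a \<in> carrier A" "p = (U, Tp a)" by (rule P1_cases)
  then have zero: "phi1 U a = \<zero>" using p(2) by (simp add: Phi_simps(3))
  have "omg \<otimes> a = omg \<otimes> \<zero>" using phi1_eq_zero_imp_omg[OF U(1,2) zero] by simp
  then have "Tp a = \<zero>\<^bsub>T\<^esub>" unfolding Tp_zero using Tp_eq_iff[OF U(2) zero_closed] by simp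
  moreover obtain V where V: "V \<in> mats" "U = phi2 E x V"
    using phi1_eq_zero_imp_phi2[OF U(1,2) zero] by (elim bexE)
  ultimately have "p = Phi2 E V" by (simp add: U(3) Phi_simps(2))
  then show "p \<in> Phi2 E ` mats" using V(1) by (rule image_eqI)
qed

lemma exact_Phi1_counit:
  "exact_at P1 (Phi1 E) (regular_module A) (A_counit E) (character_module (A_counit E))"
  unfolding exact_at_def
proof (intro subset_antisym subsetI)
  fix b assume "b \<in> Phi1 E ` carrier P1"
  then obtain p where b: "b = Phi1 E p" and p: "p \<in> carrier P1" by (rule imageE)
  from p obtain U a where U: "U \<in> mats" "a \<in> carrier A" "p = (U, Tp a)" by (rule P1_cases)
  then show "b \<in> a_kernel (regular_module A) (character_module (A_counit E)) (A_counit E)"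
    using counit_phi1[OF U(1,2)] by (simp add: b Phi_simps(3) a_kernel_def') (simp add: character_module_def)
next
  fix b assume "b \<in> a_kernel (regular_module A) (character_module (A_counit E)) (A_counit E)"
  then have b: "b \<in> carrier A" "A_counit E b = 0" by (simp_all add: a_kernel_def') (simp add: character_module_def)
  obtain U a where U: "U \<in> mats" "a \<in> carrier A" "phi1 U a = b \<ominus> A_counit E b \<odot> \<one>"
    using ex_phi1[OF b(1)] by (elim bexE)
  have "b = Phi1 E (U, Tp a)" using U b by (simp add: Phi_simps(3) minus_eq)
  moreover have "(U, Tp a) \<in> carrier P1" using U by (intro P1_memI)
  ultimately show "b \<in> Phi1 E ` carrier P1" by (rule image_eqI)
qed

lemma counit_surj: "A_counit E ` carrier (regular_module A) = carrier (character_module (A_counit E))"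
proof -
  have "z \<in> A_counit E ` carrier A" for z
  proof (rule image_eqI)
    show "z = A_counit E (z \<odot> \<one>)"
      by (simp add: alg_homD[OF counit(1)]) (simp add: complex_alg_def)
  qed simp
  then show ?thesis by (auto simp: character_module_def)
qed

end

context A_normal_form begin

interpretation I: A_invertible A E
  by unfold_locales (rule E)+

interpretation M: right_module A "matr_module A" by (rule right_module_matr)

lemma inj_Phi3: "inj_on (Phi3 E) (carrier A)"
proof (rule inj_onI)
  have K: "phi3_matr E x \<in> mats" by simp
  fix a b assume a: "a \<in> carrier A" and b: "b \<in> carrier A" and eq: "Phi3 E a = Phi3 E b"
  have "(a \<ominus> b) \<odot>\<^bsub>matr_module A\<^esub> phi3_matr E x \<oplus>\<^bsub>matr_module A\<^esub> b \<odot>\<^bsub>matr_module A\<^esub> phi3_matr E x =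
      \<zero>\<^bsub>matr_module A\<^esub> \<oplus>\<^bsub>matr_module A\<^esub> b \<odot>\<^bsub>matr_module A\<^esub> phi3_matr E x"
    using a b K eq by (simp add: M.rsmult_distr_ring[symmetric] minus_eq a_assoc l_neg I.Phi_simps(1) M.rsmult_closed)
  then have "(a \<ominus> b) \<odot>\<^bsub>matr_module A\<^esub> phi3_matr E x = \<zero>\<^bsub>matr_module A\<^esub>"
    using a b K by (subst (asm) M.add.right_cancel) (simp_all add: M.rsmult_closed)
  then have "a \<ominus> b = \<zero>" using a b by (intro phi3_matr_inj) (simp_all add: matr_module_simps(2))
  then show "a = b" using a b by simp
qed

lemma exact_Phi3_Phi2:
  "exact_at (regular_module A) (Phi3 E) (matr_module A) (Phi2 E) (direct_sum_module (matr_module A) (T_module E))"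
  unfolding exact_at_def
proof (intro subset_antisym subsetI)
  have K: "phi3_matr E x \<in> mats" by simp
  fix U assume "U \<in> Phi3 E ` carrier (regular_module A)"
  then obtain a where a: "U = a \<odot>\<^bsub>matr_module A\<^esub> phi3_matr E x" "a \<in> carrier A"
    unfolding I.Phi_simps(1)[abs_def] by auto
  have "phi2 E x U = a \<odot>\<^bsub>matr_module A\<^esub> (\<lambda>i j. \<zero>)"
    unfolding a(1) using phi2_smult[OF x_mats K a(2), of E] phi2_phi3_matr[OF B_rel_x E] by simp
  then have "phi2 E x U = (\<lambda>i j. \<zero>)" using a(2) by (simp add: matr_module_simps(4))
  then show "U \<in> a_kernel (matr_module A) (direct_sum_module (matr_module A) (T_module E)) (Phi2 E)"
    using a(2) K by (simp add: a_kernel_def' I.Phi_simps(2) matr_module_simps(2) a(1))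
next
  fix U assume "U \<in> a_kernel (matr_module A) (direct_sum_module (matr_module A) (T_module E)) (Phi2 E)"
  then have "U \<in> mats" "phi2 E x U = (\<lambda>i j. \<zero>)"
    by (simp_all add: a_kernel_def' I.Phi_simps(2) matr_module_simps(2))
  from phi2_eq_zero_imp_phi3[OF this] show "U \<in> Phi3 E ` carrier (regular_module A)"
    unfolding I.Phi_simps(1)[abs_def] by auto
qed

end

theorem theorem3p3:
  fixes E :: "complex^'n::finite^'n"
  assumes "CARD('n) \<ge> 2" and "invertible E"
  defines "A \<equiv> A_alg E"
  defines "P0 \<equiv> regular_module A"
    and "P1 \<equiv> direct_sum_module (matr_module A) (T_module E)"
    and "P2 \<equiv> matr_module A :: ('n A_elem, ('n, 'n A_elem) matr) module"
    and "P3 \<equiv> regular_module A"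
    and "C\<epsilon> \<equiv> character_module (A_counit E)"
  shows "projective_right_module TYPE('m) TYPE('k) A P0 \<and>
         projective_right_module TYPE('m) TYPE('k) A P1 \<and>
         projective_right_module TYPE('m) TYPE('k) A P2 \<and>
         projective_right_module TYPE('m) TYPE('k) A P3 \<and>
         right_module A C\<epsilon> \<and>
         Phi3 E \<in> right_module_hom A P3 P2 \<and>
         Phi2 E \<in> right_module_hom A P2 P1 \<and>
         Phi1 E \<in> right_module_hom A P1 P0 \<and>
         A_counit E \<in> right_module_hom A P0 C\<epsilon> \<and>
         inj_on (Phi3 E) (carrier P3) \<and>
         exact_at P3 (Phi3 E) P2 (Phi2 E) P1 \<and>
         exact_at P2 (Phi2 E) P1 (Phi1 E) P0 \<and>
         exact_at P1 (Phi1 E) P0 (A_counit E) C\<epsilon> \<and>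
         A_counit E ` carrier P0 = carrier C\<epsilon>"
proof -
  note inv = matrix_inv_inverse[OF assms(2)]
  have A_eq: "A = A_alg E" by (simp add: A_def)
  interpret complex_algebra A unfolding A_eq by (rule complex_algebra_A_alg)
  interpret I: A_invertible A E
    by unfold_locales (rule A_eq inv)+
  \<comment> \<open>The size assumption enters here, through the isotropic vectors for E and for its
    inverse.\<close>
  obtain P Pi Q Qi r0 r1 c0 c1 where nf: "normal_form E (matrix_inv E) P Pi Q Qi r0 r1 c0 c1"
    using ex_normal_form[OF assms(1,2)] by (elim exE)
  interpret N: A_normal_form E P Pi Q Qi r0 r1 c0 c1 A
    by (intro A_normal_form.intro congruence_form.intro nf I.A_algebra_axioms)
  show ?thesis
    unfolding P0_def P1_def P2_def P3_def C\<epsilon>_def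
    by (intro conjI projective_regular projective_matr projective_direct_sum I.projective_T
        N.inj_Phi3[folded regular_module_simps(1)] N.exact_Phi3_Phi2 right_module_character I.counit(1) I.Phi_homs I.exact_Phi2_Phi1 I.exact_Phi1_counit I.counit_surj)
qed

end
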